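(* Let $(M_0,g_0)$ be a complete (connected, smooth) Riemannian manifold, let $F$ be a smooth time-dependent $(1,1)$ tensor field on $M_0$ with self-adjoint component $S$, and let $V : M_0\times\mathbb{R}\to\mathbb{R}$ be a smooth potential. Assume that: (i) $\|S(t)\|$ is bounded along finite times, i.e. for each $T>0$ there is a constant $N_T$ such that $\|S(t)\|\le N_T$ for all $t\in[-T,T]$; (ii) $V$ is bounded from below along finite times, i.e. there is a continuous function $\beta_0:\mathbb{R}\to\mathbb{R}$ such that $V(p,t)\ge\beta_0(t)$ for all $(p,t)\in M_0\times\mathbb{R}$; (iii) there exists a continuous function $\alpha_0:\mathbb{R}\to\mathbb{R}$ such that, with $\beta_0$ as in (ii), $$\left|\frac{\partial V}{\partial t}(p,t)\right|\ \le\ \alpha_0(t)\,\bigl(V(p,t)-\beta_0(t)\bigr)\quad\text{for all }(p,t)\in M_0\times\mathbb{R}.$$ Then each inextensible solution $\gamma$ of the equation $$\frac{D\dot\gamma}{dt}(t)\ =\ F_{(\gamma(t),t)}\,\dot\gamma(t)-\nabla^{M_0}V(\gamma(t),t)$$ is complete, i.e. defined on all of $\mathbb{R}$.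
   Context: $(M_0,g_0)$ is a connected smooth $n$-dimensional Riemannian manifold; it is complete if all its inextensible geodesics are defined on $\mathbb{R}$ (equivalently, its distance is complete). $D/dt$ denotes the covariant derivative along $\gamma$ induced by the Levi-Civita connection of $g_0$, $\dot\gamma$ is the velocity of $\gamma$, and $\nabla^{M_0}V(p,t)$ is the $g_0$-gradient at $p$ of the function $V(\cdot,t)$. A smooth time-dependent $(1,1)$ tensor field $F$ is a smooth $(1,1)$ tensor field along the natural projection $\pi:M_0\times\mathbb{R}\to M_0$, i.e. for each $(p,t)$ a linear map $F_{(p,t)}:T_pM_0\to T_pM_0$ depending smoothly on $(p,t)$. It need be neither self-adjoint nor skew-adjoint; $S_{(p,t)}$ denotes the self-adjoint part of $F_{(p,t)}$ with respect to $g_0$. For $t\in\mathbb{R}$ put $$S_{\sup}(t)=\sup_{v\in TM_0,\ \|v\|=1} g_0(v,S_{(p,t)}v),\qquad S_{\inf}(t)=\inf_{v\in TM_0,\ \|v\|=1} g_0(v,S_{(p,t)}v),$$ where $p$ denotes the base point of $v$ (so the supremum and infimum run over all $p\in M_0$ and all unit $v\in T_pM_0$), and $$\|S(t)\|=\max\{|S_{\sup}(t)|,|S_{\inf}(t)|\}.$$ Given $p\in M_0$ and $v\in T_pM_0$, the equation has a unique inextensible (maximal) smooth solution $\gamma:I\to M_0$, $0\in I$, with $\gamma(0)=p$, $\dot\gamma(0)=v$. *)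

theory Defs
  imports "HOL-Analysis.Analysis"
begin

section \<open>Smooth maps between open subsets of normed spaces\<close>

text \<open>Meant for open sets and finite-dimensional domains, where it is the usual
  \<^emph>\<open>k\<close>-fold continuous differentiability: all directional derivatives of the derivative are
  again of class \<^emph>\<open>k\<close>.\<close>

primrec k_smooth_on ::
  "nat \<Rightarrow> 'a::real_normed_vector set \<Rightarrow> ('a \<Rightarrow> 'b::real_normed_vector) \<Rightarrow> bool" where
  "k_smooth_on 0 S f \<longleftrightarrow> continuous_on S f"
| "k_smooth_on (Suc k) S f \<longleftrightarrow>
     (\<forall>x\<in>S. f differentiable (at x)) \<and>
     (\<forall>v. k_smooth_on k S (\<lambda>x. frechet_derivative f (at x) v))"

definition smooth_on :: "'a::real_normed_vector set \<Rightarrow> ('a \<Rightarrow> 'b::real_normed_vector) \<Rightarrow> bool" where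
  "smooth_on S f \<longleftrightarrow> (\<forall>k. k_smooth_on k S f)"


section \<open>Smooth manifolds and tangent vectors\<close>

text \<open>The points of the manifold form the whole type \<^typ>\<open>'a\<close>, and the model space is a Euclidean
  space \<^typ>\<open>'e\<close>, so that the dimension is \<^emph>\<open>DIM('e)\<close>. A chart is a pair of its domain and its
  coordinate map.\<close>

type_synonym ('a, 'e) chart = "'a set \<times> ('a \<Rightarrow> 'e)"

definition chart_inv :: "('a, 'e) chart \<Rightarrow> 'e \<Rightarrow> 'a" where
  "chart_inv c = inv_into (fst c) (snd c)"

definition chart_image :: "('a, 'e) chart \<Rightarrow> 'e set" where
  "chart_image c = snd c ` fst c"

definition is_chart :: "('a::topological_space, 'e::euclidean_space) chart \<Rightarrow> bool" where
  "is_chart c \<longleftrightarrow> open (fst c) \<and> open (chart_image c) \<and>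
     homeomorphism (fst c) (chart_image c) (snd c) (chart_inv c)"

text \<open>The smooth structure is given by an atlas, which need not be maximal.\<close>

definition smooth_manifold ::
  "('a::{t2_space,second_countable_topology}, 'e::euclidean_space) chart set \<Rightarrow> bool" where
  "smooth_manifold A \<longleftrightarrow>
     (\<forall>c\<in>A. is_chart c) \<and> (\<Union>c\<in>A. fst c) = UNIV \<and>
     (\<forall>c\<in>A. \<forall>d\<in>A. smooth_on (snd c ` (fst c \<inter> fst d)) (snd d \<circ> chart_inv c))"

text \<open>A tangent vector at \<^term>\<open>p\<close> is the family of its coordinates in the charts around \<^term>\<open>p\<close>,
  related by the Jacobians of the chart transitions. It is extended by zero to all other pairs, so
  that equality of functions is equality of tangent vectors.\<close>

type_synonym ('a, 'e) tvec = "('a, 'e) chart \<Rightarrow> 'e"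

definition tangent_space ::
  "('a, 'e::euclidean_space) chart set \<Rightarrow> 'a \<Rightarrow> ('a, 'e) tvec set" where
  "tangent_space A p = {v.
     (\<forall>c. c \<notin> A \<or> p \<notin> fst c \<longrightarrow> v c = 0) \<and>
     (\<forall>c\<in>A. \<forall>d\<in>A. p \<in> fst c \<inter> fst d \<longrightarrow>
        v d = frechet_derivative (snd d \<circ> chart_inv c) (at (snd c p)) (v c))}"

abbreviation tzero :: "('a, 'e::real_vector) tvec" where
  "tzero \<equiv> (\<lambda>c. 0)"

abbreviation tadd :: "('a, 'e::real_vector) tvec \<Rightarrow> ('a, 'e) tvec \<Rightarrow> ('a, 'e) tvec" where
  "tadd v w \<equiv> (\<lambda>c. v c + w c)"

abbreviation tdiff :: "('a, 'e::real_vector) tvec \<Rightarrow> ('a, 'e) tvec \<Rightarrow> ('a, 'e) tvec" where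
  "tdiff v w \<equiv> (\<lambda>c. v c - w c)"

abbreviation tscale :: "real \<Rightarrow> ('a, 'e::real_vector) tvec \<Rightarrow> ('a, 'e) tvec" where
  "tscale r v \<equiv> (\<lambda>c. r *\<^sub>R v c)"

text \<open>The tangent vector at \<^term>\<open>p\<close> with coordinates \<^term>\<open>u\<close> in the chart \<^term>\<open>c\<close>.\<close>

definition tvec_of ::
  "('a, 'e::euclidean_space) chart set \<Rightarrow> ('a, 'e) chart \<Rightarrow> 'a \<Rightarrow> 'e \<Rightarrow> ('a, 'e) tvec" where
  "tvec_of A c p u = (\<lambda>d. if d \<in> A \<and> p \<in> fst d
     then frechet_derivative (snd d \<circ> chart_inv c) (at (snd c p)) u else 0)"


section \<open>Riemannian metrics, (1,1) tensor fields and potentials\<close>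

type_synonym ('a, 'e) metric = "'a \<Rightarrow> ('a, 'e) tvec \<Rightarrow> ('a, 'e) tvec \<Rightarrow> real"

definition metric_coords ::
  "('a, 'e::euclidean_space) chart set \<Rightarrow> ('a, 'e) metric \<Rightarrow> ('a, 'e) chart \<Rightarrow>
   'e \<Rightarrow> 'e \<Rightarrow> 'e \<Rightarrow> real" where
  "metric_coords A g c x u w =
     g (chart_inv c x) (tvec_of A c (chart_inv c x) u) (tvec_of A c (chart_inv c x) w)"

definition riemannian_metric ::
  "('a, 'e::euclidean_space) chart set \<Rightarrow> ('a, 'e) metric \<Rightarrow> bool" where
  "riemannian_metric A g \<longleftrightarrow>
     (\<forall>p. \<forall>u\<in>tangent_space A p. \<forall>v\<in>tangent_space A p. \<forall>w\<in>tangent_space A p. \<forall>r.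
        g p u v = g p v u \<and>
        g p (tadd u v) w = g p u w + g p v w \<and>
        g p (tscale r u) v = r * g p u v) \<and>
     (\<forall>p. \<forall>v\<in>tangent_space A p. v \<noteq> tzero \<longrightarrow> g p v v > 0) \<and>
     (\<forall>c\<in>A. \<forall>u w. smooth_on (chart_image c) (\<lambda>x. metric_coords A g c x u w))"

definition riemannian_manifold ::
  "('a::{t2_space,second_countable_topology}, 'e::euclidean_space) chart set \<Rightarrow>
   ('a, 'e) metric \<Rightarrow> bool" where
  "riemannian_manifold A g \<longleftrightarrow> smooth_manifold A \<and> riemannian_metric A g"

type_synonym ('a, 'e) td_tensor = "'a \<Rightarrow> real \<Rightarrow> ('a, 'e) tvec \<Rightarrow> ('a, 'e) tvec"

text \<open>Smooth time-dependent (1,1) tensor fields, that is, along the projection from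
  the product of the manifold with the time axis to the manifold.\<close>

definition smooth_td_tensor_field ::
  "('a, 'e::euclidean_space) chart set \<Rightarrow> ('a, 'e) td_tensor \<Rightarrow> bool" where
  "smooth_td_tensor_field A F \<longleftrightarrow>
     (\<forall>p t. \<forall>v\<in>tangent_space A p. \<forall>w\<in>tangent_space A p. \<forall>r.
        F p t v \<in> tangent_space A p \<and>
        F p t (tadd v w) = tadd (F p t v) (F p t w) \<and>
        F p t (tscale r v) = tscale r (F p t v)) \<and>
     (\<forall>c\<in>A. \<forall>u. smooth_on (chart_image c \<times> UNIV)
        (\<lambda>(x, t). F (chart_inv c x) t (tvec_of A c (chart_inv c x) u) c))"

definition smooth_td_function ::
  "('a, 'e::euclidean_space) chart set \<Rightarrow> ('a \<Rightarrow> real \<Rightarrow> real) \<Rightarrow> bool" where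
  "smooth_td_function A V \<longleftrightarrow>
     (\<forall>c\<in>A. smooth_on (chart_image c \<times> UNIV) (\<lambda>(x, t). V (chart_inv c x) t))"

definition adjoint_at ::
  "('a, 'e::euclidean_space) chart set \<Rightarrow> ('a, 'e) metric \<Rightarrow> ('a, 'e) td_tensor \<Rightarrow>
   ('a, 'e) td_tensor" where
  "adjoint_at A g F p t v =
     (THE w. w \<in> tangent_space A p \<and> (\<forall>u\<in>tangent_space A p. g p w u = g p v (F p t u)))"

definition self_adjoint_part ::
  "('a, 'e::euclidean_space) chart set \<Rightarrow> ('a, 'e) metric \<Rightarrow> ('a, 'e) td_tensor \<Rightarrow>
   ('a, 'e) td_tensor" where
  "self_adjoint_part A g F p t v = tscale (1/2) (tadd (F p t v) (adjoint_at A g F p t v))"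

definition unit_bundle ::
  "('a, 'e::euclidean_space) chart set \<Rightarrow> ('a, 'e) metric \<Rightarrow> ('a \<times> ('a, 'e) tvec) set" where
  "unit_bundle A g = {(p, v). v \<in> tangent_space A p \<and> sqrt (g p v v) = 1}"

text \<open>The supremum and infimum may be infinite when the manifold is not compact, hence the values in
  the extended reals.\<close>

definition S_sup ::
  "('a, 'e::euclidean_space) chart set \<Rightarrow> ('a, 'e) metric \<Rightarrow> ('a, 'e) td_tensor \<Rightarrow> real \<Rightarrow> ereal"
  where
  "S_sup A g S t = (SUP (p, v)\<in>unit_bundle A g. ereal (g p v (S p t v)))"

definition S_inf ::
  "('a, 'e::euclidean_space) chart set \<Rightarrow> ('a, 'e) metric \<Rightarrow> ('a, 'e) td_tensor \<Rightarrow> real \<Rightarrow> ereal"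
  where
  "S_inf A g S t = (INF (p, v)\<in>unit_bundle A g. ereal (g p v (S p t v)))"

definition S_norm ::
  "('a, 'e::euclidean_space) chart set \<Rightarrow> ('a, 'e) metric \<Rightarrow> ('a, 'e) td_tensor \<Rightarrow> real \<Rightarrow> ereal"
  where
  "S_norm A g S t = max \<bar>S_sup A g S t\<bar> \<bar>S_inf A g S t\<bar>"

text \<open>The \<^term>\<open>g\<close>-gradient at \<^term>\<open>p\<close>: the vector dual to the differential, the latter computed in
  any chart around \<^term>\<open>p\<close>.\<close>

definition gradient ::
  "('a, 'e::euclidean_space) chart set \<Rightarrow> ('a, 'e) metric \<Rightarrow> ('a \<Rightarrow> real) \<Rightarrow> 'a \<Rightarrow> ('a, 'e) tvec"
  where
  "gradient A g f p =
     (THE w. w \<in> tangent_space A p \<and>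
        (\<forall>v\<in>tangent_space A p. \<forall>c\<in>A. p \<in> fst c \<longrightarrow>
           g p w v = frechet_derivative (f \<circ> chart_inv c) (at (snd c p)) (v c)))"


section \<open>Covariant derivative along curves\<close>

text \<open>The Levi-Civita connection in the chart \<^term>\<open>c\<close>: \<^term>\<open>christoffel A g c x u v\<close> has the
  components \<^emph>\<open>Gamma^k_{ij} u^i v^j\<close>. It is given by the Koszul formula for the vector fields with
  constant coordinates \<^term>\<open>u\<close>, \<^term>\<open>v\<close> and \<^term>\<open>w\<close>, whose Lie brackets vanish.\<close>

definition christoffel ::
  "('a, 'e::euclidean_space) chart set \<Rightarrow> ('a, 'e) metric \<Rightarrow> ('a, 'e) chart \<Rightarrow>
   'e \<Rightarrow> 'e \<Rightarrow> 'e \<Rightarrow> 'e" where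
  "christoffel A g c x u v =
     (THE z. \<forall>w. 2 * metric_coords A g c x z w =
          frechet_derivative (\<lambda>y. metric_coords A g c y v w) (at x) u
        + frechet_derivative (\<lambda>y. metric_coords A g c y u w) (at x) v
        - frechet_derivative (\<lambda>y. metric_coords A g c y u v) (at x) w)"

definition smooth_curve ::
  "('a::topological_space, 'e::euclidean_space) chart set \<Rightarrow> real set \<Rightarrow> (real \<Rightarrow> 'a) \<Rightarrow> bool" where
  "smooth_curve A I \<gamma> \<longleftrightarrow> continuous_on I \<gamma> \<and>
     (\<forall>c\<in>A. smooth_on {t\<in>I. \<gamma> t \<in> fst c} (snd c \<circ> \<gamma>))"

definition velocity ::
  "('a, 'e::euclidean_space) chart set \<Rightarrow> (real \<Rightarrow> 'a) \<Rightarrow> real \<Rightarrow> ('a, 'e) tvec" where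
  "velocity A \<gamma> t = (\<lambda>c. if c \<in> A \<and> \<gamma> t \<in> fst c
     then vector_derivative (snd c \<circ> \<gamma>) (at t) else 0)"

definition covariant_derivative ::
  "('a, 'e::euclidean_space) chart set \<Rightarrow> ('a, 'e) metric \<Rightarrow> (real \<Rightarrow> 'a) \<Rightarrow>
   (real \<Rightarrow> ('a, 'e) tvec) \<Rightarrow> real \<Rightarrow> ('a, 'e) tvec" where
  "covariant_derivative A g \<gamma> W t = (\<lambda>c. if c \<in> A \<and> \<gamma> t \<in> fst c
     then vector_derivative (\<lambda>s. W s c) (at t)
        + christoffel A g c (snd c (\<gamma> t)) (velocity A \<gamma> t c) (W t c)
     else 0)"


section \<open>Solutions, inextensibility and completeness\<close>

definition open_interval :: "real set \<Rightarrow> bool" where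
  "open_interval I \<longleftrightarrow> open I \<and> is_interval I \<and> I \<noteq> {}"

text \<open>\<^term>\<open>P I \<gamma>\<close> says that \<^term>\<open>\<gamma>\<close> restricted to \<^term>\<open>I\<close> is a solution; the values of
  \<^term>\<open>\<gamma>\<close> outside \<^term>\<open>I\<close> are irrelevant.\<close>

definition inextensible ::
  "(real set \<Rightarrow> (real \<Rightarrow> 'a) \<Rightarrow> bool) \<Rightarrow> real set \<Rightarrow> (real \<Rightarrow> 'a) \<Rightarrow> bool" where
  "inextensible P I \<gamma> \<longleftrightarrow> P I \<gamma> \<and>
     (\<forall>J \<delta>. P J \<delta> \<and> I \<subseteq> J \<and> (\<forall>t\<in>I. \<delta> t = \<gamma> t) \<longrightarrow> J = I)"

definition geodesic ::
  "('a::topological_space, 'e::euclidean_space) chart set \<Rightarrow> ('a, 'e) metric \<Rightarrow>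
   real set \<Rightarrow> (real \<Rightarrow> 'a) \<Rightarrow> bool" where
  "geodesic A g I \<gamma> \<longleftrightarrow> open_interval I \<and> smooth_curve A I \<gamma> \<and>
     (\<forall>t\<in>I. covariant_derivative A g \<gamma> (velocity A \<gamma>) t = tzero)"

definition complete_riemannian ::
  "('a::topological_space, 'e::euclidean_space) chart set \<Rightarrow> ('a, 'e) metric \<Rightarrow> bool" where
  "complete_riemannian A g \<longleftrightarrow> (\<forall>I \<gamma>. inextensible (geodesic A g) I \<gamma> \<longrightarrow> I = UNIV)"

definition trajectory ::
  "('a::topological_space, 'e::euclidean_space) chart set \<Rightarrow> ('a, 'e) metric \<Rightarrow>
   ('a, 'e) td_tensor \<Rightarrow> ('a \<Rightarrow> real \<Rightarrow> real) \<Rightarrow> real set \<Rightarrow> (real \<Rightarrow> 'a) \<Rightarrow> bool" where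
  "trajectory A g F V I \<gamma> \<longleftrightarrow> open_interval I \<and> smooth_curve A I \<gamma> \<and>
     (\<forall>t\<in>I. covariant_derivative A g \<gamma> (velocity A \<gamma>) t =
        tdiff (F (\<gamma> t) t (velocity A \<gamma> t)) (gradient A g (\<lambda>p. V p t) (\<gamma> t)))"

end

theory Submission
  imports Defs "HOL-Complex_Analysis.Great_Picard"
begin

text \<open>Along a solution the energy, kinetic plus potential, changes at the rate given by the
  self-adjoint part of the tensor field and by the time derivative of the potential. Relative to a
  lower bound of the potential both are bounded by a multiple of the energy, so Gronwall's inequality
  bounds the speed on bounded time intervals. A curve of bounded speed on a bounded interval
  converges at the end point because the manifold is complete, and then the local solution through
  the limit extends the solution. Time reversal treats the left end point.

  Completeness is given geodesically, and the convergence replaces the Hopf-Rinow theorem. If some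
  curve of speed at most one left the manifold in finite time, then by Arzela-Ascoli there would be
  a curve along which the infimum of such exit times decreases at unit rate. Cutting corners shows
  that this curve is continuously differentiable, and a first variation argument that it is a
  geodesic. A maximal such curve is an inextensible geodesic that is not defined at all times.\<close>

section \<open>Calculus of smooth maps\<close>

text \<open>The exit time is the distance to the points missing from the metric completion,
  expressed by curves instead of a distance function. Along every curve of speed at most one it
  drops at rate at most one, so the curves on which the rate is attained are its minimizers, while
  its positivity limits how long they can last. The obstacle is regularity: compactness yields only
  a Lipschitz curve, and the geodesic equation has to be reached from difference quotients. Freezing
  the metric at a point causes a defect of order three in the length of the interval. This is small
  enough, because the slopes of chords at halved scales then differ by the terms of a geometric
  series.

  The energy estimate has an obstacle of its own: the lower bound of the potential is continuous but
  need not be differentiable in time, so subtracting it could destroy the differentiability of the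
  energy. A constant below it on the bounded interval takes its place, and the resulting estimate
  works in both directions of time.\<close>

lemma frechet_derivative_cong_open:
  assumes "open S" "x \<in> S" "\<And>y. y \<in> S \<Longrightarrow> f y = g y"
  shows "frechet_derivative f (at x) = frechet_derivative g (at x)"
proof -
  have "(f has_derivative D) (at x) \<longleftrightarrow> (g has_derivative D) (at x)" for D
    using has_derivative_transform_within_open[of f D x UNIV S g]
      has_derivative_transform_within_open[of g D x UNIV S f] assms by auto
  then show ?thesis by (simp add: frechet_derivative_def)
qed

lemma differentiable_cong_open:
  assumes "open S" "x \<in> S" "\<And>y. y \<in> S \<Longrightarrow> f y = g y"
  shows "f differentiable (at x) \<longleftrightarrow> g differentiable (at x)"
proof -
  have "(f has_derivative D) (at x) \<longleftrightarrow> (g has_derivative D) (at x)" for D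
    using has_derivative_transform_within_open[of f D x UNIV S g]
      has_derivative_transform_within_open[of g D x UNIV S f] assms by auto
  then show ?thesis by (simp add: differentiable_def)
qed

lemma has_derivative_frechetI:
  "f differentiable (at x) \<Longrightarrow> (f has_derivative frechet_derivative f (at x)) (at x)"
  using frechet_derivative_works by blast

lemma frechet_derivative_at':
  "(f has_derivative D) (at x) \<Longrightarrow> frechet_derivative f (at x) = D"
  using frechet_derivative_at by metis

lemma k_smooth_on_cong:
  assumes "open S" "\<And>y. y \<in> S \<Longrightarrow> f y = g y"
  shows "k_smooth_on k S f \<longleftrightarrow> k_smooth_on k S g"
  using assms(2)
proof (induction k arbitrary: f g)
  case 0 then show ?case by (simp cong: continuous_on_cong)
next
  case (Suc k)
  show ?case
    using Suc.IH[of "\<lambda>x. frechet_derivative f (at x) v" "\<lambda>x. frechet_derivative g (at x) v" for v]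
      frechet_derivative_cong_open[OF assms(1) _ Suc.prems]
      differentiable_cong_open[OF assms(1) _ Suc.prems]
    by simp
qed

lemma k_smooth_on_congI:
  assumes "open S" "k_smooth_on k S g" "\<And>y. y \<in> S \<Longrightarrow> f y = g y"
  shows "k_smooth_on k S f"
  using k_smooth_on_cong[OF assms(1,3)] assms(2) by simp

lemma smooth_on_cong:
  assumes "open S" "\<And>y. y \<in> S \<Longrightarrow> f y = g y"
  shows "smooth_on S f \<longleftrightarrow> smooth_on S g"
  using k_smooth_on_cong[OF assms] by (simp add: smooth_on_def)

lemma k_smooth_on_subset:
  "k_smooth_on k S f \<Longrightarrow> T \<subseteq> S \<Longrightarrow> k_smooth_on k T f"
proof (induction k arbitrary: f)
  case 0 then show ?case by (auto intro: continuous_on_subset)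
next
  case (Suc k) then show ?case by (auto)
qed

lemma smooth_on_subset: "smooth_on S f \<Longrightarrow> T \<subseteq> S \<Longrightarrow> smooth_on T f"
  unfolding smooth_on_def using k_smooth_on_subset by metis

lemma k_smooth_on_local:
  assumes "\<And>x. x \<in> S \<Longrightarrow> \<exists>T. open T \<and> x \<in> T \<and> k_smooth_on k T f"
  shows "k_smooth_on k S f"
  using assms
proof (induction k arbitrary: f)
  case 0
  have "isCont f x" if "x \<in> S" for x
    using 0[OF that] by (auto simp: continuous_on_eq_continuous_at)
  then show ?case by (simp add: continuous_at_imp_continuous_on)
next
  case (Suc k)
  show ?case
  proof (simp, intro conjI ballI allI)
    fix x assume "x \<in> S" then show "f differentiable (at x)" using Suc.prems[of x] by auto
  next
    fix v
    show "k_smooth_on k S (\<lambda>x. frechet_derivative f (at x) v)"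
    proof (rule Suc.IH)
      fix x assume "x \<in> S"
      then show "\<exists>T. open T \<and> x \<in> T \<and> k_smooth_on k T (\<lambda>x. frechet_derivative f (at x) v)"
        using Suc.prems[of x] by auto
    qed
  qed
qed

lemma smooth_on_local:
  assumes "\<And>x. x \<in> S \<Longrightarrow> \<exists>T. open T \<and> x \<in> T \<and> smooth_on T f"
  shows "smooth_on S f"
  unfolding smooth_on_def
proof
  fix k show "k_smooth_on k S f"
    using assms by (intro k_smooth_on_local) (auto simp: smooth_on_def)
qed

lemma k_smooth_on_continuous: "k_smooth_on k S f \<Longrightarrow> continuous_on S f"
proof (cases k)
  case (Suc n)
  assume "k_smooth_on k S f"
  then have "\<forall>x\<in>S. isCont f x" using Suc differentiable_imp_continuous_within by auto
  then show ?thesis by (rule continuous_at_imp_continuous_on)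
qed auto

lemma k_smooth_on_Suc: "k_smooth_on (Suc k) S f \<Longrightarrow> k_smooth_on k S f"
proof (induction k arbitrary: f)
  case 0 then show ?case using k_smooth_on_continuous[OF 0] by simp
next
  case (Suc k)
  have "f differentiable (at x)" if "x \<in> S" for x using Suc.prems that by simp
  moreover have "k_smooth_on k S (\<lambda>x. frechet_derivative f (at x) v)" for v
    using Suc.prems by (intro Suc.IH) simp
  ultimately show ?case by simp
qed

lemma smooth_on_continuous: "smooth_on S f \<Longrightarrow> continuous_on S f"
  using k_smooth_on_continuous smooth_on_def by blast

lemma smooth_on_differentiable: "smooth_on S f \<Longrightarrow> x \<in> S \<Longrightarrow> f differentiable (at x)"
  unfolding smooth_on_def by (meson k_smooth_on.simps(2))

lemma smooth_on_has_derivative: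
  "smooth_on S f \<Longrightarrow> x \<in> S \<Longrightarrow> (f has_derivative frechet_derivative f (at x)) (at x)"
  using smooth_on_differentiable has_derivative_frechetI by blast

lemma smooth_on_frechet_derivative:
  "smooth_on S f \<Longrightarrow> smooth_on S (\<lambda>x. frechet_derivative f (at x) v)"
  unfolding smooth_on_def using k_smooth_on.simps(2) by blast

lemma k_smooth_on_const: "k_smooth_on k S (\<lambda>x. c)"
proof (induction k arbitrary: c)
  case (Suc k) then show ?case by (simp add: frechet_derivative_const)
qed simp

lemma k_smooth_on_bounded_linear:
  assumes "bounded_linear L"
  shows "k_smooth_on k S L"
proof (cases k)
  case 0 then show ?thesis
    using assms by (simp add: linear_continuous_on)
next
  case (Suc n)
  have d: "(L has_derivative L) (at x)" for x using assms by (rule bounded_linear_imp_has_derivative)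
  then have "frechet_derivative L (at x) = L" for x by (rule frechet_derivative_at')
  with d show ?thesis by (auto simp: Suc differentiable_def k_smooth_on_const)
qed

lemma k_smooth_on_add:
  assumes "open S" "k_smooth_on k S f" "k_smooth_on k S g"
  shows "k_smooth_on k S (\<lambda>x. f x + g x)"
  using assms(2,3)
proof (induction k arbitrary: f g)
  case 0 then show ?case by (auto intro: continuous_intros)
next
  case (Suc k)
  have d: "((\<lambda>x. f x + g x) has_derivative (\<lambda>v. frechet_derivative f (at x) v + frechet_derivative g (at x) v)) (at x)"
    if "x \<in> S" for x
    using Suc.prems that by (intro has_derivative_add has_derivative_frechetI) auto
  have e: "frechet_derivative (\<lambda>x. f x + g x) (at x) v = frechet_derivative f (at x) v + frechet_derivative g (at x) v"
    if "x \<in> S" for x v using frechet_derivative_at'[OF d[OF that]] by simp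
  have "k_smooth_on k S (\<lambda>x. frechet_derivative (\<lambda>x. f x + g x) (at x) v)" for v
    using Suc.IH[of "\<lambda>x. frechet_derivative f (at x) v" "\<lambda>x. frechet_derivative g (at x) v"] Suc.prems
      k_smooth_on_cong[OF assms(1) e[of _ v]] by simp
  with d show ?case by (auto simp: differentiable_def)
qed

text \<open>The Leibniz rule pairs the derivative of one factor with the other factor
  undifferentiated; the latter is first weakened from order \<open>Suc k\<close> to \<open>k\<close>
  so that the induction hypothesis applies to both summands.\<close>

lemma k_smooth_on_bilinear:
  assumes "bounded_bilinear pr" "open S" "k_smooth_on k S f" "k_smooth_on k S g"
  shows "k_smooth_on k S (\<lambda>x. pr (f x) (g x))"
  using assms(3,4)
proof (induction k arbitrary: f g)
  case 0 then show ?case by (auto intro: bounded_bilinear.continuous_on[OF assms(1)])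
next
  case (Suc k)
  have d: "((\<lambda>x. pr (f x) (g x)) has_derivative
      (\<lambda>v. pr (f x) (frechet_derivative g (at x) v) + pr (frechet_derivative f (at x) v) (g x))) (at x)"
    if "x \<in> S" for x
    using Suc.prems that by (intro bounded_bilinear.FDERIV[OF assms(1)] has_derivative_frechetI) auto
  have e: "frechet_derivative (\<lambda>x. pr (f x) (g x)) (at x) v =
      pr (f x) (frechet_derivative g (at x) v) + pr (frechet_derivative f (at x) v) (g x)"
    if "x \<in> S" for x v using frechet_derivative_at'[OF d[OF that]] by simp
  have "k_smooth_on k S (\<lambda>x. frechet_derivative (\<lambda>x. pr (f x) (g x)) (at x) v)" for v
    by (rule k_smooth_on_congI[OF assms(2) _ e])
      (use Suc.prems k_smooth_on_Suc[OF Suc.prems(1)] k_smooth_on_Suc[OF Suc.prems(2)]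
       in \<open>auto intro!: k_smooth_on_add assms(2) Suc.IH simp del: k_smooth_on.simps(1)\<close>)
  with d show ?case by (auto simp: differentiable_def)
qed

lemma k_smooth_on_linear_compose:
  assumes "bounded_linear L" "open S" "k_smooth_on k S f"
  shows "k_smooth_on k S (\<lambda>x. L (f x))"
  using assms(3)
proof (induction k arbitrary: f)
  case 0 then show ?case using bounded_linear.continuous_on[OF assms(1)] by auto
next
  case (Suc k)
  have d: "((\<lambda>x. L (f x)) has_derivative (\<lambda>v. L (frechet_derivative f (at x) v))) (at x)"
    if "x \<in> S" for x
    using Suc.prems that by (intro bounded_linear.has_derivative[OF assms(1)] has_derivative_frechetI) auto
  have e: "frechet_derivative (\<lambda>x. L (f x)) (at x) v = L (frechet_derivative f (at x) v)"
    if "x \<in> S" for x v using frechet_derivative_at'[OF d[OF that]] by simp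
  have "k_smooth_on k S (\<lambda>x. frechet_derivative (\<lambda>x. L (f x)) (at x) v)" for v
    by (rule k_smooth_on_congI[OF assms(2) _ e]) (use Suc.prems in \<open>auto intro!: Suc.IH\<close>)
  with d show ?case by (auto simp: differentiable_def)
qed

lemma k_smooth_on_sum:
  assumes "open S" "finite B" "\<And>b. b \<in> B \<Longrightarrow> k_smooth_on k S (f b)"
  shows "k_smooth_on k S (\<lambda>x. \<Sum>b\<in>B. f b x)"
  using assms(2,3)
proof (induction B)
  case empty then show ?case by (simp add: k_smooth_on_const)
next
  case (insert b B) then show ?case by (simp add: k_smooth_on_add assms(1))
qed

lemma linear_basis_sum:
  fixes L :: "'a::euclidean_space \<Rightarrow> 'b::real_vector"
  assumes "linear L"
  shows "L v = (\<Sum>b\<in>Basis. (v \<bullet> b) *\<^sub>R L b)"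
proof -
  have "L v = L (\<Sum>b\<in>Basis. (v \<bullet> b) *\<^sub>R b)" by (simp add: euclidean_representation)
  also have "\<dots> = (\<Sum>b\<in>Basis. (v \<bullet> b) *\<^sub>R L b)" using assms by (simp add: linear_sum linear_cmul)
  finally show ?thesis .
qed

text \<open>Smoothness is defined through derivatives in fixed directions, while the chain rule
  differentiates \<open>f\<close> in the direction \<open>frechet_derivative h (at x) v\<close>,
  which varies with \<open>x\<close>. Expanding that direction in the basis of the intermediate
  space leaves only fixed directions, at the price of scalar factors of the right order.\<close>

lemma k_smooth_on_compose:
  fixes f :: "'b::euclidean_space \<Rightarrow> 'c::real_normed_vector"
    and h :: "'a::real_normed_vector \<Rightarrow> 'b"
  assumes "open S" "open U" "k_smooth_on k U f" "k_smooth_on k S h" "\<And>x. x \<in> S \<Longrightarrow> h x \<in> U"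
  shows "k_smooth_on k S (\<lambda>x. f (h x))"
  using assms(3,4)
proof (induction k arbitrary: f)
  case 0 then show ?case using assms(5) by (auto intro: continuous_on_compose2)
next
  case (Suc k)
  have df: "(f has_derivative frechet_derivative f (at (h x))) (at (h x))" if "x \<in> S" for x
    using Suc.prems assms(5)[OF that] by (intro has_derivative_frechetI) auto
  have d: "((\<lambda>x. f (h x)) has_derivative (\<lambda>v. frechet_derivative f (at (h x)) (frechet_derivative h (at x) v))) (at x)"
    if "x \<in> S" for x
    by (rule has_derivative_compose[where f=h and g=f, OF _ df[OF that]])
      (use Suc.prems that in \<open>auto intro: has_derivative_frechetI\<close>)
  have e: "frechet_derivative (\<lambda>x. f (h x)) (at x) v =
      (\<Sum>b\<in>Basis. (frechet_derivative h (at x) v \<bullet> b) *\<^sub>R frechet_derivative f (at (h x)) b)"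
    if "x \<in> S" for x v
    using frechet_derivative_at'[OF d[OF that]]
      linear_basis_sum[OF has_derivative_linear[OF df[OF that]], of "frechet_derivative h (at x) v"]
    by simp
  have "k_smooth_on k S (\<lambda>x. frechet_derivative (\<lambda>x. f (h x)) (at x) v)" for v
  proof (rule k_smooth_on_congI[OF assms(1) _ e], intro k_smooth_on_sum k_smooth_on_bilinear[OF bounded_bilinear_scaleR] assms(1) finite_Basis)
    fix b :: 'b assume "b \<in> Basis"
    show "k_smooth_on k S (\<lambda>x. frechet_derivative h (at x) v \<bullet> b)"
      using Suc.prems by (intro k_smooth_on_linear_compose[OF bounded_linear_inner_left]) (auto simp: assms)
    show "k_smooth_on k S (\<lambda>x. frechet_derivative f (at (h x)) b)"
      using Suc.prems k_smooth_on_Suc by (intro Suc.IH[of "\<lambda>y. frechet_derivative f (at y) b"]) auto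
  qed
  with d show ?case by (auto simp: differentiable_def)
qed

lemma k_smooth_on_Pair:
  assumes "open S" "k_smooth_on k S f" "k_smooth_on k S g"
  shows "k_smooth_on k S (\<lambda>x. (f x, g x))"
proof -
  have "k_smooth_on k S (\<lambda>x. (f x, 0) + (0, g x))"
    using assms by (intro k_smooth_on_add k_smooth_on_linear_compose[where L="\<lambda>x. (x, 0)"]
        k_smooth_on_linear_compose[where L="\<lambda>x. (0, x)"]) (auto intro!: bounded_linear_intros)
  then show ?thesis by simp
qed

lemma k_smooth_on_scaleR:
  "open S \<Longrightarrow> k_smooth_on k S f \<Longrightarrow> k_smooth_on k S g \<Longrightarrow> k_smooth_on k S (\<lambda>x. f x *\<^sub>R g x)"
  by (rule k_smooth_on_bilinear[OF bounded_bilinear_scaleR])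

lemma k_smooth_on_mult:
  fixes f g :: "_ \<Rightarrow> real"
  shows "open S \<Longrightarrow> k_smooth_on k S f \<Longrightarrow> k_smooth_on k S g \<Longrightarrow> k_smooth_on k S (\<lambda>x. f x * g x)"
  by (rule k_smooth_on_bilinear[OF bounded_bilinear_mult])

lemma k_smooth_on_diff:
  "open S \<Longrightarrow> k_smooth_on k S f \<Longrightarrow> k_smooth_on k S g \<Longrightarrow> k_smooth_on k S (\<lambda>x. f x - g x)"
  using k_smooth_on_add[of S k f "\<lambda>x. - g x"]
    k_smooth_on_linear_compose[OF bounded_linear_minus[OF bounded_linear_ident], of S k g]
  by simp

lemma smooth_on_compose:
  fixes f :: "'b::euclidean_space \<Rightarrow> 'c::real_normed_vector"
    and h :: "'a::real_normed_vector \<Rightarrow> 'b"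
  assumes "open S" "open U" "smooth_on U f" "smooth_on S h" "\<And>x. x \<in> S \<Longrightarrow> h x \<in> U"
  shows "smooth_on S (\<lambda>x. f (h x))"
  using k_smooth_on_compose[of S U _ f h] assms by (auto simp: smooth_on_def)

lemma smooth_on_const: "smooth_on S (\<lambda>x. c)"
  by (simp add: smooth_on_def k_smooth_on_const)

lemma smooth_on_diff:
  "open S \<Longrightarrow> smooth_on S f \<Longrightarrow> smooth_on S g \<Longrightarrow> smooth_on S (\<lambda>x. f x - g x)"
  by (simp add: smooth_on_def k_smooth_on_diff)

lemma smooth_on_scaleR:
  "open S \<Longrightarrow> smooth_on S f \<Longrightarrow> smooth_on S g \<Longrightarrow> smooth_on S (\<lambda>x. f x *\<^sub>R g x)"
  by (simp add: smooth_on_def k_smooth_on_scaleR)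

lemma smooth_on_mult:
  fixes f g :: "_ \<Rightarrow> real"
  shows "open S \<Longrightarrow> smooth_on S f \<Longrightarrow> smooth_on S g \<Longrightarrow> smooth_on S (\<lambda>x. f x * g x)"
  by (simp add: smooth_on_def k_smooth_on_mult)

lemma smooth_on_sum:
  "open S \<Longrightarrow> finite B \<Longrightarrow> (\<And>b. b \<in> B \<Longrightarrow> smooth_on S (f b)) \<Longrightarrow> smooth_on S (\<lambda>x. \<Sum>b\<in>B. f b x)"
  by (simp add: smooth_on_def k_smooth_on_sum)

lemma smooth_on_Pair:
  "open S \<Longrightarrow> smooth_on S f \<Longrightarrow> smooth_on S g \<Longrightarrow> smooth_on S (\<lambda>x. (f x, g x))"
  by (simp add: smooth_on_def k_smooth_on_Pair)

lemma smooth_on_bounded_linear: "bounded_linear L \<Longrightarrow> smooth_on S L"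
  by (simp add: smooth_on_def k_smooth_on_bounded_linear)

lemma smooth_on_fst: "smooth_on S fst" and smooth_on_snd: "smooth_on S snd"
  by (auto intro!: smooth_on_bounded_linear bounded_linear_intros)

lemma smooth_on_ident: "smooth_on S (\<lambda>x. x)"
  by (auto intro!: smooth_on_bounded_linear bounded_linear_intros)

lemma smooth_on_linear_compose:
  "bounded_linear L \<Longrightarrow> open S \<Longrightarrow> smooth_on S f \<Longrightarrow> smooth_on S (\<lambda>x. L (f x))"
  by (simp add: smooth_on_def k_smooth_on_linear_compose)

section \<open>Positive definite linear systems\<close>

text \<open>An inner product as a bare function, because the coordinate metric at a point is one.
  The Christoffel symbols, the gradient and the adjoint all arise as solutions of linear systems
  with such a form as coefficients.\<close>

definition posdef :: "('e::euclidean_space \<Rightarrow> 'e \<Rightarrow> real) \<Rightarrow> bool" where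
  "posdef B \<longleftrightarrow> bilinear B \<and> (\<forall>u w. B u w = B w u) \<and> (\<forall>u. u \<noteq> 0 \<longrightarrow> B u u > 0)"

lemma posdefD:
  assumes "posdef B"
  shows "bilinear B" "B u w = B w u" "u \<noteq> 0 \<Longrightarrow> B u u > 0" "B u u \<ge> 0"
    "B (u + v) w = B u w + B v w" "B u (v + w) = B u v + B u w"
    "B (u - v) w = B u w - B v w" "B u (v - w) = B u v - B u w"
    "B (r *\<^sub>R u) w = r * B u w" "B u (r *\<^sub>R w) = r * B u w"
    "B 0 w = 0" "B u 0 = 0"
proof -
  show b: "bilinear B" and "B u w = B w u" and p: "u \<noteq> 0 \<Longrightarrow> B u u > 0"
    using assms by (auto simp: posdef_def)
  show "B (u + v) w = B u w + B v w" "B u (v + w) = B u v + B u w"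
    "B (u - v) w = B u w - B v w" "B u (v - w) = B u v - B u w"
    "B (r *\<^sub>R u) w = r * B u w" "B u (r *\<^sub>R w) = r * B u w" "B 0 w = 0" "B u 0 = 0"
    using b by (simp_all add: bilinear_ladd bilinear_radd bilinear_lsub bilinear_rsub
        bilinear_lmul bilinear_rmul bilinear_lzero bilinear_rzero)
  then show "B u u \<ge> 0" using p by (cases "u = 0") auto
qed

lemmas posdef_linear = posdefD(5-12)

lemma bilinear_basis_sum:
  fixes B :: "'e::euclidean_space \<Rightarrow> 'e \<Rightarrow> real"
  assumes "bilinear B"
  shows "B u w = (\<Sum>b\<in>Basis. \<Sum>c\<in>Basis. (u \<bullet> b) * (w \<bullet> c) * B b c)"
proof -
  have "B u w = (\<Sum>b\<in>Basis. (u \<bullet> b) *\<^sub>R B b w)"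
    using assms by (intro linear_basis_sum[where L="\<lambda>u. B u w"]) (simp add: bilinear_def)
  also have "\<dots> = (\<Sum>b\<in>Basis. (u \<bullet> b) *\<^sub>R (\<Sum>c\<in>Basis. (w \<bullet> c) *\<^sub>R B b c))"
    using assms linear_basis_sum[where L="B b" and v=w for b] by (simp add: bilinear_def)
  finally show ?thesis by (simp add: sum_distrib_left mult.assoc)
qed

lemma bilinear_abs_le:
  fixes B :: "'e::euclidean_space \<Rightarrow> 'e \<Rightarrow> real"
  assumes "bilinear B"
  shows "\<bar>B u w\<bar> \<le> (\<Sum>b\<in>Basis. \<Sum>c\<in>Basis. \<bar>B b c\<bar>) * norm u * norm w"
proof -
  have "\<bar>B u w\<bar> \<le> (\<Sum>b\<in>Basis. \<Sum>c\<in>Basis. \<bar>(u \<bullet> b) * (w \<bullet> c) * B b c\<bar>)"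
    unfolding bilinear_basis_sum[OF assms, of u w]
    by (intro order_trans[OF sum_abs] sum_mono order_refl)
  also have "\<dots> \<le> (\<Sum>b\<in>Basis. \<Sum>c\<in>Basis. norm u * norm w * \<bar>B b c\<bar>)"
    by (intro sum_mono) (auto simp: abs_mult Basis_le_norm intro!: mult_mono)
  finally show ?thesis by (simp add: sum_distrib_left sum_distrib_right mult_ac)
qed

text \<open>The square system is injective: a solution \<open>z\<close> of the homogeneous system
  satisfies \<open>B z z = 0\<close>. In finite dimension injectivity gives surjectivity.\<close>

lemma posdef_solvable:
  assumes "posdef B"
  shows "\<exists>!z. \<forall>b\<in>Basis. B z b = r b"
proof -
  define L where "L z = (\<Sum>b\<in>Basis. B z b *\<^sub>R b)" for z
  have lin: "linear L"
    unfolding L_def using posdef_linear[OF assms]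
    by (intro linearI) (simp_all add: scaleR_left.sum sum.distrib algebra_simps scaleR_right.sum)
  have eq: "L z \<bullet> b = B z b" if "b \<in> Basis" for z b
    using that by (simp add: L_def inner_sum_left inner_Basis if_distrib cong: if_cong)
  have zero: "z = 0" if "\<forall>b\<in>Basis. B z b = 0" for z
  proof (rule ccontr)
    assume "z \<noteq> 0"
    moreover have "B z z = (\<Sum>b\<in>Basis. (z \<bullet> b) *\<^sub>R B z b)"
      using posdefD(1)[OF assms] by (intro linear_basis_sum) (simp add: bilinear_def)
    ultimately show False using posdefD(3)[OF assms, of z] that by simp
  qed
  have "inj L"
    unfolding linear_injective_0[OF lin] using zero eq by (metis inner_zero_left)
  then have "surj L" using lin by (simp add: linear_injective_imp_surjective)
  then obtain z where z: "L z = (\<Sum>b\<in>Basis. r b *\<^sub>R b)" by (metis surjD)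
  show ?thesis
  proof (rule ex1I[of _ z])
    have "L z \<bullet> b = r b" if "b \<in> Basis" for b
      unfolding z using that by (simp add: inner_sum_left inner_Basis if_distrib cong: if_cong)
    then show "\<forall>b\<in>Basis. B z b = r b" using eq by metis
    fix y assume "\<forall>b\<in>Basis. B y b = r b"
    then have "\<forall>b\<in>Basis. B (y - z) b = 0"
      using \<open>\<forall>b\<in>Basis. B z b = r b\<close> posdef_linear[OF assms] by simp
    then show "y = z" using zero by fastforce
  qed
qed

lemma posdef_Riesz:
  assumes "posdef B" "linear f"
  shows "\<exists>!z. \<forall>w. B z w = f w"
proof -
  have "(\<forall>w. B z w = f w) \<longleftrightarrow> (\<forall>b\<in>Basis. B z b = f b)" for z
  proof
    assume *: "\<forall>b\<in>Basis. B z b = f b"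
    show "\<forall>w. B z w = f w"
    proof
      fix w
      have "B z w = (\<Sum>b\<in>Basis. (w \<bullet> b) *\<^sub>R B z b)"
        using posdefD(1)[OF assms(1)] by (intro linear_basis_sum) (simp add: bilinear_def)
      also have "\<dots> = f w" using * linear_basis_sum[OF assms(2), of w] by simp
      finally show "B z w = f w" .
    qed
  qed auto
  then show ?thesis using posdef_solvable[OF assms(1), of f] by simp
qed

text \<open>On the compact unit sphere the quadratic form attains a positive minimum; homogeneity
  carries it to all vectors.\<close>

lemma posdef_coercive:
  assumes "posdef (B :: 'e::euclidean_space \<Rightarrow> 'e \<Rightarrow> real)"
  obtains m where "m > 0" "\<And>u. m * (norm u)\<^sup>2 \<le> B u u"
proof -
  have "continuous_on (sphere 0 1) (\<lambda>u. B u u)"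
    by (subst bilinear_basis_sum[OF posdefD(1)[OF assms]]) (intro continuous_intros)
  moreover obtain b0 :: 'e where "b0 \<in> Basis" using nonempty_Basis by blast
  then have "sphere (0::'e) 1 \<noteq> {}" by (auto intro!: exI[of _ b0])
  ultimately obtain u0 where u0: "u0 \<in> sphere 0 1" "\<forall>u\<in>sphere 0 1. B u0 u0 \<le> B u u"
    using continuous_attains_inf[OF compact_sphere] by blast
  show ?thesis
  proof
    show "B u0 u0 > 0" using u0 posdefD(3)[OF assms, of u0] by fastforce
    fix u :: 'e
    show "B u0 u0 * (norm u)\<^sup>2 \<le> B u u"
    proof (cases "u = 0")
      case False
      let ?v = "(1 / norm u) *\<^sub>R u"
      have "B u0 u0 \<le> B ?v ?v" using u0 False by auto
      also have "B ?v ?v = B u u / (norm u)\<^sup>2" using posdef_linear[OF assms] by (simp add: power2_eq_square)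
      finally show ?thesis using False by (simp add: pos_le_divide_eq)
    qed (simp add: posdef_linear[OF assms])
  qed
qed

text \<open>Testing the equation with the unknown \<open>e\<close> itself and replacing
  \<open>B\<close> by \<open>B0\<close> costs at most the entrywise distance of the two forms, which
  is subtracted from the coercivity constant of \<open>B0\<close>.\<close>

lemma linear_system_estimate:
  fixes B0 B :: "'e::euclidean_space \<Rightarrow> 'e \<Rightarrow> real"
  assumes "posdef B0" "bilinear B" "\<And>u. m * (norm u)\<^sup>2 \<le> B0 u u" "\<And>b. b \<in> Basis \<Longrightarrow> B e b = f b"
  shows "(m - (\<Sum>b\<in>Basis. \<Sum>c\<in>Basis. \<bar>B0 b c - B b c\<bar>)) * norm e \<le> (\<Sum>b\<in>Basis. \<bar>f b\<bar>)"
proof (cases "e = 0")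
  case False
  have bl: "bilinear (\<lambda>u w. B0 u w - B u w)"
    using posdefD(1)[OF assms(1)] assms(2)
    by (auto simp: bilinear_def intro: linear_compose_sub)
  have "m * (norm e)\<^sup>2 \<le> (B0 e e - B e e) + B e e" using assms(3) by simp
  also have "\<dots> \<le> (\<Sum>b\<in>Basis. \<Sum>c\<in>Basis. \<bar>B0 b c - B b c\<bar>) * norm e * norm e + (\<Sum>b\<in>Basis. \<bar>f b\<bar>) * norm e"
  proof (intro add_mono)
    show "B0 e e - B e e \<le> (\<Sum>b\<in>Basis. \<Sum>c\<in>Basis. \<bar>B0 b c - B b c\<bar>) * norm e * norm e"
      using bilinear_abs_le[OF bl, of e e] by simp
    have "B e e = (\<Sum>b\<in>Basis. (e \<bullet> b) *\<^sub>R B e b)"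
      using assms(2) by (intro linear_basis_sum) (simp add: bilinear_def)
    also have "\<dots> \<le> (\<Sum>b\<in>Basis. \<bar>f b\<bar> * norm e)"
    proof (intro sum_mono)
      fix b :: 'e assume b: "b \<in> Basis"
      have "(e \<bullet> b) *\<^sub>R B e b \<le> \<bar>(e \<bullet> b) * f b\<bar>" using assms(4)[OF b] by simp
      also have "\<dots> \<le> \<bar>f b\<bar> * norm e"
        using Basis_le_norm[OF b, of e] by (simp add: abs_mult mult.commute[of _ "\<bar>f b\<bar>"] mult_left_mono)
      finally show "(e \<bullet> b) *\<^sub>R B e b \<le> \<bar>f b\<bar> * norm e" .
    qed
    finally show "B e e \<le> (\<Sum>b\<in>Basis. \<bar>f b\<bar>) * norm e" by (simp add: sum_distrib_right)
  qed
  finally have "((m - (\<Sum>b\<in>Basis. \<Sum>c\<in>Basis. \<bar>B0 b c - B b c\<bar>)) * norm e) * norm e \<le> (\<Sum>b\<in>Basis. \<bar>f b\<bar>) * norm e"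
    by (simp add: algebra_simps power2_eq_square)
  then show ?thesis using False by simp
qed (simp add: sum_nonneg)

text \<open>Near \<open>y\<close> the coefficients differ from those at \<open>y\<close> by less
  than half the coercivity constant \<open>m\<close>, so the inverses of the systems are uniformly
  bounded with constant \<open>2 / m\<close>.\<close>

lemma linear_system_eventually:
  fixes a :: "'x::t2_space \<Rightarrow> 'e::euclidean_space \<Rightarrow> 'e \<Rightarrow> real"
  assumes "open S" "y \<in> S" "\<And>x. x \<in> S \<Longrightarrow> posdef (a x)" "\<And>u w. isCont (\<lambda>x. a x u w) y"
  obtains C where "C > 0"
    "\<forall>\<^sub>F x in nhds y. \<forall>e f. (\<forall>b\<in>Basis. a x e b = f b) \<longrightarrow> norm e \<le> C * (\<Sum>b\<in>Basis. \<bar>f b\<bar>)"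
proof -
  obtain m where m: "m > 0" "\<And>u. m * (norm u)\<^sup>2 \<le> a y u u"
    using posdef_coercive[OF assms(3)[OF assms(2)]] by blast
  define \<mu> where "\<mu> x = (\<Sum>b\<in>Basis. \<Sum>c\<in>Basis. \<bar>a y b c - a x b c\<bar>)" for x
  have "isCont \<mu> y" unfolding \<mu>_def using assms(4) by (intro continuous_intros)
  then have "(\<mu> \<longlongrightarrow> \<mu> y) (nhds y)" by (simp add: isCont_def tendsto_at_iff_tendsto_nhds)
  moreover have "\<mu> y = 0" by (simp add: \<mu>_def)
  ultimately have "\<forall>\<^sub>F x in nhds y. \<mu> x < m / 2" using m by (intro order_tendstoD(2)[of \<mu> "\<mu> y"]) auto
  moreover have "\<forall>\<^sub>F x in nhds y. x \<in> S" using assms by (simp add: eventually_nhds_in_open)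
  ultimately have "\<forall>\<^sub>F x in nhds y. \<forall>e f. (\<forall>b\<in>Basis. a x e b = f b) \<longrightarrow> norm e \<le> (2 / m) * (\<Sum>b\<in>Basis. \<bar>f b\<bar>)"
  proof eventually_elim
    case (elim x)
    show ?case
    proof (intro allI impI)
      fix e f assume *: "\<forall>b\<in>Basis. a x e b = f b"
      have "(m - \<mu> x) * norm e \<le> (\<Sum>b\<in>Basis. \<bar>f b\<bar>)"
        unfolding \<mu>_def using * elim assms(2,3) posdefD(1) m by (intro linear_system_estimate) auto
      moreover have "m / 2 * norm e \<le> (m - \<mu> x) * norm e" using elim by (intro mult_right_mono) auto
      ultimately have "m / 2 * norm e \<le> (\<Sum>b\<in>Basis. \<bar>f b\<bar>)" by linarith
      then show "norm e \<le> (2 / m) * (\<Sum>b\<in>Basis. \<bar>f b\<bar>)" using m by (simp add: field_simps)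
    qed
  qed
  then show ?thesis using m by (intro that[of "2 / m"]) auto
qed

lemma linear_system_continuous:
  fixes a :: "'x::t2_space \<Rightarrow> 'e::euclidean_space \<Rightarrow> 'e \<Rightarrow> real"
  assumes "open S" "y \<in> S" "\<And>x. x \<in> S \<Longrightarrow> posdef (a x)" "\<And>u w. isCont (\<lambda>x. a x u w) y"
    "\<And>b. b \<in> Basis \<Longrightarrow> isCont (\<eta> b) y" "\<And>x b. x \<in> S \<Longrightarrow> b \<in> Basis \<Longrightarrow> a x (z x) b = \<eta> b x"
  shows "isCont z y"
proof -
  obtain C where C: "C > 0"
    "\<forall>\<^sub>F x in nhds y. \<forall>e f. (\<forall>b\<in>Basis. a x e b = f b) \<longrightarrow> norm e \<le> C * (\<Sum>b\<in>Basis. \<bar>f b\<bar>)"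
    using linear_system_eventually[OF assms(1-4)] by blast
  define \<nu> where "\<nu> x = C * (\<Sum>b\<in>Basis. \<bar>\<eta> b x - a x (z y) b\<bar>)" for x
  have "isCont \<nu> y"
    unfolding \<nu>_def using assms(4,5) by (intro continuous_intros) auto
  moreover have "\<nu> y = 0" using assms(2,6) by (simp add: \<nu>_def)
  ultimately have lim: "(\<nu> \<longlongrightarrow> 0) (nhds y)"
    using tendsto_at_iff_tendsto_nhds[of \<nu> y] by (simp add: isCont_def)
  have "\<forall>\<^sub>F x in nhds y. x \<in> S" using assms by (simp add: eventually_nhds_in_open)
  with C(2) have "\<forall>\<^sub>F x in nhds y. norm (z x - z y) \<le> \<nu> x"
  proof eventually_elim
    case (elim x)
    then show ?case using assms(6)[of x] posdefD(7)[OF assms(3)[of x]] by (simp add: \<nu>_def)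
  qed
  from Lim_null_comparison[OF this lim] have "((\<lambda>x. z x - z y) \<longlongrightarrow> 0) (nhds y)" .
  then have "(z \<longlongrightarrow> z y) (nhds y)" by (simp add: LIM_zero_iff)
  then show ?thesis by (simp add: isCont_def tendsto_at_iff_tendsto_nhds)
qed

text \<open>Formal differentiation of the equation determines the candidate \<open>l\<close> as the
  solution of a system at \<open>y\<close>. The remainder \<open>z x - z y - l (x - y)\<close> then
  solves a system at \<open>x\<close>, and the uniform bound on the inverses reduces its size to
  that of the right-hand side.\<close>

lemma linear_system_has_derivative:
  fixes a :: "'x::euclidean_space \<Rightarrow> 'e::euclidean_space \<Rightarrow> 'e \<Rightarrow> real"
  assumes "open S" "y \<in> S" "\<And>x. x \<in> S \<Longrightarrow> posdef (a x)"
    "\<And>u w. ((\<lambda>x. a x u w) has_derivative a' u w) (at y)"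
    "\<And>b. b \<in> Basis \<Longrightarrow> (\<eta> b has_derivative \<eta>' b) (at y)"
    "\<And>x b. x \<in> S \<Longrightarrow> b \<in> Basis \<Longrightarrow> a x (z x) b = \<eta> b x"
  obtains l where "(z has_derivative l) (at y)"
    "\<And>v b. b \<in> Basis \<Longrightarrow> a y (l v) b = \<eta>' b v - a' (z y) b v"
proof -
  note pd = posdefD[OF assms(3)[OF assms(2)]]
  define l where "l v = (THE s. \<forall>b\<in>Basis. a y s b = \<eta>' b v - a' (z y) b v)" for v
  have l: "a y (l v) b = \<eta>' b v - a' (z y) b v" if "b \<in> Basis" for v b
    using theI'[OF posdef_solvable[OF assms(3)[OF assms(2)], of "\<lambda>b. \<eta>' b v - a' (z y) b v"]] that
    unfolding l_def by blast
  have uniq: "s = l v" if "\<And>b. b \<in> Basis \<Longrightarrow> a y s b = \<eta>' b v - a' (z y) b v" for s v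
    using posdef_solvable[OF assms(3)[OF assms(2)], of "\<lambda>b. \<eta>' b v - a' (z y) b v"] that l by blast
  have lin_e: "linear (\<eta>' b)" if "b \<in> Basis" for b using assms(5)[OF that] has_derivative_linear by blast
  have lin_a: "linear (a' u w)" for u w using assms(4) has_derivative_linear by blast
  have "linear l"
  proof (rule linearI)
    fix u v show "l (u + v) = l u + l v"
      by (rule uniq[symmetric]) (simp add: pd(5-12) l linear_add[OF lin_a] linear_add[OF lin_e])
  next
    fix r v show "l (r *\<^sub>R v) = r *\<^sub>R l v"
      by (rule uniq[symmetric]) (simp add: pd(5-12) l linear_cmul[OF lin_a] linear_cmul[OF lin_e] algebra_simps)
  qed
  then have bl: "bounded_linear l" by (simp add: linear_linear)
  obtain C where C: "C > 0"
    "\<forall>\<^sub>F x in nhds y. \<forall>e f. (\<forall>b\<in>Basis. a x e b = f b) \<longrightarrow> norm e \<le> C * (\<Sum>b\<in>Basis. \<bar>f b\<bar>)"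
    using linear_system_eventually[OF assms(1,2), of a, OF assms(3)] assms(4) has_derivative_continuous
    by blast
  \<comment> \<open>Right-hand side of the system solved by the remainder. It vanishes at
    \<open>y\<close>, and so does its derivative, by the defining equation of
    \<open>l\<close>.\<close>
  define r where "r b x = \<eta> b x - a x (z y) b - (\<Sum>c\<in>Basis. (l (x - y) \<bullet> c) * a x c b)" for b x
  have rd: "(r b has_derivative (\<lambda>v. 0)) (at y)" if b: "b \<in> Basis" for b
  proof -
    have ld: "((\<lambda>x. l (x - y) \<bullet> c) has_derivative (\<lambda>v. l v \<bullet> c)) (at y)" for c
      by (intro has_derivative_inner_left bounded_linear.has_derivative[OF bl])
        (auto intro!: derivative_eq_intros)
    have "(r b has_derivative (\<lambda>v. \<eta>' b v - a' (z y) b v -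
        (\<Sum>c\<in>Basis. (l (y - y) \<bullet> c) * a' c b v + (l v \<bullet> c) * a y c b))) (at y)"
      unfolding r_def
      by (intro has_derivative_diff has_derivative_sum has_derivative_mult ld assms(4) assms(5)[OF b])
    moreover have "(\<Sum>c\<in>Basis. (l v \<bullet> c) * a y c b) = \<eta>' b v - a' (z y) b v" for v
      using linear_basis_sum[of "\<lambda>u. a y u b" "l v"] pd(1) l[OF b, of v] by (simp add: bilinear_def)
    moreover have "l 0 = 0" using \<open>linear l\<close> by (rule linear_0)
    ultimately show ?thesis by simp
  qed
  have r0: "r b y = 0" if "b \<in> Basis" for b
    using assms(2,6) that linear_0[OF \<open>linear l\<close>] by (simp add: r_def)
  have lim: "((\<lambda>x. C * (\<Sum>b\<in>Basis. \<bar>norm (r b x) / norm (x - y)\<bar>)) \<longlongrightarrow> C * (\<Sum>b\<in>(Basis::'e set). \<bar>0\<bar>)) (at y)"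
  proof (intro tendsto_intros)
    fix b :: 'e assume b: "b \<in> Basis"
    show "((\<lambda>x. norm (r b x) / norm (x - y)) \<longlongrightarrow> 0) (at y)"
      using rd[OF b] r0[OF b] by (simp add: has_derivative_iff_norm)
  qed
  have "\<forall>\<^sub>F x in at y. x \<in> S" using assms by (simp add: eventually_at_in_open')
  moreover have "\<forall>\<^sub>F x in at y. \<forall>e f. (\<forall>b\<in>Basis. a x e b = f b) \<longrightarrow> norm e \<le> C * (\<Sum>b\<in>Basis. \<bar>f b\<bar>)"
    using C(2) eventually_at_filter by (simp add: eventually_at_filter eventually_mono)
  ultimately have "\<forall>\<^sub>F x in at y. norm (norm (z x - z y - l (x - y)) / norm (x - y))
      \<le> C * (\<Sum>b\<in>Basis. \<bar>norm (r b x) / norm (x - y)\<bar>)"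
  proof eventually_elim
    case (elim x)
    have "a x (z x - z y - l (x - y)) b = r b x" if "b \<in> Basis" for b
    proof -
      have "a x (l (x - y)) b = (\<Sum>c\<in>Basis. (l (x - y) \<bullet> c) * a x c b)"
        using linear_basis_sum[of "\<lambda>u. a x u b" "l (x - y)"] posdefD(1)[OF assms(3)[OF elim(1)]]
        by (simp add: bilinear_def)
      then show ?thesis using posdefD(7)[OF assms(3)[OF elim(1)]] assms(6)[OF elim(1) that]
        by (simp add: r_def)
    qed
    then have "norm (z x - z y - l (x - y)) \<le> C * (\<Sum>b\<in>Basis. \<bar>r b x\<bar>)"
      using elim(2)[rule_format, where f="\<lambda>b. r b x"] by auto
    then have "norm (z x - z y - l (x - y)) / norm (x - y) \<le> C * (\<Sum>b\<in>Basis. \<bar>r b x\<bar>) / norm (x - y)"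
      by (rule divide_right_mono) simp
    then show ?case by (simp add: sum_divide_distrib[symmetric])
  qed
  from Lim_null_comparison[OF this] lim
  have "((\<lambda>x. norm (z x - z y - l (x - y)) / norm (x - y)) \<longlongrightarrow> 0) (at y)" by simp
  then have "(z has_derivative l) (at y)" using bl by (simp add: has_derivative_iff_norm)
  then show ?thesis using l that by blast
qed

text \<open>The derivative of a solution solves the same system with a new right-hand side in which
  \<open>z\<close> occurs undifferentiated, so regularity is gained one order at a time. It is
  applied to objects specified by definite descriptions, whose smoothness is not visible
  otherwise.\<close>

lemma k_smooth_on_linear_system:
  fixes a :: "'x::euclidean_space \<Rightarrow> 'e::euclidean_space \<Rightarrow> 'e \<Rightarrow> real"
  assumes "open S" "\<And>x. x \<in> S \<Longrightarrow> posdef (a x)" "\<And>u w. k_smooth_on k S (\<lambda>x. a x u w)"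
    "\<And>b. b \<in> Basis \<Longrightarrow> k_smooth_on k S (\<eta> b)"
    "\<And>x b. x \<in> S \<Longrightarrow> b \<in> Basis \<Longrightarrow> a x (z x) b = \<eta> b x"
  shows "k_smooth_on k S z"
  using assms(3-5)
proof (induction k arbitrary: \<eta> z)
  case 0
  have "isCont z y" if y: "y \<in> S" for y
    using 0(1)[of u w for u w] 0(2) y assms(1)
    by (intro linear_system_continuous[OF assms(1) y assms(2) _ _ 0(3)])
      (auto simp: continuous_on_eq_continuous_at)
  then show ?case by (simp add: continuous_at_imp_continuous_on)
next
  case (Suc k)
  have zk: "k_smooth_on k S z"
    using Suc.prems k_smooth_on_Suc by (intro Suc.IH[of \<eta> z]) blast+
  define \<eta>' where "\<eta>' v b x = frechet_derivative (\<eta> b) (at x) v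
      - (\<Sum>c\<in>Basis. (z x \<bullet> c) * frechet_derivative (\<lambda>x. a x c b) (at x) v)" for v b x
  have ex: "\<exists>l. (z has_derivative l) (at y) \<and> (\<forall>v. \<forall>b\<in>Basis. a y (l v) b = \<eta>' v b y)"
    if y: "y \<in> S" for y
  proof -
    have ad: "((\<lambda>x. a x u w) has_derivative frechet_derivative (\<lambda>x. a x u w) (at y)) (at y)" for u w
      using Suc.prems(1) y by (intro has_derivative_frechetI) auto
    obtain l where l: "(z has_derivative l) (at y)"
      "\<And>v b. b \<in> Basis \<Longrightarrow> a y (l v) b = frechet_derivative (\<eta> b) (at y) v
          - frechet_derivative (\<lambda>x. a x (z y) b) (at y) v"
      using linear_system_has_derivative[OF assms(1) y assms(2) ad _ Suc.prems(3),
          of "\<lambda>b. frechet_derivative (\<eta> b) (at y)"] Suc.prems(2) y has_derivative_frechetI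
      by (metis k_smooth_on.simps(2))
    \<comment> \<open>The derivative is taken with \<open>z y\<close> frozen, but \<open>y\<close>
      varies afterwards; the basis expansion separates the two dependences.\<close>
    have "frechet_derivative (\<lambda>x. a x (z y) b) (at y) v =
        (\<Sum>c\<in>Basis. (z y \<bullet> c) * frechet_derivative (\<lambda>x. a x c b) (at y) v)" for b v
    proof -
      have 1: "((\<lambda>x. \<Sum>c\<in>Basis. (z y \<bullet> c) * a x c b) has_derivative
          (\<lambda>v. \<Sum>c\<in>Basis. (z y \<bullet> c) * frechet_derivative (\<lambda>x. a x c b) (at y) v)) (at y)"
        by (intro has_derivative_sum has_derivative_mult_right ad)
      have 2: "a x (z y) b = (\<Sum>c\<in>Basis. (z y \<bullet> c) * a x c b)" if "x \<in> S" for x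
        using linear_basis_sum[of "\<lambda>u. a x u b" "z y"] posdefD(1)[OF assms(2)[OF that]]
        by (simp add: bilinear_def)
      show ?thesis
        using frechet_derivative_cong_open[OF assms(1) y 2] frechet_derivative_at'[OF 1] by simp
    qed
    with l show ?thesis by (auto simp: \<eta>'_def)
  qed
  have "k_smooth_on k S (\<lambda>x. frechet_derivative z (at x) v)" for v
  proof (rule Suc.IH[of "\<eta>' v"])
    show "k_smooth_on k S (\<lambda>x. a x u w)" for u w using Suc.prems(1) k_smooth_on_Suc by blast
    show "k_smooth_on k S (\<eta>' v b)" if "b \<in> Basis" for b
      unfolding \<eta>'_def using Suc.prems(1) Suc.prems(2)[OF that]
      by (intro k_smooth_on_diff k_smooth_on_sum k_smooth_on_mult
          k_smooth_on_linear_compose[OF bounded_linear_inner_left] zk assms(1) finite_Basis) auto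
    show "a x (frechet_derivative z (at x) v) b = \<eta>' v b x" if "x \<in> S" "b \<in> Basis" for x b
      using ex[OF that(1)] that(2) frechet_derivative_at' by metis
  qed
  moreover have "z differentiable (at y)" if "y \<in> S" for y using ex[OF that] by (auto simp: differentiable_def)
  ultimately show ?case by simp
qed

lemma smooth_on_linear_system:
  fixes a :: "'x::euclidean_space \<Rightarrow> 'e::euclidean_space \<Rightarrow> 'e \<Rightarrow> real"
  assumes "open S" "\<And>x. x \<in> S \<Longrightarrow> posdef (a x)" "\<And>u w. smooth_on S (\<lambda>x. a x u w)"
    "\<And>b. b \<in> Basis \<Longrightarrow> smooth_on S (\<eta> b)"
    "\<And>x b. x \<in> S \<Longrightarrow> b \<in> Basis \<Longrightarrow> a x (z x) b = \<eta> b x"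
  shows "smooth_on S z"
  using k_smooth_on_linear_system[OF assms(1,2) _ _ assms(5)] assms(3,4) by (auto simp: smooth_on_def)

section \<open>Mixed derivatives and ordinary differential equations\<close>

lemma frechet_line_derivative:
  fixes f :: "'a::real_normed_vector \<Rightarrow> 'b::real_normed_vector"
  assumes "f differentiable (at (c + s *\<^sub>R u))"
  shows "((\<lambda>s. f (c + s *\<^sub>R u)) has_vector_derivative frechet_derivative f (at (c + s *\<^sub>R u)) u) (at s)"
proof -
  have 1: "((\<lambda>s. c + s *\<^sub>R u) has_derivative (\<lambda>r. r *\<^sub>R u)) (at s)"
    by (auto intro!: derivative_eq_intros)
  have "((\<lambda>s. f (c + s *\<^sub>R u)) has_derivative (\<lambda>r. frechet_derivative f (at (c + s *\<^sub>R u)) (r *\<^sub>R u))) (at s)"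
    using has_derivative_compose[OF 1, of f] has_derivative_frechetI[OF assms] by simp
  moreover have "frechet_derivative f (at (c + s *\<^sub>R u)) (r *\<^sub>R u) = r *\<^sub>R frechet_derivative f (at (c + s *\<^sub>R u)) u" for r
    using linear_cmul[OF linear_frechet_derivative[OF assms]] .
  ultimately show ?thesis by (simp add: has_vector_derivative_def)
qed

text \<open>The mean value theorem is applied to the second difference twice, first along
  \<open>u\<close> to the difference of two parallel segments and then along \<open>v\<close> to the
  derivative in direction \<open>u\<close>.\<close>

lemma mixed_difference:
  fixes f :: "'a::real_normed_vector \<Rightarrow> real"
  assumes "ball x r \<subseteq> S" "smooth_on S f" "h > 0" "h * (norm u + norm v) < r"
  shows "\<exists>p\<in>ball x r. f (x + h *\<^sub>R u + h *\<^sub>R v) - f (x + h *\<^sub>R u) - f (x + h *\<^sub>R v) + f x =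
    h\<^sup>2 * frechet_derivative (\<lambda>y. frechet_derivative f (at y) u) (at p) v"
proof -
  have mem: "x + s *\<^sub>R u + t *\<^sub>R v \<in> ball x r" if "0 \<le> s" "s \<le> h" "0 \<le> t" "t \<le> h" for s t
  proof -
    have "norm (s *\<^sub>R u + t *\<^sub>R v) \<le> s * norm u + t * norm v"
      using norm_triangle_ineq[of "s *\<^sub>R u" "t *\<^sub>R v"] that by simp
    also have "\<dots> \<le> h * norm u + h * norm v" using that by (intro add_mono mult_right_mono) auto
    also have "\<dots> < r" using assms(4) by (simp add: algebra_simps)
    finally have "norm (s *\<^sub>R u + t *\<^sub>R v) < r" .
    moreover have "dist x (x + s *\<^sub>R u + t *\<^sub>R v) = norm (s *\<^sub>R u + t *\<^sub>R v)"
      by (metis add.assoc add_diff_cancel_left' dist_commute dist_norm)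
    ultimately show ?thesis by simp
  qed
  have df: "f differentiable (at p)" if "p \<in> ball x r" for p
    using smooth_on_differentiable[OF assms(2)] assms(1) that by auto
  have ddf: "(\<lambda>y. frechet_derivative f (at y) u) differentiable (at p)" if "p \<in> ball x r" for p
    using smooth_on_differentiable[OF smooth_on_frechet_derivative[OF assms(2)]] assms(1) that by auto
  define g where "g s = f ((x + h *\<^sub>R v) + s *\<^sub>R u) - f (x + s *\<^sub>R u)" for s
  have "\<exists>z>0. z < h \<and> g h - g 0 = (h - 0) * (frechet_derivative f (at ((x + h *\<^sub>R v) + z *\<^sub>R u)) u
      - frechet_derivative f (at (x + z *\<^sub>R u)) u)"
  proof (rule MVT2[OF assms(3)])
    fix s assume s: "0 \<le> s" "s \<le> h"
    have "(x + h *\<^sub>R v) + s *\<^sub>R u \<in> ball x r" "x + s *\<^sub>R u \<in> ball x r"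
      using mem[OF s, of h] mem[OF s, of 0] assms(3) by (simp_all add: add_ac)
    then show "DERIV g s :> frechet_derivative f (at ((x + h *\<^sub>R v) + s *\<^sub>R u)) u - frechet_derivative f (at (x + s *\<^sub>R u)) u"
      unfolding g_def
      using frechet_line_derivative[of f "x + h *\<^sub>R v" s u] frechet_line_derivative[of f x s u] df
      by (intro DERIV_diff) (auto simp: has_real_derivative_iff_has_vector_derivative)
  qed
  then obtain z where z: "0 < z" "z < h"
    "g h - g 0 = h * (frechet_derivative f (at ((x + h *\<^sub>R v) + z *\<^sub>R u)) u - frechet_derivative f (at (x + z *\<^sub>R u)) u)"
    by auto
  define k where "k t = frechet_derivative f (at ((x + z *\<^sub>R u) + t *\<^sub>R v)) u" for t
  have "\<exists>w>0. w < h \<and> k h - k 0 = (h - 0) * frechet_derivative (\<lambda>y. frechet_derivative f (at y) u) (at ((x + z *\<^sub>R u) + w *\<^sub>R v)) v"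
  proof (rule MVT2[OF assms(3)])
    fix t assume t: "0 \<le> t" "t \<le> h"
    show "DERIV k t :> frechet_derivative (\<lambda>y. frechet_derivative f (at y) u) (at ((x + z *\<^sub>R u) + t *\<^sub>R v)) v"
      unfolding k_def
      using frechet_line_derivative[of "\<lambda>y. frechet_derivative f (at y) u" "x + z *\<^sub>R u" t v] ddf mem[of z t] z t
      by (simp add: has_real_derivative_iff_has_vector_derivative)
  qed
  then obtain w where w: "0 < w" "w < h"
    "k h - k 0 = h * frechet_derivative (\<lambda>y. frechet_derivative f (at y) u) (at ((x + z *\<^sub>R u) + w *\<^sub>R v)) v"
    by auto
  have "f (x + h *\<^sub>R u + h *\<^sub>R v) - f (x + h *\<^sub>R u) - f (x + h *\<^sub>R v) + f x = g h - g 0"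
    by (simp add: g_def algebra_simps)
  also have "\<dots> = h * (k h - k 0)" by (simp add: z(3) k_def add_ac)
  finally show ?thesis
    using w mem[of z w] z by (intro bexI[of _ "(x + z *\<^sub>R u) + w *\<^sub>R v"]) (auto simp: power2_eq_square)
qed

text \<open>The second difference over a parallelogram is symmetric in \<open>u\<close> and
  \<open>v\<close>, so the two mixed derivatives take a common value at a pair of points close to
  \<open>x\<close>; by continuity they agree at \<open>x\<close>.\<close>

lemma mixed_derivatives_commute_real:
  fixes f :: "'a::real_normed_vector \<Rightarrow> real"
  assumes "open S" "smooth_on S f" "x \<in> S"
  shows "frechet_derivative (\<lambda>y. frechet_derivative f (at y) u) (at x) v =
    frechet_derivative (\<lambda>y. frechet_derivative f (at y) v) (at x) u"
proof -
  define D where "D u v y = frechet_derivative (\<lambda>y. frechet_derivative f (at y) u) (at y) v" for u v y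
  have cont: "isCont (D u v) x" for u v
    using smooth_on_continuous[OF smooth_on_frechet_derivative[OF smooth_on_frechet_derivative[OF assms(2)]]]
      assms by (simp add: D_def[abs_def] continuous_on_eq_continuous_at)
  have "\<bar>D u v x - D v u x\<bar> \<le> e" if "e > 0" for e
  proof -
    obtain d1 where d1: "d1 > 0" "\<And>y. dist y x < d1 \<Longrightarrow> dist (D u v y) (D u v x) < e / 2"
      using cont[of u v] \<open>e > 0\<close> unfolding continuous_at_eps_delta by (metis half_gt_zero)
    obtain d2 where d2: "d2 > 0" "\<And>y. dist y x < d2 \<Longrightarrow> dist (D v u y) (D v u x) < e / 2"
      using cont[of v u] \<open>e > 0\<close> unfolding continuous_at_eps_delta by (metis half_gt_zero)
    obtain d3 where d3: "d3 > 0" "ball x d3 \<subseteq> S" using assms open_contains_ball by blast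
    define r where "r = min d1 (min d2 d3)"
    have r: "r > 0" "ball x r \<subseteq> S" using d1 d2 d3 by (auto simp: r_def)
    \<comment> \<open>The summand 1 keeps the divisor positive when \<open>u\<close> and
      \<open>v\<close> are zero.\<close>
    define n where "n = norm u + norm v + 1"
    define h where "h = r / 2 / n"
    have np: "n > 0" by (simp add: n_def add_nonneg_pos)
    have h: "h > 0" using r np by (simp add: h_def)
    have "h * (norm u + norm v) \<le> h * n" using h by (simp add: n_def)
    also have "\<dots> = r / 2" using np by (simp add: h_def)
    also have "\<dots> < r" using r by simp
    finally have hr: "h * (norm u + norm v) < r" .
    obtain p where p: "p \<in> ball x r"
      "f (x + h *\<^sub>R u + h *\<^sub>R v) - f (x + h *\<^sub>R u) - f (x + h *\<^sub>R v) + f x = h\<^sup>2 * D u v p"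
      using mixed_difference[OF r(2) assms(2) h hr] unfolding D_def by blast
    obtain q where q: "q \<in> ball x r"
      "f (x + h *\<^sub>R v + h *\<^sub>R u) - f (x + h *\<^sub>R v) - f (x + h *\<^sub>R u) + f x = h\<^sup>2 * D v u q"
      using mixed_difference[OF r(2) assms(2) h, of v u] hr unfolding D_def by (metis add.commute)
    have sw: "x + h *\<^sub>R v + h *\<^sub>R u = x + h *\<^sub>R u + h *\<^sub>R v" by (simp add: add_ac)
    have "h\<^sup>2 * D u v p = h\<^sup>2 * D v u q" using p(2) q(2) unfolding sw by linarith
    then have "D u v p = D v u q" using h by simp
    moreover have "dist (D u v p) (D u v x) < e / 2" "dist (D v u q) (D v u x) < e / 2"
      using d1(2)[of p] d2(2)[of q] p q by (auto simp: r_def dist_commute)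
    ultimately show ?thesis unfolding dist_real_def by linarith
  qed
  then have "\<bar>D u v x - D v u x\<bar> \<le> 0 + e" if "e > 0" for e using that by simp
  from field_le_epsilon[OF this] have "D u v x = D v u x" by simp
  then show ?thesis by (simp add: D_def)
qed

lemma mixed_derivatives_commute:
  fixes f :: "'a::real_normed_vector \<Rightarrow> 'b::euclidean_space"
  assumes "open S" "smooth_on S f" "x \<in> S"
  shows "frechet_derivative (\<lambda>y. frechet_derivative f (at y) u) (at x) v =
    frechet_derivative (\<lambda>y. frechet_derivative f (at y) v) (at x) u"
proof (rule euclidean_eqI)
  fix b :: 'b assume "b \<in> Basis"
  have fb: "frechet_derivative (\<lambda>y. g y \<bullet> b) (at y) w = frechet_derivative g (at y) w \<bullet> b"
    if "g differentiable (at y)" for g :: "'a \<Rightarrow> 'b" and y w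
    using frechet_derivative_at'[OF has_derivative_inner_left[OF has_derivative_frechetI[OF that]]] by metis
  have fb2: "frechet_derivative (\<lambda>y. frechet_derivative (\<lambda>y. f y \<bullet> b) (at y) u) (at x) v =
      frechet_derivative (\<lambda>y. frechet_derivative f (at y) u) (at x) v \<bullet> b" for u v
  proof -
    have "frechet_derivative (\<lambda>y. frechet_derivative (\<lambda>y. f y \<bullet> b) (at y) u) (at x) v =
        frechet_derivative (\<lambda>y. frechet_derivative f (at y) u \<bullet> b) (at x) v"
      by (subst frechet_derivative_cong_open[OF assms(1,3), of _ "\<lambda>y. frechet_derivative f (at y) u \<bullet> b"])
        (use fb smooth_on_differentiable[OF assms(2)] in auto)
    then show ?thesis
      using fb[OF smooth_on_differentiable[OF smooth_on_frechet_derivative[OF assms(2)] assms(3)]] by simp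
  qed
  have "smooth_on S (\<lambda>y. f y \<bullet> b)"
    by (intro smooth_on_linear_compose[OF bounded_linear_inner_left] assms)
  from mixed_derivatives_commute_real[OF assms(1) this assms(3), of u v]
  show "frechet_derivative (\<lambda>y. frechet_derivative f (at y) u) (at x) v \<bullet> b =
    frechet_derivative (\<lambda>y. frechet_derivative f (at y) v) (at x) u \<bullet> b"
    by (simp add: fb2)
qed

lemma k_smooth_on_Suc_real:
  fixes x :: "real \<Rightarrow> 'e::real_normed_vector"
  assumes "open S" "\<And>t. t \<in> S \<Longrightarrow> (x has_vector_derivative v t) (at t)" "k_smooth_on k S v"
  shows "k_smooth_on (Suc k) S x"
proof -
  have e: "frechet_derivative x (at t) s = s *\<^sub>R v t" if "t \<in> S" for t s
    using frechet_derivative_at'[OF assms(2)[OF that, unfolded has_vector_derivative_def]] by simp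
  have "k_smooth_on k S (\<lambda>t. frechet_derivative x (at t) s)" for s
    by (rule k_smooth_on_congI[OF assms(1) k_smooth_on_scaleR[OF assms(1) k_smooth_on_const assms(3)] e])
  moreover have "x differentiable (at t)" if "t \<in> S" for t
    using assms(2)[OF that] by (auto simp: has_vector_derivative_def differentiable_def)
  ultimately show ?thesis by simp
qed

text \<open>Bootstrapping: if \<open>x\<close> and \<open>v\<close> have order \<open>k\<close>,
  then so has the right-hand side of the equation, and both gain one order.\<close>

lemma second_order_solution_smooth:
  fixes H :: "'e::euclidean_space \<times> real \<times> 'e \<Rightarrow> 'e"
  assumes "open S" "open U" "smooth_on (U \<times> UNIV \<times> UNIV) H" "\<And>t. t \<in> S \<Longrightarrow> x t \<in> U"
    "\<And>t. t \<in> S \<Longrightarrow> (x has_vector_derivative v t) (at t)"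
    "\<And>t. t \<in> S \<Longrightarrow> (v has_vector_derivative H (x t, t, v t)) (at t)"
  shows "smooth_on S x"
proof -
  have "k_smooth_on k S x \<and> k_smooth_on k S v" for k
  proof (induction k)
    case 0
    have "isCont x t" "isCont v t" if "t \<in> S" for t
      using assms(5,6)[OF that] has_vector_derivative_continuous by blast+
    then show ?case by (simp add: continuous_at_imp_continuous_on)
  next
    case (Suc k)
    have "k_smooth_on k S (\<lambda>t. H (x t, t, v t))"
      using assms(3,4) Suc smooth_on_ident[of S]
      by (intro k_smooth_on_compose[where U="U \<times> UNIV \<times> UNIV" and f=H and h="\<lambda>t. (x t, t, v t)"]
          k_smooth_on_Pair assms(1) open_Times assms(2) open_UNIV) (auto simp: smooth_on_def)
    then show ?case using Suc k_smooth_on_Suc_real[OF assms(1,5)] k_smooth_on_Suc_real[OF assms(1,6)] by blast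
  qed
  then show ?thesis by (simp add: smooth_on_def)
qed

text \<open>Off the single point \<open>b\<close> the function is a primitive of the continuous
  \<open>f\<close>, and the fundamental theorem tolerates one exceptional point. This joins a
  solution and its continuation at the time where they meet.\<close>

lemma has_vector_derivative_removable:
  fixes z :: "real \<Rightarrow> 'z::banach"
  assumes "a < b" "b < c" "continuous_on {a..c} z" "continuous_on {a..c} f"
    "\<And>t. t \<in> {a<..<c} - {b} \<Longrightarrow> (z has_vector_derivative f t) (at t)"
  shows "(z has_vector_derivative f b) (at b)"
proof -
  have z: "z t = z a + integral {a..t} f" if "t \<in> {a..c}" for t
  proof -
    have "(f has_integral (z t - z a)) {a..t}"
      using assms that by (intro fundamental_theorem_of_calculus_interior_strong[of "{b}"])
        (auto intro: continuous_on_subset)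
    then show ?thesis by (simp add: integral_unique)
  qed
  have "((\<lambda>u. z a + integral {a..u} f) has_vector_derivative f b) (at b within {a..c})"
    using integral_has_vector_derivative[OF assms(4), of b] assms
    by (auto intro!: derivative_eq_intros)
  from has_vector_derivative_transform[OF _ z this]
  have "(z has_vector_derivative f b) (at b within {a..c})" using assms by simp
  then show ?thesis using assms by (simp add: at_within_Icc_at)
qed

text \<open>Composing the right-hand side with the closest-point projection onto the ball makes it
  globally Lipschitz, so that the Picard operator is a contraction of a whole function space.\<close>

lemma ode_solution_exists:
  fixes h :: "real \<Rightarrow> 'z::euclidean_space \<Rightarrow> 'z"
  assumes "r > 0" "e0 > 0" "continuous_on ({b..b+e0} \<times> cball z0 r) (\<lambda>(t, z). h t z)"
    "\<And>t z z'. t \<in> {b..b+e0} \<Longrightarrow> z \<in> cball z0 r \<Longrightarrow> z' \<in> cball z0 r \<Longrightarrow> norm (h t z - h t z') \<le> L * norm (z - z')"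
  obtains e Z where "e > 0" "e \<le> e0" "continuous_on {b..b+e} Z" "Z b = z0"
    "\<And>t. t \<in> {b..b+e} \<Longrightarrow> Z t \<in> cball z0 r"
    "\<And>t. t \<in> {b<..<b+e} \<Longrightarrow> (Z has_vector_derivative h t (Z t)) (at t)"
proof -
  define K where "K = cball z0 r"
  have K: "compact K" "convex K" "closed K" "z0 \<in> K" "K \<noteq> {}" using assms(1) by (auto simp: K_def)
  have "compact ((\<lambda>(t, z). h t z) ` ({b..b+e0} \<times> K))"
    using assms(3) K by (intro compact_continuous_image) (auto simp: K_def intro: compact_Times)
  from compact_imp_bounded[OF this] obtain M0
    where "\<forall>y\<in>(\<lambda>(t, z). h t z) ` ({b..b+e0} \<times> K). norm y \<le> M0" unfolding bounded_iff by blast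
  then have M0: "\<And>t z. t \<in> {b..b+e0} \<Longrightarrow> z \<in> K \<Longrightarrow> norm (h t z) \<le> M0" by force
  define M where "M = max M0 1"
  have M: "M > 0" "\<And>t z. t \<in> {b..b+e0} \<Longrightarrow> z \<in> K \<Longrightarrow> norm (h t z) \<le> M"
    using M0 by (auto simp: M_def intro: max.coboundedI1)
  define L' where "L' = max L 1"
  have L': "L' > 0" "norm (h t z - h t z') \<le> L' * norm (z - z')"
    if "t \<in> {b..b+e0}" "z \<in> K" "z' \<in> K" for t z z'
    using assms(4)[of t z z'] that mult_right_mono[of L L' "norm (z - z')"] by (auto simp: L'_def K_def)
  have L'p: "L' > 0" by (simp add: L'_def)
  \<comment> \<open>\<open>r / M\<close> keeps the Picard iterates inside the ball, and
    \<open>1 / (2 * L')\<close> makes the operator a contraction with factor one half.\<close>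
  define e where "e = min e0 (min (r / M) (1 / (2 * L')))"
  have e: "e > 0" "e \<le> e0" "e \<le> r / M" "e \<le> 1 / (2 * L')"
    using assms(1,2) M L'p by (auto simp: e_def)
  have e': "M * e \<le> r" "L' * e \<le> 1 / 2"
    using e(3,4) M(1) L'p by (auto simp: field_simps)
  \<comment> \<open>Freezing time outside the interval lets the operator act on bounded continuous
    functions on the whole line, a complete metric space that is available as a type.\<close>
  define cl where "cl t = max b (min t (b + e))" for t
  have cl: "cl t \<in> {b..b+e}" "t \<in> {b..b+e} \<Longrightarrow> cl t = t" for t using e by (auto simp: cl_def)
  define P where "P = closest_point K"
  have P: "P z \<in> K" "z \<in> K \<Longrightarrow> P z = z" "norm (P z - P z') \<le> norm (z - z')" for z z'
    using closest_point_in_set[OF K(3,5)] closest_point_self closest_point_lipschitz[OF K(2,3,5)]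
    by (auto simp: P_def dist_norm)
  have cont: "continuous_on {b..b+e} (\<lambda>s. h s (P (f s)))" if "continuous_on UNIV f" for f
  proof -
    have "continuous_on {b..b+e} (\<lambda>s. (s, P (f s)))"
      unfolding P_def using that
      by (intro continuous_intros continuous_on_compose2[OF continuous_on_closest_point[OF K(2,3,5), of UNIV]])
        (auto intro: continuous_on_subset)
    then have "continuous_on {b..b+e} (\<lambda>s. (\<lambda>(t, z). h t z) (s, P (f s)))"
      using P e by (intro continuous_on_compose2[OF assms(3)]) (auto simp: K_def)
    then show ?thesis by simp
  qed
  define Tf where "Tf f t = z0 + integral {b..cl t} (\<lambda>s. h s (P (f s)))" for f :: "real \<Rightarrow> 'z" and t
  have Tnorm: "norm (integral {b..cl t} (\<lambda>s. h s (P (f s)))) \<le> r" if "continuous_on UNIV f" for f t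
  proof -
    have "norm (integral {b..cl t} (\<lambda>s. h s (P (f s)))) \<le> M * (cl t - b)"
    proof (rule integral_bound)
      show "continuous_on {b..cl t} (\<lambda>s. h s (P (f s)))"
        using cont[OF that] cl(1)[of t] by (auto intro: continuous_on_subset)
      show "norm (h s (P (f s))) \<le> M" if "s \<in> {b..cl t}" for s
        using M(2) P(1) that cl(1)[of t] e by auto
    qed (use cl(1)[of t] in auto)
    also have "\<dots> \<le> M * e" using cl(1)[of t] M by (intro mult_left_mono) auto
    finally show ?thesis using e' by simp
  qed
  have Tb: "Tf f \<in> bcontfun" if "continuous_on UNIV f" for f
  proof -
    have "continuous_on {b..b+e} (\<lambda>u. integral {b..u} (\<lambda>s. h s (P (f s))))"
      by (intro indefinite_integral_continuous_1 integrable_continuous_real cont that)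
    then have "continuous_on UNIV (\<lambda>t. integral {b..cl t} (\<lambda>s. h s (P (f s))))"
      by (rule continuous_on_compose2) (use cl in \<open>auto simp: cl_def intro!: continuous_intros\<close>)
    then have "continuous_on UNIV (Tf f)" unfolding Tf_def[abs_def] by (intro continuous_intros)
    moreover have "Tf f t \<in> cball z0 r" for t
      using Tnorm[OF that] by (simp add: Tf_def dist_norm)
    then have "bounded (range (Tf f))" by (intro bounded_subset[OF bounded_cball]) auto
    ultimately show ?thesis by (simp add: bcontfun_def)
  qed
  define T where "T F = Bcontfun (Tf (apply_bcontfun F))" for F
  have T: "apply_bcontfun (T F) = Tf (apply_bcontfun F)" for F
    unfolding T_def by (intro Bcontfun_inverse Tb) simp
  have "\<exists>!F. T F = F"
  proof (rule banach_fix_type[of "1/2"])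
    show "\<forall>F G. dist (T F) (T G) \<le> 1 / 2 * dist F G"
    proof (intro allI dist_bound)
      fix F G :: "real \<Rightarrow>\<^sub>C 'z" and t
      have int: "(\<lambda>s. h s (P (apply_bcontfun F s))) integrable_on {b..cl t}" for F :: "real \<Rightarrow>\<^sub>C 'z"
        by (intro integrable_continuous_real continuous_on_subset[OF cont]) (use cl(1)[of t] in auto)
      have cF: "continuous_on {b..cl t} (\<lambda>s. h s (P (apply_bcontfun F s)))" for F :: "real \<Rightarrow>\<^sub>C 'z"
        by (intro continuous_on_subset[OF cont]) (use cl(1)[of t] in auto)
      have "dist (T F t) (T G t) =
          norm (integral {b..cl t} (\<lambda>s. h s (P (F s)) - h s (P (G s))))"
        by (simp add: T Tf_def dist_norm integral_diff[OF int int])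
      also have "\<dots> \<le> (L' * dist F G) * (cl t - b)"
      proof (rule integral_bound)
        show "continuous_on {b..cl t} (\<lambda>s. h s (P (F s)) - h s (P (G s)))"
          by (intro continuous_on_diff cF)
        fix s assume s: "s \<in> {b..cl t}"
        have "norm (h s (P (F s)) - h s (P (G s))) \<le> L' * norm (P (F s) - P (G s))"
          using s cl(1)[of t] e by (intro L'(2) P) auto
        also have "\<dots> \<le> L' * norm (F s - G s)" using P(3) L'p by simp
        also have "\<dots> \<le> L' * dist F G" using dist_bounded[of F s G] L'p by (simp add: dist_norm)
        finally show "norm (h s (P (F s)) - h s (P (G s))) \<le> L' * dist F G" .
      qed (use cl(1)[of t] in auto)
      also have "\<dots> \<le> (L' * dist F G) * e" using cl(1)[of t] L'p by (intro mult_left_mono) auto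
      also have "\<dots> = (L' * e) * dist F G" by simp
      also have "\<dots> \<le> 1 / 2 * dist F G" using e' by (intro mult_right_mono) auto
      finally show "dist (T F t) (T G t) \<le> 1 / 2 * dist F G" .
    qed
  qed auto
  then obtain F where F: "T F = F" by blast
  define Z where "Z = apply_bcontfun F"
  have Zc: "continuous_on UNIV Z" by (simp add: Z_def)
  have Z: "Z t = z0 + integral {b..cl t} (\<lambda>s. h s (P (Z s)))" for t
    using T[of F] F by (metis Tf_def Z_def)
  have ZK: "Z t \<in> K" for t
    unfolding K_def by (subst Z) (use Tnorm[OF Zc] in \<open>simp add: dist_norm\<close>)
  show ?thesis
  proof
    show "e > 0" "e \<le> e0" by (fact e)+
    show "continuous_on {b..b+e} Z" using Zc continuous_on_subset by blast
    show "Z b = z0" using cl(2)[of b] e by (subst Z) simp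
    show "Z t \<in> cball z0 r" for t using ZK by (simp add: K_def)
    fix t assume t: "t \<in> {b<..<b+e}"
    have "((\<lambda>u. z0 + integral {b..u} (\<lambda>s. h s (P (Z s)))) has_vector_derivative h t (P (Z t))) (at t within {b..b+e})"
      using integral_has_vector_derivative[OF cont[OF Zc], of t] t by (auto intro!: derivative_eq_intros)
    moreover have "Z t = z0 + integral {b..t} (\<lambda>s. h s (P (Z s)))" if "t \<in> {b..b+e}" for t
      using Z[of t] cl(2)[OF that] by simp
    ultimately have "(Z has_vector_derivative h t (P (Z t))) (at t within {b..b+e})"
      using has_vector_derivative_transform[of t "{b..b+e}" Z] t by auto
    then show "(Z has_vector_derivative h t (Z t)) (at t)"
      using t P(2)[OF ZK] by (simp add: at_within_Icc_at)
  qed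
qed

section \<open>Riemannian metrics in coordinates\<close>

lemma bilinearI:
  fixes B :: "'e::euclidean_space \<Rightarrow> 'e \<Rightarrow> real"
  assumes "\<And>u. linear (\<lambda>w. B u w)" "\<And>w. linear (\<lambda>u. B u w)"
  shows "bilinear B"
  using assms by (simp add: bilinear_def)

locale riemannian =
  fixes A :: "('a::{t2_space,second_countable_topology}, 'e::euclidean_space) chart set"
    and g :: "('a, 'e) metric"
  assumes riemannian: "riemannian_manifold A g"
begin

abbreviation "G \<equiv> metric_coords A g"

definition DG :: "('a, 'e) chart \<Rightarrow> 'e \<Rightarrow> 'e \<Rightarrow> 'e \<Rightarrow> 'e \<Rightarrow> real" where
  "DG c x d u w = frechet_derivative (\<lambda>y. G c y u w) (at x) d"

text \<open>Indexed by the point and not by its coordinates, so that Jacobians compose without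
  conversions.\<close>

definition jac :: "('a, 'e) chart \<Rightarrow> ('a, 'e) chart \<Rightarrow> 'a \<Rightarrow> 'e \<Rightarrow> 'e" where
  "jac c d p = frechet_derivative (snd d \<circ> chart_inv c) (at (snd c p))"

lemma is_chart: "c \<in> A \<Longrightarrow> is_chart c"
  using riemannian by (auto simp: riemannian_manifold_def smooth_manifold_def)

lemma chart_homeo: "c \<in> A \<Longrightarrow> homeomorphism (fst c) (chart_image c) (snd c) (chart_inv c)"
  using is_chart by (auto simp: is_chart_def)

lemma open_chart: "c \<in> A \<Longrightarrow> open (fst c)" and open_chart_image: "c \<in> A \<Longrightarrow> open (chart_image c)"
  using is_chart by (auto simp: is_chart_def)

lemma chart_cover: obtains c where "c \<in> A" "p \<in> fst c"
proof -
  have "p \<in> (\<Union>c\<in>A. fst c)"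
    using riemannian unfolding riemannian_manifold_def smooth_manifold_def by blast
  then show ?thesis using that by blast
qed

lemma chart_inv_left: "c \<in> A \<Longrightarrow> p \<in> fst c \<Longrightarrow> chart_inv c (snd c p) = p"
  and chart_inv_right: "c \<in> A \<Longrightarrow> x \<in> chart_image c \<Longrightarrow> snd c (chart_inv c x) = x"
  and chart_inv_mem: "c \<in> A \<Longrightarrow> x \<in> chart_image c \<Longrightarrow> chart_inv c x \<in> fst c"
  and chart_mem: "c \<in> A \<Longrightarrow> p \<in> fst c \<Longrightarrow> snd c p \<in> chart_image c"
  and continuous_on_chart: "c \<in> A \<Longrightarrow> continuous_on (fst c) (snd c)"
  and continuous_on_chart_inv: "c \<in> A \<Longrightarrow> continuous_on (chart_image c) (chart_inv c)"
  using chart_homeo[of c] unfolding homeomorphism_def by auto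

lemma transition_domain:
  assumes "c \<in> A" "d \<in> A"
  shows "open (snd c ` (fst c \<inter> fst d))"
    "x \<in> snd c ` (fst c \<inter> fst d) \<longleftrightarrow> x \<in> chart_image c \<and> chart_inv c x \<in> fst d"
proof -
  show eq: "x \<in> snd c ` (fst c \<inter> fst d) \<longleftrightarrow> x \<in> chart_image c \<and> chart_inv c x \<in> fst d" for x
  proof
    assume "x \<in> snd c ` (fst c \<inter> fst d)"
    then obtain p where "x = snd c p" "p \<in> fst c" "p \<in> fst d" by auto
    then show "x \<in> chart_image c \<and> chart_inv c x \<in> fst d"
      using chart_inv_left[OF assms(1)] chart_mem[OF assms(1)] by simp
  next
    assume "x \<in> chart_image c \<and> chart_inv c x \<in> fst d"
    then show "x \<in> snd c ` (fst c \<inter> fst d)"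
      using chart_inv_right[OF assms(1)] chart_inv_mem[OF assms(1)] by (intro image_eqI[of _ _ "chart_inv c x"]) auto
  qed
  have "open (chart_image c \<inter> chart_inv c -` fst d)"
    using continuous_open_preimage[OF continuous_on_chart_inv[OF assms(1)] open_chart_image[OF assms(1)] open_chart[OF assms(2)]] .
  moreover have "snd c ` (fst c \<inter> fst d) = chart_image c \<inter> chart_inv c -` fst d" using eq by auto
  ultimately show "open (snd c ` (fst c \<inter> fst d))" by simp
qed

lemma open_chart_vimage:
  assumes "c \<in> A" "open X"
  shows "open {p \<in> fst c. snd c p \<in> X}"
proof -
  have "{p \<in> fst c. snd c p \<in> X} = snd c -` X \<inter> fst c" by auto
  then show ?thesis
    using continuous_on_chart[OF assms(1)] open_chart[OF assms(1)] assms(2) by (simp add: continuous_on_open_vimage)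
qed

lemma smooth_transition:
  "c \<in> A \<Longrightarrow> d \<in> A \<Longrightarrow> smooth_on (snd c ` (fst c \<inter> fst d)) (snd d \<circ> chart_inv c)"
  using riemannian by (auto simp: riemannian_manifold_def smooth_manifold_def)

lemma transition_has_derivative:
  assumes "c \<in> A" "d \<in> A" "p \<in> fst c" "p \<in> fst d"
  shows "((snd d \<circ> chart_inv c) has_derivative jac c d p) (at (snd c p))"
  unfolding jac_def using smooth_transition[OF assms(1,2)] assms(3,4)
  by (intro smooth_on_has_derivative) auto

lemma linear_jac:
  "c \<in> A \<Longrightarrow> d \<in> A \<Longrightarrow> p \<in> fst c \<Longrightarrow> p \<in> fst d \<Longrightarrow> linear (jac c d p)"
  using transition_has_derivative has_derivative_linear by blast

lemma jac_compose:
  assumes "c \<in> A" "d \<in> A" "e \<in> A" "p \<in> fst c" "p \<in> fst d" "p \<in> fst e"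
  shows "jac d e p (jac c d p u) = jac c e p u"
proof -
  have 1: "((snd d \<circ> chart_inv c) has_derivative jac c d p) (at (snd c p))"
    by (intro transition_has_derivative assms)
  have 2: "((snd e \<circ> chart_inv d) has_derivative jac d e p) (at ((snd d \<circ> chart_inv c) (snd c p)))"
    using transition_has_derivative[OF assms(2,3,5,6)] by (simp add: chart_inv_left assms)
  have "((\<lambda>x. (snd e \<circ> chart_inv d) ((snd d \<circ> chart_inv c) x)) has_derivative (\<lambda>u. jac d e p (jac c d p u))) (at (snd c p))"
    by (rule has_derivative_compose[OF 1 2])
  then have "((snd e \<circ> chart_inv c) has_derivative (\<lambda>u. jac d e p (jac c d p u))) (at (snd c p))"
    by (rule has_derivative_transform_within_open[OF _ transition_domain(1)[OF assms(1,2)]])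
      (use assms chart_inv_left transition_domain in auto)
  then show ?thesis using frechet_derivative_at' by (metis jac_def)
qed

lemma jac_refl:
  assumes "c \<in> A" "p \<in> fst c"
  shows "jac c c p u = u"
proof -
  have "((snd c \<circ> chart_inv c) has_derivative (\<lambda>u. u)) (at (snd c p))"
    by (rule has_derivative_transform_within_open[OF has_derivative_ident open_chart_image[OF assms(1)]])
      (use assms chart_mem chart_inv_right in auto)
  then show ?thesis using frechet_derivative_at' by (metis jac_def)
qed

lemma tvec_of_apply:
  "tvec_of A c p u d = (if d \<in> A \<and> p \<in> fst d then jac c d p u else 0)"
  by (simp add: tvec_of_def jac_def)

lemma tangent_space_iff:
  "v \<in> tangent_space A p \<longleftrightarrow> (\<forall>c. c \<notin> A \<or> p \<notin> fst c \<longrightarrow> v c = 0) \<and>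
     (\<forall>c\<in>A. \<forall>d\<in>A. p \<in> fst c \<inter> fst d \<longrightarrow> v d = jac c d p (v c))"
  by (simp add: tangent_space_def jac_def)

lemma tvec_of_tangent: "c \<in> A \<Longrightarrow> p \<in> fst c \<Longrightarrow> tvec_of A c p u \<in> tangent_space A p"
  by (auto simp: tangent_space_iff tvec_of_apply jac_compose)

lemma tvec_of_same: "c \<in> A \<Longrightarrow> p \<in> fst c \<Longrightarrow> tvec_of A c p u c = u"
  by (simp add: tvec_of_apply jac_refl)

lemma tangent_transform:
  "v \<in> tangent_space A p \<Longrightarrow> c \<in> A \<Longrightarrow> d \<in> A \<Longrightarrow> p \<in> fst c \<Longrightarrow> p \<in> fst d \<Longrightarrow> v d = jac c d p (v c)"
  unfolding tangent_space_iff by blast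

lemma tangent_outside: "v \<in> tangent_space A p \<Longrightarrow> c \<notin> A \<or> p \<notin> fst c \<Longrightarrow> v c = 0"
  unfolding tangent_space_iff by blast

lemma tangent_eq_tvec_of:
  assumes "c \<in> A" "p \<in> fst c" "v \<in> tangent_space A p"
  shows "v = tvec_of A c p (v c)"
proof
  fix d
  show "v d = tvec_of A c p (v c) d"
    using tangent_transform[OF assms(3,1) _ assms(2), of d] tangent_outside[OF assms(3), of d]
    by (simp add: tvec_of_apply)
qed

lemma tangent_eqI:
  assumes "c \<in> A" "p \<in> fst c" "v \<in> tangent_space A p" "w \<in> tangent_space A p" "v c = w c"
  shows "v = w"
  using tangent_eq_tvec_of[OF assms(1,2,3)] tangent_eq_tvec_of[OF assms(1,2,4)] assms(5) by metis

lemma tvec_of_add: "c \<in> A \<Longrightarrow> p \<in> fst c \<Longrightarrow> tvec_of A c p (u + w) = tadd (tvec_of A c p u) (tvec_of A c p w)"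
  and tvec_of_scale: "c \<in> A \<Longrightarrow> p \<in> fst c \<Longrightarrow> tvec_of A c p (r *\<^sub>R u) = tscale r (tvec_of A c p u)"
  by (auto simp: tvec_of_apply fun_eq_iff linear_add[OF linear_jac] linear_cmul[OF linear_jac])

lemma tangent_add:
  assumes "v \<in> tangent_space A p" "w \<in> tangent_space A p" shows "tadd v w \<in> tangent_space A p"
proof -
  obtain c where c: "c \<in> A" "p \<in> fst c" using chart_cover .
  have "tadd v w = tvec_of A c p (v c + w c)"
    using tangent_eq_tvec_of[OF c assms(1)] tangent_eq_tvec_of[OF c assms(2)] tvec_of_add[OF c] by metis
  then show ?thesis using tvec_of_tangent[OF c] by simp
qed

lemma tangent_scale:
  assumes "v \<in> tangent_space A p" shows "tscale r v \<in> tangent_space A p"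
proof -
  obtain c where c: "c \<in> A" "p \<in> fst c" using chart_cover .
  have "tscale r v = tvec_of A c p (r *\<^sub>R v c)"
    using tangent_eq_tvec_of[OF c assms(1)] tvec_of_scale[OF c] by metis
  then show ?thesis using tvec_of_tangent[OF c] by simp
qed

lemma tangent_diff:
  assumes "v \<in> tangent_space A p" "w \<in> tangent_space A p" shows "tdiff v w \<in> tangent_space A p"
  using tangent_add[OF assms(1) tangent_scale[OF assms(2), of "-1"]] by simp

lemma metricD:
  assumes "u \<in> tangent_space A p" "v \<in> tangent_space A p" "w \<in> tangent_space A p"
  shows "g p u v = g p v u" "g p (tadd u v) w = g p u w + g p v w" "g p (tscale r u) v = r * g p u v"
    "v \<noteq> tzero \<Longrightarrow> g p v v > 0"
  using riemannian assms unfolding riemannian_manifold_def riemannian_metric_def by blast+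

lemma smooth_G: "c \<in> A \<Longrightarrow> smooth_on (chart_image c) (\<lambda>x. G c x u w)"
  using riemannian unfolding riemannian_manifold_def riemannian_metric_def by blast

lemma metric_eq_G:
  assumes "c \<in> A" "p \<in> fst c" "v \<in> tangent_space A p" "w \<in> tangent_space A p"
  shows "g p v w = G c (snd c p) (v c) (w c)"
  using tangent_eq_tvec_of[OF assms(1,2,3), symmetric] tangent_eq_tvec_of[OF assms(1,2,4), symmetric]
  by (simp add: metric_coords_def chart_inv_left assms(1,2))

lemma posdef_G:
  assumes "c \<in> A" "x \<in> chart_image c"
  shows "posdef (G c x)"
proof -
  let ?p = "chart_inv c x"
  have p: "?p \<in> fst c" using chart_inv_mem[OF assms] .
  note T = tvec_of_tangent[OF assms(1) p]
  have sym: "G c x u w = G c x w u" for u w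
    unfolding metric_coords_def by (rule metricD(1)[OF T T T])
  have l: "linear (\<lambda>u. G c x u w)" for w
    by (intro linearI)
      (simp_all add: metric_coords_def tvec_of_add[OF assms(1) p] tvec_of_scale[OF assms(1) p]
        metricD(2,3)[OF T T T])
  have "bilinear (G c x)"
  proof (rule bilinearI)
    show "linear (\<lambda>w. G c x u w)" for u by (subst sym) (rule l)
  qed (rule l)
  moreover have "G c x u u > 0" if "u \<noteq> 0" for u
  proof -
    have "tvec_of A c ?p u \<noteq> tzero" using tvec_of_same[OF assms(1) p] that by metis
    then show ?thesis unfolding metric_coords_def by (rule metricD(4)[OF T T T])
  qed
  ultimately show ?thesis unfolding posdef_def using sym by blast
qed

lemmas G_linear = posdef_linear[OF posdef_G]
lemmas G_sym = posdefD(2)[OF posdef_G]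

lemma G_transition:
  assumes "c \<in> A" "d \<in> A" "p \<in> fst c" "p \<in> fst d"
  shows "G d (snd d p) (jac c d p u) (jac c d p w) = G c (snd c p) u w"
  using metric_eq_G[OF assms(1,3) tvec_of_tangent[OF assms(1,3)] tvec_of_tangent[OF assms(1,3)]]
    metric_eq_G[OF assms(2,4) tvec_of_tangent[OF assms(1,3)] tvec_of_tangent[OF assms(1,3)]]
  by (simp add: jac_refl assms tvec_of_apply)

lemma smooth_DG: "c \<in> A \<Longrightarrow> smooth_on (chart_image c) (\<lambda>x. DG c x d u w)"
  unfolding DG_def by (intro smooth_on_frechet_derivative smooth_G)

lemma G_has_derivative:
  "c \<in> A \<Longrightarrow> x \<in> chart_image c \<Longrightarrow> ((\<lambda>y. G c y u w) has_derivative (\<lambda>d. DG c x d u w)) (at x)"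
  unfolding DG_def using smooth_on_has_derivative[OF smooth_G] by simp

lemma linear_DG: "c \<in> A \<Longrightarrow> x \<in> chart_image c \<Longrightarrow> linear (\<lambda>d. DG c x d u w)"
  using G_has_derivative has_derivative_linear by blast

text \<open>The derivative is defined for a frozen pair of vectors, so its bilinearity in that pair
  is recovered by differentiating the basis expansion of the metric.\<close>

lemma DG_expand:
  assumes "c \<in> A" "x \<in> chart_image c"
  shows "DG c x d u w = (\<Sum>i\<in>Basis. \<Sum>j\<in>Basis. (u \<bullet> i) * (w \<bullet> j) * DG c x d i j)"
proof -
  have "((\<lambda>y. \<Sum>i\<in>Basis. \<Sum>j\<in>Basis. (u \<bullet> i) * (w \<bullet> j) * G c y i j) has_derivative
      (\<lambda>d. \<Sum>i\<in>Basis. \<Sum>j\<in>Basis. (u \<bullet> i) * (w \<bullet> j) * DG c x d i j)) (at x)"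
    by (intro has_derivative_sum has_derivative_mult_right G_has_derivative assms)
  then have "((\<lambda>y. G c y u w) has_derivative
      (\<lambda>d. \<Sum>i\<in>Basis. \<Sum>j\<in>Basis. (u \<bullet> i) * (w \<bullet> j) * DG c x d i j)) (at x)"
    by (rule has_derivative_transform_within_open[OF _ open_chart_image[OF assms(1)] assms(2)])
      (rule bilinear_basis_sum[OF posdefD(1)[OF posdef_G[OF assms(1)]], symmetric])
  from frechet_derivative_at'[OF this] show ?thesis by (simp add: DG_def)
qed

lemma bilinear_DG:
  assumes "c \<in> A" "x \<in> chart_image c"
  shows "bilinear (DG c x d)"
proof (rule bilinearI)
  have "linear (\<lambda>w. \<Sum>i\<in>Basis. \<Sum>j\<in>Basis. (u \<bullet> i) * (w \<bullet> j) * DG c x d i j)" (is "linear ?L") for u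
  proof (rule linearI)
    show "?L (x + y) = ?L x + ?L y" for x y
      by (simp only: inner_add_left distrib_left distrib_right sum.distrib)
    show "?L (r *\<^sub>R x) = r *\<^sub>R ?L x" for r x
      by (simp add: sum_distrib_left mult.assoc mult.left_commute)
  qed
  then show "linear (\<lambda>w. DG c x d u w)" for u by (subst DG_expand[OF assms])
  have "linear (\<lambda>u. \<Sum>i\<in>Basis. \<Sum>j\<in>Basis. (u \<bullet> i) * (w \<bullet> j) * DG c x d i j)" (is "linear ?L") for w
  proof (rule linearI)
    show "?L (x + y) = ?L x + ?L y" for x y
      by (simp only: inner_add_left distrib_left distrib_right sum.distrib)
    show "?L (r *\<^sub>R x) = r *\<^sub>R ?L x" for r x
      by (simp add: sum_distrib_left mult.assoc mult.left_commute)
  qed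
  then show "linear (\<lambda>u. DG c x d u w)" for w by (subst DG_expand[OF assms])
qed

lemma DG_linear:
  assumes "c \<in> A" "x \<in> chart_image c"
  shows "DG c x (d + e) u w = DG c x d u w + DG c x e u w" "DG c x (r *\<^sub>R d) u w = r * DG c x d u w"
    "DG c x d (u + v) w = DG c x d u w + DG c x d v w" "DG c x d (r *\<^sub>R u) w = r * DG c x d u w"
    "DG c x d w (u + v) = DG c x d w u + DG c x d w v" "DG c x d w (r *\<^sub>R u) = r * DG c x d w u"
  using linear_add[OF linear_DG[OF assms]] linear_cmul[OF linear_DG[OF assms]] bilinear_DG[OF assms]
  by (simp_all add: bilinear_ladd bilinear_radd bilinear_lmul bilinear_rmul)

lemma DG_expand3:
  assumes "c \<in> A" "x \<in> chart_image c"
  shows "DG c x d u w = (\<Sum>k\<in>Basis. (d \<bullet> k) * (\<Sum>i\<in>Basis. \<Sum>j\<in>Basis. (u \<bullet> i) * (w \<bullet> j) * DG c x k i j))"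
  using linear_basis_sum[OF linear_DG[OF assms], of d u w] by (simp add: DG_expand[OF assms, symmetric])

text \<open>Expanding in the basis reduces the rule for three moving arguments to sums and products
  of real functions.\<close>

lemma G_compose_has_derivative:
  assumes "c \<in> A" "x t \<in> chart_image c" "t \<in> S"
    "(x has_derivative x') (at t within S)" "(u has_derivative u') (at t within S)" "(w has_derivative w') (at t within S)"
  shows "((\<lambda>t. G c (x t) (u t) (w t)) has_derivative
      (\<lambda>s. DG c (x t) (x' s) (u t) (w t) + G c (x t) (u' s) (w t) + G c (x t) (u t) (w' s))) (at t within S)"
proof -
  have gd: "((\<lambda>t. G c (x t) i j) has_derivative (\<lambda>s. DG c (x t) (x' s) i j)) (at t within S)" for i j
    by (rule has_derivative_compose[where f=x and g="\<lambda>y. G c y i j", OF assms(4) G_has_derivative[OF assms(1,2)]])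
  have "((\<lambda>t. \<Sum>i\<in>Basis. \<Sum>j\<in>Basis. ((u t \<bullet> i) * (w t \<bullet> j)) * G c (x t) i j) has_derivative
      (\<lambda>s. \<Sum>i\<in>Basis. \<Sum>j\<in>Basis. ((u t \<bullet> i) * (w t \<bullet> j)) * DG c (x t) (x' s) i j
        + ((u t \<bullet> i) * (w' s \<bullet> j) + (u' s \<bullet> i) * (w t \<bullet> j)) * G c (x t) i j)) (at t within S)"
    by (intro has_derivative_sum has_derivative_mult gd has_derivative_inner_left assms(5,6))
  moreover have "(\<Sum>i\<in>Basis. \<Sum>j\<in>Basis. ((u t \<bullet> i) * (w t \<bullet> j)) * DG c (x t) (x' s) i j
        + ((u t \<bullet> i) * (w' s \<bullet> j) + (u' s \<bullet> i) * (w t \<bullet> j)) * G c (x t) i j) =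
      DG c (x t) (x' s) (u t) (w t) + G c (x t) (u' s) (w t) + G c (x t) (u t) (w' s)" for s
    unfolding DG_expand[OF assms(1,2), of _ "u t" "w t"]
      bilinear_basis_sum[OF posdefD(1)[OF posdef_G[OF assms(1,2)]], of "u' s" "w t"]
      bilinear_basis_sum[OF posdefD(1)[OF posdef_G[OF assms(1,2)]], of "u t" "w' s"]
    by (simp only: distrib_right sum.distrib add_ac)
  ultimately have 1: "((\<lambda>t. \<Sum>i\<in>Basis. \<Sum>j\<in>Basis. ((u t \<bullet> i) * (w t \<bullet> j)) * G c (x t) i j) has_derivative
      (\<lambda>s. DG c (x t) (x' s) (u t) (w t) + G c (x t) (u' s) (w t) + G c (x t) (u t) (w' s))) (at t within S)"
    by simp
  have eq: "(\<Sum>i\<in>Basis. \<Sum>j\<in>Basis. ((u s \<bullet> i) * (w s \<bullet> j)) * G c (x s) i j) = G c (x s) (u s) (w s)"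
    if "x s \<in> chart_image c" for s
    using bilinear_basis_sum[OF posdefD(1)[OF posdef_G[OF assms(1) that]], of "u s" "w s"] by simp
  \<comment> \<open>The expansion represents \<open>G\<close> only inside the chart image;
    continuity keeps \<open>x\<close> there near \<open>t\<close>.\<close>
  have "(x \<longlongrightarrow> x t) (at t within S)"
    using has_derivative_continuous[OF assms(4)] by (simp add: continuous_within)
  then have "\<forall>\<^sub>F s in at t within S. x s \<in> chart_image c"
    using open_chart_image[OF assms(1)] assms(2) topological_tendstoD by blast
  then have "\<forall>\<^sub>F s in at t within S. (\<Sum>i\<in>Basis. \<Sum>j\<in>Basis. ((u s \<bullet> i) * (w s \<bullet> j)) * G c (x s) i j) = G c (x s) (u s) (w s)"
    by eventually_elim (rule eq)
  from has_derivative_transform_eventually[OF 1 this eq[OF assms(2)] assms(3)] show ?thesis .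
qed

lemma G_curve_derivative:
  assumes "c \<in> A" "x t \<in> chart_image c" "t \<in> S"
    "(x has_vector_derivative x') (at t within S)" "(u has_vector_derivative u') (at t within S)"
    "(w has_vector_derivative w') (at t within S)"
  shows "((\<lambda>t. G c (x t) (u t) (w t)) has_vector_derivative
      DG c (x t) x' (u t) (w t) + G c (x t) u' (w t) + G c (x t) (u t) w') (at t within S)"
  using G_compose_has_derivative[where x=x and t=t, OF assms(1-3), of "\<lambda>s. s *\<^sub>R x'" u "\<lambda>s. s *\<^sub>R u'" w "\<lambda>s. s *\<^sub>R w'"] assms
  by (simp add: has_vector_derivative_def DG_linear[OF assms(1,2)] G_linear[OF assms(1,2)] algebra_simps)

lemma continuous_on_G:
  assumes "c \<in> A" "continuous_on S x" "continuous_on S u" "continuous_on S w" "\<And>t. t \<in> S \<Longrightarrow> x t \<in> chart_image c"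
  shows "continuous_on S (\<lambda>t. G c (x t) (u t) (w t))"
proof -
  have cont: "continuous_on S (\<lambda>t. G c (x t) i j)" for i j
    by (rule continuous_on_compose2[where g="\<lambda>y. G c y i j", OF smooth_on_continuous[OF smooth_G[OF assms(1)]] assms(2)])
      (use assms(5) in auto)
  have "continuous_on S (\<lambda>t. \<Sum>i\<in>Basis. \<Sum>j\<in>Basis. (u t \<bullet> i) * (w t \<bullet> j) * G c (x t) i j)"
    using assms by (intro continuous_intros cont) auto
  then show ?thesis
    by (rule continuous_on_eq) (rule bilinear_basis_sum[OF posdefD(1)[OF posdef_G[OF assms(1) assms(5)]], symmetric])
qed

lemma continuous_on_DG:
  assumes "c \<in> A" "continuous_on S x" "continuous_on S d" "continuous_on S u" "continuous_on S w"
    "\<And>t. t \<in> S \<Longrightarrow> x t \<in> chart_image c"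
  shows "continuous_on S (\<lambda>t. DG c (x t) (d t) (u t) (w t))"
proof -
  have cont: "continuous_on S (\<lambda>t. DG c (x t) k i j)" for k i j
    by (rule continuous_on_compose2[where g="\<lambda>y. DG c y k i j", OF smooth_on_continuous[OF smooth_DG[OF assms(1)]] assms(2)])
      (use assms(6) in auto)
  have "continuous_on S (\<lambda>t. \<Sum>k\<in>Basis. (d t \<bullet> k) * (\<Sum>i\<in>Basis. \<Sum>j\<in>Basis. (u t \<bullet> i) * (w t \<bullet> j) * DG c (x t) k i j))"
    using assms by (intro continuous_intros cont) auto
  then show ?thesis
    by (rule continuous_on_eq) (rule DG_expand3[OF assms(1) assms(6), symmetric])
qed

lemma smooth_on_G_compose:
  assumes "c \<in> A" "open S" "smooth_on S x" "smooth_on S u" "smooth_on S w" "\<And>t. t \<in> S \<Longrightarrow> x t \<in> chart_image c"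
  shows "smooth_on S (\<lambda>t. G c (x t) (u t) (w t))"
proof -
  have smooth: "smooth_on S (\<lambda>t. G c (x t) i j)" for i j
    by (rule smooth_on_compose[where f="\<lambda>y. G c y i j", OF assms(2) open_chart_image[OF assms(1)] smooth_G[OF assms(1)] assms(3,6)])
  have "smooth_on S (\<lambda>t. \<Sum>i\<in>Basis. \<Sum>j\<in>Basis. (u t \<bullet> i) * (w t \<bullet> j) * G c (x t) i j)"
    using assms by (intro smooth_on_sum smooth_on_mult smooth_on_linear_compose[OF bounded_linear_inner_left]
        smooth) auto
  then show ?thesis
    by (subst smooth_on_cong[OF assms(2) bilinear_basis_sum[OF posdefD(1)[OF posdef_G[OF assms(1) assms(6)]]]])
qed

lemma smooth_on_DG_compose:
  assumes "c \<in> A" "open S" "smooth_on S x" "smooth_on S d" "smooth_on S u" "smooth_on S w"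
    "\<And>t. t \<in> S \<Longrightarrow> x t \<in> chart_image c"
  shows "smooth_on S (\<lambda>t. DG c (x t) (d t) (u t) (w t))"
proof -
  have smooth: "smooth_on S (\<lambda>t. DG c (x t) k i j)" for k i j
    by (rule smooth_on_compose[where f="\<lambda>y. DG c y k i j", OF assms(2) open_chart_image[OF assms(1)] smooth_DG[OF assms(1)] assms(3,7)])
  have "smooth_on S (\<lambda>t. \<Sum>k\<in>Basis. (d t \<bullet> k) * (\<Sum>i\<in>Basis. \<Sum>j\<in>Basis. (u t \<bullet> i) * (w t \<bullet> j) * DG c (x t) k i j))"
    using assms by (intro smooth_on_sum smooth_on_mult smooth_on_linear_compose[OF bounded_linear_inner_left]
        smooth) auto
  then show ?thesis
    by (subst smooth_on_cong[OF assms(2) DG_expand3[OF assms(1) assms(7)]])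
qed

text \<open>The right-hand side of the Koszul formula is linear in \<open>w\<close>, so the Riesz
  representation with respect to the coordinate metric makes the description in
  \<open>christoffel\<close> well defined.\<close>

lemma christoffel_eq:
  assumes "c \<in> A" "x \<in> chart_image c"
  shows "2 * G c x (christoffel A g c x u v) w = DG c x u v w + DG c x v u w - DG c x w u v"
proof -
  let ?f = "\<lambda>w. (DG c x u v w + DG c x v u w - DG c x w u v) / 2"
  have "linear ?f"
    by (intro linearI) (simp_all add: DG_linear[OF assms] algebra_simps add_divide_distrib diff_divide_distrib)
  from posdef_Riesz[OF posdef_G[OF assms] this]
  have "\<exists>!z. \<forall>w. 2 * G c x z w = DG c x u v w + DG c x v u w - DG c x w u v"
    by (simp add: field_simps)
  from theI'[OF this] show ?thesis unfolding christoffel_def DG_def by blast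
qed

end

section \<open>Curves and the covariant derivative\<close>

lemma smooth_real_has_vector_derivative:
  fixes x :: "real \<Rightarrow> 'e::real_normed_vector"
  assumes "smooth_on S x" "t \<in> S"
  shows "(x has_vector_derivative vector_derivative x (at t)) (at t)"
  using smooth_on_differentiable[OF assms] by (simp add: vector_derivative_works)

lemma smooth_on_vector_derivative:
  fixes x :: "real \<Rightarrow> 'e::real_normed_vector"
  assumes "open S" "smooth_on S x"
  shows "smooth_on S (\<lambda>t. vector_derivative x (at t))"
proof -
  have "frechet_derivative x (at t) 1 = vector_derivative x (at t)" if "t \<in> S" for t
    using frechet_derivative_at'[OF smooth_real_has_vector_derivative[OF assms(2) that, unfolded has_vector_derivative_def]]
    by simp
  from smooth_on_cong[OF assms(1) this] show ?thesis using smooth_on_frechet_derivative[OF assms(2), of 1] by simp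
qed

lemma vector_derivative_cong_open:
  assumes "open S" "t \<in> S" "\<And>s. s \<in> S \<Longrightarrow> x s = y s"
  shows "vector_derivative x (at t) = vector_derivative y (at t)"
proof -
  have "(x has_vector_derivative D) (at t) \<longleftrightarrow> (y has_vector_derivative D) (at t)" for D
    using has_vector_derivative_transform_within_open[of x D t S y]
      has_vector_derivative_transform_within_open[of y D t S x] assms by auto
  then show ?thesis by (simp add: vector_derivative_def)
qed

text \<open>Zorn's lemma on graphs ordered by inclusion. Graphs forget the values outside the
  interval, so inclusion means extension. The hypothesis \<open>local\<close> says that the property
  is decided near each point, which carries it to the union of a chain.\<close>

lemma inextensible_extension:
  fixes P :: "real set \<Rightarrow> (real \<Rightarrow> 'a) \<Rightarrow> bool"
  assumes "P I \<gamma>" "\<And>J \<delta>. P J \<delta> \<Longrightarrow> open_interval J"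
    and local: "\<And>J \<delta>. open_interval J \<Longrightarrow>
      (\<And>t. t \<in> J \<Longrightarrow> \<exists>J' \<delta>'. t \<in> J' \<and> J' \<subseteq> J \<and> P J' \<delta>' \<and> (\<forall>s\<in>J'. \<delta> s = \<delta>' s)) \<Longrightarrow> P J \<delta>"
  obtains J \<delta> where "inextensible P J \<delta>" "I \<subseteq> J" "\<And>t. t \<in> I \<Longrightarrow> \<delta> t = \<gamma> t"
proof -
  define gr where "gr J \<delta> = (\<lambda>t. (t, \<delta> t)) ` J" for J :: "real set" and \<delta> :: "real \<Rightarrow> 'a"
  define E where "E = {gr J \<delta> | J \<delta>. P J \<delta> \<and> I \<subseteq> J \<and> (\<forall>t\<in>I. \<delta> t = \<gamma> t)}"
  have gr_mem: "(t, y) \<in> gr J \<delta> \<longleftrightarrow> t \<in> J \<and> y = \<delta> t" for t y J \<delta> by (auto simp: gr_def)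
  have "gr I \<gamma> \<in> E" using assms(1) by (auto simp: E_def)
  then have "E \<noteq> {}" by auto
  moreover have "\<Union>C \<in> E" if ne: "C \<noteq> {}" and "subset.chain E C" for C
  proof -
    have CE: "C \<subseteq> E" and lin: "\<And>X Y. X \<in> C \<Longrightarrow> Y \<in> C \<Longrightarrow> X \<subseteq> Y \<or> Y \<subseteq> X"
      using that(2) by (auto simp: subset_chain_def)
    have rep: "\<exists>J \<delta>. X = gr J \<delta> \<and> P J \<delta> \<and> I \<subseteq> J \<and> (\<forall>t\<in>I. \<delta> t = \<gamma> t)" if "X \<in> C" for X
      using that CE by (auto simp: E_def)
    define J where "J = fst ` \<Union>C"
    \<comment> \<open>Any two members of the chain are comparable, so there is at most one such
      value at each time.\<close>
    define \<delta> where "\<delta> t = (SOME y. (t, y) \<in> \<Union>C)" for t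
    have uniq: "y = \<delta> t" if "(t, y) \<in> X" "X \<in> C" for t y X
    proof -
      have "(t, \<delta> t) \<in> \<Union>C" unfolding \<delta>_def by (rule someI[of _ y]) (use that in auto)
      then obtain Y where Y: "(t, \<delta> t) \<in> Y" "Y \<in> C" by auto
      have "\<exists>Z\<in>C. (t, y) \<in> Z \<and> (t, \<delta> t) \<in> Z"
        using lin[OF that(2) Y(2)] that Y by (auto dest: subsetD)
      then obtain Z where Z: "Z \<in> C" "(t, y) \<in> Z" "(t, \<delta> t) \<in> Z" by auto
      obtain K \<epsilon> where "Z = gr K \<epsilon>" using rep[OF Z(1)] by auto
      then show ?thesis using Z gr_mem by simp
    qed
    have un: "\<Union>C = gr J \<delta>"
    proof (rule set_eqI, clarify)
      fix t y
      have "t \<in> J \<longleftrightarrow> (\<exists>y. (t, y) \<in> \<Union>C)" unfolding J_def by force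
      then show "(t, y) \<in> \<Union>C \<longleftrightarrow> (t, y) \<in> gr J \<delta>"
        unfolding gr_mem using uniq by auto
    qed
    obtain X0 where X0: "X0 \<in> C" using ne by auto
    have IJ: "I \<subseteq> J" "\<forall>t\<in>I. \<delta> t = \<gamma> t"
    proof -
      obtain J0 \<delta>0 where 0: "X0 = gr J0 \<delta>0" "I \<subseteq> J0" "\<forall>t\<in>I. \<delta>0 t = \<gamma> t" using rep[OF X0] by auto
      have X0t: "(t, \<gamma> t) \<in> X0" if "t \<in> I" for t using that gr_mem 0 by auto
      show "I \<subseteq> J" using X0t X0 un gr_mem by blast
      show "\<forall>t\<in>I. \<delta> t = \<gamma> t" using uniq[OF X0t X0] by simp
    qed
    have loc: "\<exists>J' \<delta>'. t \<in> J' \<and> J' \<subseteq> J \<and> P J' \<delta>' \<and> (\<forall>s\<in>J'. \<delta> s = \<delta>' s) \<and> gr J' \<delta>' \<in> C" if t: "t \<in> J" for t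
    proof -
      obtain y X where X: "(t, y) \<in> X" "X \<in> C" using t by (auto simp: J_def)
      obtain J' \<delta>' where J': "X = gr J' \<delta>'" "P J' \<delta>'" using rep[OF X(2)] by auto
      have "s \<in> J \<and> \<delta> s = \<delta>' s" if "s \<in> J'" for s
      proof -
        have "(s, \<delta>' s) \<in> X" using that J' gr_mem by auto
        then have "(s, \<delta>' s) \<in> gr J \<delta>" using X(2) un by auto
        then show ?thesis by (simp add: gr_mem)
      qed
      moreover have "t \<in> J'" using X J' gr_mem by simp
      ultimately show ?thesis using X J' by auto
    qed
    have "open_interval J"
    proof -
      have "open J"
        unfolding open_subopen[of J] using loc assms(2) by (meson open_interval_def)
      moreover have "is_interval J"
        unfolding is_interval_1
      proof (intro ballI allI impI)
        fix a b x assume ab: "a \<in> J" "b \<in> J" "a \<le> x \<and> x \<le> b"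
        obtain J1 \<delta>1 where 1: "a \<in> J1" "J1 \<subseteq> J" "P J1 \<delta>1" "gr J1 \<delta>1 \<in> C" using loc[OF ab(1)] by blast
        obtain J2 \<delta>2 where 2: "b \<in> J2" "J2 \<subseteq> J" "P J2 \<delta>2" "gr J2 \<delta>2 \<in> C" using loc[OF ab(2)] by blast
        \<comment> \<open>Comparability of the graphs puts both end points into one interval, which
          then contains everything between them.\<close>
        have "J1 \<subseteq> J2 \<or> J2 \<subseteq> J1" using lin[OF 1(4) 2(4)] by (auto simp: gr_def)
        then obtain K \<delta>3 where K: "a \<in> K" "b \<in> K" "K \<subseteq> J" "P K \<delta>3" using 1 2 by blast
        have "is_interval K" using assms(2)[OF K(4)] by (simp add: open_interval_def)
        then have "x \<in> K" using K(1,2) ab(3) unfolding is_interval_1 by blast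
        then show "x \<in> J" using K by blast
      qed
      moreover have "J \<noteq> {}" using IJ assms(1,2) by (auto simp: open_interval_def)
      ultimately show ?thesis by (simp add: open_interval_def)
    qed
    then have "P J \<delta>" by (rule local) (use loc in blast)
    then show ?thesis using IJ un by (auto simp: E_def)
  qed
  ultimately obtain M where M: "M \<in> E" "\<And>X. X \<in> E \<Longrightarrow> M \<subseteq> X \<Longrightarrow> X = M"
    using subset_Zorn_nonempty[of E] by metis
  then obtain J \<delta> where J: "M = gr J \<delta>" "P J \<delta>" "I \<subseteq> J" "\<forall>t\<in>I. \<delta> t = \<gamma> t" by (auto simp: E_def)
  have "K = J" if K: "P K \<epsilon>" "J \<subseteq> K" "\<forall>t\<in>J. \<epsilon> t = \<delta> t" for K \<epsilon>
  proof -
    have "gr K \<epsilon> \<in> E" using K J by (force simp: E_def)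
    moreover have "M \<subseteq> gr K \<epsilon>" using K J by (force simp: gr_def)
    ultimately have "gr K \<epsilon> = gr J \<delta>" using M(2) J(1) by blast
    then have "fst ` gr K \<epsilon> = fst ` gr J \<delta>" by simp
    then show ?thesis by (simp add: gr_def image_image)
  qed
  then have "inextensible P J \<delta>" using J by (auto simp: inextensible_def)
  then show ?thesis using that J by blast
qed

context riemannian
begin

lemma open_curve_domain:
  assumes "open I" "smooth_curve A I \<gamma>" "c \<in> A"
  shows "open {t \<in> I. \<gamma> t \<in> fst c}"
proof -
  have "{t \<in> I. \<gamma> t \<in> fst c} = I \<inter> \<gamma> -` fst c" by auto
  then show ?thesis
    using continuous_open_preimage[of I \<gamma> "fst c"] assms open_chart by (simp add: smooth_curve_def)
qed

lemma smooth_curve_coords: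
  "smooth_curve A I \<gamma> \<Longrightarrow> c \<in> A \<Longrightarrow> smooth_on {t \<in> I. \<gamma> t \<in> fst c} (snd c \<circ> \<gamma>)"
  by (simp add: smooth_curve_def)

lemma curve_has_velocity:
  assumes "smooth_curve A I \<gamma>" "c \<in> A" "t \<in> I" "\<gamma> t \<in> fst c"
  shows "((snd c \<circ> \<gamma>) has_vector_derivative velocity A \<gamma> t c) (at t)"
  using smooth_real_has_vector_derivative[OF smooth_curve_coords[OF assms(1,2)], of t] assms
  by (simp add: velocity_def)

lemma smooth_velocity:
  assumes "open I" "smooth_curve A I \<gamma>" "c \<in> A"
  shows "smooth_on {t \<in> I. \<gamma> t \<in> fst c} (\<lambda>t. velocity A \<gamma> t c)"
  by (subst smooth_on_cong[OF open_curve_domain[OF assms], of _ "\<lambda>t. vector_derivative (snd c \<circ> \<gamma>) (at t)"])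
    (auto simp: velocity_def assms intro!: smooth_on_vector_derivative open_curve_domain smooth_curve_coords)

lemma velocity_has_derivative:
  assumes "open I" "smooth_curve A I \<gamma>" "c \<in> A" "t \<in> I" "\<gamma> t \<in> fst c"
  shows "((\<lambda>t. velocity A \<gamma> t c) has_vector_derivative vector_derivative (\<lambda>s. velocity A \<gamma> s c) (at t)) (at t)"
  using smooth_real_has_vector_derivative[OF smooth_velocity[OF assms(1-3)], of t] assms by simp

lemma velocity_tangent:
  assumes "open I" "smooth_curve A I \<gamma>" "t \<in> I"
  shows "velocity A \<gamma> t \<in> tangent_space A (\<gamma> t)"
  unfolding tangent_space_iff
proof (intro conjI allI impI ballI)
  fix c assume "c \<notin> A \<or> \<gamma> t \<notin> fst c" then show "velocity A \<gamma> t c = 0" by (auto simp: velocity_def)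
next
  fix c d assume cd: "c \<in> A" "d \<in> A" "\<gamma> t \<in> fst c \<inter> fst d"
  have "((snd c \<circ> \<gamma>) has_derivative (\<lambda>s. s *\<^sub>R velocity A \<gamma> t c)) (at t)"
    using curve_has_velocity[OF assms(2) cd(1) assms(3)] cd by (simp add: has_vector_derivative_def)
  moreover have "((snd d \<circ> chart_inv c) has_derivative jac c d (\<gamma> t)) (at ((snd c \<circ> \<gamma>) t))"
    using transition_has_derivative[OF cd(1,2), of "\<gamma> t"] cd by simp
  ultimately have "((\<lambda>s. (snd d \<circ> chart_inv c) ((snd c \<circ> \<gamma>) s)) has_derivative
      (\<lambda>s. jac c d (\<gamma> t) (s *\<^sub>R velocity A \<gamma> t c))) (at t)"
    by (rule has_derivative_compose[where f="snd c \<circ> \<gamma>" and g="snd d \<circ> chart_inv c"])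
  then have "((snd d \<circ> \<gamma>) has_derivative (\<lambda>s. jac c d (\<gamma> t) (s *\<^sub>R velocity A \<gamma> t c))) (at t)"
    by (rule has_derivative_transform_within_open[OF _ open_curve_domain[OF assms(1,2) cd(1)]])
      (use assms cd chart_inv_left in auto)
  then have "((snd d \<circ> \<gamma>) has_vector_derivative jac c d (\<gamma> t) (velocity A \<gamma> t c)) (at t)"
    using linear_cmul[OF linear_jac[OF cd(1,2)]] cd by (simp add: has_vector_derivative_def)
  moreover have "((snd d \<circ> \<gamma>) has_vector_derivative velocity A \<gamma> t d) (at t)"
    using curve_has_velocity[OF assms(2) cd(2) assms(3)] cd by simp
  ultimately show "velocity A \<gamma> t d = jac c d (\<gamma> t) (velocity A \<gamma> t c)"
    using vector_derivative_unique_at by blast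
qed

lemma velocity_cong:
  assumes "open S" "t \<in> S" "\<And>s. s \<in> S \<Longrightarrow> \<gamma> s = \<delta> s"
  shows "velocity A \<gamma> t = velocity A \<delta> t"
proof
  fix c :: "('a, 'e) chart"
  have "vector_derivative (snd c \<circ> \<gamma>) (at t) = vector_derivative (snd c \<circ> \<delta>) (at t)"
    by (rule vector_derivative_cong_open[OF assms(1,2)]) (simp add: assms(3))
  then show "velocity A \<gamma> t c = velocity A \<delta> t c" using assms(2,3) by (simp add: velocity_def)
qed

lemma acceleration_cong:
  assumes "open S" "t \<in> S" "\<And>s. s \<in> S \<Longrightarrow> \<gamma> s = \<delta> s"
  shows "covariant_derivative A g \<gamma> (velocity A \<gamma>) t = covariant_derivative A g \<delta> (velocity A \<delta>) t"
proof
  fix c :: "('a, 'e) chart"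
  have "vector_derivative (\<lambda>s. velocity A \<gamma> s c) (at t) = vector_derivative (\<lambda>s. velocity A \<delta> s c) (at t)"
    by (rule vector_derivative_cong_open[OF assms(1,2)]) (simp add: velocity_cong[OF assms(1) _ assms(3)])
  then show "covariant_derivative A g \<gamma> (velocity A \<gamma>) t c = covariant_derivative A g \<delta> (velocity A \<delta>) t c"
    using velocity_cong[OF assms] assms(2,3) by (simp add: covariant_derivative_def)
qed

section \<open>Change of charts for second derivatives and Christoffel symbols\<close>

definition hess :: "('a, 'e) chart \<Rightarrow> ('a, 'e) chart \<Rightarrow> 'a \<Rightarrow> 'e \<Rightarrow> 'e \<Rightarrow> 'e" where
  "hess c d p u e = frechet_derivative (\<lambda>x. frechet_derivative (snd d \<circ> chart_inv c) (at x) u) (at (snd c p)) e"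

lemma hess_sym:
  assumes "c \<in> A" "d \<in> A" "p \<in> fst c" "p \<in> fst d"
  shows "hess c d p u e = hess c d p e u"
  unfolding hess_def
  by (rule mixed_derivatives_commute[OF transition_domain(1) smooth_transition]) (use assms in auto)

lemma jac_has_derivative:
  assumes "c \<in> A" "d \<in> A" "p \<in> fst c" "p \<in> fst d"
  shows "((\<lambda>x. frechet_derivative (snd d \<circ> chart_inv c) (at x) u) has_derivative hess c d p u) (at (snd c p))"
  unfolding hess_def using assms
  by (intro smooth_on_has_derivative[OF smooth_on_frechet_derivative[OF smooth_transition]]) auto

lemma linear_hess:
  assumes "c \<in> A" "d \<in> A" "p \<in> fst c" "p \<in> fst d"
  shows "linear (hess c d p u)" "linear (\<lambda>u. hess c d p u e)"
proof -
  show 1: "linear (hess c d p u)" for u using jac_has_derivative[OF assms] has_derivative_linear by blast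
  have "(\<lambda>u. hess c d p u e) = hess c d p e" using hess_sym[OF assms] by auto
  then show "linear (\<lambda>u. hess c d p u e)" using 1 by simp
qed

lemma jac_at: "c \<in> A \<Longrightarrow> p \<in> fst c \<Longrightarrow> frechet_derivative (snd d \<circ> chart_inv c) (at (snd c p)) u = jac c d p u"
  by (simp add: jac_def)

text \<open>Differentiation of the isometry identity \<open>G_transition\<close> along
  \<open>e\<close>; the two \<open>hess\<close> terms come from the dependence of the Jacobian on
  the base point.\<close>

lemma metric_derivative_transform:
  assumes "c \<in> A" "d \<in> A" "p \<in> fst c" "p \<in> fst d"
  shows "DG d (snd d p) (jac c d p e) (jac c d p u) (jac c d p w)
    + G d (snd d p) (hess c d p u e) (jac c d p w) + G d (snd d p) (jac c d p u) (hess c d p w e)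
    = DG c (snd c p) e u w"
proof -
  let ?W = "snd c ` (fst c \<inter> fst d)"
  let ?T = "snd d \<circ> chart_inv c"
  let ?J = "\<lambda>x. frechet_derivative ?T (at x)"
  have Tp: "?T (snd c p) = snd d p" using chart_inv_left[OF assms(1,3)] by simp
  have "((\<lambda>x. G d (?T x) (?J x u) (?J x w)) has_derivative
      (\<lambda>e. DG d (?T (snd c p)) (jac c d p e) (?J (snd c p) u) (?J (snd c p) w)
        + G d (?T (snd c p)) (hess c d p u e) (?J (snd c p) w)
        + G d (?T (snd c p)) (?J (snd c p) u) (hess c d p w e))) (at (snd c p))"
    using chart_mem[OF assms(2,4)] Tp
    by (intro G_compose_has_derivative[where x="?T" and u="\<lambda>x. ?J x u" and w="\<lambda>x. ?J x w"] assms(2)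
        transition_has_derivative[OF assms] jac_has_derivative[OF assms]) auto
  then have "((\<lambda>x. G c x u w) has_derivative
      (\<lambda>e. DG d (snd d p) (jac c d p e) (jac c d p u) (jac c d p w)
        + G d (snd d p) (hess c d p u e) (jac c d p w)
        + G d (snd d p) (jac c d p u) (hess c d p w e))) (at (snd c p))"
    unfolding Tp jac_at[OF assms(1,3)]
  proof (rule has_derivative_transform_within_open[OF _ transition_domain(1)[OF assms(1,2)]])
    show "snd c p \<in> ?W" using assms by auto
    fix x assume "x \<in> ?W"
    then obtain q where q: "x = snd c q" "q \<in> fst c" "q \<in> fst d" by auto
    show "G d (?T x) (?J x u) (?J x w) = G c x u w"
      using G_transition[OF assms(1,2) q(2,3), of u w] jac_at[OF assms(1) q(2)] chart_inv_left[OF assms(1) q(2)]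
      by (simp add: q(1))
  qed
  from frechet_derivative_at'[OF this] show ?thesis by (simp add: DG_def)
qed

text \<open>The transformed metric derivatives are combined as in the Koszul formula. By the
  symmetry of \<open>hess\<close> all second-order terms cancel except the one paired with
  \<open>jac c d p w\<close>. Equal arguments are the case that occurs in the acceleration of a
  curve.\<close>

lemma christoffel_transform:
  assumes "c \<in> A" "d \<in> A" "p \<in> fst c" "p \<in> fst d"
  shows "hess c d p v v + christoffel A g d (snd d p) (jac c d p v) (jac c d p v)
    = jac c d p (christoffel A g c (snd c p) v v)"
proof -
  note xc = chart_mem[OF assms(1,3)] and xd = chart_mem[OF assms(2,4)]
  let ?J = "jac c d p" and ?K = "hess c d p"
  let ?\<Gamma>c = "christoffel A g c (snd c p) v v" and ?\<Gamma>d = "christoffel A g d (snd d p) (?J v) (?J v)"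
  have eq: "G d (snd d p) (?K v v + ?\<Gamma>d) (?J w) = G d (snd d p) (?J ?\<Gamma>c) (?J w)" for w
  proof -
    have 1: "2 * G d (snd d p) ?\<Gamma>d (?J w) = 2 * DG d (snd d p) (?J v) (?J v) (?J w) - DG d (snd d p) (?J w) (?J v) (?J v)"
      using christoffel_eq[OF assms(2) xd, of "?J v" "?J v" "?J w"] by simp
    have 2: "2 * G c (snd c p) ?\<Gamma>c w = 2 * DG c (snd c p) v v w - DG c (snd c p) w v v"
      using christoffel_eq[OF assms(1) xc, of v v w] by simp
    have 3: "G d (snd d p) (?J ?\<Gamma>c) (?J w) = G c (snd c p) ?\<Gamma>c w" by (rule G_transition[OF assms])
    note 4 = metric_derivative_transform[OF assms, of v v w]
    note 5 = metric_derivative_transform[OF assms, of w v v]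
    have 6: "?K v w = ?K w v" by (rule hess_sym[OF assms])
    have 7: "G d (snd d p) (?J v) (?K w v) = G d (snd d p) (?K w v) (?J v)" by (rule G_sym[OF assms(2) xd])
    have 8: "G d (snd d p) (?K v v + ?\<Gamma>d) (?J w) = G d (snd d p) (?K v v) (?J w) + G d (snd d p) ?\<Gamma>d (?J w)"
      by (rule G_linear(1)[OF assms(2) xd])
    show ?thesis using 1 2 3 4 5 7 8 unfolding 6 by linarith
  qed
  define z where "z = ?K v v + ?\<Gamma>d - ?J ?\<Gamma>c"
  have "G d (snd d p) z (?J w) = 0" for w
    unfolding z_def G_linear(3)[OF assms(2) xd] using eq[of w] by simp
  \<comment> \<open>The Jacobian is onto, so \<open>z\<close> itself is among the test vectors and
    definiteness forces it to vanish.\<close>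
  moreover have "?J (jac d c p z) = z"
    using jac_compose[OF assms(2,1,2,4,3,4)] jac_refl[OF assms(2,4)] by simp
  ultimately have "G d (snd d p) z z = 0" by metis
  then have "z = 0" using posdefD(3)[OF posdef_G[OF assms(2) xd], of z] by fastforce
  then show ?thesis by (simp add: z_def)
qed

text \<open>The second derivative of the coordinates is not a tensor; its extra \<open>hess\<close>
  term under a change of chart is compensated by the transformation of the Christoffel symbols.
  Consequently the equation of motion may be verified in a single chart.\<close>

lemma acceleration_tangent:
  assumes "open I" "smooth_curve A I \<gamma>" "t \<in> I"
  shows "covariant_derivative A g \<gamma> (velocity A \<gamma>) t \<in> tangent_space A (\<gamma> t)"
  unfolding tangent_space_iff
proof (intro conjI allI impI ballI)
  fix c assume "c \<notin> A \<or> \<gamma> t \<notin> fst c"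
  then show "covariant_derivative A g \<gamma> (velocity A \<gamma>) t c = 0" by (auto simp: covariant_derivative_def)
next
  fix c d assume cd0: "c \<in> A" "d \<in> A" "\<gamma> t \<in> fst c \<inter> fst d"
  then have cd: "c \<in> A" "d \<in> A" "\<gamma> t \<in> fst c" "\<gamma> t \<in> fst d" by auto
  let ?J = "\<lambda>x. frechet_derivative (snd d \<circ> chart_inv c) (at x)"
  let ?v = "velocity A \<gamma> t c" and ?a = "vector_derivative (\<lambda>s. velocity A \<gamma> s c) (at t)"
  have x: "((snd c \<circ> \<gamma>) has_derivative (\<lambda>s. s *\<^sub>R ?v)) (at t)"
    using curve_has_velocity[OF assms(2) cd(1) assms(3) cd(3)] by (simp add: has_vector_derivative_def)
  have J: "((\<lambda>s. ?J ((snd c \<circ> \<gamma>) s) b) has_derivative (\<lambda>s. hess c d (\<gamma> t) b (s *\<^sub>R ?v))) (at t)" for b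
    using jac_has_derivative[OF cd]
    by (intro has_derivative_compose[where f="snd c \<circ> \<gamma>" and g="\<lambda>x. ?J x b", OF x]) simp
  have v: "((\<lambda>s. velocity A \<gamma> s c) has_derivative (\<lambda>s. s *\<^sub>R ?a)) (at t)"
    using velocity_has_derivative[OF assms(1,2) cd(1) assms(3) cd(3)] by (simp add: has_vector_derivative_def)
  have "((\<lambda>s. \<Sum>b\<in>Basis. (velocity A \<gamma> s c \<bullet> b) *\<^sub>R ?J ((snd c \<circ> \<gamma>) s) b) has_derivative
      (\<lambda>s. \<Sum>b\<in>Basis. (?v \<bullet> b) *\<^sub>R hess c d (\<gamma> t) b (s *\<^sub>R ?v) + (s *\<^sub>R ?a \<bullet> b) *\<^sub>R ?J ((snd c \<circ> \<gamma>) t) b)) (at t)"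
    by (intro has_derivative_sum has_derivative_scaleR has_derivative_inner_left v J)
  moreover have "(\<Sum>b\<in>Basis. (?v \<bullet> b) *\<^sub>R hess c d (\<gamma> t) b (s *\<^sub>R ?v) + (s *\<^sub>R ?a \<bullet> b) *\<^sub>R ?J ((snd c \<circ> \<gamma>) t) b)
      = s *\<^sub>R (hess c d (\<gamma> t) ?v ?v + jac c d (\<gamma> t) ?a)" for s
    unfolding sum.distrib o_apply jac_at[OF cd(1,3)]
      linear_basis_sum[OF linear_hess(2)[OF cd], symmetric] linear_basis_sum[OF linear_jac[OF cd], symmetric]
    by (simp add: linear_cmul[OF linear_hess(1)[OF cd]] linear_cmul[OF linear_jac[OF cd]] scaleR_add_right)
  ultimately have D: "((\<lambda>s. \<Sum>b\<in>Basis. (velocity A \<gamma> s c \<bullet> b) *\<^sub>R ?J ((snd c \<circ> \<gamma>) s) b) has_vector_derivative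
      hess c d (\<gamma> t) ?v ?v + jac c d (\<gamma> t) ?a) (at t)"
    by (simp add: has_vector_derivative_def)
  have "((\<lambda>s. velocity A \<gamma> s d) has_vector_derivative hess c d (\<gamma> t) ?v ?v + jac c d (\<gamma> t) ?a) (at t)"
  proof (rule has_vector_derivative_transform_within_open[OF D])
    show "open ({t \<in> I. \<gamma> t \<in> fst c} \<inter> {t \<in> I. \<gamma> t \<in> fst d})"
      using open_curve_domain[OF assms(1,2)] cd by blast
    show "t \<in> {t \<in> I. \<gamma> t \<in> fst c} \<inter> {t \<in> I. \<gamma> t \<in> fst d}" using assms cd by auto
    fix s assume "s \<in> {t \<in> I. \<gamma> t \<in> fst c} \<inter> {t \<in> I. \<gamma> t \<in> fst d}"
    then have s: "s \<in> I" "\<gamma> s \<in> fst c" "\<gamma> s \<in> fst d" by auto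
    show "(\<Sum>b\<in>Basis. (velocity A \<gamma> s c \<bullet> b) *\<^sub>R ?J ((snd c \<circ> \<gamma>) s) b) = velocity A \<gamma> s d"
      unfolding o_apply jac_at[OF cd(1) s(2)] linear_basis_sum[OF linear_jac[OF cd(1,2) s(2,3)], symmetric]
      using tangent_transform[OF velocity_tangent[OF assms(1,2) s(1)] cd(1,2) s(2,3)] by simp
  qed
  then have a: "vector_derivative (\<lambda>s. velocity A \<gamma> s d) (at t) = hess c d (\<gamma> t) ?v ?v + jac c d (\<gamma> t) ?a"
    by (rule vector_derivative_at)
  have vd: "velocity A \<gamma> t d = jac c d (\<gamma> t) ?v"
    by (rule tangent_transform[OF velocity_tangent[OF assms] cd])
  show "covariant_derivative A g \<gamma> (velocity A \<gamma>) t d = jac c d (\<gamma> t) (covariant_derivative A g \<gamma> (velocity A \<gamma>) t c)"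
    using christoffel_transform[OF cd, of ?v] cd
    by (simp add: covariant_derivative_def a vd linear_add[OF linear_jac[OF cd]] algebra_simps)
qed

text \<open>The description demands one vector representing the differential in every chart. The
  Riesz vector of a single chart does so because the differentials of the chart expressions
  correspond under the Jacobians.\<close>

lemma gradient_props:
  assumes "\<And>c. c \<in> A \<Longrightarrow> p \<in> fst c \<Longrightarrow> (f \<circ> chart_inv c) differentiable (at (snd c p))"
  shows "gradient A g f p \<in> tangent_space A p"
    "v \<in> tangent_space A p \<Longrightarrow> c \<in> A \<Longrightarrow> p \<in> fst c \<Longrightarrow>
      g p (gradient A g f p) v = frechet_derivative (f \<circ> chart_inv c) (at (snd c p)) (v c)"
proof -
  obtain c0 where c0: "c0 \<in> A" "p \<in> fst c0" using chart_cover .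
  let ?D = "\<lambda>c. frechet_derivative (f \<circ> chart_inv c) (at (snd c p))"
  have chain: "?D c (v c) = ?D c0 (v c0)" if "v \<in> tangent_space A p" "c \<in> A" "p \<in> fst c" for v c
  proof -
    have 1: "((f \<circ> chart_inv c) has_derivative ?D c) (at ((snd c \<circ> chart_inv c0) (snd c0 p)))"
      using has_derivative_frechetI[OF assms[OF that(2,3)]] chart_inv_left[OF c0] by simp
    have "((\<lambda>x. (f \<circ> chart_inv c) ((snd c \<circ> chart_inv c0) x)) has_derivative (\<lambda>u. ?D c (jac c0 c p u))) (at (snd c0 p))"
      using 1 by (intro has_derivative_compose[where f="snd c \<circ> chart_inv c0" and g="f \<circ> chart_inv c"]
          transition_has_derivative c0 that)
    then have "((f \<circ> chart_inv c0) has_derivative (\<lambda>u. ?D c (jac c0 c p u))) (at (snd c0 p))"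
      by (rule has_derivative_transform_within_open[OF _ transition_domain(1)[OF c0(1) that(2)]])
        (use c0 that chart_inv_left transition_domain in auto)
    from frechet_derivative_at'[OF this] show ?thesis
      using tangent_transform[OF that(1) c0(1) that(2) c0(2) that(3)] by simp
  qed
  have x0: "snd c0 p \<in> chart_image c0" using chart_mem c0 .
  have lin: "linear (?D c0)"
    using has_derivative_linear[OF has_derivative_frechetI[OF assms[OF c0]]] .
  obtain z where z: "\<And>w. G c0 (snd c0 p) z w = ?D c0 w"
    and zu: "\<And>y. (\<And>w. G c0 (snd c0 p) y w = ?D c0 w) \<Longrightarrow> y = z"
    using posdef_Riesz[OF posdef_G[OF c0(1) x0] lin] by metis
  have "\<exists>!w. w \<in> tangent_space A p \<and> (\<forall>v\<in>tangent_space A p. \<forall>c\<in>A. p \<in> fst c \<longrightarrow> g p w v = ?D c (v c))"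
  proof (rule ex1I[of _ "tvec_of A c0 p z"], intro conjI ballI impI)
    show "tvec_of A c0 p z \<in> tangent_space A p" by (rule tvec_of_tangent[OF c0])
    fix v c assume v: "v \<in> tangent_space A p" "c \<in> A" "p \<in> fst c"
    show "g p (tvec_of A c0 p z) v = ?D c (v c)"
      using metric_eq_G[OF c0 tvec_of_tangent[OF c0] v(1), of z] chain[OF v] z[of "v c0"]
      by (simp add: tvec_of_same[OF c0])
  next
    fix w assume w: "w \<in> tangent_space A p \<and> (\<forall>v\<in>tangent_space A p. \<forall>c\<in>A. p \<in> fst c \<longrightarrow> g p w v = ?D c (v c))"
    have "G c0 (snd c0 p) (w c0) u = ?D c0 u" for u
      using w tvec_of_tangent[OF c0, of u] metric_eq_G[OF c0 _ tvec_of_tangent[OF c0, of u], of w] c0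
      by (metis tvec_of_same)
    then have "w c0 = z" by (rule zu)
    then show "w = tvec_of A c0 p z" using tangent_eq_tvec_of[OF c0, of w] w by blast
  qed
  from theI'[OF this] show "gradient A g f p \<in> tangent_space A p"
    "v \<in> tangent_space A p \<Longrightarrow> c \<in> A \<Longrightarrow> p \<in> fst c \<Longrightarrow> g p (gradient A g f p) v = ?D c (v c)"
    unfolding gradient_def by blast+
qed

end

section \<open>Curves of speed at most one\<close>

text \<open>Expansion of the nonnegative value of the form at
  \<open>\<theta> *\<^sub>R u - w\<close>.\<close>

lemma posdef_young:
  assumes "posdef B" "\<theta> > 0"
  shows "B (u + w) (u + w) \<le> (1 + \<theta>) * B u u + (1 + 1 / \<theta>) * B w w"
proof -
  have "0 \<le> B (\<theta> *\<^sub>R u - w) (\<theta> *\<^sub>R u - w)" by (rule posdefD(4)[OF assms(1)])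
  also have "\<dots> = \<theta>\<^sup>2 * B u u - 2 * \<theta> * B u w + B w w"
    using posdefD(2)[OF assms(1), of w u] by (simp add: posdef_linear[OF assms(1)] algebra_simps power2_eq_square)
  finally have "2 * \<theta> * B u w \<le> \<theta>\<^sup>2 * B u u + B w w" by simp
  then have "2 * B u w \<le> \<theta> * B u u + B w w / \<theta>"
    using assms(2) by (simp add: field_simps power2_eq_square)
  moreover have "B (u + w) (u + w) = B u u + 2 * B u w + B w w"
    using posdefD(2)[OF assms(1), of w u] by (simp add: posdef_linear[OF assms(1)])
  ultimately show ?thesis by (simp add: algebra_simps)
qed

text \<open>With parameter \<open>k / h\<close> Young's inequality turns the two bounds into
  \<open>L * h * (h + k)\<close> and \<open>L * k * (h + k)\<close>. The result makes squared length
  bounds additive over adjacent intervals.\<close>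

lemma posdef_subadditive:
  assumes "posdef B" "B u u \<le> L * h\<^sup>2" "B w w \<le> L * k\<^sup>2" "h \<ge> 0" "k \<ge> 0"
  shows "B (u + w) (u + w) \<le> L * (h + k)\<^sup>2"
proof -
  consider "h = 0" | "k = 0" | "h > 0" "k > 0" using assms(4,5) by linarith
  then show ?thesis
  proof cases
    case 1
    then have "u = 0" using posdefD(3)[OF assms(1), of u] assms(2) by fastforce
    then show ?thesis using 1 assms(3) by simp
  next
    case 2
    then have "w = 0" using posdefD(3)[OF assms(1), of w] assms(3) by fastforce
    then show ?thesis using 2 assms(2) by simp
  next
    case 3
    have "B (u + w) (u + w) \<le> (1 + k / h) * B u u + (1 + 1 / (k / h)) * B w w"
      using 3 by (intro posdef_young assms(1)) simp
    also have "\<dots> \<le> (1 + k / h) * (L * h\<^sup>2) + (1 + 1 / (k / h)) * (L * k\<^sup>2)"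
      using 3 assms(2,3) by (intro add_mono mult_left_mono) auto
    also have "\<dots> = L * (h + k)\<^sup>2" using 3 by (simp add: field_simps power2_eq_square)
    finally show ?thesis .
  qed
qed

text \<open>An error that is small compared with the step \<open>h\<close>, such as the remainder of
  a differentiable map, does not spoil a squared length bound at leading order.\<close>

lemma posdef_perturb:
  fixes B :: "'e::euclidean_space \<Rightarrow> 'e \<Rightarrow> real"
  assumes "posdef B" "\<epsilon> > 0"
  obtains \<delta> where "\<delta> > 0"
    "\<And>a e h. B a a \<le> (1 + \<delta>) * h\<^sup>2 \<Longrightarrow> norm e \<le> \<delta> * \<bar>h\<bar> \<Longrightarrow> B (a + e) (a + e) \<le> (1 + \<epsilon>) * h\<^sup>2"
proof -
  define K where "K = (\<Sum>b\<in>Basis. \<Sum>c\<in>Basis. \<bar>B b c\<bar>)"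
  have K: "K \<ge> 0" "B e e \<le> K * (norm e)\<^sup>2" for e
    using bilinear_abs_le[OF posdefD(1)[OF assms(1)], of e e]
    by (auto simp: K_def sum_nonneg power2_eq_square mult.assoc)
  \<comment> \<open>With \<open>\<theta>\<close> at most 1, \<open>(1 + \<theta>)\<^sup>2\<close> is
    at most \<open>1 + 3 * \<theta>\<close>, hence at most \<open>1 + \<epsilon> / 2\<close>; the
    other half of \<open>\<epsilon>\<close> is left for the error vector and fixes
    \<open>\<delta>\<close>.\<close>
  define \<theta> where "\<theta> = min 1 (\<epsilon> / 6)"
  have \<theta>: "\<theta> > 0" "\<theta> \<le> 1" "\<theta> \<le> \<epsilon> / 6" using assms(2) by (auto simp: \<theta>_def)
  define N where "N = (1 + 1 / \<theta>) * (K + 1)"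
  define \<delta> where "\<delta> = min \<theta> (\<epsilon> / (2 * N))"
  have "1 + 1 / \<theta> > 0" using \<theta> by (simp add: add_pos_pos)
  then have den: "N > 0" using K(1) by (simp add: N_def)
  have \<delta>: "\<delta> > 0" "\<delta> \<le> \<theta>" "\<delta> \<le> 1" "\<delta> \<le> \<epsilon> / (2 * N)"
    using \<theta> den assms(2) by (auto simp: \<delta>_def)
  show ?thesis
  proof
    fix a e :: 'e and h assume a: "B a a \<le> (1 + \<delta>) * h\<^sup>2" and e: "norm e \<le> \<delta> * \<bar>h\<bar>"
    have "(norm e)\<^sup>2 \<le> (\<delta> * \<bar>h\<bar>)\<^sup>2" using e by (intro power_mono) auto
    also have "\<dots> = \<delta> * \<delta> * h\<^sup>2" by (simp add: power_mult_distrib power2_eq_square)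
    also have "\<dots> \<le> \<delta> * h\<^sup>2" using \<delta> by (intro mult_right_mono) (auto simp: mult_left_le)
    finally have e2: "(norm e)\<^sup>2 \<le> \<delta> * h\<^sup>2" .
    have "B (a + e) (a + e) \<le> (1 + \<theta>) * B a a + (1 + 1 / \<theta>) * B e e"
      by (rule posdef_young[OF assms(1) \<theta>(1)])
    also have "\<dots> \<le> (1 + \<theta>) * ((1 + \<theta>) * h\<^sup>2) + (1 + 1 / \<theta>) * ((K + 1) * (\<delta> * h\<^sup>2))"
    proof (intro add_mono mult_left_mono)
      have "(1 + \<delta>) * h\<^sup>2 \<le> (1 + \<theta>) * h\<^sup>2" using \<delta> by (intro mult_right_mono) auto
      then show "B a a \<le> (1 + \<theta>) * h\<^sup>2" using a by linarith
      have "K * (norm e)\<^sup>2 \<le> (K + 1) * (\<delta> * h\<^sup>2)" using e2 K by (intro mult_mono) auto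
      then show "B e e \<le> (K + 1) * (\<delta> * h\<^sup>2)" using K(2)[of e] by linarith
    qed (use \<theta> in auto)
    also have "\<dots> = ((1 + \<theta>)\<^sup>2 + N * \<delta>) * h\<^sup>2"
      by (simp add: N_def algebra_simps power2_eq_square add_divide_distrib)
    also have "\<dots> \<le> (1 + \<epsilon>) * h\<^sup>2"
    proof (intro mult_right_mono)
      have "N * \<delta> \<le> N * (\<epsilon> / (2 * N))" using \<delta>(4) den by (intro mult_left_mono) auto
      also have "\<dots> = \<epsilon> / 2" using den by simp
      finally have 1: "N * \<delta> \<le> \<epsilon> / 2" .
      have "\<theta> * \<theta> \<le> \<theta>" using \<theta> by (simp add: mult_left_le)
      then have "(1 + \<theta>)\<^sup>2 \<le> 1 + 3 * \<theta>" by (simp add: power2_eq_square algebra_simps)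
      with 1 \<theta> show "(1 + \<theta>)\<^sup>2 + N * \<delta> \<le> 1 + \<epsilon>" by linarith
    qed simp
    finally show "B (a + e) (a + e) \<le> (1 + \<epsilon>) * h\<^sup>2" .
  qed (rule \<delta>)
qed

lemma continuous_bounded_above:
  fixes f :: "'x::topological_space \<Rightarrow> real"
  assumes "compact C" "continuous_on C f"
  obtains b where "b \<ge> 0" "\<And>x. x \<in> C \<Longrightarrow> f x \<le> b"
proof (cases "C = {}")
  case False
  then obtain x0 where "x0 \<in> C" "\<forall>x\<in>C. f x \<le> f x0"
    using continuous_attains_sup[OF assms(1) _ assms(2)] by blast
  then show ?thesis by (intro that[of "max 0 (f x0)"]) auto
qed (auto intro: that[of 0])

context riemannian
begin

text \<open>Speed at most one is imposed on difference quotients, so that these curves survive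
  concatenation and uniform limits; they need not be differentiable.\<close>

definition slow_at :: "('a, 'e) chart \<Rightarrow> real set \<Rightarrow> (real \<Rightarrow> 'a) \<Rightarrow> real \<Rightarrow> bool" where
  "slow_at c S \<gamma> t \<longleftrightarrow> (\<forall>\<epsilon>>0. \<forall>\<^sub>F s in at t within S. \<gamma> s \<in> fst c \<and>
     G c (snd c (\<gamma> t)) (snd c (\<gamma> s) - snd c (\<gamma> t)) (snd c (\<gamma> s) - snd c (\<gamma> t)) \<le> (1 + \<epsilon>) * (s - t)\<^sup>2)"

definition slow :: "real set \<Rightarrow> (real \<Rightarrow> 'a) \<Rightarrow> bool" where
  "slow S \<gamma> \<longleftrightarrow> (\<forall>t\<in>S. \<forall>c\<in>A. \<gamma> t \<in> fst c \<longrightarrow> slow_at c S \<gamma> t)"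

lemma slow_at_coords_tendsto:
  assumes "c \<in> A" "\<gamma> t \<in> fst c" "slow_at c S \<gamma> t"
  obtains L where "L > 0"
    "\<forall>\<^sub>F s in at t within S. \<gamma> s \<in> fst c \<and> norm (snd c (\<gamma> s) - snd c (\<gamma> t)) \<le> L * \<bar>s - t\<bar>"
    "((\<lambda>s. snd c (\<gamma> s)) \<longlongrightarrow> snd c (\<gamma> t)) (at t within S)"
proof -
  let ?x = "\<lambda>s. snd c (\<gamma> s)"
  obtain m where m: "m > 0" "\<And>u. m * (norm u)\<^sup>2 \<le> G c (?x t) u u"
    using posdef_coercive[OF posdef_G[OF assms(1) chart_mem[OF assms(1,2)]]] by blast
  have "\<forall>\<^sub>F s in at t within S. \<gamma> s \<in> fst c \<and> G c (?x t) (?x s - ?x t) (?x s - ?x t) \<le> (1 + 1) * (s - t)\<^sup>2"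
    using assms(3) unfolding slow_at_def by (meson zero_less_one)
  then have ev: "\<forall>\<^sub>F s in at t within S. \<gamma> s \<in> fst c \<and> norm (?x s - ?x t) \<le> sqrt (2 / m) * \<bar>s - t\<bar>"
  proof eventually_elim
    case (elim s)
    have "m * (norm (?x s - ?x t))\<^sup>2 \<le> 2 * (s - t)\<^sup>2" using m(2)[of "?x s - ?x t"] elim by simp
    then have "(norm (?x s - ?x t))\<^sup>2 \<le> 2 / m * (s - t)\<^sup>2" using m(1) by (simp add: field_simps)
    then have "sqrt ((norm (?x s - ?x t))\<^sup>2) \<le> sqrt (2 / m * (s - t)\<^sup>2)" by (rule real_sqrt_le_mono)
    moreover have "sqrt (2 / m * (s - t)\<^sup>2) = sqrt (2 / m) * \<bar>s - t\<bar>"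
      by (simp only: real_sqrt_mult real_sqrt_abs)
    ultimately show ?case using elim by simp
  qed
  have lim: "((\<lambda>s. sqrt (2 / m) * \<bar>s - t\<bar>) \<longlongrightarrow> sqrt (2 / m) * \<bar>t - t\<bar>) (at t within S)"
    by (intro tendsto_intros)
  have "((\<lambda>s. ?x s - ?x t) \<longlongrightarrow> 0) (at t within S)"
    by (rule Lim_null_comparison[OF eventually_mono[OF ev]]) (use lim in auto)
  then have "(?x \<longlongrightarrow> ?x t) (at t within S)" by (simp add: LIM_zero_iff)
  then show ?thesis using m ev by (intro that[of "sqrt (2 / m)"]) auto
qed

lemma slow_at_tendsto:
  assumes "c \<in> A" "\<gamma> t \<in> fst c" "slow_at c S \<gamma> t"
  shows "(\<gamma> \<longlongrightarrow> \<gamma> t) (at t within S)"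
proof -
  obtain L where L: "\<forall>\<^sub>F s in at t within S. \<gamma> s \<in> fst c \<and> norm (snd c (\<gamma> s) - snd c (\<gamma> t)) \<le> L * \<bar>s - t\<bar>"
    "((\<lambda>s. snd c (\<gamma> s)) \<longlongrightarrow> snd c (\<gamma> t)) (at t within S)"
    by (rule slow_at_coords_tendsto[OF assms])
  have "isCont (chart_inv c) (snd c (\<gamma> t))"
    using continuous_on_chart_inv[OF assms(1)] open_chart_image[OF assms(1)] chart_mem[OF assms(1,2)]
    by (simp add: continuous_on_eq_continuous_at)
  from isCont_tendsto_compose[OF this L(2)]
  have 1: "((\<lambda>s. chart_inv c (snd c (\<gamma> s))) \<longlongrightarrow> \<gamma> t) (at t within S)"
    by (simp add: chart_inv_left[OF assms(1,2)])
  have "\<forall>\<^sub>F s in at t within S. chart_inv c (snd c (\<gamma> s)) = \<gamma> s"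
    using L(1) by eventually_elim (simp add: chart_inv_left assms(1))
  from Lim_transform_eventually[OF 1 this] show ?thesis .
qed

lemma slow_continuous_on: "slow S \<gamma> \<Longrightarrow> continuous_on S \<gamma>"
  unfolding continuous_on_def
proof
  fix t assume "slow S \<gamma>" "t \<in> S"
  moreover obtain c where "c \<in> A" "\<gamma> t \<in> fst c" by (rule chart_cover)
  ultimately show "(\<gamma> \<longlongrightarrow> \<gamma> t) (at t within S)" using slow_at_tendsto by (auto simp: slow_def)
qed

text \<open>The change of chart maps an increment to its image under the Jacobian plus a remainder
  of smaller order. The Jacobian is an isometry of the two coordinate metrics and
  \<open>posdef_perturb\<close> absorbs the remainder, so the condition does not depend on the
  chart.\<close>

lemma slow_at_transition:
  assumes "c \<in> A" "d \<in> A" "\<gamma> t \<in> fst c" "\<gamma> t \<in> fst d" "slow_at c S \<gamma> t"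
  shows "slow_at d S \<gamma> t"
  unfolding slow_at_def
proof (intro allI impI)
  fix \<epsilon> :: real assume "\<epsilon> > 0"
  let ?x = "\<lambda>s. snd c (\<gamma> s)" and ?y = "\<lambda>s. snd d (\<gamma> s)" and ?T = "snd d \<circ> chart_inv c" and ?J = "jac c d (\<gamma> t)"
  obtain \<delta> where \<delta>: "\<delta> > 0" "\<And>a e h. G d (?y t) a a \<le> (1 + \<delta>) * h\<^sup>2 \<Longrightarrow> norm e \<le> \<delta> * \<bar>h\<bar> \<Longrightarrow>
      G d (?y t) (a + e) (a + e) \<le> (1 + \<epsilon>) * h\<^sup>2"
    using posdef_perturb[OF posdef_G[OF assms(2) chart_mem[OF assms(2,4)]] \<open>\<epsilon> > 0\<close>] by blast
  obtain L where L: "L > 0"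
    "\<forall>\<^sub>F s in at t within S. \<gamma> s \<in> fst c \<and> norm (?x s - ?x t) \<le> L * \<bar>s - t\<bar>"
    "(?x \<longlongrightarrow> ?x t) (at t within S)"
    by (rule slow_at_coords_tendsto[OF assms(1,3,5)])
  have "(?T has_derivative ?J) (at (?x t))" by (rule transition_has_derivative[OF assms(1-4)])
  then have "\<forall>e>0. \<exists>d>0. \<forall>y. norm (y - ?x t) < d \<longrightarrow> norm (?T y - ?T (?x t) - ?J (y - ?x t)) \<le> e * norm (y - ?x t)"
    unfolding has_derivative_at_alt by blast
  moreover have "\<delta> / L > 0" using \<delta> L by simp
  ultimately obtain r where r: "r > 0"
    "\<And>y. norm (y - ?x t) < r \<Longrightarrow> norm (?T y - ?T (?x t) - ?J (y - ?x t)) \<le> \<delta> / L * norm (y - ?x t)"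
    by blast
  have "\<forall>\<^sub>F s in at t within S. norm (?x s - ?x t) < r"
    using tendstoD[OF L(3) r(1)] by (simp add: dist_norm)
  moreover have "\<forall>\<^sub>F s in at t within S. \<gamma> s \<in> fst d"
    using topological_tendstoD[OF slow_at_tendsto[OF assms(1,3,5)] open_chart[OF assms(2)] assms(4)] .
  moreover have "\<forall>\<^sub>F s in at t within S. \<gamma> s \<in> fst c \<and> G c (?x t) (?x s - ?x t) (?x s - ?x t) \<le> (1 + \<delta>) * (s - t)\<^sup>2"
    using assms(5) \<delta>(1) by (simp add: slow_at_def)
  ultimately show "\<forall>\<^sub>F s in at t within S. \<gamma> s \<in> fst d \<and>
      G d (?y t) (?y s - ?y t) (?y s - ?y t) \<le> (1 + \<epsilon>) * (s - t)\<^sup>2"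
    using L(2)
  proof eventually_elim
    case (elim s)
    have T: "?T (?x s) = ?y s" "?T (?x t) = ?y t"
      using chart_inv_left[OF assms(1)] elim assms(3) by simp_all
    have "norm (?y s - ?y t - ?J (?x s - ?x t)) \<le> \<delta> / L * norm (?x s - ?x t)"
      using r(2)[OF elim(1)] by (simp only: T)
    also have "\<dots> \<le> \<delta> / L * (L * \<bar>s - t\<bar>)" using elim \<delta> L by (intro mult_left_mono) auto
    finally have e: "norm (?y s - ?y t - ?J (?x s - ?x t)) \<le> \<delta> * \<bar>s - t\<bar>" using L(1) by simp
    have "G d (?y t) (?J (?x s - ?x t)) (?J (?x s - ?x t)) \<le> (1 + \<delta>) * (s - t)\<^sup>2"
      using elim G_transition[OF assms(1-4)] by simp
    from \<delta>(2)[OF this e] show ?case using elim by simp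
  qed
qed

lemma slowI:
  assumes "\<And>t. t \<in> S \<Longrightarrow> \<exists>c\<in>A. \<gamma> t \<in> fst c \<and> slow_at c S \<gamma> t"
  shows "slow S \<gamma>"
  unfolding slow_def using assms slow_at_transition by blast

lemma slowD: "slow S \<gamma> \<Longrightarrow> t \<in> S \<Longrightarrow> c \<in> A \<Longrightarrow> \<gamma> t \<in> fst c \<Longrightarrow> slow_at c S \<gamma> t"
  by (simp add: slow_def)

lemma slow_at_mono:
  assumes "slow_at c S \<gamma> t" "at t within S' \<le> at t within S"
  shows "slow_at c S' \<gamma> t"
  using assms(1) filter_leD[OF assms(2)] unfolding slow_at_def by blast

lemma slow_subset:
  assumes "slow S \<gamma>" "S' \<subseteq> S" shows "slow S' \<gamma>"
  unfolding slow_def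
proof (intro ballI impI)
  fix t c assume "t \<in> S'" "c \<in> A" "\<gamma> t \<in> fst c"
  then show "slow_at c S' \<gamma> t"
    using slowD[OF assms(1), of t c] assms(2) by (intro slow_at_mono[OF _ at_le[OF assms(2)]]) auto
qed

lemma slow_at_cong:
  assumes "\<And>s. s \<in> S \<Longrightarrow> \<gamma> s = \<delta> s" "\<gamma> t = \<delta> t"
  shows "slow_at c S \<gamma> t \<longleftrightarrow> slow_at c S \<delta> t"
proof -
  have *: "(\<forall>\<^sub>F s in at t within S. P (\<gamma> s) s) \<longleftrightarrow> (\<forall>\<^sub>F s in at t within S. P (\<delta> s) s)" for P
    using assms(1) by (auto simp: eventually_at)
  show ?thesis
    unfolding slow_at_def assms(2)
    using *[of "\<lambda>p s. p \<in> fst c \<and> G c (snd c (\<delta> t)) (snd c p - snd c (\<delta> t)) (snd c p - snd c (\<delta> t)) \<le> (1 + \<epsilon>) * (s - t)\<^sup>2" for \<epsilon>]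
    by simp
qed

lemma slow_cong: "(\<And>s. s \<in> S \<Longrightarrow> \<gamma> s = \<delta> s) \<Longrightarrow> slow S \<gamma> \<longleftrightarrow> slow S \<delta>"
  unfolding slow_def using slow_at_cong[of S \<gamma> \<delta>] by auto

lemma slow_local:
  assumes "\<And>t. t \<in> S \<Longrightarrow> \<exists>T. open T \<and> t \<in> T \<and> slow (S \<inter> T) \<gamma>"
  shows "slow S \<gamma>"
  unfolding slow_def
proof (intro ballI impI)
  fix t c assume t: "t \<in> S" "c \<in> A" "\<gamma> t \<in> fst c"
  then obtain T where T: "open T" "t \<in> T" "slow (S \<inter> T) \<gamma>" using assms by blast
  have "at t within S = at t within (S \<inter> T)" using T by (intro at_within_nhd[of t T]) auto
  then show "slow_at c S \<gamma> t" using slowD[OF T(3), of t c] t T by (simp add: slow_at_def)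
qed

lemma slow_glue:
  assumes "slow (S \<inter> {..b}) \<gamma>" "slow (S \<inter> {b..}) \<gamma>"
  shows "slow S \<gamma>"
  unfolding slow_def
proof (intro ballI impI)
  fix t c assume t: "t \<in> S" "c \<in> A" "\<gamma> t \<in> fst c"
  consider "t < b" | "t > b" | "t = b" by linarith
  then show "slow_at c S \<gamma> t"
  proof cases
    case 1
    have "at t within S = at t within (S \<inter> {..b})" using 1 by (intro at_within_nhd[of t "{..<b}"]) auto
    then show ?thesis using slowD[OF assms(1), of t c] t 1 by (simp add: slow_at_def)
  next
    case 2
    have "at t within S = at t within (S \<inter> {b..})" using 2 by (intro at_within_nhd[of t "{b<..}"]) auto
    then show ?thesis using slowD[OF assms(2), of t c] t 2 by (simp add: slow_at_def)
  next
    case 3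
    have "S = S \<inter> {..b} \<union> S \<inter> {b..}" by auto
    \<comment> \<open>At the junction the filter is the supremum of the two one-sided ones, and the
      condition refers to the same base point \<open>\<gamma> b\<close> on both sides.\<close>
    then have "at t within S = sup (at t within (S \<inter> {..b})) (at t within (S \<inter> {b..}))"
      by (metis at_within_union)
    then show ?thesis using slowD[OF assms(1), of t c] slowD[OF assms(2), of t c] t 3
      by (simp add: slow_at_def eventually_sup)
  qed
qed

lemma slow_shift:
  assumes "slow S \<gamma>" "\<And>t. t \<in> S' \<Longrightarrow> t + a \<in> S"
  shows "slow S' (\<lambda>t. \<gamma> (t + a))"
  unfolding slow_def
proof (intro ballI impI)
  fix t c assume t: "t \<in> S'" "c \<in> A" "\<gamma> (t + a) \<in> fst c"
  have "filterlim (\<lambda>s. s + a) (at (t + a) within S) (at t within S')"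
    unfolding filterlim_at
    by (auto simp: eventually_at assms(2) intro!: tendsto_intros exI[of _ 1])
  then have "(\<forall>\<^sub>F s in at (t + a) within S. P s) \<Longrightarrow> (\<forall>\<^sub>F s in at t within S'. P (s + a))" for P
    by (simp add: filterlim_iff)
  from this[of "\<lambda>s. \<gamma> s \<in> fst c \<and> G c (snd c (\<gamma> (t + a))) (snd c (\<gamma> s) - snd c (\<gamma> (t + a)))
      (snd c (\<gamma> s) - snd c (\<gamma> (t + a))) \<le> (1 + \<epsilon>) * (s - (t + a))\<^sup>2" for \<epsilon>]
  show "slow_at c S' (\<lambda>t. \<gamma> (t + a)) t"
    using slowD[OF assms(1) assms(2)[OF t(1)] t(2,3)] by (simp add: slow_at_def)
qed

lemma slow_at_derivative:
  assumes "c \<in> A" "\<gamma> t \<in> fst c" "\<forall>\<^sub>F s in at t within S. \<gamma> s \<in> fst c"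
    "((\<lambda>s. snd c (\<gamma> s)) has_vector_derivative v) (at t within S)" "G c (snd c (\<gamma> t)) v v \<le> 1"
  shows "slow_at c S \<gamma> t"
  unfolding slow_at_def
proof (intro allI impI)
  fix \<epsilon> :: real assume "\<epsilon> > 0"
  let ?x = "\<lambda>s. snd c (\<gamma> s)"
  have xm: "?x t \<in> chart_image c" using chart_mem[OF assms(1,2)] .
  obtain \<delta> where \<delta>: "\<delta> > 0" "\<And>a e h. G c (?x t) a a \<le> (1 + \<delta>) * h\<^sup>2 \<Longrightarrow> norm e \<le> \<delta> * \<bar>h\<bar> \<Longrightarrow>
      G c (?x t) (a + e) (a + e) \<le> (1 + \<epsilon>) * h\<^sup>2"
    using posdef_perturb[OF posdef_G[OF assms(1) xm] \<open>\<epsilon> > 0\<close>] by blast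
  obtain r where r: "r > 0" "\<And>s. s \<in> S \<Longrightarrow> norm (s - t) < r \<Longrightarrow>
      norm (?x s - ?x t - (s - t) *\<^sub>R v) \<le> \<delta> * norm (s - t)"
    using assms(4) \<delta>(1) unfolding has_vector_derivative_def has_derivative_within_alt by blast
  have "\<forall>\<^sub>F s in at t within S. s \<in> S \<and> norm (s - t) < r"
    using r(1) by (auto simp: eventually_at dist_real_def)
  then show "\<forall>\<^sub>F s in at t within S. \<gamma> s \<in> fst c \<and> G c (?x t) (?x s - ?x t) (?x s - ?x t) \<le> (1 + \<epsilon>) * (s - t)\<^sup>2"
    using assms(3)
  proof eventually_elim
    case (elim s)
    have "norm (?x s - ?x t - (s - t) *\<^sub>R v) \<le> \<delta> * \<bar>s - t\<bar>" using r(2) elim by auto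
    moreover have "G c (?x t) ((s - t) *\<^sub>R v) ((s - t) *\<^sub>R v) = (s - t)\<^sup>2 * G c (?x t) v v"
      by (simp add: G_linear[OF assms(1) xm] power2_eq_square)
    moreover have "(s - t)\<^sup>2 * G c (?x t) v v \<le> (s - t)\<^sup>2 * (1 + \<delta>)"
      using assms(5) \<delta>(1) by (intro mult_left_mono) auto
    ultimately have "G c (?x t) ((s - t) *\<^sub>R v + (?x s - ?x t - (s - t) *\<^sub>R v))
        ((s - t) *\<^sub>R v + (?x s - ?x t - (s - t) *\<^sub>R v)) \<le> (1 + \<epsilon>) * (s - t)\<^sup>2"
      by (intro \<delta>(2)) (auto simp: mult.commute)
    then show ?case using elim by simp
  qed
qed

text \<open>One constant \<open>K\<close> controls the metric on a closed coordinate ball: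
  comparison with the Euclidean norm in both directions, and Lipschitz dependence on the point. The
  latter is a relative error, so that it can be multiplied into estimates for the metric frozen at
  another point.\<close>

definition good_ball :: "('a, 'e) chart \<Rightarrow> 'e \<Rightarrow> real \<Rightarrow> real \<Rightarrow> bool" where
  "good_ball c x0 r K \<longleftrightarrow> c \<in> A \<and> r > 0 \<and> K \<ge> 1 \<and> cball x0 r \<subseteq> chart_image c \<and>
     (\<forall>y\<in>cball x0 r. \<forall>u. (norm u)\<^sup>2 \<le> K * G c y u u \<and> G c y u u \<le> K * (norm u)\<^sup>2) \<and>
     (\<forall>y\<in>cball x0 r. \<forall>z\<in>cball x0 r. \<forall>u. G c y u u \<le> (1 + K * norm (y - z)) * G c z u u)"

lemma DG_abs_le:
  assumes "c \<in> A" "x \<in> chart_image c"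
  shows "\<bar>DG c x d u w\<bar> \<le> (\<Sum>k\<in>Basis. \<Sum>i\<in>Basis. \<Sum>j\<in>Basis. \<bar>DG c x k i j\<bar>) * norm d * norm u * norm w"
proof -
  have "\<bar>DG c x d u w\<bar> = \<bar>\<Sum>k\<in>Basis. (d \<bullet> k) *\<^sub>R DG c x k u w\<bar>"
    using linear_basis_sum[OF linear_DG[OF assms], of d u w] by simp
  also have "\<dots> \<le> (\<Sum>k\<in>Basis. norm d * ((\<Sum>i\<in>Basis. \<Sum>j\<in>Basis. \<bar>DG c x k i j\<bar>) * norm u * norm w))"
    by (intro order_trans[OF sum_abs] sum_mono)
      (auto simp: abs_mult intro!: mult_mono Basis_le_norm bilinear_abs_le[OF bilinear_DG[OF assms]])
  finally show ?thesis by (simp add: sum_distrib_left[symmetric] sum_distrib_right[symmetric] mult_ac)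
qed

lemma good_ball_exists:
  assumes "c \<in> A" "x0 \<in> chart_image c"
  obtains r K where "good_ball c x0 r K"
proof -
  obtain r where r: "r > 0" "cball x0 r \<subseteq> chart_image c"
    using open_chart_image[OF assms(1)] assms(2) open_contains_cball by blast
  let ?C = "cball x0 r"
  have mem: "y \<in> chart_image c" if "y \<in> ?C" for y using r that by auto
  have "continuous_on (?C \<times> sphere 0 1) (\<lambda>z. G c (fst z) (snd z) (snd z))"
    by (intro continuous_on_G assms(1)) (auto intro!: continuous_intros mem)
  moreover have "compact (?C \<times> sphere (0::'e) 1)" by (intro compact_Times) auto
  moreover obtain b0 :: 'e where "b0 \<in> Basis" using nonempty_Basis by blast
  then have "(x0, b0) \<in> ?C \<times> sphere 0 1" using r by auto
  ultimately obtain z0 where z0: "z0 \<in> ?C \<times> sphere (0::'e) 1"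
      "\<forall>z\<in>?C \<times> sphere 0 1. G c (fst z0) (snd z0) (snd z0) \<le> G c (fst z) (snd z) (snd z)"
    using continuous_attains_inf[of "?C \<times> sphere (0::'e) 1" "\<lambda>z. G c (fst z) (snd z) (snd z)"] by blast
  define m where "m = G c (fst z0) (snd z0) (snd z0)"
  have "norm (snd z0) = 1" "fst z0 \<in> ?C" using z0(1) by (auto simp: mem_Times_iff)
  then have m: "m > 0"
    unfolding m_def by (intro posdefD(3)[OF posdef_G[OF assms(1) mem]]) auto
  have low: "m * (norm u)\<^sup>2 \<le> G c y u u" if y: "y \<in> ?C" for y u
  proof (cases "u = 0")
    case False
    have "m \<le> G c y ((1 / norm u) *\<^sub>R u) ((1 / norm u) *\<^sub>R u)"
      using z0(2) y False by (auto simp: m_def)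
    also have "\<dots> = G c y u u / (norm u)\<^sup>2"
      by (simp add: G_linear[OF assms(1) mem[OF y]] power2_eq_square)
    finally show ?thesis using False by (simp add: pos_le_divide_eq)
  qed (simp add: G_linear[OF assms(1) mem[OF y]])
  obtain k1 where k1: "k1 \<ge> 0" "\<And>y. y \<in> ?C \<Longrightarrow> (\<Sum>i\<in>Basis. \<Sum>j\<in>Basis. \<bar>G c y i j\<bar>) \<le> k1"
  proof (rule continuous_bounded_above[of ?C "\<lambda>y. \<Sum>i\<in>Basis. \<Sum>j\<in>Basis. \<bar>G c y i j\<bar>"])
    show "continuous_on ?C (\<lambda>y. \<Sum>i\<in>Basis. \<Sum>j\<in>Basis. \<bar>G c y i j\<bar>)"
      by (intro continuous_on_sum continuous_on_rabs continuous_on_G assms(1)) (auto intro!: continuous_intros mem)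
  qed (auto)
  obtain k2 where k2: "k2 \<ge> 0" "\<And>y. y \<in> ?C \<Longrightarrow> (\<Sum>k\<in>Basis. \<Sum>i\<in>Basis. \<Sum>j\<in>Basis. \<bar>DG c y k i j\<bar>) \<le> k2"
  proof (rule continuous_bounded_above[of ?C "\<lambda>y. \<Sum>k\<in>Basis. \<Sum>i\<in>Basis. \<Sum>j\<in>Basis. \<bar>DG c y k i j\<bar>"])
    show "continuous_on ?C (\<lambda>y. \<Sum>k\<in>Basis. \<Sum>i\<in>Basis. \<Sum>j\<in>Basis. \<bar>DG c y k i j\<bar>)"
      by (intro continuous_on_sum continuous_on_rabs continuous_on_DG assms(1)) (auto intro!: continuous_intros mem)
  qed (auto)
  have up: "G c y u u \<le> k1 * (norm u)\<^sup>2" if y: "y \<in> ?C" for y u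
  proof -
    have "G c y u u \<le> (\<Sum>i\<in>Basis. \<Sum>j\<in>Basis. \<bar>G c y i j\<bar>) * norm u * norm u"
      using bilinear_abs_le[OF posdefD(1)[OF posdef_G[OF assms(1) mem[OF y]]], of u u] by simp
    also have "\<dots> \<le> k1 * norm u * norm u" using k1(2)[OF y] by (intro mult_right_mono) auto
    finally show ?thesis by (simp add: power2_eq_square mult.assoc)
  qed
  have lip: "G c y u u \<le> (1 + k2 / m * norm (y - z)) * G c z u u" if y: "y \<in> ?C" and z: "z \<in> ?C" for y z u
  proof -
    have "norm (G c y u u - G c z u u) \<le> (k2 * (norm u)\<^sup>2) * norm (y - z)"
    proof (rule differentiable_bound[of ?C])
      fix x assume x: "x \<in> ?C"
      show "((\<lambda>y. G c y u u) has_derivative (\<lambda>d. DG c x d u u)) (at x within ?C)"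
        using G_has_derivative[OF assms(1) mem[OF x]] by (rule has_derivative_at_withinI)
      show "onorm (\<lambda>d. DG c x d u u) \<le> k2 * (norm u)\<^sup>2"
      proof (rule onorm_le)
        fix d
        have "\<bar>DG c x d u u\<bar> \<le> (\<Sum>k\<in>Basis. \<Sum>i\<in>Basis. \<Sum>j\<in>Basis. \<bar>DG c x k i j\<bar>) * norm d * norm u * norm u"
          by (rule DG_abs_le[OF assms(1) mem[OF x]])
        also have "\<dots> \<le> k2 * norm d * norm u * norm u" using k2(2)[OF x] by (intro mult_right_mono) auto
        finally show "norm (DG c x d u u) \<le> k2 * (norm u)\<^sup>2 * norm d" by (simp add: power2_eq_square mult_ac)
      qed
    qed (use y z in auto)
    then have "G c y u u \<le> G c z u u + k2 * norm (y - z) * (norm u)\<^sup>2" by (simp add: mult_ac abs_le_iff)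
    also have "\<dots> \<le> G c z u u + k2 * norm (y - z) * (G c z u u / m)"
      using low[OF z, of u] m k2 by (intro add_left_mono mult_left_mono) (auto simp: field_simps)
    finally show ?thesis by (simp add: algebra_simps)
  qed
  \<comment> \<open>\<open>k2\<close> bounds the derivatives of the metric and thus an absolute
    error; dividing by the lower bound \<open>m\<close> of the metric makes it relative.\<close>
  define K where "K = max 1 (max (1 / m) (max k1 (k2 / m)))"
  have K: "K \<ge> 1" "1 / m \<le> K" "k1 \<le> K" "k2 / m \<le> K" by (auto simp: K_def)
  have pos: "G c y u u \<ge> 0" if "y \<in> ?C" for y u using posdefD(4)[OF posdef_G[OF assms(1) mem[OF that]]] .
  have "good_ball c x0 r K"
    unfolding good_ball_def
  proof (intro conjI ballI allI assms(1) r K(1))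
    fix y u assume y: "y \<in> ?C"
    have "(norm u)\<^sup>2 \<le> 1 / m * G c y u u" using low[OF y, of u] m by (simp add: field_simps)
    also have "\<dots> \<le> K * G c y u u" using K pos[OF y] by (intro mult_right_mono) auto
    finally show "(norm u)\<^sup>2 \<le> K * G c y u u" .
    show "G c y u u \<le> K * (norm u)\<^sup>2" using up[OF y, of u] mult_right_mono[OF K(3), of "(norm u)\<^sup>2"] by simp
  next
    fix y z u assume yz: "y \<in> ?C" "z \<in> ?C"
    have "(1 + k2 / m * norm (y - z)) * G c z u u \<le> (1 + K * norm (y - z)) * G c z u u"
      using K(4) pos[OF yz(2)] by (intro mult_right_mono add_left_mono) auto
    then show "G c y u u \<le> (1 + K * norm (y - z)) * G c z u u" using lip[OF yz, of u] by linarith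
  qed
  then show ?thesis by (rule that)
qed

end

section \<open>Slow curves inside a good ball: length estimates, confinement and limits\<close>

context riemannian
begin

lemma good_ballD:
  assumes "good_ball c x0 r K"
  shows "c \<in> A" "r > 0" "K \<ge> 1" "cball x0 r \<subseteq> chart_image c"
    "y \<in> cball x0 r \<Longrightarrow> (norm u)\<^sup>2 \<le> K * G c y u u" "y \<in> cball x0 r \<Longrightarrow> G c y u u \<le> K * (norm u)\<^sup>2"
    "y \<in> cball x0 r \<Longrightarrow> z \<in> cball x0 r \<Longrightarrow> G c y u u \<le> (1 + K * norm (y - z)) * G c z u u"
    "y \<in> cball x0 r \<Longrightarrow> G c y u u \<ge> 0"
proof -
  show 1: "c \<in> A" "r > 0" "K \<ge> 1" "cball x0 r \<subseteq> chart_image c"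
    "y \<in> cball x0 r \<Longrightarrow> (norm u)\<^sup>2 \<le> K * G c y u u" "y \<in> cball x0 r \<Longrightarrow> G c y u u \<le> K * (norm u)\<^sup>2"
    "y \<in> cball x0 r \<Longrightarrow> z \<in> cball x0 r \<Longrightarrow> G c y u u \<le> (1 + K * norm (y - z)) * G c z u u"
    using assms by (auto simp: good_ball_def)
  show "y \<in> cball x0 r \<Longrightarrow> G c y u u \<ge> 0" using posdefD(4)[OF posdef_G[OF 1(1)]] 1(4) by auto
qed

text \<open>Slowness is infinitesimal. With the metric frozen at \<open>y\<close>, squared length
  bounds are additive over adjacent intervals and hold near each time with a factor
  \<open>1 + \<epsilon>\<close>, so bisection gives them on the whole interval. The factor
  \<open>1 + K * D\<close> pays for freezing the metric.\<close>

lemma slow_quadratic_estimate: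
  assumes gb: "good_ball c x0 r K" and sl: "slow {a..b} \<gamma>" and "a \<le> b"
    and mem: "\<And>t. t \<in> {a..b} \<Longrightarrow> \<gamma> t \<in> fst c \<and> snd c (\<gamma> t) \<in> cball x0 r"
    and y: "y \<in> cball x0 r" "\<And>t. t \<in> {a..b} \<Longrightarrow> norm (y - snd c (\<gamma> t)) \<le> D"
  shows "G c y (snd c (\<gamma> b) - snd c (\<gamma> a)) (snd c (\<gamma> b) - snd c (\<gamma> a)) \<le> (1 + K * D) * (b - a)\<^sup>2"
proof -
  let ?x = "\<lambda>t. snd c (\<gamma> t)"
  note gD = good_ballD[OF gb]
  have pd: "posdef (G c y)" using posdef_G[OF gD(1)] gD(4) y(1) by auto
  have D0: "D \<ge> 0" using y(2)[of a] \<open>a \<le> b\<close> norm_ge_zero order_trans by (metis atLeastAtMost_iff order_refl)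
  have KD: "1 + K * D > 0" using gD(3) D0 by (simp add: add_pos_nonneg)
  have eps: "G c y (?x b - ?x a) (?x b - ?x a) \<le> ((1 + K * D) * (1 + \<epsilon>)) * (b - a)\<^sup>2" if "\<epsilon> > 0" for \<epsilon>
  proof -
    define L where "L = (1 + K * D) * (1 + \<epsilon>)"
    \<comment> \<open>Bisection also inspects intervals that stick out of \<open>{a..b}\<close>; the
      premise makes the property vacuous there.\<close>
    define P where "P s t \<longleftrightarrow> (a \<le> s \<and> t \<le> b \<longrightarrow> G c y (?x t - ?x s) (?x t - ?x s) \<le> L * (t - s)\<^sup>2)" for s t
    have "P a b" using \<open>a \<le> b\<close>
    proof (induction rule: Bolzano)
      case (trans s t u)
      show ?case unfolding P_def
      proof
        assume g: "a \<le> s \<and> u \<le> b"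
        have "G c y ((?x t - ?x s) + (?x u - ?x t)) ((?x t - ?x s) + (?x u - ?x t)) \<le> L * ((t - s) + (u - t))\<^sup>2"
          using trans g by (intro posdef_subadditive pd) (auto simp: P_def)
        then show "G c y (?x u - ?x s) (?x u - ?x s) \<le> L * (u - s)\<^sup>2" by simp
      qed
    next
      case (local \<tau>)
      have \<tau>: "\<tau> \<in> {a..b}" using local by simp
      have "\<forall>\<^sub>F s in at \<tau> within {a..b}. \<gamma> s \<in> fst c \<and> G c (?x \<tau>) (?x s - ?x \<tau>) (?x s - ?x \<tau>) \<le> (1 + \<epsilon>) * (s - \<tau>)\<^sup>2"
        using slowD[OF sl \<tau> gD(1)] mem[OF \<tau>] \<open>\<epsilon> > 0\<close> by (simp add: slow_at_def)
      then obtain d where d: "d > 0" "\<And>s. s \<in> {a..b} \<Longrightarrow> s \<noteq> \<tau> \<Longrightarrow> dist s \<tau> < d \<Longrightarrow>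
          G c (?x \<tau>) (?x s - ?x \<tau>) (?x s - ?x \<tau>) \<le> (1 + \<epsilon>) * (s - \<tau>)\<^sup>2"
        unfolding eventually_at by blast
      have near: "G c y (?x s - ?x \<tau>) (?x s - ?x \<tau>) \<le> L * (s - \<tau>)\<^sup>2" if s: "s \<in> {a..b}" "\<bar>s - \<tau>\<bar> < d" for s
      proof (cases "s = \<tau>")
        case True then show ?thesis by (simp add: posdef_linear[OF pd])
      next
        case False
        let ?u = "?x s - ?x \<tau>"
        have "G c y ?u ?u \<le> (1 + K * norm (y - ?x \<tau>)) * G c (?x \<tau>) ?u ?u"
          using gD(7) y(1) mem[OF \<tau>] by blast
        also have "\<dots> \<le> (1 + K * D) * G c (?x \<tau>) ?u ?u"
          using y(2)[OF \<tau>] gD(3) gD(8)[of "?x \<tau>" ?u] mem[OF \<tau>]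
          by (intro mult_right_mono add_left_mono mult_left_mono) auto
        also have "\<dots> \<le> (1 + K * D) * ((1 + \<epsilon>) * (s - \<tau>)\<^sup>2)"
          using d(2)[OF s(1) False] s(2) KD by (intro mult_left_mono) (auto simp: dist_real_def)
        finally show ?thesis by (simp add: L_def mult.assoc)
      qed
      have "P s t" if st: "s \<le> \<tau> \<and> \<tau> \<le> t \<and> t - s < d" for s t
        unfolding P_def
      proof
        assume g: "a \<le> s \<and> t \<le> b"
        have 1: "G c y (?x s - ?x \<tau>) (?x s - ?x \<tau>) \<le> L * (s - \<tau>)\<^sup>2" by (rule near) (use g st local in auto)
        have 2: "G c y (?x t - ?x \<tau>) (?x t - ?x \<tau>) \<le> L * (t - \<tau>)\<^sup>2" by (rule near) (use g st local in auto)
        have "G c y (?x \<tau> - ?x s) (?x \<tau> - ?x s) = G c y (?x s - ?x \<tau>) (?x s - ?x \<tau>)"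
          by (simp add: posdef_linear[OF pd])
        then have "G c y ((?x \<tau> - ?x s) + (?x t - ?x \<tau>)) ((?x \<tau> - ?x s) + (?x t - ?x \<tau>)) \<le> L * ((\<tau> - s) + (t - \<tau>))\<^sup>2"
          using 1 2 st by (intro posdef_subadditive pd) (auto simp: power2_commute)
        then show "G c y (?x t - ?x s) (?x t - ?x s) \<le> L * (t - s)\<^sup>2" by simp
      qed
      then show ?case using d(1) by blast
    qed
    then show ?thesis by (simp add: P_def L_def)
  qed
  show ?thesis
  proof (rule field_le_epsilon)
    fix e :: real assume "e > 0"
    define \<epsilon> where "\<epsilon> = e / ((1 + K * D) * (b - a)\<^sup>2 + 1)"
    have den: "(1 + K * D) * (b - a)\<^sup>2 + 1 > 0" using KD by (simp add: add_nonneg_pos)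
    then have e0: "\<epsilon> > 0" using \<open>e > 0\<close> by (simp add: \<epsilon>_def)
    have "(1 + K * D) * (b - a)\<^sup>2 * \<epsilon> \<le> ((1 + K * D) * (b - a)\<^sup>2 + 1) * \<epsilon>" using e0 by (intro mult_right_mono) auto
    also have "\<dots> = e" using den by (simp add: \<epsilon>_def)
    finally show "G c y (?x b - ?x a) (?x b - ?x a) \<le> (1 + K * D) * (b - a)\<^sup>2 + e"
      using eps[OF e0] by (simp add: algebra_simps)
  qed
qed

text \<open>Lipschitz constant of slow curves in coordinates: points of the ball are at most
  \<open>2 * r\<close> apart, which is the \<open>D\<close> of the quadratic estimate, and the outer
  \<open>K\<close> passes to the Euclidean norm. The squared estimate yields a square root, which
  this number dominates because it is at least 1.\<close>

definition lip :: "real \<Rightarrow> real \<Rightarrow> real" where "lip r K = K * (1 + K * (2 * r))"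

lemma lip_ge_1: "good_ball c x0 r K \<Longrightarrow> lip r K \<ge> 1"
  using good_ballD(2,3)[of c x0 r K] by (simp add: lip_def mult_ge1_I)

lemma slow_lipschitz:
  assumes gb: "good_ball c x0 r K" and sl: "slow {a..b} \<gamma>" and "a \<le> b"
    and mem: "\<And>t. t \<in> {a..b} \<Longrightarrow> \<gamma> t \<in> fst c \<and> snd c (\<gamma> t) \<in> cball x0 r"
  shows "norm (snd c (\<gamma> b) - snd c (\<gamma> a)) \<le> lip r K * (b - a)"
proof -
  let ?x = "\<lambda>t. snd c (\<gamma> t)"
  note gD = good_ballD[OF gb]
  have ma: "?x a \<in> cball x0 r" using mem[of a] \<open>a \<le> b\<close> by auto
  have "norm (?x a - ?x t) \<le> 2 * r" if "t \<in> {a..b}" for t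
  proof -
    have "dist (?x a) (?x t) \<le> dist x0 (?x a) + dist x0 (?x t)" by (metis dist_commute dist_triangle)
    then show ?thesis using ma mem[OF that] by (auto simp: dist_norm)
  qed
  from slow_quadratic_estimate[OF assms ma this]
  have 1: "G c (?x a) (?x b - ?x a) (?x b - ?x a) \<le> (1 + K * (2 * r)) * (b - a)\<^sup>2" by simp
  have "(norm (?x b - ?x a))\<^sup>2 \<le> K * G c (?x a) (?x b - ?x a) (?x b - ?x a)" by (rule gD(5)[OF ma])
  also have "\<dots> \<le> lip r K * (b - a)\<^sup>2"
    using mult_left_mono[OF 1, of K] gD(3) by (simp add: lip_def mult.assoc)
  also have "\<dots> \<le> lip r K * lip r K * (b - a)\<^sup>2"
    using lip_ge_1[OF gb] by (intro mult_right_mono) auto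
  finally have "(norm (?x b - ?x a))\<^sup>2 \<le> (lip r K * (b - a))\<^sup>2" by (simp add: power2_eq_square mult_ac)
  then show ?thesis
    by (rule power2_le_imp_le[OF _ mult_nonneg_nonneg]) (use lip_ge_1[OF gb] \<open>a \<le> b\<close> in simp_all)
qed

text \<open>Feeding the Lipschitz bound back into the quadratic estimate replaces the diameter of
  the ball by a multiple of \<open>b - a\<close>. The excess over the ideal bound becomes of third
  order, with a constant common to all slow curves in the ball, so that the estimate passes to
  limits.\<close>

lemma slow_sharp_estimate:
  assumes gb: "good_ball c x0 r K" and sl: "slow {a..b} \<gamma>" and "a \<le> b"
    and mem: "\<And>t. t \<in> {a..b} \<Longrightarrow> \<gamma> t \<in> fst c \<and> snd c (\<gamma> t) \<in> cball x0 r"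
    and "\<tau> \<in> {a..b}"
  shows "G c (snd c (\<gamma> \<tau>)) (snd c (\<gamma> b) - snd c (\<gamma> a)) (snd c (\<gamma> b) - snd c (\<gamma> a))
    \<le> (1 + K * (lip r K * (b - a))) * (b - a)\<^sup>2"
proof (rule slow_quadratic_estimate[OF gb sl \<open>a \<le> b\<close> mem])
  let ?x = "\<lambda>t. snd c (\<gamma> t)"
  show "?x \<tau> \<in> cball x0 r" using mem assms(5) by blast
  fix t assume t: "t \<in> {a..b}"
  have *: "norm (?x v - ?x u) \<le> lip r K * (b - a)" if uv: "u \<in> {a..b}" "v \<in> {a..b}" "u \<le> v" for u v
  proof -
    have "norm (?x v - ?x u) \<le> lip r K * (v - u)"
      using uv by (intro slow_lipschitz[OF gb slow_subset[OF sl]] mem) auto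
    also have "\<dots> \<le> lip r K * (b - a)" using uv lip_ge_1[OF gb] by (intro mult_left_mono) auto
    finally show ?thesis .
  qed
  show "norm (?x \<tau> - ?x t) \<le> lip r K * (b - a)"
    using *[of t \<tau>] *[of \<tau> t] t assms(5) by (cases "t \<le> \<tau>") (auto simp: norm_minus_commute)
qed auto

text \<open>The way back from a quantitative estimate, as it is available for limits of slow curves,
  to slowness.\<close>

lemma slow_at_from_estimate:
  assumes "d > 0" "C \<ge> 0" "\<And>s. s \<in> S \<Longrightarrow> \<bar>s - t\<bar> < d \<Longrightarrow> \<gamma> s \<in> fst c \<and>
    G c (snd c (\<gamma> t)) (snd c (\<gamma> s) - snd c (\<gamma> t)) (snd c (\<gamma> s) - snd c (\<gamma> t)) \<le> (1 + C * \<bar>s - t\<bar>) * (s - t)\<^sup>2"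
  shows "slow_at c S \<gamma> t"
  unfolding slow_at_def
proof (intro allI impI)
  fix \<epsilon> :: real assume "\<epsilon> > 0"
  define e where "e = min d (\<epsilon> / (C + 1))"
  have e: "e > 0" "e \<le> d" "e \<le> \<epsilon> / (C + 1)" using assms(1,2) \<open>\<epsilon> > 0\<close> by (auto simp: e_def)
  show "\<forall>\<^sub>F s in at t within S. \<gamma> s \<in> fst c \<and>
     G c (snd c (\<gamma> t)) (snd c (\<gamma> s) - snd c (\<gamma> t)) (snd c (\<gamma> s) - snd c (\<gamma> t)) \<le> (1 + \<epsilon>) * (s - t)\<^sup>2"
    unfolding eventually_at
  proof (intro exI[of _ e] conjI e ballI impI)
    fix s assume s: "s \<in> S" "s \<noteq> t \<and> dist s t < e"
    then have st: "\<bar>s - t\<bar> < e" by (simp add: dist_real_def)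
    then show "\<gamma> s \<in> fst c" using assms(3)[OF s(1)] e by simp
    have "C * \<bar>s - t\<bar> \<le> (C + 1) * (\<epsilon> / (C + 1))" using st e assms(2) by (intro mult_mono) auto
    then have "1 + C * \<bar>s - t\<bar> \<le> 1 + \<epsilon>" using assms(2) by simp
    then have "(1 + C * \<bar>s - t\<bar>) * (s - t)\<^sup>2 \<le> (1 + \<epsilon>) * (s - t)\<^sup>2" by (intro mult_right_mono) auto
    then show "G c (snd c (\<gamma> t)) (snd c (\<gamma> s) - snd c (\<gamma> t)) (snd c (\<gamma> s) - snd c (\<gamma> t)) \<le> (1 + \<epsilon>) * (s - t)\<^sup>2"
      using assms(3)[OF s(1)] st e by linarith
  qed
qed

text \<open>Closedness is meant in the manifold, not merely in the chart domain: the set is a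
  compact image under \<open>chart_inv\<close>, and the manifold is Hausdorff.\<close>

lemma chart_ball_open:
  assumes "c \<in> A" "cball x0 r \<subseteq> chart_image c"
  shows "open {p \<in> fst c. snd c p \<in> ball x0 r}" "\<rho> \<le> r \<Longrightarrow> closed {p \<in> fst c. snd c p \<in> cball x0 \<rho>}"
proof -
  show "open {p \<in> fst c. snd c p \<in> ball x0 r}" by (rule open_chart_vimage[OF assms(1)]) simp
  assume "\<rho> \<le> r"
  then have sub: "cball x0 \<rho> \<subseteq> chart_image c" using assms(2) by auto
  have "{p \<in> fst c. snd c p \<in> cball x0 \<rho>} = chart_inv c ` cball x0 \<rho>"
  proof (intro set_eqI iffI)
    fix p assume "p \<in> {p \<in> fst c. snd c p \<in> cball x0 \<rho>}"
    then show "p \<in> chart_inv c ` cball x0 \<rho>" using chart_inv_left[OF assms(1)] by (intro image_eqI[of _ _ "snd c p"]) auto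
  next
    fix p assume "p \<in> chart_inv c ` cball x0 \<rho>"
    then obtain x where "x \<in> cball x0 \<rho>" "p = chart_inv c x" by blast
    then show "p \<in> {p \<in> fst c. snd c p \<in> cball x0 \<rho>}"
      using chart_inv_right[OF assms(1), of x] chart_inv_mem[OF assms(1), of x] sub by auto
  qed
  moreover have "compact (chart_inv c ` cball x0 \<rho>)"
    using continuous_on_subset[OF continuous_on_chart_inv[OF assms(1)] sub] by (intro compact_continuous_image) auto
  ultimately show "closed {p \<in> fst c. snd c p \<in> cball x0 \<rho>}" by (simp add: compact_imp_closed)
qed

text \<open>At the first time outside the open ball the curve would be a limit of points in a
  strictly smaller closed ball, by the Lipschitz bound up to that time. The smaller ball is closed
  in the manifold and lies within the open one.\<close>

lemma slow_stays:
  assumes gb: "good_ball c x0 r K" and sl: "slow {a..b} \<gamma>" and "a \<le> b"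
    and start: "\<gamma> a \<in> fst c" "snd c (\<gamma> a) = x0" and small: "lip r K * (b - a) < r"
    and t: "t \<in> {a..b}"
  shows "\<gamma> t \<in> fst c \<and> norm (snd c (\<gamma> t) - x0) \<le> lip r K * (t - a)"
proof -
  let ?x = "\<lambda>t. snd c (\<gamma> t)"
  note gD = good_ballD[OF gb]
  define W where "W = {p \<in> fst c. snd c p \<in> ball x0 r}"
  have W: "open W" unfolding W_def by (rule chart_ball_open[OF gD(1,4)])
  have cont: "continuous_on {a..b} \<gamma>" using sl by (rule slow_continuous_on)
  have bound: "norm (?x s - x0) \<le> lip r K * (s - a)" if s: "s \<in> {a..b}" "\<And>u. u \<in> {a..s} \<Longrightarrow> \<gamma> u \<in> W" for s
  proof -
    have "norm (?x s - ?x a) \<le> lip r K * (s - a)"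
      using s by (intro slow_lipschitz[OF gb slow_subset[OF sl]]) (force simp: W_def)+
    then show ?thesis by (simp add: start)
  qed
  have inW: "\<gamma> s \<in> W" if "s \<in> {a..b}" for s
  proof (rule ccontr)
    assume "\<gamma> s \<notin> W"
    define Z where "Z = {u \<in> {a..b}. \<gamma> u \<in> - W}"
    have "closed Z"
    proof -
      have "Z = {a..b} \<inter> \<gamma> -` (- W)" by (auto simp: Z_def)
      moreover have "closed ({a..b} \<inter> \<gamma> -` (- W))"
        by (rule continuous_closed_preimage[OF cont]) (use W in \<open>simp_all add: closed_Compl\<close>)
      ultimately show ?thesis by simp
    qed
    moreover have "Z \<noteq> {}" "bdd_below Z" using \<open>\<gamma> s \<notin> W\<close> that by (auto simp: Z_def bdd_below_def)
    ultimately have "Inf Z \<in> Z" by (intro closed_contains_Inf)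
    define T where "T = Inf Z"
    have T: "T \<in> {a..b}" "\<gamma> T \<notin> W" using \<open>Inf Z \<in> Z\<close> by (auto simp: T_def Z_def)
    have before: "\<gamma> u \<in> W" if "u \<in> {a..<T}" for u
    proof (rule ccontr)
      assume "\<gamma> u \<notin> W"
      then have "u \<in> Z" using that T by (auto simp: Z_def)
      then have "T \<le> u" unfolding T_def using \<open>bdd_below Z\<close> by (rule cInf_lower)
      then show False using that by simp
    qed
    have "a \<noteq> T" using T start gD(2) by (auto simp: W_def)
    then have aT: "a < T" using T by simp
    define \<rho> where "\<rho> = lip r K * (T - a)"
    have "\<rho> \<le> lip r K * (b - a)" unfolding \<rho>_def using T lip_ge_1[OF gb] by (intro mult_left_mono) auto
    then have \<rho>: "\<rho> < r" using small by linarith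
    have "\<gamma> u \<in> {p \<in> fst c. snd c p \<in> cball x0 \<rho>}" if u: "u \<in> {a..<T}" for u
    proof -
      have "norm (?x u - x0) \<le> lip r K * (u - a)" using u T before by (intro bound) auto
      also have "\<dots> \<le> \<rho>" unfolding \<rho>_def using u lip_ge_1[OF gb] by (intro mult_left_mono) auto
      finally show ?thesis using before[OF u] by (simp add: W_def dist_norm norm_minus_commute)
    qed
    then have "\<forall>\<^sub>F u in at_left T. \<gamma> u \<in> {p \<in> fst c. snd c p \<in> cball x0 \<rho>}"
      using eventually_at_left_real[OF aT] by (auto elim!: eventually_mono)
    moreover have "(\<gamma> \<longlongrightarrow> \<gamma> T) (at_left T)"
    proof -
      have "(\<gamma> \<longlongrightarrow> \<gamma> T) (at T within {a..b})" using cont T by (simp add: continuous_on_def)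
      then have "(\<gamma> \<longlongrightarrow> \<gamma> T) (at T within {a..<T})" by (rule tendsto_within_subset) (use T in auto)
      moreover have "at_left T = at T within {a..<T}" using aT by (intro at_within_nhd[of _ "{a<..}"]) auto
      ultimately show ?thesis by simp
    qed
    ultimately have "\<gamma> T \<in> {p \<in> fst c. snd c p \<in> cball x0 \<rho>}"
      using chart_ball_open(2)[OF gD(1,4), of \<rho>] \<rho> by (intro Lim_in_closed_set[of _ \<gamma> "at_left T"]) auto
    then show False using T \<rho> by (auto simp: W_def)
  qed
  show ?thesis using inW[OF t] bound[OF t] inW t by (auto simp: W_def)
qed

text \<open>The coordinates are uniformly continuous and so extend to the end time; the closed ball
  keeps their limit in the chart image, where the inverse chart is continuous.\<close>

lemma slow_has_limit:
  assumes gb: "good_ball c x0 r K" and sl: "slow {a..<b} \<gamma>" and "a < b"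
    and mem: "\<And>t. t \<in> {a..<b} \<Longrightarrow> \<gamma> t \<in> fst c \<and> snd c (\<gamma> t) \<in> cball x0 r"
  obtains q where "(\<gamma> \<longlongrightarrow> q) (at_left b)"
proof -
  let ?x = "\<lambda>t. snd c (\<gamma> t)"
  note gD = good_ballD[OF gb]
  have "uniformly_continuous_on {a..<b} ?x"
    unfolding uniformly_continuous_on_def
  proof (intro allI impI)
    fix e :: real assume "e > 0"
    show "\<exists>d>0. \<forall>x\<in>{a..<b}. \<forall>x'\<in>{a..<b}. dist x' x < d \<longrightarrow> dist (?x x') (?x x) < e"
    proof (intro exI[of _ "e / lip r K"] conjI ballI impI)
      show "e / lip r K > 0" using \<open>e > 0\<close> lip_ge_1[OF gb] by simp
      fix s t assume st: "s \<in> {a..<b}" "t \<in> {a..<b}" "dist t s < e / lip r K"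
      have *: "norm (?x v - ?x u) \<le> lip r K * (v - u)" if "u \<in> {a..<b}" "v \<in> {a..<b}" "u \<le> v" for u v
        using that by (intro slow_lipschitz[OF gb slow_subset[OF sl]] mem) auto
      have "dist (?x t) (?x s) \<le> lip r K * \<bar>t - s\<bar>"
        using *[of s t] *[of t s] st by (cases "s \<le> t") (auto simp: dist_norm norm_minus_commute)
      also have "\<dots> < e" using st(3) lip_ge_1[OF gb] by (simp add: dist_real_def field_simps)
      finally show "dist (?x t) (?x s) < e" .
    qed
  qed
  moreover have "b \<in> closure {a..<b}" using \<open>a < b\<close> by simp
  ultimately obtain l where "(?x \<longlongrightarrow> l) (at b within {a..<b})"
    using uniformly_continuous_on_extension_at_closure by blast
  moreover have eq: "at_left b = at b within {a..<b}" using \<open>a < b\<close> by (intro at_within_nhd[of _ "{a<..}"]) auto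
  ultimately have l: "(?x \<longlongrightarrow> l) (at_left b)" by simp
  have ev: "\<forall>\<^sub>F t in at_left b. t \<in> {a..<b}"
    using eventually_at_left_real[OF \<open>a < b\<close>] by (auto elim!: eventually_mono)
  have "l \<in> cball x0 r"
    by (rule Lim_in_closed_set[OF _ eventually_mono[OF ev] _ l]) (use mem in auto)
  then have "isCont (chart_inv c) l"
    using continuous_on_chart_inv[OF gD(1)] open_chart_image[OF gD(1)] gD(4)
    by (auto simp: continuous_on_eq_continuous_at)
  from isCont_tendsto_compose[OF this l]
  have "((\<lambda>t. chart_inv c (?x t)) \<longlongrightarrow> chart_inv c l) (at_left b)" .
  moreover have "\<forall>\<^sub>F t in at_left b. chart_inv c (?x t) = \<gamma> t"
    using ev by eventually_elim (use mem chart_inv_left[OF gD(1)] in auto)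
  ultimately show ?thesis using that Lim_transform_eventually by blast
qed

text \<open>Slowness at the new end point concerns quotients based at \<open>\<gamma> b\<close>,
  about which the half-open interval says nothing directly. They are limits of the sharp estimates
  on \<open>{s..t}\<close> with the metric taken at the right end \<open>t\<close>, as
  \<open>t\<close> tends to \<open>b\<close>.\<close>

lemma slow_closure:
  assumes "slow {a..<b} \<gamma>" "a < b" "(\<gamma> \<longlongrightarrow> \<gamma> b) (at_left b)"
  shows "slow {a..b} \<gamma>"
proof -
  obtain c where c: "c \<in> A" "\<gamma> b \<in> fst c" by (rule chart_cover)
  obtain r K where gb: "good_ball c (snd c (\<gamma> b)) r K" using good_ball_exists[OF c(1) chart_mem[OF c]] .
  let ?x = "\<lambda>t. snd c (\<gamma> t)"
  note gD = good_ballD[OF gb]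
  have "\<gamma> b \<in> {p \<in> fst c. snd c p \<in> ball (?x b) r}" using c gD(2) by simp
  from topological_tendstoD[OF assms(3) chart_ball_open(1)[OF gD(1,4)] this]
  obtain a' where a': "a' < b" "\<And>t. a' < t \<Longrightarrow> t < b \<Longrightarrow> \<gamma> t \<in> fst c \<and> ?x t \<in> ball (?x b) r"
    unfolding eventually_at_left_field by auto
  define a1 where "a1 = (max a a' + b) / 2"
  have a1: "a < a1" "a' < a1" "a1 < b" using a'(1) assms(2) by (auto simp: a1_def)
  have mem: "\<gamma> t \<in> fst c \<and> ?x t \<in> cball (?x b) r" if "t \<in> {a1..b}" for t
    using a'(2)[of t] that a1 c gD(2) by (cases "t = b") auto
  have xl: "(?x \<longlongrightarrow> ?x b) (at_left b)"
    using continuous_on_chart[OF c(1)] open_chart[OF c(1)] c(2) assms(3)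
    by (auto simp: continuous_on_eq_continuous_at intro: isCont_tendsto_compose)
  have est: "G c (?x b) (?x s - ?x b) (?x s - ?x b) \<le> (1 + (K * lip r K) * (b - s)) * (b - s)\<^sup>2" if s: "s \<in> {a1..<b}" for s
  proof -
    have "((\<lambda>t. G c (?x t) (?x t - ?x s) (?x t - ?x s)) \<longlongrightarrow> G c (?x b) (?x b - ?x s) (?x b - ?x s)) (at_left b)"
    proof -
      have "isCont (\<lambda>z. G c z (z - ?x s) (z - ?x s)) (?x b)"
        using continuous_on_G[of c "chart_image c" "\<lambda>z. z" "\<lambda>z. z - ?x s" "\<lambda>z. z - ?x s"] c chart_mem[OF c] open_chart_image[OF c(1)]
        by (auto simp: continuous_on_eq_continuous_at intro!: continuous_intros)
      from isCont_tendsto_compose[OF this xl] show ?thesis .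
    qed
    moreover have "((\<lambda>t. (1 + K * (lip r K * (t - s))) * (t - s)\<^sup>2) \<longlongrightarrow> (1 + K * (lip r K * (b - s))) * (b - s)\<^sup>2) (at_left b)"
      by (intro tendsto_intros)
    moreover have "\<forall>\<^sub>F t in at_left b. t \<in> {s<..<b}" using s by (intro eventually_at_left_real) auto
    then have "\<forall>\<^sub>F t in at_left b. G c (?x t) (?x t - ?x s) (?x t - ?x s) \<le> (1 + K * (lip r K * (t - s))) * (t - s)\<^sup>2"
    proof eventually_elim
      case (elim t)
      then show ?case using s a1
        by (intro slow_sharp_estimate[OF gb slow_subset[OF assms(1)]] mem) auto
    qed
    ultimately have "G c (?x b) (?x b - ?x s) (?x b - ?x s) \<le> (1 + K * (lip r K * (b - s))) * (b - s)\<^sup>2"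
      by (intro tendsto_le[of "at_left b"]) auto
    moreover have "G c (?x b) (?x b - ?x s) (?x b - ?x s) = G c (?x b) (?x s - ?x b) (?x s - ?x b)"
      using chart_mem[OF c] by (simp add: G_linear[OF c(1)])
    ultimately show ?thesis by (simp add: mult.assoc)
  qed
  have "slow_at c {a..b} \<gamma> b"
  proof (rule slow_at_from_estimate[of "b - a1" "K * lip r K"])
    show "b - a1 > 0" "K * lip r K \<ge> 0" using a1 gD(3) lip_ge_1[OF gb] by auto
    fix s assume s: "s \<in> {a..b}" "\<bar>s - b\<bar> < b - a1"
    show "\<gamma> s \<in> fst c \<and> G c (?x b) (?x s - ?x b) (?x s - ?x b) \<le> (1 + K * lip r K * \<bar>s - b\<bar>) * (s - b)\<^sup>2"
    proof (cases "s = b")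
      case True then show ?thesis using c chart_mem[OF c] by (simp add: G_linear[OF c(1)])
    next
      case False
      then have "s \<in> {a1..<b}" using s by auto
      then show ?thesis using est[of s] mem[of s] by (simp add: power2_commute)
    qed
  qed
  moreover have "slow_at d {a..b} \<gamma> t" if "t \<in> {a..<b}" "d \<in> A" "\<gamma> t \<in> fst d" for t d
  proof -
    have "at t within {a..b} = at t within {a..<b}" using that by (intro at_within_nhd[of t "{..<b}"]) auto
    then show ?thesis using slowD[OF assms(1) that] by (simp add: slow_at_def)
  qed
  ultimately show ?thesis
  proof (intro slowI)
    fix t assume t: "t \<in> {a..b}"
    obtain d where d: "d \<in> A" "\<gamma> t \<in> fst d" by (rule chart_cover)
    show "\<exists>c\<in>A. \<gamma> t \<in> fst c \<and> slow_at c {a..b} \<gamma> t"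
    proof (cases "t = b")
      case True then show ?thesis using c \<open>slow_at c {a..b} \<gamma> b\<close> by blast
    next
      case False then show ?thesis
        using d t \<open>\<And>t d. t \<in> {a..<b} \<Longrightarrow> d \<in> A \<Longrightarrow> \<gamma> t \<in> fst d \<Longrightarrow> slow_at d {a..b} \<gamma> t\<close>[of t d] by auto
    qed
  qed
qed

end

context riemannian
begin

lemma tendsto_G:
  assumes "c \<in> A" "(x \<longlongrightarrow> x0) F" "(u \<longlongrightarrow> u0) F" "(w \<longlongrightarrow> w0) F" "x0 \<in> chart_image c"
  shows "((\<lambda>n. G c (x n) (u n) (w n)) \<longlongrightarrow> G c x0 u0 w0) F"
proof -
  let ?S = "chart_image c \<times> (UNIV :: ('e \<times> 'e) set)"
  have "continuous_on ?S (\<lambda>z. G c (fst z) (fst (snd z)) (snd (snd z)))"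
    by (intro continuous_on_G assms(1)) (auto intro!: continuous_intros)
  moreover have "open ?S" using open_chart_image[OF assms(1)] by (intro open_Times) auto
  ultimately have "isCont (\<lambda>z. G c (fst z) (fst (snd z)) (snd (snd z))) (x0, u0, w0)"
    using assms(5) by (simp add: continuous_on_eq_continuous_at)
  from isCont_tendsto_compose[OF this tendsto_Pair[OF assms(2) tendsto_Pair[OF assms(3,4)]]]
  show ?thesis by simp
qed

lemma slow_chart_curve:
  assumes "c \<in> A" "\<And>t. t \<in> S \<Longrightarrow> x t \<in> chart_image c"
    "\<And>t. t \<in> S \<Longrightarrow> (x has_vector_derivative v t) (at t within S)"
    "\<And>t. t \<in> S \<Longrightarrow> G c (x t) (v t) (v t) \<le> 1"
  shows "slow S (\<lambda>t. chart_inv c (x t))"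
proof (rule slowI)
  fix t assume t: "t \<in> S"
  have "slow_at c S (\<lambda>t. chart_inv c (x t)) t"
  proof (rule slow_at_derivative[OF assms(1)])
    show "chart_inv c (x t) \<in> fst c" using chart_inv_mem[OF assms(1,2)] t by simp
    show "\<forall>\<^sub>F s in at t within S. chart_inv c (x s) \<in> fst c"
      using chart_inv_mem[OF assms(1,2)] by (auto simp: eventually_at intro: exI[of _ 1])
    show "((\<lambda>s. snd c (chart_inv c (x s))) has_vector_derivative v t) (at t within S)"
      by (rule has_vector_derivative_transform[OF t _ assms(3)[OF t]]) (simp add: chart_inv_right assms(1,2))
    show "G c (snd c (chart_inv c (x t))) (v t) (v t) \<le> 1"
      using assms(4)[OF t] by (simp add: chart_inv_right assms(1) assms(2)[OF t])
  qed
  then show "\<exists>c'\<in>A. chart_inv c (x t) \<in> fst c' \<and> slow_at c' S (\<lambda>t. chart_inv c (x t)) t"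
    using assms(1) chart_inv_mem[OF assms(1) assms(2)[OF t]] by blast
qed

section \<open>The time needed to leave the manifold\<close>

text \<open>Leaving the manifold is encoded as having no limit at the finite time \<open>b\<close>.
  In the metric completion such a curve ends at an added point, so the infimum of these times is the
  distance from \<open>p\<close> to the added points.\<close>

definition exits :: "'a \<Rightarrow> real set" where
  "exits p = {b. 0 < b \<and> (\<exists>\<gamma>. slow {0..<b} \<gamma> \<and> \<gamma> 0 = p \<and> \<not> (\<exists>q. (\<gamma> \<longlongrightarrow> q) (at_left b)))}"

text \<open>The cut-off \<^term>\<open>B\<close> only serves to make the infimum meaningful where no curve leaves the manifold.\<close>

definition exit_time :: "real \<Rightarrow> 'a \<Rightarrow> real" where
  "exit_time B p = Inf (insert B (exits p))"

lemma exits_bdd_below: "bdd_below (insert B (exits p))"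
  by (rule bdd_belowI[of _ "min B 0"]) (auto simp: exits_def)

lemma exit_time_le: "b \<in> insert B (exits p) \<Longrightarrow> exit_time B p \<le> b"
  unfolding exit_time_def by (rule cInf_lower[OF _ exits_bdd_below])

lemma exit_time_greatest: "(\<And>b. b \<in> insert B (exits p) \<Longrightarrow> m \<le> b) \<Longrightarrow> m \<le> exit_time B p"
  unfolding exit_time_def by (rule cInf_greatest) auto

lemma tendsto_at_left_shift:
  fixes f :: "real \<Rightarrow> 'x::topological_space"
  assumes "(f \<longlongrightarrow> q) (at_left (b + s))"
  shows "((\<lambda>t. f (t + s)) \<longlongrightarrow> q) (at_left b)"
proof -
  have "filterlim (\<lambda>t. t + s) (at_left (b + s)) (at_left b)"
    unfolding filterlim_at by (auto simp: eventually_at_filter intro!: tendsto_intros)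
  from filterlim_compose[OF assms this] show ?thesis .
qed

lemma exits_tail:
  assumes "slow {0..<b} \<gamma>" "\<not> (\<exists>q. (\<gamma> \<longlongrightarrow> q) (at_left b))" "0 \<le> s" "s < b"
  shows "b - s \<in> exits (\<gamma> s)"
proof -
  have "slow {0..<b - s} (\<lambda>t. \<gamma> (t + s))" by (rule slow_shift[OF assms(1)]) (use assms(3) in auto)
  moreover have "\<not> ((\<lambda>t. \<gamma> (t + s)) \<longlongrightarrow> q) (at_left (b - s))" for q
    using tendsto_at_left_shift[of "\<lambda>t. \<gamma> (t + s)" q b "- s"] assms(2) by auto
  ultimately show ?thesis using assms(4) unfolding exits_def by (auto intro!: exI[of _ "\<lambda>t. \<gamma> (t + s)"])
qed

lemma slow_append:
  assumes "slow (S \<inter> {..s}) \<gamma>" "slow ((\<lambda>t. t - s) ` (S \<inter> {s..})) \<delta>" "\<delta> 0 = \<gamma> s"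
  shows "slow S (\<lambda>t. if t < s then \<gamma> t else \<delta> (t - s))"
proof (rule slow_glue[of _ s])
  show "slow (S \<inter> {..s}) (\<lambda>t. if t < s then \<gamma> t else \<delta> (t - s))"
    using assms(3) by (subst slow_cong[of _ _ \<gamma>]) (auto intro: assms(1))
  have "slow (S \<inter> {s..}) (\<lambda>t. \<delta> (t + (- s)))" by (rule slow_shift[OF assms(2)]) auto
  then show "slow (S \<inter> {s..}) (\<lambda>t. if t < s then \<gamma> t else \<delta> (t - s))"
    by (subst slow_cong[of _ _ "\<lambda>t. \<delta> (t + (- s))"]) auto
qed

lemma exits_append:
  assumes "slow {0..s} \<gamma>" "0 \<le> s" "b \<in> exits (\<gamma> s)"
  shows "s + b \<in> exits (\<gamma> 0)"
proof -
  obtain \<delta> where \<delta>: "0 < b" "slow {0..<b} \<delta>" "\<delta> 0 = \<gamma> s" "\<And>q. \<not> (\<delta> \<longlongrightarrow> q) (at_left b)"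
    using assms(3) by (auto simp: exits_def)
  let ?\<eta> = "\<lambda>t. if t < s then \<gamma> t else \<delta> (t - s)"
  have "slow {0..<s + b} ?\<eta>"
  proof (rule slow_append)
    show "slow ({0..<s + b} \<inter> {..s}) \<gamma>" by (rule slow_subset[OF assms(1)]) auto
    show "slow ((\<lambda>t. t - s) ` ({0..<s + b} \<inter> {s..})) \<delta>" by (rule slow_subset[OF \<delta>(2)]) auto
  qed (rule \<delta>)
  moreover have "?\<eta> 0 = \<gamma> 0" using \<delta>(3) assms(2) by auto
  moreover have "\<not> (?\<eta> \<longlongrightarrow> q) (at_left (s + b))" for q
  proof
    assume "(?\<eta> \<longlongrightarrow> q) (at_left (s + b))"
    then have "((\<lambda>t. ?\<eta> (t + s)) \<longlongrightarrow> q) (at_left b)"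
      by (intro tendsto_at_left_shift) (simp add: add.commute)
    moreover have "\<forall>\<^sub>F t in at_left b. ?\<eta> (t + s) = \<delta> t"
      using eventually_at_left_real[OF \<delta>(1)] by eventually_elim auto
    ultimately have "(\<delta> \<longlongrightarrow> q) (at_left b)" using Lim_transform_eventually by blast
    then show False using \<delta>(4) by blast
  qed
  ultimately show ?thesis using \<delta>(1) assms(2) unfolding exits_def by (auto intro!: exI[of _ ?\<eta>])
qed

text \<open>Any curve leaving from \<open>\<gamma> t\<close> may be preceded by the given piece of
  \<open>\<gamma>\<close>, which delays the exit by \<open>t - s\<close>. The cut-off
  \<open>B\<close> does no harm because \<open>t - s\<close> is nonnegative.\<close>

lemma exit_time_slow:
  assumes "B > 0" "slow {s..t} \<gamma>" "s \<le> t"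
  shows "exit_time B (\<gamma> s) \<le> (t - s) + exit_time B (\<gamma> t)"
proof -
  have sl: "slow {0..t - s} (\<lambda>u. \<gamma> (u + s))" by (rule slow_shift[OF assms(2)]) auto
  have "exit_time B (\<gamma> s) - (t - s) \<le> exit_time B (\<gamma> t)"
  proof (rule exit_time_greatest)
    fix b assume "b \<in> insert B (exits (\<gamma> t))"
    then consider "b = B" | "b \<in> exits (\<gamma> t)" by blast
    then show "exit_time B (\<gamma> s) - (t - s) \<le> b"
    proof cases
      case 1 then show ?thesis using exit_time_le[of B B "\<gamma> s"] assms(3) by simp
    next
      case 2
      then have "(t - s) + b \<in> exits (\<gamma> s)" using exits_append[OF sl] assms(3) by simp
      then show ?thesis using exit_time_le[of "(t - s) + b" B "\<gamma> s"] by simp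
    qed
  qed
  then show ?thesis by simp
qed

text \<open>Before that time a slow curve is confined to the good ball, where it would
  converge.\<close>

lemma exits_ge:
  assumes "p \<in> fst c" "good_ball c (snd c p) r K" "b \<in> exits p"
  shows "r / lip r K \<le> b"
proof (rule ccontr)
  assume "\<not> ?thesis"
  then have small: "lip r K * b < r" using lip_ge_1[OF assms(2)] by (simp add: field_simps)
  obtain \<gamma> where \<gamma>: "0 < b" "slow {0..<b} \<gamma>" "\<gamma> 0 = p" "\<not> (\<exists>q. (\<gamma> \<longlongrightarrow> q) (at_left b))"
    using assms(3) by (auto simp: exits_def)
  have "\<gamma> t \<in> fst c \<and> snd c (\<gamma> t) \<in> cball (snd c p) r" if t: "t \<in> {0..<b}" for t
  proof -
    have le: "lip r K * t \<le> lip r K * b" using t lip_ge_1[OF assms(2)] by (intro mult_left_mono) auto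
    have "\<gamma> t \<in> fst c \<and> norm (snd c (\<gamma> t) - snd c p) \<le> lip r K * (t - 0)"
      using t \<gamma> assms(1) le small
      by (intro slow_stays[OF assms(2) slow_subset[OF \<gamma>(2)], of 0 t]) auto
    then show ?thesis using le small by (auto simp: dist_norm norm_minus_commute)
  qed
  from slow_has_limit[OF assms(2) \<gamma>(2,1) this] show False using \<gamma>(4) by blast
qed

lemma exit_time_pos:
  assumes "B > 0" shows "exit_time B p > 0"
proof -
  obtain c where c: "c \<in> A" "p \<in> fst c" by (rule chart_cover)
  obtain r K where gb: "good_ball c (snd c p) r K" using good_ball_exists[OF c(1) chart_mem[OF c]] .
  have "r / lip r K > 0" using good_ballD(2)[OF gb] lip_ge_1[OF gb] by simp
  moreover have "min B (r / lip r K) \<le> exit_time B p"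
    by (rule exit_time_greatest) (use exits_ge[OF c(2) gb] in \<open>auto intro: min.coboundedI2\<close>)
  ultimately show ?thesis using assms by linarith
qed

text \<open>The coordinate segment from \<open>y\<close> to \<open>z\<close> is traversed in time
  \<open>K * norm (z - y)\<close>. Its squared speed is then at most \<open>1 / K\<close>, and
  \<open>K\<close> is at least 1.\<close>

lemma exit_time_lipschitz:
  assumes "B > 0" "good_ball c x0 r K" "y \<in> cball x0 r" "z \<in> cball x0 r"
  shows "exit_time B (chart_inv c y) \<le> exit_time B (chart_inv c z) + K * norm (z - y)"
proof (cases "y = z")
  case False
  note gD = good_ballD[OF assms(2)]
  define T where "T = K * norm (z - y)"
  have T: "T > 0" using False gD(3) by (simp add: T_def)
  let ?x = "\<lambda>t. y + (t / T) *\<^sub>R (z - y)"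
  have xm: "?x t \<in> cball x0 r" if "t \<in> {0..T}" for t
  proof -
    have "?x t = (1 - t / T) *\<^sub>R y + (t / T) *\<^sub>R z" by (simp add: algebra_simps)
    then show ?thesis using convexD[OF convex_cball assms(3,4), of "1 - t / T" "t / T"] that T by auto
  qed
  have "slow {0..T} (\<lambda>t. chart_inv c (?x t))"
  proof (rule slow_chart_curve[OF gD(1)])
    fix t assume t: "t \<in> {0..T}"
    show mem: "?x t \<in> chart_image c" using xm[OF t] gD(4) by auto
    show "(?x has_vector_derivative (1 / T) *\<^sub>R (z - y)) (at t within {0..T})"
      using T by (auto intro!: derivative_eq_intros)
    have "G c (?x t) ((1 / T) *\<^sub>R (z - y)) ((1 / T) *\<^sub>R (z - y)) = G c (?x t) (z - y) (z - y) / T\<^sup>2"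
      by (simp add: posdef_linear(5,6)[OF posdef_G[OF gD(1) mem]] power2_eq_square)
    also have "\<dots> \<le> (K * (norm (z - y))\<^sup>2) / T\<^sup>2" by (intro divide_right_mono gD(6) xm t) auto
    also have "\<dots> = 1 / K" using T False gD(3) by (simp add: T_def power2_eq_square)
    also have "\<dots> \<le> 1" using gD(3) by simp
    finally show "G c (?x t) ((1 / T) *\<^sub>R (z - y)) ((1 / T) *\<^sub>R (z - y)) \<le> 1" .
  qed
  from exit_time_slow[OF assms(1) this] T gD(3) False show ?thesis by (simp add: T_def)
qed simp

text \<open>Since \<^term>\<open>2 * \<sigma> \<le> 1 + \<sigma>\<^sup>2\<close>, half of one plus the energy bounds the length; this avoids
  square roots in the first variation.\<close>

lemma exit_time_energy:
  assumes "B > 0" "c \<in> A" "a \<le> b" "\<And>t. t \<in> {a..b} \<Longrightarrow> y t \<in> chart_image c"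
    "\<And>t. t \<in> {a..b} \<Longrightarrow> (y has_vector_derivative y' t) (at t within {a..b})" "continuous_on {a..b} y'"
  shows "exit_time B (chart_inv c (y a)) - exit_time B (chart_inv c (y b)) \<le>
    integral {a..b} (\<lambda>t. (1 + G c (y t) (y' t) (y' t)) / 2)"
proof -
  define f where "f t = G c (y t) (y' t) (y' t)" for t
  define R where "R t = exit_time B (chart_inv c (y t))" for t
  let ?h = "\<lambda>t. (1 + f t) / 2"
  have yc: "continuous_on {a..b} y"
    by (rule continuous_on_vector_derivative[OF assms(5)])
  have fc: "continuous_on {a..b} f" unfolding f_def using assms yc by (intro continuous_on_G) auto
  have f0: "f t \<ge> 0" if "t \<in> {a..b}" for t unfolding f_def using posdefD(4)[OF posdef_G[OF assms(2,4)]] that by simp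
  have hint: "?h integrable_on {s..t}" if "a \<le> s" "t \<le> b" for s t
    using that by (intro integrable_continuous_real continuous_intros continuous_on_subset[OF fc]) auto
  have eps: "R a - R b \<le> integral {a..b} ?h + \<epsilon> * (b - a)" if "\<epsilon> > 0" for \<epsilon>
  proof -
    \<comment> \<open>Both sides are additive over adjacent intervals, so bisection leaves only
      short intervals, on which the speed is almost constant.\<close>
    define P where "P s t \<longleftrightarrow> (a \<le> s \<and> t \<le> b \<longrightarrow> R s - R t \<le> integral {s..t} ?h + \<epsilon> * (t - s))" for s t
    have "P a b" using assms(3)
    proof (induction rule: Bolzano)
      case (trans s t u)
      show ?case unfolding P_def
      proof
        assume g: "a \<le> s \<and> u \<le> b"
        have "integral {s..t} ?h + integral {t..u} ?h = integral {s..u} ?h"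
          by (rule Henstock_Kurzweil_Integration.integral_combine[OF trans(3,4)]) (use g hint in blast)
        then show "R s - R u \<le> integral {s..u} ?h + \<epsilon> * (u - s)"
          using trans g by (simp add: P_def algebra_simps)
      qed
    next
      case (local \<tau>)
      have \<tau>: "\<tau> \<in> {a..b}" using local by simp
      then obtain d where d: "d > 0" "\<And>s. s \<in> {a..b} \<Longrightarrow> dist s \<tau> < d \<Longrightarrow> dist (f s) (f \<tau>) < \<epsilon>"
        using fc \<open>\<epsilon> > 0\<close> unfolding continuous_on_iff by meson
      have "P s t" if st: "s \<le> \<tau> \<and> \<tau> \<le> t \<and> t - s < d" for s t
        unfolding P_def
      proof
        assume g: "a \<le> s \<and> t \<le> b"
        have near: "f u \<le> f \<tau> + \<epsilon>" "f u \<ge> f \<tau> - \<epsilon>" if "u \<in> {s..t}" for u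
        proof -
          have "u \<in> {a..b}" "dist u \<tau> < d" using that st g by (auto simp: dist_real_def)
          then have "\<bar>f u - f \<tau>\<bar> < \<epsilon>" using d(2) by (simp add: dist_real_def)
          then show "f u \<le> f \<tau> + \<epsilon>" "f u \<ge> f \<tau> - \<epsilon>" by linarith+
        qed
        \<comment> \<open>Bound for the speed on the whole short interval, used to rescale time;
          adding \<open>\<epsilon>\<close> keeps it positive even where the curve stands
          still.\<close>
        define \<sigma> where "\<sigma> = sqrt (f \<tau> + \<epsilon>)"
        have \<sigma>: "\<sigma> > 0" "\<sigma>\<^sup>2 = f \<tau> + \<epsilon>" using f0[OF \<tau>] \<open>\<epsilon> > 0\<close> by (simp_all add: \<sigma>_def)
        let ?T = "\<sigma> * (t - s)"
        have T0: "?T \<ge> 0" using \<sigma> st by simp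
        have m: "s + u / \<sigma> \<in> {s..t}" if "u \<in> {0..?T}" for u using that \<sigma> by (auto simp: field_simps)
        then have mab: "s + u / \<sigma> \<in> {a..b}" if "u \<in> {0..?T}" for u using that g by force
        have "slow {0..?T} (\<lambda>u. chart_inv c (y (s + u / \<sigma>)))"
        proof (rule slow_chart_curve[OF assms(2)])
          fix u assume u: "u \<in> {0..?T}"
          show mem: "y (s + u / \<sigma>) \<in> chart_image c" using assms(4) mab[OF u] by blast
          have "((\<lambda>u. s + u / \<sigma>) has_vector_derivative 1 / \<sigma>) (at u within {0..?T})"
            by (auto intro!: derivative_eq_intros)
          moreover have "(y has_vector_derivative y' (s + u / \<sigma>)) (at (s + u / \<sigma>) within (\<lambda>u. s + u / \<sigma>) ` {0..?T})"
            by (rule has_vector_derivative_within_subset[OF assms(5)[OF mab[OF u]]]) (use mab in auto)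
          ultimately show "((\<lambda>u. y (s + u / \<sigma>)) has_vector_derivative (1 / \<sigma>) *\<^sub>R y' (s + u / \<sigma>)) (at u within {0..?T})"
            using vector_diff_chain_within[of "\<lambda>u. s + u / \<sigma>"] by (simp add: o_def)
          have "G c (y (s + u / \<sigma>)) ((1 / \<sigma>) *\<^sub>R y' (s + u / \<sigma>)) ((1 / \<sigma>) *\<^sub>R y' (s + u / \<sigma>)) = f (s + u / \<sigma>) / \<sigma>\<^sup>2"
            by (simp add: f_def posdef_linear(5,6)[OF posdef_G[OF assms(2) mem]] power2_eq_square)
          also have "\<dots> \<le> 1"
            by (rule divide_le_eq_1_pos[THEN iffD2, OF zero_less_power[OF \<sigma>(1)]])
              (use near(1)[OF m[OF u]] \<sigma>(2) in simp)
          finally show "G c (y (s + u / \<sigma>)) ((1 / \<sigma>) *\<^sub>R y' (s + u / \<sigma>)) ((1 / \<sigma>) *\<^sub>R y' (s + u / \<sigma>)) \<le> 1" .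
        qed
        from exit_time_slow[OF assms(1) this T0] have "R s - R t \<le> \<sigma> * (t - s)" using \<sigma>(1) by (simp add: R_def)
        moreover have "\<sigma> \<le> (1 + \<sigma>\<^sup>2) / 2" using sum_squares_bound[of \<sigma> 1] by simp
        then have "\<sigma> * (t - s) \<le> ((1 + f \<tau> + \<epsilon>) / 2) * (t - s)" using st \<sigma>(2) by (intro mult_right_mono) auto
        moreover have "((1 + f \<tau> - \<epsilon>) / 2) * (t - s) \<le> integral {s..t} ?h"
        proof -
          have "integral {s..t} (\<lambda>_. (1 + f \<tau> - \<epsilon>) / 2) \<le> integral {s..t} ?h"
          proof (rule integral_le)
            show "(\<lambda>_. (1 + f \<tau> - \<epsilon>) / 2) integrable_on {s..t}" by (rule integrable_const_ivl)
            show "?h integrable_on {s..t}" using hint g by blast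
            show "(1 + f \<tau> - \<epsilon>) / 2 \<le> ?h u" if "u \<in> {s..t}" for u
              by (rule divide_right_mono) (use near(2)[OF that] in auto)
          qed
          then show ?thesis using st by (simp add: mult.commute)
        qed
        ultimately show "R s - R t \<le> integral {s..t} ?h + \<epsilon> * (t - s)" by (simp add: algebra_simps add_divide_distrib diff_divide_distrib)
      qed
      then show ?case using d(1) by blast
    qed
    then show ?thesis by (simp add: P_def)
  qed
  have "R a - R b \<le> integral {a..b} ?h"
  proof (rule field_le_epsilon)
    fix e :: real assume "e > 0"
    have "e / (b - a + 1) > 0" using \<open>e > 0\<close> assms(3) by simp
    moreover have "e / (b - a + 1) * (b - a) \<le> e" using \<open>e > 0\<close> assms(3) by (simp add: field_simps)
    ultimately show "R a - R b \<le> integral {a..b} ?h + e" using eps[of "e / (b - a + 1)"] by linarith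
  qed
  then show ?thesis by (simp add: R_def f_def)
qed

text \<open>Curves whose exit times approach the infimum stay for a common time in one good ball
  with a common Lipschitz constant, so a subsequence converges uniformly. As the infimum is below
  the cut-off, it is approached by genuine exit times.\<close>

lemma optimal_curve_exists:
  assumes "B > 0" "exit_time B p < B"
  obtains \<tau> \<gamma> where "\<tau> > 0" "slow {0..\<tau>} \<gamma>" "\<gamma> 0 = p" "\<And>t. t \<in> {0..\<tau>} \<Longrightarrow> exit_time B (\<gamma> t) = exit_time B p - t"
proof -
  obtain c where c: "c \<in> A" "p \<in> fst c" by (rule chart_cover)
  define x0 where "x0 = snd c p"
  obtain r K where gb: "good_ball c x0 r K" using good_ball_exists[OF c(1) chart_mem[OF c]] unfolding x0_def .
  note gD = good_ballD[OF gb]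
  define L where "L = lip r K"
  have L: "L \<ge> 1" using lip_ge_1[OF gb] by (simp add: L_def)
  \<comment> \<open>Short enough for all curves to stay in the ball and, by the lower bound on exit
    times, for all of them to be defined on \<open>{0..\<tau>}\<close>.\<close>
  define \<tau> where "\<tau> = r / (2 * L)"
  have \<tau>: "\<tau> > 0" "L * \<tau> < r" "\<tau> < r / L" using L gD(2) by (simp_all add: \<tau>_def field_simps)
  have "\<exists>b \<gamma>. slow {0..<b} \<gamma> \<and> \<gamma> 0 = p \<and> \<not> (\<exists>q. (\<gamma> \<longlongrightarrow> q) (at_left b)) \<and> b < exit_time B p + inverse (real (Suc n)) \<and> b > \<tau>" for n
  proof -
    have "Inf (insert B (exits p)) < min B (exit_time B p + inverse (real (Suc n)))"
      using assms(2) by (simp add: exit_time_def)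
    then obtain b where b: "b \<in> insert B (exits p)" "b < min B (exit_time B p + inverse (real (Suc n)))"
      using cInf_lessD[of "insert B (exits p)"] by blast
    then have be: "b \<in> exits p" by auto
    then have "b > \<tau>" using exits_ge[OF c(2) gb[unfolded x0_def] be] \<tau>(3) by (simp add: L_def)
    then show ?thesis using be b(2) by (auto simp: exits_def)
  qed
  then obtain b \<gamma>n where bn: "\<And>n. slow {0..<b n} (\<gamma>n n)" "\<And>n. \<gamma>n n 0 = p"
    "\<And>n. \<not> (\<exists>q. (\<gamma>n n \<longlongrightarrow> q) (at_left (b n)))" "\<And>n. b n < exit_time B p + inverse (real (Suc n))" "\<And>n. b n > \<tau>"
    by metis
  define x where "x n t = snd c (\<gamma>n n t)" for n t
  have sl: "slow {0..\<tau>} (\<gamma>n n)" for n by (rule slow_subset[OF bn(1)[of n]]) (use bn(5)[of n] in auto)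
  have st: "\<gamma>n n t \<in> fst c \<and> norm (x n t - x0) \<le> L * t" if "t \<in> {0..\<tau>}" for n t
    unfolding x_def using slow_stays[OF gb sl[of n] _ _ _ _ that] \<tau> bn(2) c(2) by (simp add: x0_def L_def)
  have mem: "\<gamma>n n t \<in> fst c \<and> snd c (\<gamma>n n t) \<in> cball x0 r" if t: "t \<in> {0..\<tau>}" for n t
  proof -
    have "L * t \<le> L * \<tau>" using t L by (intro mult_left_mono) auto
    then show ?thesis using st[OF t, of n] \<tau>(2) by (simp add: x_def dist_norm norm_minus_commute)
  qed
  have lipx: "norm (x n s - x n t) \<le> L * \<bar>s - t\<bar>" if "s \<in> {0..\<tau>}" "t \<in> {0..\<tau>}" for n s t
  proof -
    have *: "norm (x n v - x n u) \<le> L * (v - u)" if "u \<in> {0..\<tau>}" "v \<in> {0..\<tau>}" "u \<le> v" for u v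
      unfolding x_def L_def using that by (intro slow_lipschitz[OF gb slow_subset[OF sl]] mem) auto
    show ?thesis using *[of s t] *[of t s] that by (cases "s \<le> t") (auto simp: norm_minus_commute)
  qed
  obtain X k where X: "continuous_on {0..\<tau>} X" "strict_mono (k :: nat \<Rightarrow> nat)"
    "\<And>e. 0 < e \<Longrightarrow> \<exists>N. \<forall>n t. n \<ge> N \<and> t \<in> {0..\<tau>} \<longrightarrow> norm (x (k n) t - X t) < e"
  proof (rule Arzela_Ascoli[of "{0..\<tau>}" x "norm x0 + r"])
    show "norm (x n t) \<le> norm x0 + r" if t: "t \<in> {0..\<tau>}" for n t
    proof -
      have "norm (x n t - x0) \<le> r" using mem[OF t, of n] by (simp add: x_def dist_norm norm_minus_commute)
      then show ?thesis using norm_triangle_sub[of "x n t" x0] by linarith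
    qed
    show "\<exists>d>0. \<forall>n t. t \<in> {0..\<tau>} \<and> norm (s - t) < d \<longrightarrow> norm (x n s - x n t) < e"
      if s: "s \<in> {0..\<tau>}" "0 < e" for s e
    proof (intro exI[of _ "e / L"] conjI allI impI)
      show "e / L > 0" using s L by simp
      fix n t assume t: "t \<in> {0..\<tau>} \<and> norm (s - t) < e / L"
      then have "norm (x n s - x n t) \<le> L * \<bar>s - t\<bar>" using lipx s by blast
      also have "\<dots> < e" using t L by (simp add: field_simps)
      finally show "norm (x n s - x n t) < e" .
    qed
  qed auto
  have lim: "(\<lambda>n. x (k n) t) \<longlonglongrightarrow> X t" if "t \<in> {0..\<tau>}" for t
  proof (rule LIMSEQ_I)
    fix e :: real assume "0 < e"
    then show "\<exists>N. \<forall>n\<ge>N. norm (x (k n) t - X t) < e" using X(3)[of e] that by blast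
  qed
  have Xm: "X t \<in> cball x0 r" if "t \<in> {0..\<tau>}" for t
    by (rule closed_sequentially[OF closed_cball _ lim[OF that]]) (use mem[OF that] in \<open>simp add: x_def\<close>)
  have XU: "X t \<in> chart_image c" if "t \<in> {0..\<tau>}" for t using Xm[OF that] gD(4) by auto
  have "x n 0 = x0" for n by (simp add: x_def bn(2) x0_def)
  then have X0: "X 0 = x0" using lim[of 0] \<tau>(1) by (simp add: LIMSEQ_const_iff)
  define \<gamma> where "\<gamma> t = chart_inv c (X t)" for t
  have g0: "\<gamma> 0 = p" using X0 chart_inv_left[OF c] by (simp add: \<gamma>_def x0_def)
  \<comment> \<open>The neighbourhoods in the definition of slowness may shrink along the sequence;
    the sharp estimate is a closed condition with constants independent of the curve, and it
    survives the limit.\<close>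
  have est: "G c (X v) (X t - X s) (X t - X s) \<le> (1 + K * (L * (t - s))) * (t - s)\<^sup>2"
    if "s \<in> {0..\<tau>}" "t \<in> {0..\<tau>}" "s \<le> t" "v \<in> {s..t}" for s t v
  proof (rule LIMSEQ_le_const2)
    have v: "v \<in> {0..\<tau>}" using that by auto
    show "(\<lambda>n. G c (x (k n) v) (x (k n) t - x (k n) s) (x (k n) t - x (k n) s)) \<longlonglongrightarrow> G c (X v) (X t - X s) (X t - X s)"
      using that by (intro tendsto_G c tendsto_diff lim XU v)
    show "\<exists>N. \<forall>n\<ge>N. G c (x (k n) v) (x (k n) t - x (k n) s) (x (k n) t - x (k n) s) \<le> (1 + K * (L * (t - s))) * (t - s)\<^sup>2"
      unfolding x_def L_def using that
      by (intro exI allI impI slow_sharp_estimate[OF gb slow_subset[OF sl]] mem) auto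
  qed
  have slow: "slow {0..\<tau>} \<gamma>"
  proof (rule slowI)
    fix t assume t: "t \<in> {0..\<tau>}"
    have sg: "snd c (\<gamma> s) = X s" "\<gamma> s \<in> fst c" if "s \<in> {0..\<tau>}" for s
      using chart_inv_right[OF c(1) XU[OF that]] chart_inv_mem[OF c(1) XU[OF that]] by (simp_all add: \<gamma>_def)
    have "slow_at c {0..\<tau>} \<gamma> t"
    proof (rule slow_at_from_estimate[of 1 "K * L"])
      show "0 \<le> K * L" using gD(3) L by simp
      fix s assume s: "s \<in> {0..\<tau>}"
      have "G c (X t) (X s - X t) (X s - X t) \<le> (1 + K * L * \<bar>s - t\<bar>) * (s - t)\<^sup>2"
      proof (cases "t \<le> s")
        case True then show ?thesis using est[OF t s, of t] by (simp add: mult.assoc)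
      next
        case False
        have "G c (X t) (X s - X t) (X s - X t) = G c (X t) (X t - X s) (X t - X s)"
          by (simp add: G_linear[OF c(1) XU[OF t]])
        then show ?thesis using est[OF s t, of t] False by (simp add: mult.assoc power2_commute)
      qed
      then show "\<gamma> s \<in> fst c \<and> G c (snd c (\<gamma> t)) (snd c (\<gamma> s) - snd c (\<gamma> t)) (snd c (\<gamma> s) - snd c (\<gamma> t))
          \<le> (1 + K * L * \<bar>s - t\<bar>) * (s - t)\<^sup>2"
        using sg s t by simp
    qed simp
    then show "\<exists>c\<in>A. \<gamma> t \<in> fst c \<and> slow_at c {0..\<tau>} \<gamma> t" using c sg t by blast
  qed
  have \<tau>m: "\<tau> \<in> {0..\<tau>}" using \<tau> by simp
  \<comment> \<open>At time \<open>\<tau>\<close> the approximating curves have used up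
    \<open>\<tau>\<close> of an almost minimal exit time. Together with the bound on the rate of
    decrease this forces equality at every intermediate time.\<close>
  have end_le: "exit_time B (\<gamma> \<tau>) \<le> exit_time B p - \<tau>"
  proof (rule LIMSEQ_le_const)
    show "(\<lambda>n. (exit_time B p + inverse (real (Suc (k n))) - \<tau>) + K * norm (x (k n) \<tau> - X \<tau>)) \<longlonglongrightarrow> exit_time B p - \<tau>"
    proof -
      have "(\<lambda>n. inverse (real (Suc (k n)))) \<longlonglongrightarrow> 0"
        using LIMSEQ_subseq_LIMSEQ[OF LIMSEQ_inverse_real_of_nat X(2)] by (simp add: o_def)
      moreover have "(\<lambda>n. norm (x (k n) \<tau> - X \<tau>)) \<longlonglongrightarrow> 0"
        using lim[OF \<tau>m] by (simp add: tendsto_norm_zero_iff LIM_zero_iff)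
      ultimately have "(\<lambda>n. (exit_time B p + inverse (real (Suc (k n))) - \<tau>) + K * norm (x (k n) \<tau> - X \<tau>)) \<longlonglongrightarrow> (exit_time B p + 0 - \<tau>) + K * 0"
        by (intro tendsto_intros)
      then show ?thesis by simp
    qed
    have "exit_time B (\<gamma> \<tau>) \<le> (exit_time B p + inverse (real (Suc (k n))) - \<tau>) + K * norm (x (k n) \<tau> - X \<tau>)" for n
    proof -
      have "exit_time B (\<gamma> \<tau>) \<le> exit_time B (chart_inv c (x (k n) \<tau>)) + K * norm (x (k n) \<tau> - X \<tau>)"
        unfolding \<gamma>_def using mem[OF \<tau>m] by (intro exit_time_lipschitz[OF assms(1) gb] Xm \<tau>m) (simp add: x_def)
      also have "chart_inv c (x (k n) \<tau>) = \<gamma>n (k n) \<tau>" using mem[OF \<tau>m] chart_inv_left[OF c(1)] by (simp add: x_def)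
      also have "exit_time B (\<gamma>n (k n) \<tau>) \<le> b (k n) - \<tau>"
        using exits_tail[OF bn(1,3) _ bn(5)] \<tau>(1) by (intro exit_time_le) auto
      finally show ?thesis using bn(4)[of "k n"] by linarith
    qed
    then show "\<exists>N. \<forall>n\<ge>N. exit_time B (\<gamma> \<tau>) \<le> (exit_time B p + inverse (real (Suc (k n))) - \<tau>) + K * norm (x (k n) \<tau> - X \<tau>)" by blast
  qed
  have "exit_time B (\<gamma> t) = exit_time B p - t" if t: "t \<in> {0..\<tau>}" for t
  proof -
    have "exit_time B (\<gamma> 0) \<le> (t - 0) + exit_time B (\<gamma> t)" by (rule exit_time_slow[OF assms(1) slow_subset[OF slow]]) (use t in auto)
    moreover have "exit_time B (\<gamma> t) \<le> (\<tau> - t) + exit_time B (\<gamma> \<tau>)" by (rule exit_time_slow[OF assms(1) slow_subset[OF slow]]) (use t in auto)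
    ultimately show ?thesis using end_le g0 by simp
  qed
  then show ?thesis using that[OF \<tau>(1) slow g0] by blast
qed

end

section \<open>Regularity of optimal curves\<close>

text \<open>Halving the step changes the slope of the chord from \<open>t\<close> by at most
  \<open>sqrt (M * h)\<close>. These bounds form a geometric series with ratio
  \<open>1 / sqrt 2\<close>, so the slopes converge as the step shrinks, with a rate.\<close>

lemma chord_slopes_converge:
  fixes x :: "real \<Rightarrow> 'e::euclidean_space"
  assumes M: "M \<ge> 0" and "t < hi"
    and chord: "\<And>r s u. t \<le> r \<Longrightarrow> r < s \<Longrightarrow> s < u \<Longrightarrow> u \<le> hi \<Longrightarrow>
      (s - r) * (u - s) * (norm ((x s - x r) /\<^sub>R (s - r) - (x u - x s) /\<^sub>R (u - s)))\<^sup>2 \<le> M * (u - r) ^ 3"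
  obtains v where "\<And>h. 0 < h \<Longrightarrow> t + h \<le> hi \<Longrightarrow> norm ((x (t + h) - x t) /\<^sub>R h - v) \<le> 4 * sqrt (M * h)"
proof -
  define D where "D h = (x (t + h) - x t) /\<^sub>R h" for h
  have half: "norm (D h - D h') \<le> sqrt (M * h)" if h: "0 < h" "t + h \<le> hi" "h / 2 \<le> h'" "h' \<le> h" for h h'
  proof (cases "h' = h")
    case True then show ?thesis using M h by simp
  next
    case False
    define k where "k = h - h'"
    have k: "k > 0" "k \<le> h'" "h' > 0" "h' + k = h" using h False by (auto simp: k_def)
    define w where "w = (x (t + h) - x (t + h')) /\<^sub>R k"
    have c: "h' * k * (norm (D h' - w))\<^sup>2 \<le> M * h ^ 3"
      using chord[of t "t + h'" "t + h"] k h by (simp add: D_def w_def k_def)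
    have xh: "x (t + h) - x t = h' *\<^sub>R D h' + k *\<^sub>R w" using k by (simp add: D_def w_def)
    \<comment> \<open>The slope over \<open>h\<close> is the weighted mean of the slopes over
      \<open>h'\<close> and over the rest, so it differs from \<open>D h'\<close> only by the
      fraction \<open>k / h\<close> of their difference.\<close>
    have "h *\<^sub>R (D h - D h') = k *\<^sub>R (w - D h')"
    proof -
      have "h *\<^sub>R D h = x (t + h) - x t" using h by (simp add: D_def)
      then have "h *\<^sub>R (D h - D h') = h' *\<^sub>R D h' + k *\<^sub>R w - (h' + k) *\<^sub>R D h'"
        by (simp only: xh k(4) scaleR_diff_right)
      then show ?thesis by (simp add: algebra_simps)
    qed
    then have "h * norm (D h - D h') = k * norm (w - D h')"
      using h k by (metis abs_of_pos norm_scaleR)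
    then have "h\<^sup>2 * (norm (D h - D h'))\<^sup>2 = k\<^sup>2 * (norm (D h' - w))\<^sup>2"
      by (metis norm_minus_commute power_mult_distrib)
    also have "\<dots> \<le> h' * k * (norm (D h' - w))\<^sup>2"
      using k by (intro mult_right_mono) (auto simp: power2_eq_square intro: mult_right_mono)
    also have "\<dots> \<le> h\<^sup>2 * (M * h)" using c by (simp add: power2_eq_square power3_eq_cube mult_ac)
    finally have "(norm (D h - D h'))\<^sup>2 \<le> M * h" using h by simp
    then show ?thesis by (rule real_le_rsqrt)
  qed
  have chain: "norm (D h - D h') \<le> 4 * sqrt (M * h)" if "0 < h" "t + h \<le> hi" "h / 2 ^ n \<le> h'" "h' \<le> h" for h h' n
    using that
  proof (induction n arbitrary: h)
    case 0 then show ?case using M by simp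
  next
    case (Suc n)
    show ?case
    proof (cases "h / 2 \<le> h'")
      case True
      have "norm (D h - D h') \<le> sqrt (M * h)" using half Suc.prems True by blast
      also have "\<dots> \<le> 4 * sqrt (M * h)" using M Suc.prems by simp
      finally show ?thesis .
    next
      case False
      have 1: "norm (D h - D (h / 2)) \<le> sqrt (M * h)" using half[of h "h / 2"] Suc.prems by simp
      have 2: "norm (D (h / 2) - D h') \<le> 4 * sqrt (M * (h / 2))"
        using False Suc.prems by (intro Suc.IH) (auto simp: field_simps)
      \<comment> \<open>The constant 4 reproduces itself in the induction:
        \<open>1 + 4 / sqrt 2\<close> is at most 4.\<close>
      have "4 / 3 \<le> sqrt 2" by (rule real_le_rsqrt) (simp add: power2_eq_square)
      then have s: "4 * sqrt (M * (h / 2)) \<le> 3 * sqrt (M * h)"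
      proof -
        have "4 * sqrt (M * (h / 2)) = (4 / sqrt 2) * sqrt (M * h)" by (simp add: real_sqrt_mult real_sqrt_divide)
        moreover have "4 / sqrt 2 \<le> 3" using \<open>4 / 3 \<le> sqrt 2\<close> by (simp add: field_simps)
        ultimately show ?thesis using M Suc.prems by (metis mult_nonneg_nonneg less_imp_le mult_right_mono real_sqrt_ge_zero)
      qed
      have "norm (D h - D h') \<le> norm (D h - D (h / 2)) + norm (D (h / 2) - D h')"
        using norm_triangle_ineq[of "D h - D (h / 2)" "D (h / 2) - D h'"] by simp
      then show ?thesis using 1 2 s by linarith
    qed
  qed
  have any: "norm (D h - D h') \<le> 4 * sqrt (M * h)" if h: "0 < h" "t + h \<le> hi" "0 < h'" "h' \<le> h" for h h'
  proof -
    obtain n where "(1 / 2 :: real) ^ n < h' / h"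
      using real_arch_pow_inv[of "h' / h" "1 / 2"] h by auto
    then have "h / 2 ^ n \<le> h'" using h by (simp add: field_simps power_divide)
    then show ?thesis using chain h by blast
  qed
  define hn where "hn n = (hi - t) * inverse (real (Suc n))" for n
  have hn: "hn n > 0" "t + hn n \<le> hi" for n
  proof -
    show "hn n > 0" using assms(2) by (simp add: hn_def)
    have "hn n \<le> (hi - t) * 1"
      unfolding hn_def using assms(2) by (intro mult_left_mono) (auto simp: inverse_le_1_iff)
    then show "t + hn n \<le> hi" by simp
  qed
  have hn0: "hn \<longlonglongrightarrow> 0"
  proof -
    have "(\<lambda>n. (hi - t) * inverse (real (Suc n))) \<longlonglongrightarrow> (hi - t) * 0"
      by (intro tendsto_intros LIMSEQ_inverse_real_of_nat)
    then show ?thesis by (simp add: hn_def[abs_def])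
  qed
  have small: "\<exists>N. \<forall>n\<ge>N. hn n < e" if "e > 0" for e
    using LIMSEQ_D[OF hn0 that] by (auto simp: abs_less_iff)
  have "Cauchy (\<lambda>n. D (hn n))"
  proof (rule metric_CauchyI)
    fix e :: real assume "e > 0"
    define d where "d = (e / 8)\<^sup>2 / (M + 1)"
    have "d > 0" using \<open>e > 0\<close> M by (simp add: d_def)
    then obtain N where N: "\<And>n. n \<ge> N \<Longrightarrow> hn n < d" using small by blast
    have lt: "4 * sqrt (M * hn n) < e" if "n \<ge> N" for n
    proof -
      have "M * hn n \<le> (M + 1) * d" using N[OF that] hn[of n] M by (intro mult_mono) auto
      also have "\<dots> = (e / 8)\<^sup>2" using M by (simp add: d_def)
      finally have "sqrt (M * hn n) \<le> e / 8" using \<open>e > 0\<close> by (intro real_le_lsqrt) auto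
      then show ?thesis using \<open>e > 0\<close> by simp
    qed
    show "\<exists>N. \<forall>m\<ge>N. \<forall>n\<ge>N. dist (D (hn m)) (D (hn n)) < e"
    proof (intro exI[of _ N] allI impI)
      fix m n assume mn: "m \<ge> N" "n \<ge> N"
      show "dist (D (hn m)) (D (hn n)) < e"
      proof (cases "hn n \<le> hn m")
        case True
        show ?thesis using any[OF hn hn(1) True] lt[OF mn(1)] by (simp add: dist_norm)
      next
        case False
        then have "hn m \<le> hn n" by simp
        from any[OF hn hn(1) this] show ?thesis using lt[OF mn(2)] by (simp add: dist_norm norm_minus_commute)
      qed
    qed
  qed
  then obtain v where v: "(\<lambda>n. D (hn n)) \<longlonglongrightarrow> v" using Cauchy_convergent convergent_def by blast
  show ?thesis
  proof (rule that)
    fix h :: real assume h: "0 < h" "t + h \<le> hi"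
    show "norm ((x (t + h) - x t) /\<^sub>R h - v) \<le> 4 * sqrt (M * h)"
    proof (rule LIMSEQ_le_const2)
      show "(\<lambda>n. norm (D h - D (hn n))) \<longlonglongrightarrow> norm ((x (t + h) - x t) /\<^sub>R h - v)"
        unfolding D_def[of h, symmetric] by (intro tendsto_intros v)
      obtain N where "\<And>n. n \<ge> N \<Longrightarrow> hn n < h" using small[OF h(1)] by blast
      then show "\<exists>N. \<forall>n\<ge>N. norm (D h - D (hn n)) \<le> 4 * sqrt (M * h)"
        using any[OF h] hn(1) less_imp_le by blast
    qed
  qed
qed

text \<open>Slopes to the right and, after reflection, to the left converge; the chord estimate on
  \<open>t - h\<close>, \<open>t\<close>, \<open>t + h\<close> makes the two limits equal. The rate
  is uniform in \<open>t\<close>, which gives a velocity that is Hoelder continuous with exponent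
  one half.\<close>

lemma chord_estimate_imp_C1:
  fixes x :: "real \<Rightarrow> 'e::euclidean_space"
  assumes M: "M \<ge> 0"
    and chord: "\<And>r s u. lo \<le> r \<Longrightarrow> r < s \<Longrightarrow> s < u \<Longrightarrow> u \<le> hi \<Longrightarrow>
      (s - r) * (u - s) * (norm ((x s - x r) /\<^sub>R (s - r) - (x u - x s) /\<^sub>R (u - s)))\<^sup>2 \<le> M * (u - r) ^ 3"
  obtains v where "continuous_on {lo<..<hi} v" "\<And>t. t \<in> {lo<..<hi} \<Longrightarrow> (x has_vector_derivative v t) (at t)"
proof -
  have fwd: "\<exists>v. \<forall>h. 0 < h \<and> t + h \<le> hi \<longrightarrow> norm ((x (t + h) - x t) /\<^sub>R h - v) \<le> 4 * sqrt (M * h)"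
    if t: "t \<in> {lo<..<hi}" for t
  proof -
    obtain v where "\<And>h. 0 < h \<Longrightarrow> t + h \<le> hi \<Longrightarrow> norm ((x (t + h) - x t) /\<^sub>R h - v) \<le> 4 * sqrt (M * h)"
      by (rule chord_slopes_converge[OF M, of t hi x]) (use t chord in auto)
    then show ?thesis by blast
  qed
  have bwd: "\<exists>v. \<forall>h. 0 < h \<and> lo \<le> t - h \<longrightarrow> norm ((x t - x (t - h)) /\<^sub>R h - v) \<le> 4 * sqrt (M * h)"
    if t: "t \<in> {lo<..<hi}" for t
  proof -
    obtain v where v: "\<And>h. 0 < h \<Longrightarrow> - t + h \<le> - lo \<Longrightarrow>
        norm ((x (- (- t + h)) - x (- (- t))) /\<^sub>R h - v) \<le> 4 * sqrt (M * h)"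
    proof (rule chord_slopes_converge[OF M, of "- t" "- lo" "\<lambda>s. x (- s)"])
      fix r s u assume *: "- t \<le> r" "r < s" "s < u" "u \<le> - lo"
      have "norm ((x (- s) - x (- r)) /\<^sub>R (s - r) - (x (- u) - x (- s)) /\<^sub>R (u - s))
          = norm ((x (- s) - x (- u)) /\<^sub>R (u - s) - (x (- r) - x (- s)) /\<^sub>R (s - r))"
        by (simp add: algebra_simps norm_minus_commute)
      then show "(s - r) * (u - s) * (norm ((x (- s) - x (- r)) /\<^sub>R (s - r) - (x (- u) - x (- s)) /\<^sub>R (u - s)))\<^sup>2 \<le> M * (u - r) ^ 3"
        using chord[of "- u" "- s" "- r"] * t by (simp add: mult_ac)
    qed (use t in auto)
    have "norm ((x t - x (t - h)) /\<^sub>R h - (- v)) \<le> 4 * sqrt (M * h)" if "0 < h" "lo \<le> t - h" for h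
    proof -
      have "norm ((x t - x (t - h)) /\<^sub>R h - (- v)) = norm ((x (t - h) - x t) /\<^sub>R h - v)"
        by (metis (no_types, opaque_lifting) minus_diff_eq norm_minus_cancel scaleR_minus_right minus_diff_minus)
      then show ?thesis using v[of h] that by simp
    qed
    then show ?thesis by blast
  qed
  obtain v where v: "\<And>t h. t \<in> {lo<..<hi} \<Longrightarrow> 0 < h \<Longrightarrow> t + h \<le> hi \<Longrightarrow> norm ((x (t + h) - x t) /\<^sub>R h - v t) \<le> 4 * sqrt (M * h)"
    using fwd by metis
  obtain v' where v': "\<And>t h. t \<in> {lo<..<hi} \<Longrightarrow> 0 < h \<Longrightarrow> lo \<le> t - h \<Longrightarrow> norm ((x t - x (t - h)) /\<^sub>R h - v' t) \<le> 4 * sqrt (M * h)"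
    using bwd by metis
  have sq0: "((\<lambda>h. C * sqrt (M * h)) \<longlongrightarrow> 0) (at_right 0)" for C
  proof -
    have "((\<lambda>h. C * sqrt (M * h)) \<longlongrightarrow> C * sqrt (M * 0)) (at_right 0)" by (intro tendsto_intros)
    then show ?thesis by simp
  qed
  have eq: "v' t = v t" if t: "t \<in> {lo<..<hi}" for t
  proof -
    have "\<forall>\<^sub>F h in at_right 0. h \<in> {0<..<min (t - lo) (hi - t)}"
      using t by (intro eventually_at_right_real) auto
    \<comment> \<open>The 11 is 3 for the difference of the two chords, whose estimate has 8 under
      the root, rounded up to 9, and 4 for each one-sided rate.\<close>
    then have "\<forall>\<^sub>F h in at_right 0. norm (v' t - v t) \<le> 11 * sqrt (M * h)"
    proof eventually_elim
      case (elim h)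
      let ?a = "(x t - x (t - h)) /\<^sub>R h" and ?b = "(x (t + h) - x t) /\<^sub>R h"
      have "h * h * (norm (?a - ?b))\<^sup>2 \<le> M * (2 * h) ^ 3"
        using chord[of "t - h" t "t + h"] elim by simp
      also have "\<dots> = (h * h) * (8 * (M * h))" by (simp add: power3_eq_cube)
      also have "\<dots> \<le> (h * h) * (9 * (M * h))" using M elim by (intro mult_left_mono) auto
      finally have "(h * h) * (norm (?a - ?b))\<^sup>2 \<le> (h * h) * (9 * (M * h))" .
      then have "(norm (?a - ?b))\<^sup>2 \<le> 9 * (M * h)" using elim by simp
      then have "norm (?a - ?b) \<le> sqrt (9 * (M * h))" by (rule real_le_rsqrt)
      then have 1: "norm (?a - ?b) \<le> 3 * sqrt (M * h)" by (simp add: real_sqrt_mult)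
      have "v' t - v t = (?a - ?b) - (?a - v' t) + (?b - v t)" by simp
      then have "norm (v' t - v t) \<le> norm (?a - ?b) + norm (?a - v' t) + norm (?b - v t)"
        using norm_triangle_ineq[of "(?a - ?b) - (?a - v' t)" "?b - v t"] norm_triangle_ineq4[of "?a - ?b" "?a - v' t"]
        by simp
      then show ?case using 1 v[OF t, of h] v'[OF t, of h] elim by simp
    qed
    moreover have "((\<lambda>h. norm (v' t - v t)) \<longlongrightarrow> norm (v' t - v t)) (at_right (0::real))" by simp
    ultimately have "norm (v' t - v t) \<le> 0" using sq0[of 11] by (intro tendsto_le[of "at_right (0::real)"]) auto
    then show ?thesis by simp
  qed
  have slope: "norm (x s - x t - (s - t) *\<^sub>R v t) \<le> 4 * sqrt (M * \<bar>s - t\<bar>) * \<bar>s - t\<bar>"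
    if "t \<in> {lo<..<hi}" "s \<in> {lo<..<hi}" for s t
  proof -
    consider "s = t" | "s > t" | "s < t" by linarith
    then show ?thesis
    proof cases
      case 2
      have "norm ((s - t) *\<^sub>R ((x (t + (s - t)) - x t) /\<^sub>R (s - t) - v t)) \<le> (s - t) * (4 * sqrt (M * (s - t)))"
        using v[OF that(1), of "s - t"] 2 that by (simp add: mult_left_mono)
      then show ?thesis using 2 by (simp add: scaleR_diff_right mult_ac)
    next
      case 3
      have "norm ((t - s) *\<^sub>R ((x t - x (t - (t - s))) /\<^sub>R (t - s) - v t)) \<le> (t - s) * (4 * sqrt (M * (t - s)))"
        using v'[OF that(1), of "t - s"] eq[OF that(1)] 3 that by (simp add: mult_left_mono)
      moreover have "(t - s) *\<^sub>R ((x t - x (t - (t - s))) /\<^sub>R (t - s) - v t) = - (x s - x t - (s - t) *\<^sub>R v t)"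
      proof -
        define e where "e = t - s"
        have e: "e > 0" "s - t = - e" "t - e = s" using 3 by (auto simp: e_def)
        have "e *\<^sub>R ((x t - x s) /\<^sub>R e - v t) = (x t - x s) - e *\<^sub>R v t" using e(1) by (simp add: scaleR_diff_right)
        then show ?thesis unfolding e(2) e_def[symmetric] by (simp add: e(3))
      qed
      ultimately show ?thesis using 3 by (simp only: norm_minus_cancel) (simp add: mult_ac)
    qed simp
  qed
  \<comment> \<open>In the sum of the slope errors at \<open>s\<close> and at \<open>t\<close> the
    chord cancels and only the difference of the velocities remains.\<close>
  have vlip: "norm (v s - v t) \<le> 8 * sqrt (M * \<bar>s - t\<bar>)" if st: "t \<in> {lo<..<hi}" "s \<in> {lo<..<hi}" for s t
  proof (cases "s = t")
    case False
    have "(s - t) *\<^sub>R (v s - v t) = (x s - x t - (s - t) *\<^sub>R v t) + (x t - x s - (t - s) *\<^sub>R v s)"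
      by (simp add: algebra_simps)
    then have "\<bar>s - t\<bar> * norm (v s - v t) \<le> norm (x s - x t - (s - t) *\<^sub>R v t) + norm (x t - x s - (t - s) *\<^sub>R v s)"
      by (metis norm_scaleR norm_triangle_ineq)
    also have "\<dots> \<le> \<bar>s - t\<bar> * (8 * sqrt (M * \<bar>s - t\<bar>))"
      using slope[OF st] slope[OF st(2,1)] by (simp add: abs_minus_commute mult_ac)
    finally show ?thesis using False by simp
  qed (use M in simp)
  have lim0: "((\<lambda>s. C * sqrt (M * \<bar>s - t\<bar>)) \<longlongrightarrow> 0) (at t)" for C t
  proof -
    have "((\<lambda>s. C * sqrt (M * \<bar>s - t\<bar>)) \<longlongrightarrow> C * sqrt (M * \<bar>t - t\<bar>)) (at t)" by (intro tendsto_intros)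
    then show ?thesis by simp
  qed
  show ?thesis
  proof
    show "continuous_on {lo<..<hi} v"
    proof (rule continuous_at_imp_continuous_on, rule ballI)
      fix t assume t: "t \<in> {lo<..<hi}"
      have "\<forall>\<^sub>F s in at t. s \<in> {lo<..<hi}" using t by (intro eventually_at_in_open') auto
      then have "\<forall>\<^sub>F s in at t. norm (v s - v t) \<le> 8 * sqrt (M * \<bar>s - t\<bar>)" by eventually_elim (rule vlip[OF t])
      from Lim_null_comparison[OF this lim0] show "isCont v t" by (simp add: isCont_def LIM_zero_iff)
    qed
    fix t assume t: "t \<in> {lo<..<hi}"
    have "\<forall>\<^sub>F s in at t. s \<in> {lo<..<hi}" using t by (intro eventually_at_in_open') auto
    then have "\<forall>\<^sub>F s in at t. norm (norm (x s - x t - (s - t) *\<^sub>R v t) / norm (s - t)) \<le> 4 * sqrt (M * \<bar>s - t\<bar>)"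
    proof eventually_elim
      case (elim s)
      show ?case
      proof (cases "s = t")
        case True then show ?thesis by simp
      next
        case False then show ?thesis using slope[OF t elim] by (simp add: pos_divide_le_eq)
      qed
    qed
    from Lim_null_comparison[OF this lim0]
    show "(x has_vector_derivative v t) (at t)"
      by (simp add: has_vector_derivative_def has_derivative_iff_norm bounded_linear_scaleR_left)
  qed
qed

context riemannian
begin

text \<open>The coordinate segment competes with the optimal curve: it cannot lower the exit time by
  \<open>t - s\<close> at a smaller cost. Hence the chord of an optimal curve is not much shorter
  than the elapsed time.\<close>

lemma optimal_lower_estimate:
  assumes "B > 0" and gb: "good_ball c x0 r K" and "s < t"
    and xs: "x s \<in> cball x0 r" "x t \<in> cball x0 r" "y \<in> cball x0 r"
    and D: "norm (x s - y) \<le> D" "norm (x t - y) \<le> D"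
    and opt: "exit_time B (chart_inv c (x s)) - exit_time B (chart_inv c (x t)) = t - s"
  shows "(t - s)\<^sup>2 \<le> (1 + K * D) * G c y (x t - x s) (x t - x s)"
proof -
  note gD = good_ballD[OF gb]
  let ?\<Delta> = "x t - x s"
  define h where "h = t - s"
  have h: "h > 0" using \<open>s < t\<close> by (simp add: h_def)
  define z where "z u = x s + ((u - s) / h) *\<^sub>R ?\<Delta>" for u
  have conv: "z u = (1 - (u - s) / h) *\<^sub>R x s + ((u - s) / h) *\<^sub>R x t" for u by (simp add: z_def algebra_simps)
  have fr: "0 \<le> (u - s) / h" "(u - s) / h \<le> 1" if "u \<in> {s..t}" for u
    using that h by (auto simp: h_def divide_le_eq)
  have zm: "z u \<in> cball x0 r" if "u \<in> {s..t}" for u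
    unfolding conv using fr[OF that] by (intro convexD[OF convex_cball xs(1,2)]) auto
  have zy: "norm (z u - y) \<le> D" if "u \<in> {s..t}" for u
  proof -
    have "z u \<in> cball y D"
      unfolding conv using fr[OF that] D by (intro convexD[OF convex_cball]) (auto simp: dist_norm norm_minus_commute)
    then show ?thesis by (simp add: dist_norm norm_minus_commute)
  qed
  define q where "q = G c y ?\<Delta> ?\<Delta>"
  have q0: "q \<ge> 0" unfolding q_def by (rule gD(8)[OF xs(3)])
  have zd: "(z has_vector_derivative (1 / h) *\<^sub>R ?\<Delta>) (at u within {s..t})" for u
    unfolding z_def using h by (auto intro!: derivative_eq_intros)
  have zst: "z s = x s" "z t = x t" using h by (simp_all add: z_def h_def)
  have "exit_time B (chart_inv c (z s)) - exit_time B (chart_inv c (z t)) \<le>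
      integral {s..t} (\<lambda>u. (1 + G c (z u) ((1 / h) *\<^sub>R ?\<Delta>) ((1 / h) *\<^sub>R ?\<Delta>)) / 2)"
    by (rule exit_time_energy[OF assms(1) gD(1)]) (use zd zm gD(4) \<open>s < t\<close> in auto)
  then have "t - s \<le> integral {s..t} (\<lambda>u. (1 + G c (z u) ((1 / h) *\<^sub>R ?\<Delta>) ((1 / h) *\<^sub>R ?\<Delta>)) / 2)"
    unfolding zst opt .
  also have "\<dots> \<le> integral {s..t} (\<lambda>u. (1 + (1 + K * D) * q / h\<^sup>2) / 2)"
  proof (rule integral_le)
    have "continuous_on {s..t} z" using zd by (rule continuous_on_vector_derivative)
    then show "(\<lambda>u. (1 + G c (z u) ((1 / h) *\<^sub>R ?\<Delta>) ((1 / h) *\<^sub>R ?\<Delta>)) / 2) integrable_on {s..t}"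
      using zm gD(4) by (intro integrable_continuous_real continuous_intros continuous_on_G gD(1)) auto
    show "(\<lambda>u. (1 + (1 + K * D) * q / h\<^sup>2) / 2) integrable_on {s..t}" by (rule integrable_const_ivl)
    fix u assume u: "u \<in> {s..t}"
    have zU: "z u \<in> chart_image c" using zm[OF u] gD(4) by auto
    have "G c (z u) ?\<Delta> ?\<Delta> \<le> (1 + K * norm (z u - y)) * q" unfolding q_def by (rule gD(7)[OF zm[OF u] xs(3)])
    also have "\<dots> \<le> (1 + K * D) * q" using zy[OF u] gD(3) q0 by (intro mult_right_mono add_left_mono mult_left_mono) auto
    finally have "G c (z u) ?\<Delta> ?\<Delta> / h\<^sup>2 \<le> (1 + K * D) * q / h\<^sup>2" by (rule divide_right_mono) simp
    moreover have "G c (z u) ((1 / h) *\<^sub>R ?\<Delta>) ((1 / h) *\<^sub>R ?\<Delta>) = G c (z u) ?\<Delta> ?\<Delta> / h\<^sup>2"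
      by (simp add: posdef_linear(5,6)[OF posdef_G[OF gD(1) zU]] power2_eq_square)
    ultimately show "(1 + G c (z u) ((1 / h) *\<^sub>R ?\<Delta>) ((1 / h) *\<^sub>R ?\<Delta>)) / 2 \<le> (1 + (1 + K * D) * q / h\<^sup>2) / 2"
      by (intro divide_right_mono add_left_mono) auto
  qed
  also have "\<dots> = h * ((1 + (1 + K * D) * q / h\<^sup>2) / 2)" using h by (simp add: h_def)
  finally have "h \<le> h * ((1 + (1 + K * D) * q / h\<^sup>2) / 2)" by (simp add: h_def)
  then have "1 \<le> (1 + (1 + K * D) * q / h\<^sup>2) / 2" using h by simp
  then have "1 \<le> (1 + K * D) * q / h\<^sup>2" by simp
  then show ?thesis using h by (simp add: q_def h_def pos_le_divide_eq)
qed

text \<open>The chord estimate is the parallelogram identity for the almost constant metric: a curve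
  that turns could be shortened by cutting the corner.\<close>

lemma optimal_chord_estimate:
  assumes "B > 0" and gb: "good_ball c x0 r K" and sl: "slow {lo..hi} \<gamma>"
    and mem: "\<And>t. t \<in> {lo..hi} \<Longrightarrow> \<gamma> t \<in> fst c \<and> snd c (\<gamma> t) \<in> cball x0 r"
    and opt: "\<And>t. t \<in> {lo..hi} \<Longrightarrow> exit_time B (\<gamma> t) = \<kappa> - t"
    and rsu: "lo \<le> a" "a < s" "s < u" "u \<le> hi"
  shows "(s - a) * (u - s) * (norm ((snd c (\<gamma> s) - snd c (\<gamma> a)) /\<^sub>R (s - a) - (snd c (\<gamma> u) - snd c (\<gamma> s)) /\<^sub>R (u - s)))\<^sup>2
    \<le> (2 * K * (K * lip r K)) * (u - a) ^ 3"
proof -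
  let ?x = "\<lambda>t. snd c (\<gamma> t)"
  note gD = good_ballD[OF gb]
  define C where "C = K * lip r K"
  have C: "C \<ge> 0" using gD(3) lip_ge_1[OF gb] by (simp add: C_def)
  define h k where "h = s - a" and "k = u - s"
  have hk: "h > 0" "k > 0" "h + k = u - a" using rsu by (auto simp: h_def k_def)
  let ?q = "G c (?x s)"
  have s: "s \<in> {lo..hi}" using rsu by simp
  have xsU: "?x s \<in> chart_image c" using mem[OF s] gD(4) by auto
  note pd = posdef_G[OF gD(1) xsU]
  define p w where "p = (?x s - ?x a) /\<^sub>R h" and "w = (?x u - ?x s) /\<^sub>R k"
  have dp: "?x s - ?x a = h *\<^sub>R p" "?x u - ?x s = k *\<^sub>R w" using hk by (simp_all add: p_def w_def)
  have up: "?q (?x t' - ?x t) (?x t' - ?x t) \<le> (1 + C * (u - a)) * (t' - t)\<^sup>2" if "a \<le> t" "t \<le> t'" "t' \<le> u" "s \<in> {t..t'}" for t t'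
  proof -
    have "?q (?x t' - ?x t) (?x t' - ?x t) \<le> (1 + K * (lip r K * (t' - t))) * (t' - t)\<^sup>2"
      using that rsu by (intro slow_sharp_estimate[OF gb slow_subset[OF sl]] mem) auto
    also have "\<dots> \<le> (1 + C * (u - a)) * (t' - t)\<^sup>2"
      using that C unfolding mult.assoc[symmetric] C_def[symmetric] by (intro mult_right_mono add_left_mono mult_left_mono) auto
    finally show ?thesis .
  qed
  have qp: "?q p p \<le> 1 + C * (u - a)"
    using up[of a s] rsu hk unfolding dp(1) by (simp add: posdef_linear[OF pd] power2_eq_square h_def[symmetric] mult_ac)
  have qw: "?q w w \<le> 1 + C * (u - a)"
    using up[of s u] rsu hk unfolding dp(2) by (simp add: posdef_linear[OF pd] power2_eq_square k_def[symmetric] mult_ac)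
  have lipu: "norm (?x t - ?x s) \<le> lip r K * (u - a)" if "t \<in> {a..u}" for t
  proof -
    have *: "norm (?x v' - ?x v) \<le> lip r K * (u - a)" if "v \<in> {a..u}" "v' \<in> {a..u}" "v \<le> v'" for v v'
    proof -
      have "norm (?x v' - ?x v) \<le> lip r K * (v' - v)"
        using that rsu by (intro slow_lipschitz[OF gb slow_subset[OF sl]] mem) auto
      also have "\<dots> \<le> lip r K * (u - a)" using that lip_ge_1[OF gb] by (intro mult_left_mono) auto
      finally show ?thesis .
    qed
    show ?thesis using *[of s t] *[of t s] that rsu by (cases "s \<le> t") (auto simp: norm_minus_commute)
  qed
  have "(u - a)\<^sup>2 \<le> (1 + K * (lip r K * (u - a))) * ?q (?x u - ?x a) (?x u - ?x a)"
  proof (rule optimal_lower_estimate[OF assms(1) gb])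
    show "exit_time B (chart_inv c (?x a)) - exit_time B (chart_inv c (?x u)) = u - a"
      using opt[of a] opt[of u] mem[of a] mem[of u] rsu by (simp add: chart_inv_left gD(1))
  qed (use rsu mem[of a] mem[of u] mem[OF s] lipu in auto)
  then have low0: "(u - a)\<^sup>2 \<le> (1 + C * (u - a)) * ?q (h *\<^sub>R p + k *\<^sub>R w) (h *\<^sub>R p + k *\<^sub>R w)"
    unfolding dp[symmetric] by (simp add: C_def mult.assoc)
  define H where "H = u - a"
  define Q where "Q = ?q (h *\<^sub>R p + k *\<^sub>R w) (h *\<^sub>R p + k *\<^sub>R w)"
  have H: "H > 0" "h + k = H" using rsu hk by (auto simp: H_def)
  \<comment> \<open>Multiplying the lower estimate by \<open>1 - C * H\<close> moves the metric
    error to the other side, because the product of \<open>1 - C * H\<close> and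
    \<open>1 + C * H\<close> is at most 1; if \<open>C * H\<close> exceeds 1, the left-hand side is
    not positive.\<close>
  have "(1 - C * H) * H\<^sup>2 \<le> Q"
  proof (cases "C * H \<le> 1")
    case True
    have "(1 - C * H) * H\<^sup>2 \<le> (1 - C * H) * ((1 + C * H) * Q)"
      using low0 True by (intro mult_left_mono) (auto simp: H_def Q_def)
    also have "\<dots> = (1 - (C * H)\<^sup>2) * Q" by (simp add: algebra_simps power2_eq_square)
    also have "\<dots> \<le> 1 * Q" using posdefD(4)[OF pd] by (intro mult_right_mono) (auto simp: Q_def)
    finally show ?thesis by simp
  next
    case False
    then have "(1 - C * H) * H\<^sup>2 \<le> 0" by (simp add: mult_nonpos_nonneg)
    then show ?thesis using posdefD(4)[OF pd, of "h *\<^sub>R p + k *\<^sub>R w"] by (simp add: Q_def)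
  qed
  \<comment> \<open>Weighted parallelogram identity with \<open>H = h + k\<close>. The upper bounds
    for \<open>p\<close> and \<open>w\<close> and the lower bound for \<open>Q\<close> match at
    leading order and leave an error of order three.\<close>
  moreover have "h * k * ?q (p - w) (p - w) = H * (h * ?q p p + k * ?q w w) - Q"
    unfolding Q_def H(2)[symmetric] using posdefD(2)[OF pd, of w p]
    by (simp add: posdef_linear[OF pd] algebra_simps)
  moreover have "H * (h * ?q p p + k * ?q w w) \<le> H * (h * (1 + C * H) + k * (1 + C * H))"
    using qp qw hk H by (intro mult_left_mono add_mono) (auto simp: H_def)
  moreover have "H * (h * (1 + C * H) + k * (1 + C * H)) = (1 + C * H) * H\<^sup>2"
    by (simp only: distrib_right[symmetric] H(2) power2_eq_square mult_ac)
  ultimately have "h * k * ?q (p - w) (p - w) \<le> (1 + C * H) * H\<^sup>2 - (1 - C * H) * H\<^sup>2" by linarith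
  also have "\<dots> = 2 * C * H ^ 3" by (simp add: algebra_simps power2_eq_square power3_eq_cube)
  finally have 1: "h * k * ?q (p - w) (p - w) \<le> 2 * C * H ^ 3" .
  have "h * k * (norm (p - w))\<^sup>2 \<le> h * k * (K * ?q (p - w) (p - w))"
    using hk gD(5) mem[OF s] by (intro mult_left_mono) auto
  also have "\<dots> = K * (h * k * ?q (p - w) (p - w))" by simp
  also have "\<dots> \<le> K * (2 * C * H ^ 3)" using 1 gD(3) by (intro mult_left_mono) auto
  finally show ?thesis unfolding h_def k_def p_def w_def C_def H_def by (simp only: mult_ac)
qed

end

context riemannian
begin

text \<open>The sharp estimate for a step \<open>h\<close>, divided by the square of
  \<open>h\<close>, has this inequality as its limit.\<close>

lemma slow_speed_le_1:
  assumes gb: "good_ball c x0 r K" and sl: "slow {lo..hi} \<gamma>"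
    and mem: "\<And>t. t \<in> {lo..hi} \<Longrightarrow> \<gamma> t \<in> fst c \<and> snd c (\<gamma> t) \<in> cball x0 r"
    and t: "t \<in> {lo<..<hi}" and v: "((\<lambda>t. snd c (\<gamma> t)) has_vector_derivative v) (at t)"
  shows "G c (snd c (\<gamma> t)) v v \<le> 1"
proof -
  let ?x = "\<lambda>t. snd c (\<gamma> t)"
  note gD = good_ballD[OF gb]
  have tU: "?x t \<in> chart_image c" using mem[of t] t gD(4) by auto
  define D where "D h = (?x (t + h) - ?x t) /\<^sub>R h" for h
  have "((\<lambda>h. norm (?x (t + h) - ?x t - h *\<^sub>R v) / norm h) \<longlongrightarrow> 0) (at 0)"
    using v by (simp add: has_vector_derivative_def has_derivative_at)
  then have "((\<lambda>h. norm (D h - v)) \<longlongrightarrow> 0) (at 0)"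
  proof (rule Lim_transform_eventually)
    have "norm (?x (t + h) - ?x t - h *\<^sub>R v) / norm h = norm (D h - v)" if "h \<noteq> 0" for h
    proof -
      have "?x (t + h) - ?x t - h *\<^sub>R v = h *\<^sub>R (D h - v)" using that by (simp add: D_def scaleR_diff_right)
      then show ?thesis using that by simp
    qed
    then show "\<forall>\<^sub>F h in at 0. norm (?x (t + h) - ?x t - h *\<^sub>R v) / norm h = norm (D h - v)"
      by (auto simp: eventually_at intro!: exI[of _ 1])
  qed
  then have "(D \<longlongrightarrow> v) (at 0)" by (simp add: tendsto_norm_zero_iff LIM_zero_iff)
  then have D: "(D \<longlongrightarrow> v) (at_right 0)" by (rule tendsto_within_subset) simp
  show ?thesis
  proof (rule tendsto_le[of "at_right (0::real)"])
    show "((\<lambda>h. G c (?x t) (D h) (D h)) \<longlongrightarrow> G c (?x t) v v) (at_right 0)"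
      by (intro tendsto_G gD(1) D tU tendsto_const)
    have "((\<lambda>h. 1 + K * (lip r K * h)) \<longlongrightarrow> 1 + K * (lip r K * 0)) (at_right 0)" by (intro tendsto_intros)
    then show "((\<lambda>h. 1 + K * (lip r K * h)) \<longlongrightarrow> 1) (at_right 0)" by simp
    have "\<forall>\<^sub>F h in at_right 0. h \<in> {0<..<hi - t}" using t by (intro eventually_at_right_real) auto
    then show "\<forall>\<^sub>F h in at_right 0. G c (?x t) (D h) (D h) \<le> 1 + K * (lip r K * h)"
    proof eventually_elim
      case (elim h)
      have "G c (?x t) (?x (t + h) - ?x t) (?x (t + h) - ?x t) \<le> (1 + K * (lip r K * (t + h - t))) * (t + h - t)\<^sup>2"
        using elim t by (intro slow_sharp_estimate[OF gb slow_subset[OF sl]] mem) auto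
      then have "G c (?x t) (?x (t + h) - ?x t) (?x (t + h) - ?x t) / h\<^sup>2 \<le> 1 + K * (lip r K * h)"
        using elim by (simp add: pos_divide_le_eq)
      moreover have "G c (?x t) (D h) (D h) = G c (?x t) (?x (t + h) - ?x t) (?x (t + h) - ?x t) / h\<^sup>2"
        by (simp only: D_def posdef_linear(5,6)[OF posdef_G[OF gD(1) tU]]) (simp add: power2_eq_square field_simps)
      ultimately show ?case by simp
    qed
  qed simp
qed

text \<open>The test field is chosen as in the lemma of du Bois-Reymond.\<close>

lemma optimal_momentum:
  assumes "B > 0" "c \<in> A" "a < b" "cball x0 r \<subseteq> chart_image c" "r' < r"
    and xm: "\<And>t. t \<in> {a..b} \<Longrightarrow> norm (x t - x0) \<le> r'"
    and xd: "\<And>t. t \<in> {a..b} \<Longrightarrow> (x has_vector_derivative v t) (at t within {a..b})"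
    and vc: "continuous_on {a..b} v"
    and speed: "\<And>t. t \<in> {a..b} \<Longrightarrow> G c (x t) (v t) (v t) \<le> 1"
    and opt: "exit_time B (chart_inv c (x a)) - exit_time B (chart_inv c (x b)) = b - a"
  obtains k where "\<And>t. t \<in> {a..b} \<Longrightarrow>
    G c (x t) (v t) e = k + integral {a..t} (\<lambda>s. DG c (x s) e (v s) (v s) / 2)"
proof -
  have ab: "a \<le> b" using assms by simp
  have xc: "continuous_on {a..b} x" using xd by (rule continuous_on_vector_derivative)
  have xU: "x t \<in> chart_image c" if "t \<in> {a..b}" for t
    using xm[OF that] assms(4,5) by (auto simp: dist_norm norm_minus_commute subset_iff)
  define P where "P t = G c (x t) (v t) e" for t
  define Q where "Q t = DG c (x t) e (v t) (v t) / 2" for t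
  define W where "W t = integral {a..t} Q" for t
  have Pc: "continuous_on {a..b} P" unfolding P_def using assms(2) xc vc xU by (intro continuous_on_G continuous_intros) auto
  have Qc: "continuous_on {a..b} Q" unfolding Q_def
    using assms(2) xc vc xU by (intro continuous_intros continuous_on_DG) auto
  have Wd: "(W has_vector_derivative Q t) (at t within {a..b})" if "t \<in> {a..b}" for t
    unfolding W_def by (rule integral_has_vector_derivative[OF Qc that])
  have Wc: "continuous_on {a..b} W" using Wd by (rule continuous_on_vector_derivative)
  \<comment> \<open>The mean of \<open>P - W\<close>, subtracted so that the primitive
    \<open>\<psi>\<close> vanishes at both ends and the variation fixes the end points.\<close>
  define k where "k = integral {a..b} (\<lambda>t. P t - W t) / (b - a)"
  define \<psi>' where "\<psi>' t = P t - W t - k" for t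
  define \<psi> where "\<psi> t = integral {a..t} \<psi>'" for t
  have \<psi>'c: "continuous_on {a..b} \<psi>'" unfolding \<psi>'_def by (intro continuous_intros Pc Wc)
  have \<psi>d: "(\<psi> has_vector_derivative \<psi>' t) (at t within {a..b})" if "t \<in> {a..b}" for t
    unfolding \<psi>_def by (rule integral_has_vector_derivative[OF \<psi>'c that])
  have \<psi>c: "continuous_on {a..b} \<psi>" using \<psi>d by (rule continuous_on_vector_derivative)
  have \<psi>a: "\<psi> a = 0" by (simp add: \<psi>_def)
  have \<psi>b: "\<psi> b = 0"
  proof -
    have "\<psi> b = integral {a..b} (\<lambda>t. P t - W t) - integral {a..b} (\<lambda>t. k)"
      unfolding \<psi>_def \<psi>'_def by (intro integral_diff integrable_continuous_real continuous_intros Pc Wc)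
    then show ?thesis using \<open>a < b\<close> by (simp add: k_def)
  qed
  define \<phi> \<phi>' where "\<phi> t = \<psi> t *\<^sub>R e" and "\<phi>' t = \<psi>' t *\<^sub>R e" for t
  have \<phi>c: "continuous_on {a..b} \<phi>" "continuous_on {a..b} \<phi>'"
    unfolding \<phi>_def \<phi>'_def by (intro continuous_intros \<psi>c \<psi>'c)+
  have \<phi>d: "(\<phi> has_vector_derivative \<phi>' t) (at t within {a..b})" if "t \<in> {a..b}" for t
    unfolding \<phi>_def \<phi>'_def using \<psi>d[OF that] by (auto intro!: derivative_eq_intros simp: has_real_derivative_iff_has_vector_derivative)
  obtain M where M: "M \<ge> 0" "\<And>t. t \<in> {a..b} \<Longrightarrow> norm (\<phi> t) \<le> M"
    using continuous_bounded_above[OF compact_Icc continuous_on_norm[OF \<phi>c(1)]] by blast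
  \<comment> \<open>The curve keeps distance \<open>r - r'\<close> from the boundary of the ball, so
    variations up to this size stay in the chart; the 1 avoids a division by zero.\<close>
  define \<epsilon>0 where "\<epsilon>0 = (r - r') / (M + 1)"
  have \<epsilon>0: "\<epsilon>0 > 0" using M assms(5) by (simp add: \<epsilon>0_def)
  let ?U = "{- \<epsilon>0<..<\<epsilon>0}"
  define y where "y \<epsilon> t = x t + \<epsilon> *\<^sub>R \<phi> t" for \<epsilon> t
  define w where "w \<epsilon> t = v t + \<epsilon> *\<^sub>R \<phi>' t" for \<epsilon> t
  have yU: "y \<epsilon> t \<in> chart_image c" if "\<epsilon> \<in> ?U" "t \<in> {a..b}" for \<epsilon> t
  proof -
    have "\<bar>\<epsilon>\<bar> * norm (\<phi> t) \<le> \<epsilon>0 * (M + 1)" using that M(1) M(2)[OF that(2)] by (intro mult_mono) auto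
    also have "\<dots> = r - r'" using M by (simp add: \<epsilon>0_def)
    finally have "norm (x t - x0) + norm (\<epsilon> *\<^sub>R \<phi> t) \<le> r" using xm[OF that(2)] by simp
    then have "norm ((x t - x0) + \<epsilon> *\<^sub>R \<phi> t) \<le> r" using norm_triangle_ineq order_trans by blast
    then have "dist x0 (y \<epsilon> t) \<le> r" by (simp add: y_def dist_norm norm_minus_commute algebra_simps)
    then show ?thesis using assms(4) by auto
  qed
  define f where "f \<epsilon> t = G c (y \<epsilon> t) (w \<epsilon> t) (w \<epsilon> t)" for \<epsilon> t
  define fx where "fx \<epsilon> t = DG c (y \<epsilon> t) (\<phi> t) (w \<epsilon> t) (w \<epsilon> t) + G c (y \<epsilon> t) (\<phi>' t) (w \<epsilon> t)
      + G c (y \<epsilon> t) (w \<epsilon> t) (\<phi>' t)" for \<epsilon> t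
  have yc: "continuous_on {a..b} (y \<epsilon>)" "continuous_on {a..b} (w \<epsilon>)" for \<epsilon>
    unfolding y_def w_def by (intro continuous_intros xc vc \<phi>c)+
  have fc: "continuous_on {a..b} (f \<epsilon>)" if "\<epsilon> \<in> ?U" for \<epsilon>
    unfolding f_def by (intro continuous_on_G assms(2) yc yU that)
  define \<Phi> where "\<Phi> \<epsilon> = integral {a..b} (f \<epsilon>)" for \<epsilon>
  have \<Phi>d: "(\<Phi> has_vector_derivative integral (cbox a b) (fx 0)) (at 0 within ?U)"
    unfolding \<Phi>_def cbox_interval[symmetric]
  proof (rule leibniz_rule_vector_derivative)
    show "((\<lambda>\<epsilon>. f \<epsilon> t) has_vector_derivative fx \<epsilon> t) (at \<epsilon> within ?U)" if "\<epsilon> \<in> ?U" "t \<in> cbox a b" for \<epsilon> t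
    proof -
      have "((\<lambda>\<epsilon>. y \<epsilon> t) has_vector_derivative \<phi> t) (at \<epsilon> within ?U)"
        "((\<lambda>\<epsilon>. w \<epsilon> t) has_vector_derivative \<phi>' t) (at \<epsilon> within ?U)"
        unfolding y_def w_def by (auto intro!: derivative_eq_intros)
      then show ?thesis unfolding f_def fx_def
        using yU[of \<epsilon> t] that assms(2) by (intro G_curve_derivative[where x="\<lambda>\<epsilon>. y \<epsilon> t"]) auto
    qed
    show "f \<epsilon> integrable_on cbox a b" if "\<epsilon> \<in> ?U" for \<epsilon>
      using fc[OF that] by (simp add: integrable_continuous_real)
    have s: "continuous_on (?U \<times> cbox a b) (\<lambda>z. h (snd z))" if "continuous_on {a..b} h" for h :: "real \<Rightarrow> 'e"
      by (rule continuous_on_compose2[OF that]) (auto intro!: continuous_intros)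
    have mU: "x (snd z) + fst z *\<^sub>R \<phi> (snd z) \<in> chart_image c" if "z \<in> ?U \<times> cbox a b" for z
      using that yU[of "fst z" "snd z"] by (auto simp: y_def)
    have "continuous_on (?U \<times> cbox a b) (\<lambda>z. fx (fst z) (snd z))"
      unfolding fx_def y_def w_def
      by (intro continuous_on_add continuous_on_DG continuous_on_G assms(2) s xc vc \<phi>c continuous_on_scaleR
          continuous_on_fst continuous_on_id mU)
    then show "continuous_on (?U \<times> cbox a b) (\<lambda>(\<epsilon>, t). fx \<epsilon> t)" by (simp add: split_beta)
    show "0 \<in> ?U" using \<epsilon>0 by simp
    show "convex ?U" by (rule convex_real_interval)
  qed
  then have D: "DERIV \<Phi> 0 :> integral {a..b} (fx 0)"
    using \<epsilon>0 by (simp add: has_real_derivative_iff_has_vector_derivative at_within_open[of 0 ?U])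
  \<comment> \<open>The speed bound makes \<open>\<Phi> 0\<close> at most \<open>b - a\<close>,
    while each varied curve lowers the exit time by \<open>b - a\<close> and therefore has energy at
    least \<open>b - a\<close>.\<close>
  have min: "\<Phi> 0 \<le> \<Phi> \<epsilon>" if \<epsilon>: "\<epsilon> \<in> ?U" for \<epsilon>
  proof -
    have "\<Phi> 0 \<le> integral {a..b} (\<lambda>t. 1)"
      unfolding \<Phi>_def
    proof (rule integral_le)
      show "f 0 integrable_on {a..b}" using fc[of 0] \<epsilon>0 by (simp add: integrable_continuous_real)
      show "f 0 t \<le> 1" if "t \<in> {a..b}" for t using speed[OF that] by (simp add: f_def y_def w_def)
    qed (rule integrable_const_ivl)
    then have 1: "\<Phi> 0 \<le> b - a" using \<open>a < b\<close> by simp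
    have "exit_time B (chart_inv c (y \<epsilon> a)) - exit_time B (chart_inv c (y \<epsilon> b)) \<le>
        integral {a..b} (\<lambda>t. (1 + G c (y \<epsilon> t) (w \<epsilon> t) (w \<epsilon> t)) / 2)"
    proof (rule exit_time_energy[OF assms(1,2) ab yU[OF \<epsilon>] _ yc(2)])
      fix t assume t: "t \<in> {a..b}"
      show "(y \<epsilon> has_vector_derivative w \<epsilon> t) (at t within {a..b})"
        unfolding y_def w_def using xd[OF t] \<phi>d[OF t] by (auto intro!: derivative_eq_intros)
    qed
    then have "b - a \<le> integral {a..b} (\<lambda>t. (1 + f \<epsilon> t) / 2)"
      using opt by (simp add: y_def f_def \<phi>_def \<psi>a \<psi>b)
    also have "\<dots> = integral {a..b} (\<lambda>t. 1 / 2 + f \<epsilon> t / 2)" by (simp add: add_divide_distrib)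
    also have "\<dots> = integral {a..b} (\<lambda>t. 1 / 2) + integral {a..b} (\<lambda>t. f \<epsilon> t / 2)"
      by (intro integral_add integrable_continuous_real continuous_intros fc \<epsilon>) auto
    also have "\<dots> = (b - a) / 2 + \<Phi> \<epsilon> / 2" using \<open>a < b\<close> by (simp add: \<Phi>_def)
    finally have "b - a \<le> \<Phi> \<epsilon>" by (simp add: field_simps)
    with 1 show ?thesis by (rule order_trans)
  qed
  have zero: "integral {a..b} (fx 0) = 0"
    by (rule DERIV_local_min[OF D \<epsilon>0], intro allI impI, rule min) auto
  have fx0: "fx 0 t = 2 * (\<psi> t * Q t + \<psi>' t * P t)" if t: "t \<in> {a..b}" for t
  proof -
    have "DG c (x t) (\<phi> t) (v t) (v t) = \<psi> t * (2 * Q t)"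
      by (simp add: \<phi>_def Q_def DG_linear(2)[OF assms(2) xU[OF t]])
    moreover have "G c (x t) (v t) (\<phi>' t) = \<psi>' t * P t"
      by (simp add: \<phi>'_def P_def posdef_linear(6)[OF posdef_G[OF assms(2) xU[OF t]]])
    moreover have "G c (x t) (\<phi>' t) (v t) = G c (x t) (v t) (\<phi>' t)"
      by (rule G_sym[OF assms(2) xU[OF t]])
    ultimately show ?thesis by (simp add: fx_def y_def w_def)
  qed
  have "integral {a..b} (\<lambda>t. 2 * (\<psi> t * Q t + \<psi>' t * P t)) = 0"
    using integral_cong[of "{a..b}", OF fx0] zero by (rule trans[OF sym])
  then have I1: "integral {a..b} (\<lambda>t. \<psi> t * Q t + \<psi>' t * P t) = 0"
    by (simp only: integral_mult_right)
  \<comment> \<open>Integration by parts with the primitive \<open>W\<close> of \<open>Q\<close>;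
    combined with \<open>I1\<close> it turns the integrand into the square of
    \<open>\<psi>'\<close>, which must vanish.\<close>
  have "((\<lambda>t. \<psi> t * W t + k * \<psi> t) has_vector_derivative (\<psi> t * Q t + \<psi>' t * W t + k * \<psi>' t)) (at t within {a..b})"
    if "t \<in> {a..b}" for t
    using has_vector_derivative_add[OF has_vector_derivative_mult[OF \<psi>d[OF that] Wd[OF that]]
        has_vector_derivative_mult_right[OF \<psi>d[OF that], of k]] .
  from fundamental_theorem_of_calculus[OF ab this]
  have I2: "((\<lambda>t. \<psi> t * Q t + \<psi>' t * W t + k * \<psi>' t) has_integral 0) {a..b}" by (simp add: \<psi>a \<psi>b)
  have "(\<lambda>t. \<psi> t * Q t + \<psi>' t * P t) integrable_on {a..b}"
    by (intro integrable_continuous_real continuous_intros \<psi>c \<psi>'c Qc Pc)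
  from integrable_integral[OF this]
  have "((\<lambda>t. \<psi> t * Q t + \<psi>' t * P t) has_integral 0) {a..b}" unfolding I1 .
  from has_integral_diff[OF this I2]
  have "((\<lambda>t. (\<psi> t * Q t + \<psi>' t * P t) - (\<psi> t * Q t + \<psi>' t * W t + k * \<psi>' t)) has_integral 0 - 0) {a..b}" .
  moreover have "(\<psi> t * Q t + \<psi>' t * P t) - (\<psi> t * Q t + \<psi>' t * W t + k * \<psi>' t) = \<psi>' t * \<psi>' t" for t
    by (simp add: \<psi>'_def algebra_simps)
  ultimately have "((\<lambda>t. \<psi>' t * \<psi>' t) has_integral 0) {a..b}" by simp
  then have "integral {a..b} (\<lambda>t. \<psi>' t * \<psi>' t) = 0" by (rule integral_unique)
  then have "\<forall>t\<in>{a..b}. \<psi>' t * \<psi>' t = 0"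
    using integral_eq_0_iff[OF continuous_on_mult[OF \<psi>'c \<psi>'c] \<open>a < b\<close>] by simp
  then have "\<psi>' t = 0" if "t \<in> {a..b}" for t using that by simp
  then have "P t = k + W t" if "t \<in> {a..b}" for t using that by (force simp: \<psi>'_def)
  then show ?thesis unfolding P_def W_def Q_def[abs_def] by (rule that)
qed

lemma coords_acceleration:
  assumes "open S" "c \<in> A" "\<And>t. t \<in> S \<Longrightarrow> \<gamma> t \<in> fst c"
    "\<And>t. t \<in> S \<Longrightarrow> ((\<lambda>t. snd c (\<gamma> t)) has_vector_derivative v t) (at t)" "t \<in> S"
  shows "velocity A \<gamma> t c = v t"
    "(v has_vector_derivative a) (at t) \<Longrightarrow>
      covariant_derivative A g \<gamma> (velocity A \<gamma>) t c = a + christoffel A g c (snd c (\<gamma> t)) (v t) (v t)"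
proof -
  have v: "velocity A \<gamma> t c = v t" if "t \<in> S" for t
    using assms(2) assms(3)[OF that] vector_derivative_at[OF assms(4)[OF that]] by (simp add: velocity_def o_def)
  then show "velocity A \<gamma> t c = v t" using assms(5) by simp
  assume "(v has_vector_derivative a) (at t)"
  then have "vector_derivative (\<lambda>s. velocity A \<gamma> s c) (at t) = a"
    using vector_derivative_cong_open[OF assms(1,5) v] vector_derivative_at[of v a t] by simp
  then show "covariant_derivative A g \<gamma> (velocity A \<gamma>) t c = a + christoffel A g c (snd c (\<gamma> t)) (v t) (v t)"
    using assms(2,3,5) v by (simp add: covariant_derivative_def)
qed

text \<open>The momentum identity makes the pairing of the velocity with each fixed \<open>e\<close>
  differentiable, although the velocity itself is so far only continuous. Read as a linear system
  with differentiable coefficients, it yields the derivative of the velocity, and the Koszul formula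
  identifies it.\<close>

lemma optimal_second_order:
  assumes "B > 0" "open I" and sl: "slow I \<gamma>" and opt: "\<And>t. t \<in> I \<Longrightarrow> exit_time B (\<gamma> t) = \<kappa> - t"
    and t0: "t0 \<in> I" and c: "c \<in> A" "\<gamma> t0 \<in> fst c"
  obtains S v where "open S" "t0 \<in> S" "S \<subseteq> I" "\<And>t. t \<in> S \<Longrightarrow> \<gamma> t \<in> fst c"
    "\<And>t. t \<in> S \<Longrightarrow> ((\<lambda>t. snd c (\<gamma> t)) has_vector_derivative v t) (at t)"
    "\<And>t. t \<in> S \<Longrightarrow> (v has_vector_derivative - christoffel A g c (snd c (\<gamma> t)) (v t) (v t)) (at t)"
proof -
  let ?x = "\<lambda>t. snd c (\<gamma> t)"
  obtain r K where gb: "good_ball c (?x t0) r K" using good_ball_exists[OF c(1) chart_mem[OF c]] .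
  note gD = good_ballD[OF gb]
  define Z where "Z = {t \<in> I. \<gamma> t \<in> {p \<in> fst c. snd c p \<in> ball (?x t0) (r / 2)}}"
  have "Z = I \<inter> \<gamma> -` {p \<in> fst c. snd c p \<in> ball (?x t0) (r / 2)}" by (auto simp: Z_def)
  moreover have "open (I \<inter> \<gamma> -` {p \<in> fst c. snd c p \<in> ball (?x t0) (r / 2)})"
    by (rule continuous_open_preimage[OF slow_continuous_on[OF sl] assms(2) open_chart_vimage[OF c(1) open_ball]])
  ultimately have "open Z" by (simp only:)
  moreover have "t0 \<in> Z" using t0 c gD(2) by (simp add: Z_def)
  ultimately obtain d where d: "d > 0" "cball t0 d \<subseteq> Z" using open_contains_cball by blast
  define lo hi where "lo = t0 - d" and "hi = t0 + d"
  have Z: "t \<in> Z" if "t \<in> {lo..hi}" for t using d that by (auto simp: cball_def dist_real_def lo_def hi_def subset_iff)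
  have mem: "\<gamma> t \<in> fst c \<and> ?x t \<in> cball (?x t0) r" "norm (?x t - ?x t0) \<le> r / 2" "t \<in> I" if "t \<in> {lo..hi}" for t
    using Z[OF that] gD(2) by (auto simp: Z_def dist_norm norm_minus_commute)
  have slw: "slow {lo..hi} \<gamma>" using sl by (rule slow_subset) (use mem in auto)
  have xU: "?x t \<in> chart_image c" if "t \<in> {lo..hi}" for t using mem(1)[OF that] gD(4) by auto
  obtain v where v: "continuous_on {lo<..<hi} v" "\<And>t. t \<in> {lo<..<hi} \<Longrightarrow> (?x has_vector_derivative v t) (at t)"
  proof (rule chord_estimate_imp_C1[of "2 * K * (K * lip r K)" lo hi ?x])
    show "0 \<le> 2 * K * (K * lip r K)" using gD(3) lip_ge_1[OF gb] by simp
    show "(s - a) * (u - s) * (norm ((?x s - ?x a) /\<^sub>R (s - a) - (?x u - ?x s) /\<^sub>R (u - s)))\<^sup>2 \<le> 2 * K * (K * lip r K) * (u - a) ^ 3"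
      if "lo \<le> a" "a < s" "s < u" "u \<le> hi" for a s u
      by (rule optimal_chord_estimate[OF assms(1) gb slw mem(1) opt[OF mem(3)] that])
  qed (rule that)
  have speed: "G c (?x t) (v t) (v t) \<le> 1" if "t \<in> {lo<..<hi}" for t
    by (rule slow_speed_le_1[OF gb slw mem(1) that v(2)[OF that]])
  \<comment> \<open>The velocity is known to be continuous on an open interval; the integral
    identity is applied on a closed one inside it.\<close>
  define a b where "a = t0 - d / 2" and "b = t0 + d / 2"
  have ab: "a < b" "{a..b} \<subseteq> {lo<..<hi}" "t0 \<in> {a<..<b}" using d(1) by (auto simp: a_def b_def lo_def hi_def)
  have abm: "t \<in> {lo<..<hi}" "t \<in> {lo..hi}" if "t \<in> {a..b}" for t using ab(2) that by auto
  have vc: "continuous_on {a..b} v" using v(1) ab(2) by (rule continuous_on_subset)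
  have xc: "continuous_on {a..b} ?x"
    by (rule continuous_on_vector_derivative[OF has_vector_derivative_at_within[OF v(2)]]) (use abm in auto)
  have Pd: "((\<lambda>t. G c (?x t) (v t) e) has_vector_derivative DG c (?x t) e (v t) (v t) / 2) (at t)"
    if t: "t \<in> {a<..<b}" for t e
  proof -
    obtain k where k: "\<And>t. t \<in> {a..b} \<Longrightarrow> G c (?x t) (v t) e = k + integral {a..t} (\<lambda>s. DG c (?x s) e (v s) (v s) / 2)"
    proof (rule optimal_momentum[OF assms(1) c(1) ab(1) gD(4), of "r / 2" ?x v e])
      show "r / 2 < r" using gD(2) by simp
      show "exit_time B (chart_inv c (?x a)) - exit_time B (chart_inv c (?x b)) = b - a"
        using opt[OF mem(3)[OF abm(2)]] mem(1)[OF abm(2)] ab(1) by (simp add: chart_inv_left c(1))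
    qed (use mem(2) abm v(2) speed vc in \<open>auto intro: has_vector_derivative_at_within\<close>)
    have cc: "continuous_on {a..b} (\<lambda>s. DG c (?x s) e (v s) (v s) / 2)"
      using xU abm(2) by (intro continuous_intros continuous_on_DG c(1) xc vc) auto
    have "((\<lambda>t. k + integral {a..t} (\<lambda>s. DG c (?x s) e (v s) (v s) / 2)) has_vector_derivative DG c (?x t) e (v t) (v t) / 2) (at t within {a..b})"
      using has_vector_derivative_add[OF has_vector_derivative_const[of k] integral_has_vector_derivative[OF cc, of t]] t
      by simp
    from has_vector_derivative_transform[OF _ k this] t
    have "((\<lambda>t. G c (?x t) (v t) e) has_vector_derivative DG c (?x t) e (v t) (v t) / 2) (at t within {a..b})" by simp
    then show ?thesis using t by (simp add: at_within_Icc_at)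
  qed
  have vd: "(v has_vector_derivative - christoffel A g c (?x t) (v t) (v t)) (at t)" if t: "t \<in> {a<..<b}" for t
  proof -
    have tab: "t \<in> {a..b}" using t by simp
    have tU: "?x t \<in> chart_image c" using xU[OF abm(2)[OF tab]] .
    have Ga: "((\<lambda>t. G c (?x t) u w) has_derivative (\<lambda>s. s * DG c (?x t) (v t) u w)) (at t)" for u w
    proof -
      have "((\<lambda>t. G c (?x t) u w) has_vector_derivative DG c (?x t) (v t) u w + G c (?x t) 0 w + G c (?x t) u 0) (at t)"
        by (rule G_curve_derivative[where x="?x"]) (use c(1) tU v(2)[OF abm(1)[OF tab]] in auto)
      then show ?thesis by (simp add: G_linear[OF c(1) tU] has_vector_derivative_def)
    qed
    obtain l where l: "(v has_derivative l) (at t)"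
      "\<And>s e. e \<in> Basis \<Longrightarrow> G c (?x t) (l s) e = s * (DG c (?x t) e (v t) (v t) / 2) - s * DG c (?x t) (v t) (v t) e"
    proof (rule linear_system_has_derivative[where a="\<lambda>t. G c (?x t)" and S="{a<..<b}" and y=t and z=v
          and \<eta>="\<lambda>e t. G c (?x t) (v t) e" and a'="\<lambda>u w s. s * DG c (?x t) (v t) u w"
          and \<eta>'="\<lambda>e s. s * (DG c (?x t) e (v t) (v t) / 2)"])
      show "posdef (G c (?x s))" if "s \<in> {a<..<b}" for s using posdef_G[OF c(1) xU[OF abm(2)]] that by simp
      show "((\<lambda>t. G c (?x t) (v t) e) has_derivative (\<lambda>s. s * (DG c (?x t) e (v t) (v t) / 2))) (at t)" for e
        using Pd[OF t, of e] by (simp add: has_vector_derivative_def)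
    qed (use t Ga in auto)
    have "\<forall>e\<in>Basis. G c (?x t) (l 1) e = G c (?x t) (- christoffel A g c (?x t) (v t) (v t)) e"
    proof
      fix e :: 'e assume "e \<in> Basis"
      then show "G c (?x t) (l 1) e = G c (?x t) (- christoffel A g c (?x t) (v t) (v t)) e"
        using l(2)[of e 1] christoffel_eq[OF c(1) tU, of "v t" "v t" e]
          posdef_linear(5)[OF posdef_G[OF c(1) tU], of "-1" "christoffel A g c (?x t) (v t) (v t)" e]
        by simp
    qed
    then have "l 1 = - christoffel A g c (?x t) (v t) (v t)"
      using posdef_solvable[OF posdef_G[OF c(1) tU], of "\<lambda>e. G c (?x t) (l 1) e"] by metis
    moreover have "l s = s *\<^sub>R l 1" for s
      using linear_cmul[OF has_derivative_linear[OF l(1)], of s 1] by simp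
    ultimately show ?thesis using l(1) unfolding has_vector_derivative_def by (metis (no_types, lifting) has_derivative_eq_rhs ext)
  qed
  show ?thesis
    by (rule that[of "{a<..<b}" v]) (use ab abm mem v(2) vd in auto)
qed

text \<open>Stated on position, time and velocity, with no actual dependence on time, to fit the
  form of second-order equation shared by geodesics and trajectories.\<close>

lemma smooth_christoffel:
  assumes "c \<in> A"
  shows "smooth_on (chart_image c \<times> UNIV \<times> UNIV) (\<lambda>z::'e \<times> real \<times> 'e. christoffel A g c (fst z) (snd (snd z)) (snd (snd z)))"
    (is "smooth_on ?S _")
proof (rule smooth_on_linear_system[where a="\<lambda>z. G c (fst z)"
      and \<eta>="\<lambda>b z. DG c (fst z) (snd (snd z)) (snd (snd z)) b - (1 / 2) * DG c (fst z) b (snd (snd z)) (snd (snd z))"])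
  show S: "open ?S" using open_chart_image[OF assms] by (intro open_Times open_UNIV)
  have s2: "smooth_on ?S (\<lambda>z. snd (snd z))" by (intro smooth_on_linear_compose[OF bounded_linear_snd] S smooth_on_snd)
  show "posdef (G c (fst z))" if "z \<in> ?S" for z using posdef_G[OF assms, of "fst z"] that by (auto simp: mem_Times_iff)
  show "smooth_on ?S (\<lambda>z. G c (fst z) u w)" for u w
    by (intro smooth_on_G_compose[OF assms S smooth_on_fst smooth_on_const smooth_on_const]) auto
  show "smooth_on ?S (\<lambda>z. DG c (fst z) (snd (snd z)) (snd (snd z)) b - (1 / 2) * DG c (fst z) b (snd (snd z)) (snd (snd z)))" for b
    by (intro smooth_on_diff smooth_on_mult smooth_on_DG_compose[OF assms S smooth_on_fst] s2 smooth_on_const S) auto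
  fix z :: "'e \<times> real \<times> 'e" and b assume "z \<in> ?S"
  then have "fst z \<in> chart_image c" by (auto simp: mem_Times_iff)
  from christoffel_eq[OF assms this, of "snd (snd z)" "snd (snd z)" b]
  show "G c (fst z) (christoffel A g c (fst z) (snd (snd z)) (snd (snd z))) b =
      DG c (fst z) (snd (snd z)) (snd (snd z)) b - (1 / 2) * DG c (fst z) b (snd (snd z)) (snd (snd z))" by simp
qed

lemma optimal_geodesic:
  assumes "B > 0" "open_interval I" "slow I \<gamma>" "\<And>t. t \<in> I \<Longrightarrow> exit_time B (\<gamma> t) = \<kappa> - t"
  shows "geodesic A g I \<gamma>"
proof -
  have I: "open I" using assms(2) by (simp add: open_interval_def)
  have "smooth_on {t \<in> I. \<gamma> t \<in> fst c} (snd c \<circ> \<gamma>)" if c: "c \<in> A" for c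
  proof (rule smooth_on_local)
    fix t0 assume "t0 \<in> {t \<in> I. \<gamma> t \<in> fst c}"
    then have t0: "t0 \<in> I" "\<gamma> t0 \<in> fst c" by auto
    obtain S v where S: "open S" "t0 \<in> S" "S \<subseteq> I" "\<And>t. t \<in> S \<Longrightarrow> \<gamma> t \<in> fst c"
      "\<And>t. t \<in> S \<Longrightarrow> ((\<lambda>t. snd c (\<gamma> t)) has_vector_derivative v t) (at t)"
      "\<And>t. t \<in> S \<Longrightarrow> (v has_vector_derivative - christoffel A g c (snd c (\<gamma> t)) (v t) (v t)) (at t)"
      by (rule optimal_second_order[OF assms(1) I assms(3,4) t0(1) c t0(2)], assumption, rule that)
    have op: "open (chart_image c \<times> (UNIV :: (real \<times> 'e) set))" using open_chart_image[OF c] by (intro open_Times open_UNIV)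
    have sm: "smooth_on (chart_image c \<times> UNIV \<times> UNIV) (\<lambda>z::'e \<times> real \<times> 'e. - christoffel A g c (fst z) (snd (snd z)) (snd (snd z)))"
      using smooth_on_linear_compose[OF bounded_linear_minus[OF bounded_linear_ident] _ smooth_christoffel[OF c]] op by simp
    have "smooth_on S (\<lambda>t. snd c (\<gamma> t))"
      by (rule second_order_solution_smooth[OF S(1) open_chart_image[OF c] sm, of _ v])
        (use S chart_mem[OF c] in auto)
    then show "\<exists>T. open T \<and> t0 \<in> T \<and> smooth_on T (snd c \<circ> \<gamma>)" using S by (auto simp: o_def)
  qed
  then have "smooth_curve A I \<gamma>" using slow_continuous_on[OF assms(3)] by (simp add: smooth_curve_def)
  moreover have "covariant_derivative A g \<gamma> (velocity A \<gamma>) t c = 0" if t: "t \<in> I" for t c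
  proof (cases "c \<in> A \<and> \<gamma> t \<in> fst c")
    case True
    obtain S v where S: "open S" "t \<in> S" "S \<subseteq> I" "\<And>t. t \<in> S \<Longrightarrow> \<gamma> t \<in> fst c"
      "\<And>t. t \<in> S \<Longrightarrow> ((\<lambda>t. snd c (\<gamma> t)) has_vector_derivative v t) (at t)"
      "\<And>t. t \<in> S \<Longrightarrow> (v has_vector_derivative - christoffel A g c (snd c (\<gamma> t)) (v t) (v t)) (at t)"
      by (rule optimal_second_order[OF assms(1) I assms(3,4) t conjunct1[OF True] conjunct2[OF True]], assumption, rule that)
    show ?thesis using coords_acceleration(2)[OF S(1) _ S(4,5,2) S(6)[OF S(2)]] True by simp
  qed (auto simp: covariant_derivative_def)
  ultimately show ?thesis using assms(2) by (auto simp: geodesic_def)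
qed

end

section \<open>Curves of finite length converge\<close>

context riemannian
begin

lemma smooth_curve_local:
  assumes "\<And>t. t \<in> J \<Longrightarrow> \<exists>J' \<delta>'. open J' \<and> t \<in> J' \<and> J' \<subseteq> J \<and> smooth_curve A J' \<delta>' \<and> (\<forall>s\<in>J'. \<delta> s = \<delta>' s)"
  shows "smooth_curve A J \<delta>"
proof -
  have "isCont \<delta> t" if t: "t \<in> J" for t
  proof -
    obtain J' \<delta>' where J': "open J'" "t \<in> J'" "smooth_curve A J' \<delta>'" "\<forall>s\<in>J'. \<delta> s = \<delta>' s" using assms[OF t] by blast
    then have "continuous_on J' \<delta>" using continuous_on_cong[of J' J' \<delta> \<delta>'] by (simp add: smooth_curve_def)
    then show ?thesis using J'(1,2) continuous_on_eq_continuous_at by blast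
  qed
  moreover have "smooth_on {t \<in> J. \<delta> t \<in> fst c} (snd c \<circ> \<delta>)" if c: "c \<in> A" for c
  proof (rule smooth_on_local)
    fix t assume "t \<in> {t \<in> J. \<delta> t \<in> fst c}"
    then have t: "t \<in> J" "\<delta> t \<in> fst c" by auto
    obtain J' \<delta>' where J': "open J'" "t \<in> J'" "J' \<subseteq> J" "smooth_curve A J' \<delta>'" "\<forall>s\<in>J'. \<delta> s = \<delta>' s" using assms[OF t(1)] by blast
    define T where "T = {s \<in> J'. \<delta>' s \<in> fst c}"
    have "open T" unfolding T_def by (rule open_curve_domain[OF J'(1,4) c])
    moreover have "smooth_on T (snd c \<circ> \<delta>')" unfolding T_def by (rule smooth_curve_coords[OF J'(4) c])
    then have "smooth_on T (snd c \<circ> \<delta>)"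
      by (subst smooth_on_cong[OF \<open>open T\<close>, of _ "snd c \<circ> \<delta>'"]) (auto simp: T_def J'(5))
    ultimately show "\<exists>T. open T \<and> t \<in> T \<and> smooth_on T (snd c \<circ> \<delta>)"
      using J' t by (intro exI[of _ T]) (auto simp: T_def)
  qed
  ultimately show ?thesis by (simp add: smooth_curve_def continuous_at_imp_continuous_on)
qed

text \<open>The locality demanded by \<open>inextensible_extension\<close>: velocity and
  acceleration at a time depend only on the curve near that time.\<close>

lemma geodesic_local:
  assumes "open_interval J"
    "\<And>t. t \<in> J \<Longrightarrow> \<exists>J' \<delta>'. t \<in> J' \<and> J' \<subseteq> J \<and> geodesic A g J' \<delta>' \<and> (\<forall>s\<in>J'. \<delta> s = \<delta>' s)"
  shows "geodesic A g J \<delta>"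
  unfolding geodesic_def
proof (intro conjI ballI assms(1))
  show "smooth_curve A J \<delta>"
  proof (rule smooth_curve_local)
    fix t assume "t \<in> J"
    from assms(2)[OF this] show "\<exists>J' \<delta>'. open J' \<and> t \<in> J' \<and> J' \<subseteq> J \<and> smooth_curve A J' \<delta>' \<and> (\<forall>s\<in>J'. \<delta> s = \<delta>' s)"
      unfolding geodesic_def open_interval_def by blast
  qed
  fix t assume "t \<in> J"
  then obtain J' \<delta>' where J': "t \<in> J'" "geodesic A g J' \<delta>'" "\<forall>s\<in>J'. \<delta> s = \<delta>' s" using assms(2) by blast
  then have "open J'" by (simp add: geodesic_def open_interval_def)
  then have "covariant_derivative A g \<delta> (velocity A \<delta>) t = covariant_derivative A g \<delta>' (velocity A \<delta>') t"
    using J' by (intro acceleration_cong[of J']) auto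
  then show "covariant_derivative A g \<delta> (velocity A \<delta>) t = tzero" using J' by (simp add: geodesic_def)
qed

lemma exit_time_tendsto:
  assumes "B > 0" "(\<gamma> \<longlongrightarrow> q) F"
  shows "((\<lambda>s. exit_time B (\<gamma> s)) \<longlongrightarrow> exit_time B q) F"
proof -
  obtain c where c: "c \<in> A" "q \<in> fst c" by (rule chart_cover)
  obtain r K where gb: "good_ball c (snd c q) r K" using good_ball_exists[OF c(1) chart_mem[OF c]] .
  note gD = good_ballD[OF gb]
  have "\<forall>\<^sub>F s in F. \<gamma> s \<in> {p \<in> fst c. snd c p \<in> ball (snd c q) r}"
    by (rule topological_tendstoD[OF assms(2) open_chart_vimage[OF c(1) open_ball]]) (use c gD(2) in auto)
  then have ev: "\<forall>\<^sub>F s in F. norm (exit_time B (\<gamma> s) - exit_time B q) \<le> K * norm (snd c (\<gamma> s) - snd c q)"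
  proof eventually_elim
    case (elim s)
    then have m: "snd c (\<gamma> s) \<in> cball (snd c q) r" "snd c q \<in> cball (snd c q) r"
      "chart_inv c (snd c (\<gamma> s)) = \<gamma> s" "chart_inv c (snd c q) = q"
      using gD(2) chart_inv_left[OF c(1)] c(2) by auto
    show ?case
      using exit_time_lipschitz[OF assms(1) gb m(1,2)] exit_time_lipschitz[OF assms(1) gb m(2,1)] unfolding m(3,4)
      by (simp add: norm_minus_commute abs_le_iff)
  qed
  have "isCont (snd c) q"
    using continuous_on_chart[OF c(1)] open_chart[OF c(1)] c(2) by (simp add: continuous_on_eq_continuous_at)
  from isCont_tendsto_compose[OF this assms(2)] have "((\<lambda>s. snd c (\<gamma> s)) \<longlongrightarrow> snd c q) F" .
  then have "((\<lambda>s. K * norm (snd c (\<gamma> s) - snd c q)) \<longlongrightarrow> K * norm (snd c q - snd c q)) F" by (intro tendsto_intros)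
  then have "((\<lambda>s. K * norm (snd c (\<gamma> s) - snd c q)) \<longlongrightarrow> 0) F" by simp
  from Lim_null_comparison[OF ev this] show ?thesis by (simp add: LIM_zero_iff)
qed

text \<open>A maximal curve along which the exit time decreases at unit rate would be a geodesic that
  cannot be extended.\<close>

lemma slow_curve_converges:
  assumes "complete_riemannian A g" "b > 0" "slow {0..<b} \<gamma>"
  obtains q where "(\<gamma> \<longlongrightarrow> q) (at_left b)"
proof (rule ccontr)
  assume "\<not> thesis"
  then have "b \<in> exits (\<gamma> 0)" using assms(2,3) that by (auto simp: exits_def)
  \<comment> \<open>Strictly above an actual exit time, so that the cut-off is inactive at
    \<open>\<gamma> 0\<close>.\<close>
  define B where "B = b + 1"
  have B: "B > 0" "exit_time B (\<gamma> 0) < B" using exit_time_le[of b B "\<gamma> 0"] \<open>b \<in> exits (\<gamma> 0)\<close> assms(2) by (auto simp: B_def)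
  define \<kappa> where "\<kappa> = exit_time B (\<gamma> 0)"
  \<comment> \<open>The clock is fixed by \<open>\<kappa>\<close>: the exit time at time
    \<open>t\<close> is prescribed and not merely its rate of decrease. Thus this condition is
    checked at each time separately, and a piece started later fits.\<close>
  define P where "P I c \<longleftrightarrow> open_interval I \<and> slow I c \<and> (\<forall>t\<in>I. exit_time B (c t) = \<kappa> - t)" for I c
  obtain \<tau> \<gamma>1 where g1: "\<tau> > 0" "slow {0..\<tau>} \<gamma>1" "\<gamma>1 0 = \<gamma> 0" "\<And>t. t \<in> {0..\<tau>} \<Longrightarrow> exit_time B (\<gamma>1 t) = exit_time B (\<gamma> 0) - t"
    by (rule optimal_curve_exists[OF B], rule that)
  have "slow {0<..<\<tau>} \<gamma>1" using g1(2) by (rule slow_subset) auto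
  then have P1: "P {0<..<\<tau>} \<gamma>1" using g1 by (auto simp: P_def open_interval_def \<kappa>_def is_interval_oo)
  obtain J \<delta> where J: "inextensible P J \<delta>" "{0<..<\<tau>} \<subseteq> J"
  proof (rule inextensible_extension[where P=P, OF P1])
    show "open_interval J" if "P J \<delta>" for J \<delta> using that by (simp add: P_def)
    show "P J \<delta>" if "open_interval J" and cov: "\<And>t. t \<in> J \<Longrightarrow>
        \<exists>J' \<delta>'. t \<in> J' \<and> J' \<subseteq> J \<and> P J' \<delta>' \<and> (\<forall>s\<in>J'. \<delta> s = \<delta>' s)" for J \<delta>
      unfolding P_def
    proof (intro conjI ballI that(1))
      show "slow J \<delta>"
      proof (rule slow_local)
        fix t assume "t \<in> J"
        then obtain J' \<delta>' where J': "t \<in> J'" "J' \<subseteq> J" "P J' \<delta>'" "\<forall>s\<in>J'. \<delta> s = \<delta>' s" using cov by blast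
        then have "slow J' \<delta>" by (subst slow_cong[of _ _ \<delta>']) (auto simp: P_def)
        moreover have "J \<inter> J' = J'" using J' by blast
        ultimately show "\<exists>T. open T \<and> t \<in> T \<and> slow (J \<inter> T) \<delta>"
          using J' by (intro exI[of _ J']) (auto simp: P_def open_interval_def)
      qed
      fix t assume "t \<in> J"
      then obtain J' \<delta>' where "t \<in> J'" "P J' \<delta>'" "\<forall>s\<in>J'. \<delta> s = \<delta>' s" using cov by blast
      then show "exit_time B (\<delta> t) = \<kappa> - t" by (simp add: P_def)
    qed
  qed
  then have PJ: "open_interval J" "slow J \<delta>" "\<And>t. t \<in> J \<Longrightarrow> exit_time B (\<delta> t) = \<kappa> - t"
    by (auto simp: inextensible_def P_def)
  \<comment> \<open>Positivity of the exit time limits the duration of an optimal curve, so that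
    \<open>J\<close> is bounded above.\<close>
  have J_lt: "t < \<kappa>" if "t \<in> J" for t using PJ(3)[OF that] exit_time_pos[OF B(1), of "\<delta> t"] by simp
  have "\<tau> / 2 \<in> J" using J(2) g1(1) by auto
  define T where "T = Sup J"
  have bdd: "bdd_above J" using J_lt by (meson bdd_above.I less_imp_le)
  have le_T: "t \<le> T" if "t \<in> J" for t unfolding T_def using that bdd by (rule cSup_upper)
  have "open J" using PJ(1) by (simp add: open_interval_def)
  have JT: "t < T" if tJ: "t \<in> J" for t
  proof -
    obtain e where "e > 0" "ball t e \<subseteq> J" using \<open>open J\<close> tJ open_contains_ball by blast
    then have "t + e / 2 \<in> J" by (auto simp: dist_real_def subset_iff)
    then show ?thesis using le_T[of "t + e / 2"] \<open>e > 0\<close> by simp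
  qed
  have T0: "T > 0" using JT[OF \<open>\<tau> / 2 \<in> J\<close>] g1(1) by simp
  have toT: "{a..<T} \<subseteq> J" if a: "a \<in> J" for a
  proof
    fix s assume s: "s \<in> {a..<T}"
    have "s < Sup J" using s by (simp add: T_def)
    then obtain u where u: "u \<in> J" "s < u" using less_cSup_iff[OF _ bdd] a by blast
    have "is_interval J" using PJ(1) by (simp add: open_interval_def)
    then show "s \<in> J" using a u s unfolding is_interval_1 by (metis atLeastLessThan_iff less_imp_le)
  qed
  have geo: "geodesic A g J \<delta>" by (rule optimal_geodesic[OF B(1) PJ])
  \<comment> \<open>Geodesic completeness enters here: the geodesic \<open>\<delta>\<close> is part
    of one defined at all times, whose continuity supplies the value at \<open>T\<close>.\<close>
  obtain J2 \<eta> where J2: "inextensible (geodesic A g) J2 \<eta>" "\<And>t. t \<in> J \<Longrightarrow> \<eta> t = \<delta> t"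
  proof (rule inextensible_extension[where P="geodesic A g", OF geo])
    show "open_interval J" if "geodesic A g J \<delta>" for J \<delta> using that by (simp add: geodesic_def)
  qed (rule geodesic_local, assumption, blast, rule that)
  have "J2 = UNIV" using J2(1) assms(1) unfolding complete_riemannian_def by blast
  then have "continuous_on UNIV \<eta>" using J2(1) by (simp add: inextensible_def geodesic_def smooth_curve_def)
  then have lim: "(\<eta> \<longlongrightarrow> \<eta> T) (at_left T)"
    by (simp add: continuous_on_eq_continuous_at isCont_def filterlim_at_split)
  define a where "a = \<tau> / 2"
  have aJ: "a \<in> J" "a < T" using \<open>\<tau> / 2 \<in> J\<close> JT[OF \<open>\<tau> / 2 \<in> J\<close>] by (simp_all add: a_def)
  have slJ: "slow J \<eta>" using PJ(2) J2(2) by (subst slow_cong[of _ _ \<delta>]) auto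
  have "slow {a..T} \<eta>"
    by (rule slow_closure[OF slow_subset[OF slJ toT[OF aJ(1)]] aJ(2) lim])
  have rT: "exit_time B (\<eta> T) = \<kappa> - T"
  proof (rule tendsto_unique[OF _ exit_time_tendsto[OF B(1) lim]])
    show "at_left T \<noteq> bot" by simp
    have "\<forall>\<^sub>F t in at_left T. t \<in> {a<..<T}" by (rule eventually_at_left_real[OF aJ(2)])
    then have "\<forall>\<^sub>F t in at_left T. \<kappa> - t = exit_time B (\<eta> t)"
    proof eventually_elim
      case (elim t)
      then have "t \<in> J" using toT[OF aJ(1)] by auto
      then show ?case using J2(2) PJ(3) by simp
    qed
    moreover have "((\<lambda>t. \<kappa> - t) \<longlongrightarrow> \<kappa> - T) (at_left T)" by (intro tendsto_intros)
    ultimately show "((\<lambda>t. exit_time B (\<eta> t)) \<longlongrightarrow> \<kappa> - T) (at_left T)" by (rule Lim_transform_eventually[rotated])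
  qed
  then have "exit_time B (\<eta> T) < B" using B(2) T0 by (simp add: \<kappa>_def)
  \<comment> \<open>Beyond \<open>T\<close> the curve continues not along \<open>\<eta>\<close>,
    whose exit time there is unknown, but along a new optimal curve from \<open>\<eta> T\<close>;
    the union contradicts maximality.\<close>
  obtain \<tau>2 \<gamma>2 where g2: "\<tau>2 > 0" "slow {0..\<tau>2} \<gamma>2" "\<gamma>2 0 = \<eta> T"
    "\<And>t. t \<in> {0..\<tau>2} \<Longrightarrow> exit_time B (\<gamma>2 t) = exit_time B (\<eta> T) - t"
    by (rule optimal_curve_exists[OF B(1) \<open>exit_time B (\<eta> T) < B\<close>], rule that)
  define J' where "J' = J \<union> {a<..<T + \<tau>2}"
  define \<delta>' where "\<delta>' = (\<lambda>t. if t < T then \<eta> t else \<gamma>2 (t - T))"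
  have memJ: "t \<in> J" if "t \<in> J'" "t < T" for t using that toT[OF aJ(1)] by (auto simp: J'_def)
  have memT: "t < T + \<tau>2" if "t \<in> J'" for t using that JT g2(1) by (force simp: J'_def)
  have "P J' \<delta>'"
    unfolding P_def
  proof (intro conjI ballI)
    have "connected J'"
      unfolding J'_def
    proof (rule connected_Un)
      show "connected J" using PJ(1) by (simp add: open_interval_def is_interval_connected_1)
      have "(a + T) / 2 \<in> {a..<T}" "(a + T) / 2 \<in> {a<..<T + \<tau>2}" using aJ(2) g2(1) by auto
      then have "(a + T) / 2 \<in> J \<inter> {a<..<T + \<tau>2}" using toT[OF aJ(1)] by blast
      then show "J \<inter> {a<..<T + \<tau>2} \<noteq> {}" by blast
    qed (rule connected_Ioo)
    then show "open_interval J'"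
      using PJ(1) aJ(1) by (auto simp: open_interval_def is_interval_connected_1 J'_def)
    show "slow J' \<delta>'"
      unfolding \<delta>'_def
    proof (rule slow_append)
      have "slow (J' \<inter> {..T} \<inter> {..a}) \<eta>" by (rule slow_subset[OF slJ]) (use memJ aJ(2) in auto)
      moreover have "slow (J' \<inter> {..T} \<inter> {a..}) \<eta>" by (rule slow_subset[OF \<open>slow {a..T} \<eta>\<close>]) auto
      ultimately show "slow (J' \<inter> {..T}) \<eta>" by (rule slow_glue)
      show "slow ((\<lambda>t. t - T) ` (J' \<inter> {T..})) \<gamma>2"
        by (rule slow_subset[OF g2(2)]) (use memT in force)
    qed (rule g2)
    fix t assume t: "t \<in> J'"
    show "exit_time B (\<delta>' t) = \<kappa> - t"
      using memJ[OF t] memT[OF t] J2(2) PJ(3) g2(4)[of "t - T"] rT by (auto simp: \<delta>'_def)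
  qed
  moreover have "J \<subseteq> J'" by (auto simp: J'_def)
  moreover have "\<forall>t\<in>J. \<delta>' t = \<delta> t" using JT J2(2) by (simp add: \<delta>'_def)
  ultimately have "J' = J" using J(1) unfolding inextensible_def by blast
  moreover have "T \<in> J'" using aJ(2) g2(1) by (simp add: J'_def)
  ultimately show False using JT[of T] by simp
qed

end

section \<open>Trajectories\<close>

context riemannian
begin

definition Fc :: "('a, 'e) td_tensor \<Rightarrow> ('a, 'e) chart \<Rightarrow> 'e \<Rightarrow> real \<Rightarrow> 'e \<Rightarrow> 'e" where
  "Fc F c x t u = F (chart_inv c x) t (tvec_of A c (chart_inv c x) u) c"

definition Vc :: "('a \<Rightarrow> real \<Rightarrow> real) \<Rightarrow> ('a, 'e) chart \<Rightarrow> 'e \<times> real \<Rightarrow> real" where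
  "Vc V c = (\<lambda>(x, t). V (chart_inv c x) t)"

text \<open>The equation of motion solved for the second derivative of the coordinates.\<close>

definition acc ::
  "('a, 'e) td_tensor \<Rightarrow> ('a \<Rightarrow> real \<Rightarrow> real) \<Rightarrow> ('a, 'e) chart \<Rightarrow> 'e \<Rightarrow> real \<Rightarrow> 'e \<Rightarrow> 'e" where
  "acc F V c x t v = Fc F c x t v - christoffel A g c x v v - gradient A g (\<lambda>p. V p t) (chart_inv c x) c"

lemma metric_linear_right:
  assumes "u \<in> tangent_space A p" "v \<in> tangent_space A p" "w \<in> tangent_space A p"
  shows "g p w (tadd u v) = g p w u + g p w v" "g p w (tscale r u) = r * g p w u"
  using metricD(1)[OF assms(3) tangent_add[OF assms(1,2)] assms(3)] metricD(1)[OF assms(3,1,1)]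
    metricD(1)[OF assms(3,2,2)] metricD(1)[OF assms(3) tangent_scale[OF assms(1)] assms(3)]
    metricD(2)[OF assms] metricD(3)[OF assms(1,3,3)]
  by simp_all

lemma metric_nonneg:
  assumes "v \<in> tangent_space A p" shows "g p v v \<ge> 0"
proof -
  obtain c where c: "c \<in> A" "p \<in> fst c" by (rule chart_cover)
  show ?thesis
    using metric_eq_G[OF c assms assms] posdefD(4)[OF posdef_G[OF c(1) chart_mem[OF c]]] by simp
qed

lemma tensor_field:
  assumes "smooth_td_tensor_field A F" "v \<in> tangent_space A p"
  shows "F p t v \<in> tangent_space A p"
    "w \<in> tangent_space A p \<Longrightarrow> F p t (tadd v w) = tadd (F p t v) (F p t w)"
    "F p t (tscale r v) = tscale r (F p t v)"
  using assms unfolding smooth_td_tensor_field_def by blast+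

lemma linear_Fc:
  assumes "smooth_td_tensor_field A F" "c \<in> A" "x \<in> chart_image c"
  shows "linear (Fc F c x t)"
proof -
  note T = tvec_of_tangent[OF assms(2) chart_inv_mem[OF assms(2,3)]]
  show ?thesis
    using tensor_field(2)[OF assms(1) T T] tensor_field(3)[OF assms(1) T]
    by (intro linearI) (simp_all add: Fc_def tvec_of_add[OF assms(2) chart_inv_mem[OF assms(2,3)]]
        tvec_of_scale[OF assms(2) chart_inv_mem[OF assms(2,3)]])
qed

lemma tensor_coords:
  assumes "smooth_td_tensor_field A F" "c \<in> A" "p \<in> fst c" "v \<in> tangent_space A p"
  shows "F p t v c = Fc F c (snd c p) t (v c)"
  unfolding Fc_def chart_inv_left[OF assms(2,3)] using tangent_eq_tvec_of[OF assms(2,3,4)] by simp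

lemma smooth_Vc:
  assumes "smooth_td_function A V" "c \<in> A"
  shows "smooth_on (chart_image c \<times> UNIV) (Vc V c)"
  using assms by (simp add: smooth_td_function_def Vc_def)

lemma Vc_has_derivative:
  assumes "smooth_td_function A V" "c \<in> A" "x \<in> chart_image c"
  shows "(Vc V c has_derivative frechet_derivative (Vc V c) (at (x, t))) (at (x, t))"
  by (rule smooth_on_has_derivative[OF smooth_Vc[OF assms(1,2)]]) (use assms(3) in auto)

lemma potential_has_derivative:
  assumes "smooth_td_function A V" "c \<in> A" "x \<in> chart_image c"
  shows "(((\<lambda>p. V p t) \<circ> chart_inv c) has_derivative (\<lambda>w. frechet_derivative (Vc V c) (at (x, t)) (w, 0))) (at x)"
proof -
  have "((\<lambda>x. (x, t)) has_derivative (\<lambda>w. (w, 0))) (at x)" by (intro has_derivative_Pair has_derivative_ident has_derivative_const)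
  from has_derivative_compose[OF this Vc_has_derivative[OF assms, of t]]
  show ?thesis by (simp add: Vc_def o_def)
qed

lemma potential_differentiable:
  assumes "smooth_td_function A V" "c \<in> A" "p \<in> fst c"
  shows "((\<lambda>p. V p t) \<circ> chart_inv c) differentiable (at (snd c p))"
  using potential_has_derivative[OF assms(1,2) chart_mem[OF assms(2,3)]] by (auto simp: differentiable_def)

lemma gradient_coords:
  assumes "smooth_td_function A V" "c \<in> A" "x \<in> chart_image c"
  shows "G c x (gradient A g (\<lambda>p. V p t) (chart_inv c x) c) w = frechet_derivative (Vc V c) (at (x, t)) (w, 0)"
proof -
  let ?p = "chart_inv c x" and ?f = "\<lambda>p. V p t"
  have p: "?p \<in> fst c" by (rule chart_inv_mem[OF assms(2,3)])
  note T = tvec_of_tangent[OF assms(2) p, of w]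
  have gt: "gradient A g ?f ?p \<in> tangent_space A ?p"
    by (rule gradient_props(1)) (rule potential_differentiable[OF assms(1)])
  have "g ?p (gradient A g ?f ?p) (tvec_of A c ?p w) = frechet_derivative (?f \<circ> chart_inv c) (at (snd c ?p)) (tvec_of A c ?p w c)"
    by (rule gradient_props(2)[OF _ T assms(2) p]) (rule potential_differentiable[OF assms(1)])
  moreover have "frechet_derivative (?f \<circ> chart_inv c) (at x) = (\<lambda>w. frechet_derivative (Vc V c) (at (x, t)) (w, 0))"
    by (rule frechet_derivative_at'[OF potential_has_derivative[OF assms]])
  ultimately show ?thesis
    using metric_eq_G[OF assms(2) p gt T] by (simp add: chart_inv_right[OF assms(2,3)] tvec_of_same[OF assms(2) p])
qed

text \<open>The tensor field is smooth for fixed vectors, so its value at the moving velocity is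
  expanded in the basis; the gradient is smooth as the solution of a linear system with the
  coordinate metric as coefficients.\<close>

lemma smooth_acc:
  assumes F: "smooth_td_tensor_field A F" and V: "smooth_td_function A V" and c: "c \<in> A"
  shows "smooth_on (chart_image c \<times> UNIV \<times> UNIV) (\<lambda>z::'e \<times> real \<times> 'e. acc F V c (fst z) (fst (snd z)) (snd (snd z)))"
    (is "smooth_on ?S _")
proof -
  have S: "open ?S" using open_chart_image[OF c] by (intro open_Times open_UNIV)
  have US: "open (chart_image c \<times> (UNIV :: real set))" using open_chart_image[OF c] by (intro open_Times open_UNIV)
  have st: "smooth_on ?S (\<lambda>z. (fst z, fst (snd z)))"
    by (intro smooth_on_Pair S smooth_on_fst smooth_on_linear_compose[OF bounded_linear_fst] smooth_on_snd)
  have sv: "smooth_on ?S (\<lambda>z. snd (snd z))"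
    by (intro smooth_on_linear_compose[OF bounded_linear_snd] S smooth_on_snd)
  have Fb: "smooth_on ?S (\<lambda>z. Fc F c (fst z) (fst (snd z)) b)" for b
  proof -
    have "smooth_on (chart_image c \<times> UNIV) (\<lambda>(x, t). Fc F c x t b)"
      using F c unfolding smooth_td_tensor_field_def Fc_def by blast
    from smooth_on_compose[OF S US this st] show ?thesis by auto
  qed
  have sm: "smooth_on ?S (\<lambda>z. \<Sum>b\<in>Basis. (snd (snd z) \<bullet> b) *\<^sub>R Fc F c (fst z) (fst (snd z)) b)"
    by (intro smooth_on_sum smooth_on_scaleR smooth_on_linear_compose[OF bounded_linear_inner_left] S sv Fb finite_Basis)
  have eq: "(\<Sum>b\<in>Basis. (snd (snd z) \<bullet> b) *\<^sub>R Fc F c (fst z) (fst (snd z)) b) = Fc F c (fst z) (fst (snd z)) (snd (snd z))"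
    if "z \<in> ?S" for z
    using linear_basis_sum[OF linear_Fc[OF F c, of "fst z"], of "fst (snd z)" "snd (snd z)"] that by (auto simp: mem_Times_iff)
  have 1: "smooth_on ?S (\<lambda>z. Fc F c (fst z) (fst (snd z)) (snd (snd z)))"
    by (rule iffD1[OF smooth_on_cong[OF S eq] sm])
  have 2: "smooth_on ?S (\<lambda>z. gradient A g (\<lambda>p. V p (fst (snd z))) (chart_inv c (fst z)) c)"
  proof (rule smooth_on_linear_system[where a="\<lambda>z. G c (fst z)"
        and \<eta>="\<lambda>b z. frechet_derivative (Vc V c) (at (fst z, fst (snd z))) (b, 0)"])
    show "posdef (G c (fst z))" if "z \<in> ?S" for z using posdef_G[OF c, of "fst z"] that by (auto simp: mem_Times_iff)
    show "smooth_on ?S (\<lambda>z. G c (fst z) u w)" for u w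
      by (intro smooth_on_G_compose[OF c S smooth_on_fst smooth_on_const smooth_on_const]) auto
    show "smooth_on ?S (\<lambda>z. frechet_derivative (Vc V c) (at (fst z, fst (snd z))) (b, 0))" for b
      by (rule smooth_on_compose[OF S US smooth_on_frechet_derivative[OF smooth_Vc[OF V c]] st]) auto
    show "G c (fst z) (gradient A g (\<lambda>p. V p (fst (snd z))) (chart_inv c (fst z)) c) b =
        frechet_derivative (Vc V c) (at (fst z, fst (snd z))) (b, 0)" if "z \<in> ?S" for z b
      using that by (intro gradient_coords[OF V c]) (auto simp: mem_Times_iff)
  qed (rule S)
  show ?thesis unfolding acc_def by (intro smooth_on_diff S 1 2 smooth_christoffel[OF c])
qed

lemma trajectory_coords:
  assumes F: "smooth_td_tensor_field A F" and tr: "trajectory A g F V I \<gamma>"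
    and t: "t \<in> I" and c: "c \<in> A" "\<gamma> t \<in> fst c"
  shows "((\<lambda>s. snd c (\<gamma> s)) has_vector_derivative velocity A \<gamma> t c) (at t)"
    "((\<lambda>s. velocity A \<gamma> s c) has_vector_derivative acc F V c (snd c (\<gamma> t)) t (velocity A \<gamma> t c)) (at t)"
proof -
  have I: "open I" "smooth_curve A I \<gamma>" using tr by (auto simp: trajectory_def open_interval_def)
  show "((\<lambda>s. snd c (\<gamma> s)) has_vector_derivative velocity A \<gamma> t c) (at t)"
    using curve_has_velocity[OF I(2) c(1) t c(2)] by (simp add: o_def)
  have "covariant_derivative A g \<gamma> (velocity A \<gamma>) t c = F (\<gamma> t) t (velocity A \<gamma> t) c - gradient A g (\<lambda>p. V p t) (\<gamma> t) c"
    using tr t by (simp add: trajectory_def)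
  then have "vector_derivative (\<lambda>s. velocity A \<gamma> s c) (at t) = acc F V c (snd c (\<gamma> t)) t (velocity A \<gamma> t c)"
    using c tensor_coords[OF F c velocity_tangent[OF I t], of t]
    by (simp add: covariant_derivative_def acc_def chart_inv_left[OF c] algebra_simps)
  then show "((\<lambda>s. velocity A \<gamma> s c) has_vector_derivative acc F V c (snd c (\<gamma> t)) t (velocity A \<gamma> t c)) (at t)"
    using velocity_has_derivative[OF I c(1) t c(2)] by simp
qed

lemma potential_time_derivative:
  assumes "smooth_td_function A V" "c \<in> A" "x \<in> chart_image c"
  shows "deriv (\<lambda>s. V (chart_inv c x) s) t = frechet_derivative (Vc V c) (at (x, t)) (0, 1)"
proof -
  have "((\<lambda>s. (x, s)) has_derivative (\<lambda>w. (0, w))) (at t)" by (intro has_derivative_Pair has_derivative_ident has_derivative_const)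
  from has_derivative_compose[OF this Vc_has_derivative[OF assms, of t]]
  have "((\<lambda>s. V (chart_inv c x) s) has_derivative (\<lambda>w. frechet_derivative (Vc V c) (at (x, t)) (0, w))) (at t)"
    by (simp add: Vc_def)
  moreover have "(\<lambda>w. frechet_derivative (Vc V c) (at (x, t)) (0, w)) = (*) (frechet_derivative (Vc V c) (at (x, t)) (0, 1))"
  proof
    fix w
    show "frechet_derivative (Vc V c) (at (x, t)) (0, w) = frechet_derivative (Vc V c) (at (x, t)) (0, 1) * w"
      using linear_cmul[OF has_derivative_linear[OF Vc_has_derivative[OF assms, of t]], of w "(0, 1)"] by (simp add: mult.commute)
  qed
  ultimately have "DERIV (\<lambda>s. V (chart_inv c x) s) t :> frechet_derivative (Vc V c) (at (x, t)) (0, 1)"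
    unfolding has_field_derivative_def by (simp only:)
  then show ?thesis by (rule DERIV_imp_deriv)
qed

text \<open>Half the derivative of the metric along the velocity cancels the Christoffel term, by
  the Koszul formula with equal arguments, and the gradient term cancels the spatial part of the
  derivative of the potential. What remains is the work of \<open>F\<close> and the explicit time
  dependence.\<close>

lemma energy_derivative:
  assumes F: "smooth_td_tensor_field A F" and V: "smooth_td_function A V"
    and tr: "trajectory A g F V I \<gamma>" and t: "t \<in> I"
  shows "((\<lambda>t. g (\<gamma> t) (velocity A \<gamma> t) (velocity A \<gamma> t) / 2 + V (\<gamma> t) t) has_real_derivative
    g (\<gamma> t) (velocity A \<gamma> t) (F (\<gamma> t) t (velocity A \<gamma> t)) + deriv (\<lambda>s. V (\<gamma> t) s) t) (at t)"
proof -
  have I: "open I" "smooth_curve A I \<gamma>" using tr by (auto simp: trajectory_def open_interval_def)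
  obtain c where c: "c \<in> A" "\<gamma> t \<in> fst c" by (rule chart_cover)
  let ?x = "\<lambda>s. snd c (\<gamma> s)" and ?v = "\<lambda>s. velocity A \<gamma> s c"
  let ?a = "acc F V c (?x t) t (?v t)" and ?D = "frechet_derivative (Vc V c) (at (?x t, t))"
  define S where "S = {s \<in> I. \<gamma> s \<in> fst c}"
  have S: "open S" "t \<in> S" using open_curve_domain[OF I c(1)] t c by (auto simp: S_def)
  have xU: "?x s \<in> chart_image c" if "s \<in> S" for s using chart_mem[OF c(1)] that by (auto simp: S_def)
  note xt = xU[OF S(2)]
  note xd = trajectory_coords[OF F tr t c]
  have G: "((\<lambda>s. G c (?x s) (?v s) (?v s)) has_vector_derivative
      DG c (?x t) (?v t) (?v t) (?v t) + G c (?x t) ?a (?v t) + G c (?x t) (?v t) ?a) (at t)"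
    by (rule G_curve_derivative[where x="?x"]) (use c xt xd in auto)
  have linD: "linear ?D" by (rule has_derivative_linear[OF Vc_has_derivative[OF V c(1) xt]])
  have "((\<lambda>s. (?x s, s)) has_derivative (\<lambda>h. (h *\<^sub>R ?v t, h))) (at t)"
    using xd(1) by (intro has_derivative_Pair has_derivative_ident) (simp add: has_vector_derivative_def)
  from has_derivative_compose[OF this, of "Vc V c" ?D] Vc_has_derivative[OF V c(1) xt]
  have "((\<lambda>s. Vc V c (?x s, s)) has_derivative (\<lambda>h. ?D (h *\<^sub>R ?v t, h))) (at t)" by simp
  moreover have "?D (h *\<^sub>R ?v t, h) = h *\<^sub>R (?D (?v t, 0) + ?D (0, 1))" for h
    using linear_cmul[OF linD, of h "(?v t, 1)"] linear_add[OF linD, of "(?v t, 0)" "(0, 1)"] by simp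
  ultimately have Vd: "((\<lambda>s. Vc V c (?x s, s)) has_vector_derivative (?D (?v t, 0) + ?D (0, 1))) (at t)"
    by (simp add: has_vector_derivative_def)
  have sym: "G c (?x t) (?v t) ?a = G c (?x t) ?a (?v t)" by (rule G_sym[OF c(1) xt])
  have a: "G c (?x t) ?a (?v t) = G c (?x t) (Fc F c (?x t) t (?v t)) (?v t)
      - G c (?x t) (christoffel A g c (?x t) (?v t) (?v t)) (?v t) - ?D (?v t, 0)"
    by (simp add: acc_def G_linear(3)[OF c(1) xt] gradient_coords[OF V c(1) xt])
  have chr: "2 * G c (?x t) (christoffel A g c (?x t) (?v t) (?v t)) (?v t) = DG c (?x t) (?v t) (?v t) (?v t)"
    using christoffel_eq[OF c(1) xt, of "?v t" "?v t" "?v t"] by simp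
  note vt = velocity_tangent[OF I t]
  have gF: "g (\<gamma> t) (velocity A \<gamma> t) (F (\<gamma> t) t (velocity A \<gamma> t)) = G c (?x t) (Fc F c (?x t) t (?v t)) (?v t)"
    using metric_eq_G[OF c vt tensor_field(1)[OF F vt, of t]] tensor_coords[OF F c vt, of t] G_sym[OF c(1) xt] by simp
  have dt: "deriv (\<lambda>s. V (\<gamma> t) s) t = ?D (0, 1)"
    using potential_time_derivative[OF V c(1) xt, of t] by (simp add: chart_inv_left[OF c])
  have "((\<lambda>s. G c (?x s) (?v s) (?v s) / 2 + Vc V c (?x s, s)) has_vector_derivative
      (DG c (?x t) (?v t) (?v t) (?v t) + G c (?x t) ?a (?v t) + G c (?x t) (?v t) ?a) / 2 + (?D (?v t, 0) + ?D (0, 1))) (at t)"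
    by (intro has_vector_derivative_add has_vector_derivative_divide G Vd)
  moreover have "(DG c (?x t) (?v t) (?v t) (?v t) + G c (?x t) ?a (?v t) + G c (?x t) (?v t) ?a) / 2 + (?D (?v t, 0) + ?D (0, 1))
      = g (\<gamma> t) (velocity A \<gamma> t) (F (\<gamma> t) t (velocity A \<gamma> t)) + deriv (\<lambda>s. V (\<gamma> t) s) t"
    unfolding gF dt sym a using chr by (simp add: field_simps)
  ultimately have "((\<lambda>s. G c (?x s) (?v s) (?v s) / 2 + Vc V c (?x s, s)) has_vector_derivative
      g (\<gamma> t) (velocity A \<gamma> t) (F (\<gamma> t) t (velocity A \<gamma> t)) + deriv (\<lambda>s. V (\<gamma> t) s) t) (at t)" by simp
  from has_vector_derivative_transform_within_open[OF this S]
  have "((\<lambda>t. g (\<gamma> t) (velocity A \<gamma> t) (velocity A \<gamma> t) / 2 + V (\<gamma> t) t) has_vector_derivative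
      g (\<gamma> t) (velocity A \<gamma> t) (F (\<gamma> t) t (velocity A \<gamma> t)) + deriv (\<lambda>s. V (\<gamma> t) s) t) (at t)"
    using metric_eq_G[OF c(1) _ velocity_tangent[OF I] velocity_tangent[OF I]] chart_inv_left[OF c(1)]
    by (simp add: S_def Vc_def)
  then show ?thesis by (simp add: has_real_derivative_iff_has_vector_derivative)
qed

section \<open>Self-adjoint part of the tensor and the energy estimate\<close>

lemma adjoint_props:
  assumes F: "smooth_td_tensor_field A F" and v: "v \<in> tangent_space A p"
  shows "adjoint_at A g F p t v \<in> tangent_space A p"
    "u \<in> tangent_space A p \<Longrightarrow> g p (adjoint_at A g F p t v) u = g p v (F p t u)"
proof -
  obtain c where c: "c \<in> A" "p \<in> fst c" by (rule chart_cover)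
  have x: "snd c p \<in> chart_image c" by (rule chart_mem[OF c])
  have "linear (\<lambda>u. G c (snd c p) (v c) (Fc F c (snd c p) t u))"
    using linear_Fc[OF F c(1) x, of t] by (intro linearI) (simp_all add: linear_add linear_cmul G_linear[OF c(1) x])
  from posdef_Riesz[OF posdef_G[OF c(1) x] this]
  obtain z where z: "\<And>u. G c (snd c p) z u = G c (snd c p) (v c) (Fc F c (snd c p) t u)"
    and zu: "\<And>y. (\<And>u. G c (snd c p) y u = G c (snd c p) (v c) (Fc F c (snd c p) t u)) \<Longrightarrow> y = z" by metis
  have gF: "g p v (F p t u) = G c (snd c p) (v c) (Fc F c (snd c p) t (u c))" if "u \<in> tangent_space A p" for u
    using metric_eq_G[OF c v tensor_field(1)[OF F that]] tensor_coords[OF F c that] by simp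
  have "\<exists>!w. w \<in> tangent_space A p \<and> (\<forall>u\<in>tangent_space A p. g p w u = g p v (F p t u))"
  proof (rule ex1I[of _ "tvec_of A c p z"], intro conjI ballI)
    show "tvec_of A c p z \<in> tangent_space A p" by (rule tvec_of_tangent[OF c])
    fix u assume u: "u \<in> tangent_space A p"
    show "g p (tvec_of A c p z) u = g p v (F p t u)"
      using metric_eq_G[OF c tvec_of_tangent[OF c] u, of z] gF[OF u] z by (simp add: tvec_of_same[OF c])
  next
    fix w assume w: "w \<in> tangent_space A p \<and> (\<forall>u\<in>tangent_space A p. g p w u = g p v (F p t u))"
    have "G c (snd c p) (w c) u = G c (snd c p) (v c) (Fc F c (snd c p) t u)" for u
      using w gF[OF tvec_of_tangent[OF c, of u]] metric_eq_G[OF c _ tvec_of_tangent[OF c, of u], of w] tvec_of_tangent[OF c, of u]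
      by (simp add: tvec_of_same[OF c])
    then have "w c = z" by (rule zu)
    then show "w = tvec_of A c p z" using tangent_eq_tvec_of[OF c, of w] w by blast
  qed
  from theI'[OF this] show "adjoint_at A g F p t v \<in> tangent_space A p"
    "u \<in> tangent_space A p \<Longrightarrow> g p (adjoint_at A g F p t v) u = g p v (F p t u)"
    unfolding adjoint_at_def by blast+
qed

text \<open>The adjoint has the same quadratic form, so the skew-adjoint part of \<open>F\<close>
  does no work.\<close>

lemma self_adjoint_form:
  assumes F: "smooth_td_tensor_field A F" and v: "v \<in> tangent_space A p"
  shows "g p v (self_adjoint_part A g F p t v) = g p v (F p t v)"
proof -
  note Fv = tensor_field(1)[OF F v, of t] and a = adjoint_props[OF F v, where t=t]
  have "g p v (self_adjoint_part A g F p t v) = 1 / 2 * (g p v (F p t v) + g p v (adjoint_at A g F p t v))"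
    unfolding self_adjoint_part_def
    using metric_linear_right(2)[OF tangent_add[OF Fv a(1)] v v, of "1/2"] metric_linear_right(1)[OF Fv a(1) v] by simp
  also have "g p v (adjoint_at A g F p t v) = g p v (F p t v)"
    using metricD(1)[OF v a(1) v] a(2)[OF v] by simp
  finally show ?thesis by simp
qed

text \<open>By homogeneity the claim reduces to unit vectors, where the value lies between
  \<open>S_inf\<close> and \<open>S_sup\<close>; the real bound on their absolute values makes both
  finite and confines them to the interval from \<open>- N\<close> to \<open>N\<close>.\<close>

lemma tensor_bound:
  assumes F: "smooth_td_tensor_field A F" and v: "v \<in> tangent_space A p"
    and N: "S_norm A g (self_adjoint_part A g F) t \<le> ereal N"
  shows "\<bar>g p v (F p t v)\<bar> \<le> N * g p v v"
proof (cases "v = tzero")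
  case True
  have "g p (tscale 0 v) w = 0 * g p v w" if "w \<in> tangent_space A p" for w using metricD(3)[OF v that that] .
  then show ?thesis using True v tensor_field(1)[OF F v] by simp
next
  case False
  let ?S = "self_adjoint_part A g F"
  have unit: "\<bar>g p u (?S p t u)\<bar> \<le> N" if u: "u \<in> tangent_space A p" "g p u u = 1" for u
  proof -
    have m: "(p, u) \<in> unit_bundle A g" using u by (simp add: unit_bundle_def)
    have sup: "ereal (g p u (?S p t u)) \<le> S_sup A g ?S t"
      unfolding S_sup_def by (rule SUP_upper2[OF m]) simp
    have inf: "S_inf A g ?S t \<le> ereal (g p u (?S p t u))"
      unfolding S_inf_def by (rule INF_lower2[OF m]) simp
    have ab: "\<bar>S_sup A g ?S t\<bar> \<le> ereal N" "\<bar>S_inf A g ?S t\<bar> \<le> ereal N" using N by (auto simp: S_norm_def)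
    have "ereal (g p u (?S p t u)) \<le> ereal N"
      using sup ab(1) by (cases "S_sup A g ?S t") auto
    moreover have "ereal (- N) \<le> ereal (g p u (?S p t u))"
      using inf ab(2) by (cases "S_inf A g ?S t") auto
    ultimately show ?thesis by (simp add: abs_le_iff)
  qed
  define n where "n = sqrt (g p v v)"
  have n: "n > 0" "n * n = g p v v" using metricD(4)[OF v v v False] by (simp_all add: n_def)
  let ?u = "tscale (1 / n) v"
  have uT: "?u \<in> tangent_space A p" by (rule tangent_scale[OF v])
  have sc: "g p ?u w = 1 / n * g p v w" if "w \<in> tangent_space A p" for w by (rule metricD(3)[OF v that that])
  have "g p ?u ?u = 1 / n * (1 / n * g p v v)" using sc[OF uT] metric_linear_right(2)[OF v v v] by simp
  also have "\<dots> = 1" using n(1) unfolding n(2)[symmetric] by simp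
  finally have "\<bar>g p ?u (?S p t ?u)\<bar> \<le> N" using unit[OF uT] by blast
  then have "\<bar>g p ?u (F p t ?u)\<bar> \<le> N" by (simp add: self_adjoint_form[OF F uT])
  moreover have "g p ?u (F p t ?u) = 1 / n * (1 / n * g p v (F p t v))"
  proof -
    have "g p ?u (F p t ?u) = 1 / n * g p v (F p t ?u)" by (rule sc[OF tensor_field(1)[OF F uT]])
    also have "g p v (F p t ?u) = 1 / n * g p v (F p t v)"
      unfolding tensor_field(3)[OF F v] by (rule metric_linear_right(2)[OF tensor_field(1)[OF F v] v v])
    finally show ?thesis .
  qed
  ultimately have "\<bar>g p v (F p t v)\<bar> / (n * n) \<le> N" using n(1) by (simp add: abs_mult)
  then show ?thesis unfolding n(2)[symmetric] using n(1) by (simp add: pos_divide_le_eq)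
qed

text \<open>Because the absolute value of the derivative is bounded,
  \<open>W s * exp (- C * s)\<close> is nonincreasing and \<open>W s * exp (C * s)\<close> is
  nondecreasing, which controls \<open>W\<close> on both sides of \<open>t0\<close>.\<close>

lemma gronwall:
  fixes W W' :: "real \<Rightarrow> real"
  assumes d: "\<And>s. s \<in> closed_segment t0 t \<Longrightarrow> (W has_real_derivative W' s) (at s)"
    and b: "\<And>s. s \<in> closed_segment t0 t \<Longrightarrow> \<bar>W' s\<bar> \<le> C * W s"
  shows "W t \<le> W t0 * exp (C * \<bar>t - t0\<bar>)"
proof (cases "t0 \<le> t")
  case True
  have "W t * exp (- C * t) \<le> W t0 * exp (- C * t0)"
  proof (rule DERIV_nonpos_imp_nonincreasing[OF True])
    fix s assume s: "t0 \<le> s" "s \<le> t"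
    then have m: "s \<in> closed_segment t0 t" using True by (simp add: closed_segment_eq_real_ivl)
    have "((\<lambda>s. W s * exp (- C * s)) has_real_derivative (W' s - C * W s) * exp (- C * s)) (at s)"
      using d[OF m] by (auto intro!: derivative_eq_intros simp: algebra_simps)
    moreover have "(W' s - C * W s) * exp (- C * s) \<le> 0" using b[OF m] by (intro mult_nonpos_nonneg) auto
    ultimately show "\<exists>y. ((\<lambda>s. W s * exp (- C * s)) has_real_derivative y) (at s) \<and> y \<le> 0" by blast
  qed
  then have "W t * exp (- C * t) * exp (C * t) \<le> W t0 * exp (- C * t0) * exp (C * t)" by (intro mult_right_mono) auto
  then show ?thesis using True by (simp add: mult.assoc exp_add[symmetric] algebra_simps)
next
  case False
  then have le: "t \<le> t0" by simp
  have "W t * exp (C * t) \<le> W t0 * exp (C * t0)"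
  proof (rule DERIV_nonneg_imp_nondecreasing[OF le])
    fix s assume s: "t \<le> s" "s \<le> t0"
    then have m: "s \<in> closed_segment t0 t" using le by (simp add: closed_segment_eq_real_ivl)
    have "((\<lambda>s. W s * exp (C * s)) has_real_derivative (W' s + C * W s) * exp (C * s)) (at s)"
      using d[OF m] by (auto intro!: derivative_eq_intros simp: algebra_simps)
    moreover have "(W' s + C * W s) * exp (C * s) \<ge> 0" using b[OF m] by (intro mult_nonneg_nonneg) auto
    ultimately show "\<exists>y. ((\<lambda>s. W s * exp (C * s)) has_real_derivative y) (at s) \<and> y \<ge> 0" by blast
  qed
  then have "W t * exp (C * t) * exp (- C * t) \<le> W t0 * exp (C * t0) * exp (- C * t)" by (intro mult_right_mono) auto
  then show ?thesis using False by (simp add: mult.assoc exp_add[symmetric] algebra_simps)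
qed

text \<open>Gronwall's inequality for the energy above a constant \<open>m\<close>. As
  \<open>m\<close> is below \<beta> on the interval, \<open>V - \<beta>\<close> and half the squared
  speed are both at most \<open>W\<close>, so both terms of the energy rate are bounded by multiples
  of \<open>W\<close>.\<close>

lemma speed_bounded:
  assumes F: "smooth_td_tensor_field A F" and V: "smooth_td_function A V"
    and tr: "trajectory A g F V I \<gamma>" and T: "T > 0"
    and N: "\<And>t. t \<in> {-T..T} \<Longrightarrow> S_norm A g (self_adjoint_part A g F) t \<le> ereal N"
    and beta: "continuous_on UNIV \<beta>" "\<And>p t. V p t \<ge> \<beta> t"
    and alpha: "continuous_on UNIV \<alpha>" "\<And>p t. \<bar>deriv (\<lambda>s. V p s) t\<bar> \<le> \<alpha> t * (V p t - \<beta> t)"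
  obtains K where "\<And>t. t \<in> I \<Longrightarrow> t \<in> {-T..T} \<Longrightarrow> g (\<gamma> t) (velocity A \<gamma> t) (velocity A \<gamma> t) \<le> K"
proof (cases "I \<inter> {-T..T} = {}")
  case True then show ?thesis using that by blast
next
  case False
  then obtain t0 where t0: "t0 \<in> I" "t0 \<in> {-T..T}" by blast
  have I: "open I" "smooth_curve A I \<gamma>" "is_interval I" using tr by (auto simp: trajectory_def open_interval_def)
  let ?k = "\<lambda>t. g (\<gamma> t) (velocity A \<gamma> t) (velocity A \<gamma> t)"
  have k0: "?k t \<ge> 0" if "t \<in> I" for t using metric_nonneg[OF velocity_tangent[OF I(1,2) that]] .
  obtain m where m: "\<And>t. t \<in> {-T..T} \<Longrightarrow> m \<le> \<beta> t"
  proof -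
    have "continuous_on {-T..T} (\<lambda>t. - \<beta> t)" using beta(1) by (intro continuous_intros) (auto intro: continuous_on_subset)
    then obtain b where "\<And>t. t \<in> {-T..T} \<Longrightarrow> - \<beta> t \<le> b" using continuous_bounded_above[OF compact_Icc] by blast
    then show ?thesis using that[of "- b"] by force
  qed
  obtain a where a: "a \<ge> 0" "\<And>t. t \<in> {-T..T} \<Longrightarrow> \<alpha> t \<le> a"
    using continuous_bounded_above[OF compact_Icc continuous_on_subset[OF alpha(1)]] by blast
  \<comment> \<open>The 2 appears because the kinetic energy is half of the squared speed;
    \<open>max N 0\<close> makes the factor nonnegative, as the monotonicity steps require.\<close>
  define C where "C = 2 * max N 0 + a"
  define W where "W t = ?k t / 2 + V (\<gamma> t) t - m" for t
  define W' where "W' t = g (\<gamma> t) (velocity A \<gamma> t) (F (\<gamma> t) t (velocity A \<gamma> t)) + deriv (\<lambda>s. V (\<gamma> t) s) t" for t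
  have Wd: "(W has_real_derivative W' t) (at t)" if "t \<in> I" for t
    unfolding W_def W'_def using DERIV_diff[OF energy_derivative[OF F V tr that] DERIV_const[of m]] by simp
  have kW: "?k t \<le> 2 * W t" if "t \<in> I" "t \<in> {-T..T}" for t
    using m[OF that(2)] beta(2)[where p="\<gamma> t" and t=t] by (simp add: W_def)
  have Wb: "\<bar>W' t\<bar> \<le> C * W t" if t: "t \<in> I" "t \<in> {-T..T}" for t
  proof -
    have "\<bar>g (\<gamma> t) (velocity A \<gamma> t) (F (\<gamma> t) t (velocity A \<gamma> t))\<bar> \<le> N * ?k t"
      by (rule tensor_bound[OF F velocity_tangent[OF I(1,2) t(1)] N[OF t(2)]])
    also have "\<dots> \<le> max N 0 * ?k t" using k0[OF t(1)] by (intro mult_right_mono) auto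
    also have "\<dots> \<le> max N 0 * (2 * W t)" using kW[OF t] by (intro mult_left_mono) auto
    finally have 1: "\<bar>g (\<gamma> t) (velocity A \<gamma> t) (F (\<gamma> t) t (velocity A \<gamma> t))\<bar> \<le> max N 0 * (2 * W t)" .
    have "\<bar>deriv (\<lambda>s. V (\<gamma> t) s) t\<bar> \<le> \<alpha> t * (V (\<gamma> t) t - \<beta> t)" by (rule alpha(2))
    also have "\<dots> \<le> a * (V (\<gamma> t) t - \<beta> t)"
      using a(2)[OF t(2)] beta(2)[where p="\<gamma> t" and t=t] by (intro mult_right_mono) auto
    also have "\<dots> \<le> a * W t" using m[OF t(2)] k0[OF t(1)] a(1) by (intro mult_left_mono) (auto simp: W_def)
    finally have "\<bar>deriv (\<lambda>s. V (\<gamma> t) s) t\<bar> \<le> a * W t" .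
    with 1 have "\<bar>W' t\<bar> \<le> max N 0 * (2 * W t) + a * W t" unfolding W'_def by linarith
    then show ?thesis by (simp add: C_def algebra_simps)
  qed
  have W0: "W t0 \<ge> 0" using kW[OF t0] k0[OF t0(1)] by linarith
  show ?thesis
  proof (rule that)
    fix t assume t: "t \<in> I" "t \<in> {-T..T}"
    have seg: "s \<in> I \<and> s \<in> {-T..T}" if "s \<in> closed_segment t0 t" for s
    proof -
      have "convex I" using I(3) by (rule is_interval_convex)
      then have "closed_segment t0 t \<subseteq> I" using t0 t by (simp add: closed_segment_subset)
      moreover have "closed_segment t0 t \<subseteq> {-T..T}" using t0 t by (intro closed_segment_subset) auto
      ultimately show ?thesis using that by blast
    qed
    have "W t \<le> W t0 * exp (C * \<bar>t - t0\<bar>)" by (rule gronwall[of t0 t W W']) (use seg Wd Wb in auto)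
    also have "\<dots> \<le> W t0 * exp (C * (2 * T))"
      using t0 t a(1) W0 by (intro mult_left_mono) (auto simp: C_def intro!: mult_left_mono)
    finally show "?k t \<le> 2 * (W t0 * exp (C * (2 * T)))" using kW[OF t] by linarith
  qed
qed

text \<open>Slowing the curve down by the factor \<open>\<sigma>\<close> gives speed at most one on
  an interval that is still bounded, so \<open>slow_curve_converges\<close> applies. The maximum
  with 1 keeps the factor positive.\<close>

lemma bounded_speed_converges:
  assumes "complete_riemannian A g" and I: "open I" "smooth_curve A I \<gamma>" and aT: "a < T" "{a..<T} \<subseteq> I"
    and K: "\<And>t. t \<in> {a..<T} \<Longrightarrow> g (\<gamma> t) (velocity A \<gamma> t) (velocity A \<gamma> t) \<le> K"
  obtains q where "(\<gamma> \<longlongrightarrow> q) (at_left T)"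
proof -
  define \<sigma> where "\<sigma> = sqrt (max K 1)"
  have \<sigma>: "\<sigma> > 0" "\<sigma>\<^sup>2 = max K 1" by (simp_all add: \<sigma>_def)
  let ?\<delta> = "\<lambda>s. \<gamma> (a + s / \<sigma>)"
  define b where "b = \<sigma> * (T - a)"
  have b: "b > 0" using \<sigma> aT by (simp add: b_def)
  have m: "a + s / \<sigma> \<in> {a..<T}" if "s \<in> {0..<b}" for s using that \<sigma> by (auto simp: b_def field_simps)
  have "slow {0..<b} ?\<delta>"
  proof (rule slowI)
    fix s assume s: "s \<in> {0..<b}"
    let ?t = "a + s / \<sigma>"
    have t: "?t \<in> {a..<T}" "?t \<in> I" using m[OF s] aT by auto
    obtain c where c: "c \<in> A" "\<gamma> ?t \<in> fst c" by (rule chart_cover)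
    have xt: "snd c (\<gamma> ?t) \<in> chart_image c" by (rule chart_mem[OF c])
    have "slow_at c {0..<b} ?\<delta> s"
    proof (rule slow_at_derivative[where \<gamma>="?\<delta>" and t=s, OF c])
      have "((\<lambda>s. a + s / \<sigma>) \<longlongrightarrow> ?t) (at s within {0..<b})" by (intro tendsto_intros) (use \<sigma> in auto)
      from topological_tendstoD[OF this open_curve_domain[OF I c(1)]] t c
      have "\<forall>\<^sub>F s in at s within {0..<b}. a + s / \<sigma> \<in> {t \<in> I. \<gamma> t \<in> fst c}" by simp
      then show "\<forall>\<^sub>F s in at s within {0..<b}. ?\<delta> s \<in> fst c" by eventually_elim simp
      have "((\<lambda>s. a + s / \<sigma>) has_vector_derivative 1 / \<sigma>) (at s)" by (auto intro!: derivative_eq_intros)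
      moreover have "((snd c \<circ> \<gamma>) has_vector_derivative velocity A \<gamma> ?t c) (at ?t)" by (rule curve_has_velocity[OF I(2) c(1) t(2) c(2)])
      ultimately have "((snd c \<circ> \<gamma> \<circ> (\<lambda>s. a + s / \<sigma>)) has_vector_derivative (1 / \<sigma>) *\<^sub>R velocity A \<gamma> ?t c) (at s)"
        by (rule vector_diff_chain_at)
      then show "((\<lambda>s. snd c (?\<delta> s)) has_vector_derivative (1 / \<sigma>) *\<^sub>R velocity A \<gamma> ?t c) (at s within {0..<b})"
        by (simp add: o_def has_vector_derivative_at_within)
      have "G c (snd c (\<gamma> ?t)) ((1 / \<sigma>) *\<^sub>R velocity A \<gamma> ?t c) ((1 / \<sigma>) *\<^sub>R velocity A \<gamma> ?t c) = g (\<gamma> ?t) (velocity A \<gamma> ?t) (velocity A \<gamma> ?t) / \<sigma>\<^sup>2"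
        using metric_eq_G[OF c velocity_tangent[OF I t(2)] velocity_tangent[OF I t(2)]]
        by (simp add: posdef_linear(5,6)[OF posdef_G[OF c(1) xt]] power2_eq_square)
      also have "\<dots> \<le> 1" using K[OF t(1)] by (simp add: \<sigma>(2) divide_le_eq_1 less_max_iff_disj le_max_iff_disj)
      finally show "G c (snd c (\<gamma> ?t)) ((1 / \<sigma>) *\<^sub>R velocity A \<gamma> ?t c) ((1 / \<sigma>) *\<^sub>R velocity A \<gamma> ?t c) \<le> 1" .
    qed
    then show "\<exists>c\<in>A. ?\<delta> s \<in> fst c \<and> slow_at c {0..<b} ?\<delta> s" using c by blast
  qed
  then obtain q where q: "(?\<delta> \<longlongrightarrow> q) (at_left b)" by (rule slow_curve_converges[OF assms(1) b])
  have "filterlim (\<lambda>t. \<sigma> * (t - a)) (at_left b) (at_left T)"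
    unfolding filterlim_at
  proof
    show "((\<lambda>t. \<sigma> * (t - a)) \<longlongrightarrow> b) (at_left T)" unfolding b_def by (intro tendsto_intros)
    show "\<forall>\<^sub>F t in at_left T. \<sigma> * (t - a) \<in> {..<b} \<and> \<sigma> * (t - a) \<noteq> b"
      using \<sigma> by (auto simp: eventually_at_filter b_def)
  qed
  from filterlim_compose[OF q this] have "((\<lambda>t. \<gamma> (a + \<sigma> * (t - a) / \<sigma>)) \<longlongrightarrow> q) (at_left T)" .
  then have "(\<gamma> \<longlongrightarrow> q) (at_left T)" using \<sigma> by simp
  then show ?thesis by (rule that)
qed

end

section \<open>Extending trajectories\<close>

text \<open>The operator norm of the derivative is at most the sum of the norms of its values on the
  basis, and this sum is continuous, hence bounded on the compact set. Convexity serves the mean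
  value inequality.\<close>

lemma smooth_on_compact_bounds:
  fixes f :: "'x::euclidean_space \<Rightarrow> 'y::real_normed_vector"
  assumes "smooth_on S f" "compact C" "C \<subseteq> S"
  obtains M L where "M \<ge> 0" "L \<ge> 0" "\<And>x. x \<in> C \<Longrightarrow> norm (f x) \<le> M"
    "\<And>x y. convex C \<Longrightarrow> x \<in> C \<Longrightarrow> y \<in> C \<Longrightarrow> norm (f x - f y) \<le> L * norm (x - y)"
proof -
  obtain M where M: "M \<ge> 0" "\<And>x. x \<in> C \<Longrightarrow> norm (f x) \<le> M"
    using continuous_bounded_above[OF assms(2) continuous_on_norm[OF continuous_on_subset[OF smooth_on_continuous[OF assms(1)] assms(3)]]]
    by blast
  have "continuous_on C (\<lambda>x. \<Sum>b\<in>Basis. norm (frechet_derivative f (at x) b))"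
    by (intro continuous_on_sum continuous_on_norm
        continuous_on_subset[OF smooth_on_continuous[OF smooth_on_frechet_derivative[OF assms(1)]] assms(3)])
  from continuous_bounded_above[OF assms(2) this] obtain L where L: "L \<ge> 0"
    "\<And>x. x \<in> C \<Longrightarrow> (\<Sum>b\<in>Basis. norm (frechet_derivative f (at x) b)) \<le> L" by blast
  have "norm (f x - f y) \<le> L * norm (x - y)" if C: "convex C" "x \<in> C" "y \<in> C" for x y
  proof (rule differentiable_bound[OF C(1) _ _ C(2,3)])
    fix z assume z: "z \<in> C"
    have d: "(f has_derivative frechet_derivative f (at z)) (at z)"
      using z assms(3) by (intro smooth_on_has_derivative[OF assms(1)]) auto
    then show "(f has_derivative frechet_derivative f (at z)) (at z within C)" by (rule has_derivative_at_withinI)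
    show "onorm (frechet_derivative f (at z)) \<le> L"
    proof (rule onorm_le)
      fix u
      have "norm (frechet_derivative f (at z) u) = norm (\<Sum>b\<in>Basis. (u \<bullet> b) *\<^sub>R frechet_derivative f (at z) b)"
        using linear_basis_sum[OF has_derivative_linear[OF d], of u] by simp
      also have "\<dots> \<le> (\<Sum>b\<in>Basis. norm u * norm (frechet_derivative f (at z) b))"
        by (intro order_trans[OF norm_sum] sum_mono) (auto intro!: mult_right_mono Basis_le_norm)
      also have "\<dots> \<le> L * norm u"
        unfolding sum_distrib_left[symmetric] using L(2)[OF z] by (simp add: mult.commute[of L] mult_left_mono)
      finally show "norm (frechet_derivative f (at z) u) \<le> L * norm u" .
    qed
  qed
  with M L show ?thesis by (intro that[of M L]) auto
qed

text \<open>A bounded derivative makes \<open>f\<close> Lipschitz, and uniformly continuous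
  functions extend to the closure.\<close>

lemma bounded_derivative_has_limit:
  fixes f :: "real \<Rightarrow> 'y::banach"
  assumes "a < b" "\<And>t. t \<in> {a..<b} \<Longrightarrow> (f has_vector_derivative f' t) (at t)"
    "\<And>t. t \<in> {a..<b} \<Longrightarrow> norm (f' t) \<le> M"
  obtains l where "(f \<longlongrightarrow> l) (at_left b)"
proof -
  have lip: "norm (f s - f t) \<le> (max M 1) * norm (s - t)" if st: "s \<in> {a..<b}" "t \<in> {a..<b}" for s t
  proof (rule differentiable_bound[of "{a..<b}" f "\<lambda>u s. s *\<^sub>R f' u"])
    show "(f has_derivative (\<lambda>s. s *\<^sub>R f' u)) (at u within {a..<b})" if "u \<in> {a..<b}" for u
      using has_vector_derivative_at_within[OF assms(2)[OF that]] by (simp add: has_vector_derivative_def)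
    show "onorm (\<lambda>s. s *\<^sub>R f' u) \<le> max M 1" if u: "u \<in> {a..<b}" for u
    proof (rule onorm_le)
      fix s :: real
      have "norm (s *\<^sub>R f' u) \<le> \<bar>s\<bar> * max M 1"
        using assms(3)[OF u] by (auto intro!: mult_left_mono)
      then show "norm (s *\<^sub>R f' u) \<le> max M 1 * norm s" by (simp add: mult.commute)
    qed
  qed (use st in auto)
  have "uniformly_continuous_on {a..<b} f"
    unfolding uniformly_continuous_on_def
  proof (intro allI impI)
    fix e :: real assume "e > 0"
    show "\<exists>d>0. \<forall>x\<in>{a..<b}. \<forall>x'\<in>{a..<b}. dist x' x < d \<longrightarrow> dist (f x') (f x) < e"
    proof (intro exI[of _ "e / max M 1"] conjI ballI impI)
      show "e / max M 1 > 0" using \<open>e > 0\<close> by simp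
      fix s t assume st: "s \<in> {a..<b}" "t \<in> {a..<b}" "dist t s < e / max M 1"
      have "dist (f t) (f s) \<le> max M 1 * dist t s" using lip[OF st(2,1)] by (simp add: dist_norm)
      also have "\<dots> < e" using st(3) by (simp add: pos_less_divide_eq mult.commute)
      finally show "dist (f t) (f s) < e" .
    qed
  qed
  moreover have "b \<in> closure {a..<b}" using \<open>a < b\<close> by simp
  ultimately obtain l where "(f \<longlongrightarrow> l) (at b within {a..<b})"
    using uniformly_continuous_on_extension_at_closure by blast
  moreover have "at_left b = at b within {a..<b}" using \<open>a < b\<close> by (intro at_within_nhd[of _ "{a<..}"]) auto
  ultimately show ?thesis using that by simp
qed

context riemannian
begin

lemma smooth_curve_in_chart:
  assumes "open S" "c \<in> A" "\<And>t. t \<in> S \<Longrightarrow> \<delta> t \<in> fst c" "smooth_on S (\<lambda>t. snd c (\<delta> t))"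
  shows "smooth_curve A S \<delta>"
proof -
  have xU: "snd c (\<delta> t) \<in> chart_image c" if "t \<in> S" for t using chart_mem[OF assms(2,3)] that by simp
  have eq: "chart_inv c (snd c (\<delta> t)) = \<delta> t" if "t \<in> S" for t by (rule chart_inv_left[OF assms(2) assms(3)[OF that]])
  have "continuous_on S (\<lambda>t. chart_inv c (snd c (\<delta> t)))"
    by (rule continuous_on_compose2[OF continuous_on_chart_inv[OF assms(2)] smooth_on_continuous[OF assms(4)]]) (use xU in auto)
  then have cont: "continuous_on S \<delta>" using eq by (simp cong: continuous_on_cong)
  have "smooth_on {t \<in> S. \<delta> t \<in> fst d} (snd d \<circ> \<delta>)" if d: "d \<in> A" for d
  proof -
    have "{t \<in> S. \<delta> t \<in> fst d} = S \<inter> \<delta> -` fst d" by auto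
    then have op: "open {t \<in> S. \<delta> t \<in> fst d}"
      using continuous_open_preimage[OF cont assms(1) open_chart[OF d]] by simp
    have "smooth_on {t \<in> S. \<delta> t \<in> fst d} (\<lambda>t. (snd d \<circ> chart_inv c) (snd c (\<delta> t)))"
    proof (rule smooth_on_compose[OF op transition_domain(1)[OF assms(2) d] smooth_transition[OF assms(2) d]])
      show "smooth_on {t \<in> S. \<delta> t \<in> fst d} (\<lambda>t. snd c (\<delta> t))" by (rule smooth_on_subset[OF assms(4)]) auto
      show "snd c (\<delta> t) \<in> snd c ` (fst c \<inter> fst d)" if "t \<in> {t \<in> S. \<delta> t \<in> fst d}" for t using that assms(3) by auto
    qed
    then show ?thesis by (subst smooth_on_cong[OF op, of _ "\<lambda>t. (snd d \<circ> chart_inv c) (snd c (\<delta> t))"]) (use eq in auto)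
  qed
  with cont show ?thesis by (simp add: smooth_curve_def)
qed

text \<open>Convergence of the position is not yet convergence of the velocity. In a chart around
  the limit the velocity is bounded, so the equation bounds its derivative and it converges as well.
  The limits are initial data for a local solution of the first-order system for position and
  velocity.\<close>

lemma trajectory_continues:
  assumes F: "smooth_td_tensor_field A F" and V: "smooth_td_function A V"
    and tr: "trajectory A g F V I \<gamma>" and aT: "a < T" "{a..<T} \<subseteq> I"
    and speed: "\<And>t. t \<in> {a..<T} \<Longrightarrow> g (\<gamma> t) (velocity A \<gamma> t) (velocity A \<gamma> t) \<le> k"
    and lim: "(\<gamma> \<longlongrightarrow> q) (at_left T)"
  obtains c a2 e x v where "c \<in> A" "a \<le> a2" "a2 < T" "e > 0"
    "\<And>t. t \<in> {a2<..<T} \<Longrightarrow> \<gamma> t \<in> fst c \<and> x t = snd c (\<gamma> t)"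
    "\<And>t. t \<in> {a2<..<T + e} \<Longrightarrow> x t \<in> chart_image c"
    "\<And>t. t \<in> {a2<..<T + e} \<Longrightarrow> (x has_vector_derivative v t) (at t)"
    "\<And>t. t \<in> {a2<..<T + e} \<Longrightarrow> (v has_vector_derivative acc F V c (x t) t (v t)) (at t)"
proof -
  have I: "open I" "smooth_curve A I \<gamma>" using tr by (auto simp: trajectory_def open_interval_def)
  obtain c where c: "c \<in> A" "q \<in> fst c" by (rule chart_cover)
  define xq where "xq = snd c q"
  obtain r K where gb: "good_ball c xq r K" using good_ball_exists[OF c(1) chart_mem[OF c]] unfolding xq_def .
  note gD = good_ballD[OF gb]
  have "q \<in> {p \<in> fst c. snd c p \<in> ball xq r}" using c gD(2) by (simp add: xq_def)
  from topological_tendstoD[OF lim chart_ball_open(1)[OF gD(1,4)] this]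
  obtain a' where a': "a' < T" "\<And>t. a' < t \<Longrightarrow> t < T \<Longrightarrow> \<gamma> t \<in> fst c \<and> snd c (\<gamma> t) \<in> ball xq r"
    unfolding eventually_at_left_field by auto
  define a2 where "a2 = (max a a' + T) / 2"
  have a2: "a \<le> a2" "a' < a2" "a2 < T" using a'(1) aT(1) by (auto simp: a2_def)
  define x0 v0 where "x0 t = snd c (\<gamma> t)" and "v0 t = velocity A \<gamma> t c" for t
  have m0: "t \<in> I" "t \<in> {a..<T}" "\<gamma> t \<in> fst c" "x0 t \<in> cball xq r" "x0 t \<in> chart_image c" if "t \<in> {a2..<T}" for t
    using a'(2)[of t] that a2 aT(2) gD(4) by (auto simp: x0_def)
  have d0: "(x0 has_vector_derivative v0 t) (at t)" "(v0 has_vector_derivative acc F V c (x0 t) t (v0 t)) (at t)"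
    if "t \<in> {a2..<T}" for t
    using trajectory_coords[OF F tr m0(1)[OF that] c(1) m0(3)[OF that]] by (simp_all add: x0_def[abs_def] v0_def[abs_def])
  define Mv where "Mv = sqrt (K * max k 0)"
  have v0b: "norm (v0 t) \<le> Mv" if "t \<in> {a2..<T}" for t
  proof -
    have "(norm (v0 t))\<^sup>2 \<le> K * G c (x0 t) (v0 t) (v0 t)" by (rule gD(5)[OF m0(4)[OF that]])
    also have "G c (x0 t) (v0 t) (v0 t) = g (\<gamma> t) (velocity A \<gamma> t) (velocity A \<gamma> t)"
      using metric_eq_G[OF c(1) m0(3)[OF that]] velocity_tangent[OF I m0(1)[OF that]] by (simp add: x0_def v0_def)
    also have "K * \<dots> \<le> K * max k 0" using speed[OF m0(2)[OF that]] gD(3) by (intro mult_left_mono) auto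
    finally show ?thesis unfolding Mv_def by (rule real_le_rsqrt)
  qed
  let ?H = "\<lambda>z::'e \<times> real \<times> 'e. acc F V c (fst z) (fst (snd z)) (snd (snd z))"
  note smH = smooth_acc[OF F V c(1)]
  \<comment> \<open>Compact set containing position, time and velocity shortly before
    \<open>T\<close>; the right-hand side is bounded on it.\<close>
  define C0 where "C0 = cball xq r \<times> {a2..T + 1} \<times> cball (0 :: 'e) Mv"
  have C0: "compact C0" unfolding C0_def by (intro compact_Times compact_cball compact_Icc)
  have C0s: "C0 \<subseteq> chart_image c \<times> UNIV \<times> UNIV" using gD(4) by (auto simp: C0_def)
  obtain Ma where Ma: "\<And>z. z \<in> C0 \<Longrightarrow> norm (?H z) \<le> Ma"
  proof (rule smooth_on_compact_bounds[OF smH C0 C0s])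
    fix M assume "\<And>z. z \<in> C0 \<Longrightarrow> norm (?H z) \<le> M"
    then show thesis by (rule that)
  qed
  obtain vq where vq: "(v0 \<longlongrightarrow> vq) (at_left T)"
  proof (rule bounded_derivative_has_limit[OF a2(3) d0(2)])
    fix t assume t: "t \<in> {a2..<T}"
    then have "(x0 t, t, v0 t) \<in> C0" using m0(4)[OF t] v0b[OF t] by (auto simp: C0_def)
    from Ma[OF this] show "norm (acc F V c (x0 t) t (v0 t)) \<le> Ma" by simp
  qed
  have xql: "(x0 \<longlongrightarrow> xq) (at_left T)"
    unfolding x0_def xq_def
  proof (rule isCont_tendsto_compose[OF _ lim])
    show "isCont (snd c) q"
      using continuous_on_chart[OF c(1)] open_chart[OF c(1)] c(2) by (simp add: continuous_on_eq_continuous_at)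
  qed
  define h where "h t z = (snd z, acc F V c (fst z) t (snd z))" for t and z :: "'e \<times> 'e"
  have bm: "fst z \<in> cball xq r \<and> snd z \<in> cball vq r" if "z \<in> cball (xq, vq) r" for z
    using that dist_fst_le[of "(xq, vq)" z] dist_snd_le[of "(xq, vq)" z] by auto
  \<comment> \<open>A separate set after \<open>T\<close>, centred at the limit of the velocity and
    convex, on which the right-hand side is Lipschitz as the Picard theorem requires.\<close>
  define C1 where "C1 = cball xq r \<times> {T..T + 1} \<times> cball vq r"
  have C1: "compact C1" "convex C1" unfolding C1_def
    by (intro compact_Times compact_cball compact_Icc convex_Times convex_cball convex_closed_interval | simp)+
  have C1s: "C1 \<subseteq> chart_image c \<times> UNIV \<times> UNIV" using gD(4) by (auto simp: C1_def)
  obtain L where L: "L \<ge> 0" "\<And>z z'. z \<in> C1 \<Longrightarrow> z' \<in> C1 \<Longrightarrow> norm (?H z - ?H z') \<le> L * norm (z - z')"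
  proof (rule smooth_on_compact_bounds[OF smH C1(1) C1s])
    fix M L' assume "0 \<le> L'" and "\<And>x y. convex C1 \<Longrightarrow> x \<in> C1 \<Longrightarrow> y \<in> C1 \<Longrightarrow> norm (?H x - ?H y) \<le> L' * norm (x - y)"
    from this(1) this(2)[OF C1(2)] show thesis by (rule that)
  qed
  have hc: "continuous_on ({T..T+1} \<times> cball (xq, vq) r) (\<lambda>(t, z). h t z)"
  proof -
    have "continuous_on ({T..T+1} \<times> cball (xq, vq) r) (\<lambda>y. ?H (fst (snd y), fst y, snd (snd y)))"
      by (rule continuous_on_compose2[OF continuous_on_subset[OF smooth_on_continuous[OF smH] C1s]])
        (intro continuous_intros, use bm in \<open>force simp: C1_def\<close>)
    then have "continuous_on ({T..T+1} \<times> cball (xq, vq) r) (\<lambda>y. (snd (snd y), acc F V c (fst (snd y)) (fst y) (snd (snd y))))"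
      by (intro continuous_on_Pair continuous_on_snd continuous_on_id) simp
    then show ?thesis by (simp add: h_def split_beta)
  qed
  have hl: "norm (h t z - h t z') \<le> (1 + L) * norm (z - z')"
    if "t \<in> {T..T+1}" "z \<in> cball (xq, vq) r" "z' \<in> cball (xq, vq) r" for t z z'
  proof -
    have "norm (?H (fst z, t, snd z) - ?H (fst z', t, snd z')) \<le> L * norm ((fst z, t, snd z) - (fst z', t, snd z'))"
      using that bm by (intro L(2)) (auto simp: C1_def)
    also have "norm ((fst z, t, snd z) - (fst z', t, snd z')) = norm (z - z')"
      by (simp add: norm_Pair norm_prod_def)
    finally have 1: "norm (acc F V c (fst z) t (snd z) - acc F V c (fst z') t (snd z')) \<le> L * norm (z - z')" by simp
    have 2: "norm (snd z - snd z') \<le> norm (z - z')" using dist_snd_le[of z z'] by (simp add: dist_norm)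
    have "norm (h t z - h t z') \<le> norm (snd z - snd z') + norm (acc F V c (fst z) t (snd z) - acc F V c (fst z') t (snd z'))"
      unfolding h_def by (simp add: norm_Pair_le)
    then show ?thesis using 1 2 by (simp add: algebra_simps)
  qed
  obtain e Z where e: "e > 0" "e \<le> 1" and Zc: "continuous_on {T..T+e} Z" and ZT: "Z T = (xq, vq)"
    and ZB: "\<And>t. t \<in> {T..T+e} \<Longrightarrow> Z t \<in> cball (xq, vq) r"
    and Zd: "\<And>t. t \<in> {T<..<T+e} \<Longrightarrow> (Z has_vector_derivative h t (Z t)) (at t)"
    by (rule ode_solution_exists[OF gD(2) zero_less_one hc hl], assumption, assumption, assumption, rule that)
  define y where "y t = (if t < T then (x0 t, v0 t) else Z t)" for t
  have yU: "fst (y t) \<in> chart_image c" if "t \<in> {a2..T+e}" for t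
    using that m0(5)[of t] ZB[of t] bm[of "Z t"] gD(4) by (auto simp: y_def)
  have yd1: "(y has_vector_derivative h t (y t)) (at t)" if "t \<in> {a2<..<T}" for t
  proof -
    have tt: "t \<in> {a2..<T}" using that by simp
    have "((\<lambda>t. (x0 t, v0 t)) has_vector_derivative h t (x0 t, v0 t)) (at t)"
      unfolding h_def fst_conv snd_conv by (rule has_vector_derivative_Pair[OF d0[OF tt]])
    then have "(y has_vector_derivative h t (x0 t, v0 t)) (at t)"
      by (rule has_vector_derivative_transform_within_open[of _ _ _ "{a2<..<T}"]) (use that in \<open>auto simp: y_def\<close>)
    then show ?thesis using that by (simp add: y_def)
  qed
  have yd2: "(y has_vector_derivative h t (y t)) (at t)" if "t \<in> {T<..<T+e}" for t
  proof -
    have "(y has_vector_derivative h t (Z t)) (at t)"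
      by (rule has_vector_derivative_transform_within_open[OF Zd[OF that], of "{T<..<T+e}"]) (use that in \<open>auto simp: y_def\<close>)
    then show ?thesis using that by (simp add: y_def)
  qed
  have yc: "continuous_on {a2..T+e} y"
  proof -
    have l: "continuous_on {a2..T} y"
      unfolding continuous_on_eq_continuous_within
    proof
      fix t assume t: "t \<in> {a2..T}"
      show "continuous (at t within {a2..T}) y"
      proof (cases "t = T")
        case True
        have "((\<lambda>t. (x0 t, v0 t)) \<longlongrightarrow> (xq, vq)) (at_left T)" by (intro tendsto_Pair xql vq)
        moreover have "\<forall>\<^sub>F t in at_left T. (x0 t, v0 t) = y t" by (auto simp: eventually_at_filter y_def)
        ultimately have "(y \<longlongrightarrow> (xq, vq)) (at_left T)" by (rule Lim_transform_eventually)
        then have "(y \<longlongrightarrow> y T) (at T within {a2..T})"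
          using a2(3) by (simp add: y_def ZT at_within_Icc_at_left)
        then show ?thesis using True by (simp add: continuous_within)
      next
        case False
        then have tt: "t \<in> {a2..<T}" using t by simp
        have "((\<lambda>t. (x0 t, v0 t)) has_vector_derivative (v0 t, acc F V c (x0 t) t (v0 t))) (at t)"
          by (rule has_vector_derivative_Pair[OF d0[OF tt]])
        then have "(y has_vector_derivative (v0 t, acc F V c (x0 t) t (v0 t))) (at t)"
          by (rule has_vector_derivative_transform_within_open[of _ _ _ "{..<T}"]) (use tt in \<open>auto simp: y_def\<close>)
        then show ?thesis by (rule continuous_at_imp_continuous_at_within[OF has_vector_derivative_continuous])
      qed
    qed
    have rr: "continuous_on {T..T+e} y" by (rule continuous_on_eq[OF Zc]) (auto simp: y_def)
    have "{a2..T+e} = {a2..T} \<union> {T..T+e}" using a2(3) e(1) by auto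
    then show ?thesis using continuous_on_closed_Un[OF closed_atLeastAtMost closed_atLeastAtMost l rr] by simp
  qed
  have hyc: "continuous_on {a2..T+e} (\<lambda>t. h t (y t))"
  proof -
    have "continuous_on {a2..T+e} (\<lambda>t. ?H (fst (y t), t, snd (y t)))"
      by (rule continuous_on_compose2[OF smooth_on_continuous[OF smH]], intro continuous_intros yc) (use yU in auto)
    then show ?thesis unfolding h_def by (intro continuous_on_Pair continuous_on_snd yc) simp
  qed
  have yd: "(y has_vector_derivative h t (y t)) (at t)" if t: "t \<in> {a2<..<T+e}" for t
  proof -
    consider "t < T" | "t > T" | "t = T" by linarith
    then show ?thesis
    proof cases
      case 3
      \<comment> \<open>The equation holds on both sides of \<open>T\<close> and its right-hand side
        is continuous across \<open>T\<close>, so it holds at the junction too.\<close>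
      have "(y has_vector_derivative h T (y T)) (at T)"
        by (rule has_vector_derivative_removable[OF a2(3) _ yc hyc]) (use e(1) yd1 yd2 in force)+
      then show ?thesis using 3 by simp
    qed (use yd1 yd2 t in auto)
  qed
  show ?thesis
  proof (rule that[of c a2 e "\<lambda>t. fst (y t)" "\<lambda>t. snd (y t)"])
    show "c \<in> A" "a \<le> a2" "a2 < T" "e > 0" by (fact c(1) a2(1) a2(3) e(1))+
    show "\<gamma> t \<in> fst c \<and> fst (y t) = snd c (\<gamma> t)" if "t \<in> {a2<..<T}" for t
      using that m0(3)[of t] by (simp add: y_def x0_def)
    show "fst (y t) \<in> chart_image c" if "t \<in> {a2<..<T+e}" for t using yU that by simp
    fix t assume t: "t \<in> {a2<..<T+e}"
    have yh: "(y has_derivative (\<lambda>s. s *\<^sub>R h t (y t))) (at t)" using yd[OF t] by (simp add: has_vector_derivative_def)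
    show "((\<lambda>t. fst (y t)) has_vector_derivative snd (y t)) (at t)"
      using has_derivative_fst[OF yh] by (simp add: has_vector_derivative_def h_def)
    show "((\<lambda>t. snd (y t)) has_vector_derivative acc F V c (fst (y t)) t (snd (y t))) (at t)"
      using has_derivative_snd[OF yh] by (simp add: has_vector_derivative_def h_def)
  qed
qed

text \<open>The old curve on \<open>I\<close> and the chart solution reaching past \<open>T\<close>
  agree on their overlap, so each condition is checked on one of two open sets.\<close>

lemma trajectory_extends:
  assumes F: "smooth_td_tensor_field A F" and V: "smooth_td_function A V"
    and tr: "trajectory A g F V I \<gamma>" and aT: "a < T" "{a..<T} \<subseteq> I" and IT: "\<And>t. t \<in> I \<Longrightarrow> t < T"
    and speed: "\<And>t. t \<in> {a..<T} \<Longrightarrow> g (\<gamma> t) (velocity A \<gamma> t) (velocity A \<gamma> t) \<le> k"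
    and lim: "(\<gamma> \<longlongrightarrow> q) (at_left T)"
  obtains J \<delta> where "trajectory A g F V J \<delta>" "I \<subseteq> J" "J \<noteq> I" "\<And>t. t \<in> I \<Longrightarrow> \<delta> t = \<gamma> t"
proof -
  have I: "open_interval I" "smooth_curve A I \<gamma>" using tr by (auto simp: trajectory_def)
  obtain c a2 e x v where c: "c \<in> A" and a2: "a \<le> a2" "a2 < T" and e: "e > 0"
    and xg: "\<And>t. t \<in> {a2<..<T} \<Longrightarrow> \<gamma> t \<in> fst c \<and> x t = snd c (\<gamma> t)"
    and xU: "\<And>t. t \<in> {a2<..<T + e} \<Longrightarrow> x t \<in> chart_image c"
    and xd: "\<And>t. t \<in> {a2<..<T + e} \<Longrightarrow> (x has_vector_derivative v t) (at t)"
    and vd: "\<And>t. t \<in> {a2<..<T + e} \<Longrightarrow> (v has_vector_derivative acc F V c (x t) t (v t)) (at t)"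
    by (rule trajectory_continues[OF F V tr aT speed lim], assumption, rule that)
  let ?S = "{a2<..<T + e}"
  define \<delta> where "\<delta> t = (if t < T then \<gamma> t else chart_inv c (x t))" for t
  have dS: "\<delta> t = chart_inv c (x t)" if "t \<in> ?S" for t
    using xg[of t] that chart_inv_left[OF c] by (auto simp: \<delta>_def)
  have dc: "\<delta> t \<in> fst c" "snd c (\<delta> t) = x t" if "t \<in> ?S" for t
    using dS[OF that] chart_inv_mem[OF c xU[OF that]] chart_inv_right[OF c xU[OF that]] by simp_all
  have dI: "\<delta> t = \<gamma> t" if "t \<in> I" for t using IT[OF that] by (simp add: \<delta>_def)
  define J where "J = I \<union> ?S"
  have "smooth_on ?S x"
    by (rule second_order_solution_smooth[OF open_greaterThanLessThan open_chart_image[OF c] smooth_acc[OF F V c], where v=v])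
      (use xU xd vd in auto)
  then have "smooth_on ?S (\<lambda>t. snd c (\<delta> t))"
    by (subst smooth_on_cong[OF open_greaterThanLessThan dc(2)])
  then have scS: "smooth_curve A ?S \<delta>" by (intro smooth_curve_in_chart[OF open_greaterThanLessThan c dc(1)]) auto
  have Jo: "open_interval J"
  proof -
    have "connected J"
      unfolding J_def
    proof (rule connected_Un)
      show "connected I" using I(1) by (simp add: open_interval_def is_interval_connected_1)
      have "(a2 + T) / 2 \<in> {a..<T}" "(a2 + T) / 2 \<in> ?S" using a2 e by auto
      then show "I \<inter> ?S \<noteq> {}" using aT(2) by blast
    qed (rule connected_Ioo)
    then show ?thesis using I(1) by (auto simp: open_interval_def is_interval_connected_1 J_def)
  qed
  have sc: "smooth_curve A J \<delta>"
  proof (rule smooth_curve_local)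
    fix t assume "t \<in> J"
    then consider "t \<in> I" | "t \<in> ?S" by (auto simp: J_def)
    then show "\<exists>J' \<delta>'. open J' \<and> t \<in> J' \<and> J' \<subseteq> J \<and> smooth_curve A J' \<delta>' \<and> (\<forall>s\<in>J'. \<delta> s = \<delta>' s)"
    proof cases
      case 1 then show ?thesis using I dI by (intro exI[of _ I] exI[of _ \<gamma>]) (auto simp: J_def open_interval_def)
    next
      case 2 then show ?thesis using scS by (intro exI[of _ ?S] exI[of _ \<delta>]) (auto simp: J_def)
    qed
  qed
  have Jop: "open J" using Jo by (simp add: open_interval_def)
  have "trajectory A g F V J \<delta>"
    unfolding trajectory_def
  proof (intro conjI ballI Jo sc)
    fix t assume t: "t \<in> J"
    then consider "t \<in> I" | "t \<in> ?S" by (auto simp: J_def)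
    then show "covariant_derivative A g \<delta> (velocity A \<delta>) t =
        tdiff (F (\<delta> t) t (velocity A \<delta> t)) (gradient A g (\<lambda>p. V p t) (\<delta> t))"
    proof cases
      case 1
      have "open I" using I(1) by (simp add: open_interval_def)
      from acceleration_cong[OF this 1 dI] velocity_cong[OF this 1 dI] show ?thesis
        using tr 1 dI[OF 1] by (simp add: trajectory_def)
    next
      case 2
      note vt = velocity_tangent[OF Jop sc t]
      have gt: "gradient A g (\<lambda>p. V p t) (\<delta> t) \<in> tangent_space A (\<delta> t)"
        by (rule gradient_props(1)) (rule potential_differentiable[OF V])
      have xd': "((\<lambda>t. snd c (\<delta> t)) has_vector_derivative v s) (at s)" if "s \<in> ?S" for s
        by (rule has_vector_derivative_transform_within_open[OF xd[OF that] open_greaterThanLessThan that]) (use dc(2) in simp)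
      have ca1: "velocity A \<delta> t c = v t"
        by (rule coords_acceleration(1)[where S="?S", OF open_greaterThanLessThan c]) (use dc(1) xd' 2 in simp_all)
      have ca2: "covariant_derivative A g \<delta> (velocity A \<delta>) t c =
          acc F V c (x t) t (v t) + christoffel A g c (snd c (\<delta> t)) (v t) (v t)"
        by (rule coords_acceleration(2)[where S="?S" and v=v, OF open_greaterThanLessThan c])
          (use dc(1) xd' 2 vd in simp_all)
      show ?thesis
      \<comment> \<open>Both sides are tangent vectors at the same point, so equality in the chart
        \<open>c\<close> is enough.\<close>
      proof (rule tangent_eqI[OF c dc(1)[OF 2] acceleration_tangent[OF Jop sc t]])
        show "tdiff (F (\<delta> t) t (velocity A \<delta> t)) (gradient A g (\<lambda>p. V p t) (\<delta> t)) \<in> tangent_space A (\<delta> t)"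
          by (rule tangent_diff[OF tensor_field(1)[OF F vt] gt])
        show "covariant_derivative A g \<delta> (velocity A \<delta>) t c = F (\<delta> t) t (velocity A \<delta> t) c - gradient A g (\<lambda>p. V p t) (\<delta> t) c"
          using ca2 tensor_coords[OF F c dc(1)[OF 2] vt, of t] ca1 dc(2)[OF 2] dS[OF 2]
          by (simp add: acc_def)
      qed
    qed
  qed
  moreover have "T \<in> J" using a2 e by (simp add: J_def)
  then have "J \<noteq> I" using IT by blast
  ultimately show ?thesis using dI by (intro that[of J \<delta>]) (auto simp: J_def)
qed

end

section \<open>Time reversal\<close>

lemma open_interval_uminus: "open_interval I \<Longrightarrow> open_interval (uminus ` I)"
  using open_negations[of I] by (auto simp: open_interval_def is_interval_connected_1
      intro!: connected_continuous_image continuous_intros)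

lemma has_vector_derivative_reflect:
  assumes "(x has_vector_derivative v) (at (- t))"
  shows "((\<lambda>s. x (- s)) has_vector_derivative - v) (at t)"
proof -
  have "(uminus has_vector_derivative - 1) (at (t::real))"
    using has_vector_derivative_minus[OF has_vector_derivative_id[of "at t"]] by simp
  from vector_diff_chain_at[OF this assms] show ?thesis by (simp add: o_def)
qed

context riemannian
begin

lemma smooth_curve_reflect:
  assumes "open I" "smooth_curve A I \<gamma>"
  shows "smooth_curve A (uminus ` I) (\<lambda>t. \<gamma> (- t))"
proof -
  have "continuous_on (uminus ` I) (\<lambda>t. \<gamma> (- t))"
    by (rule continuous_on_compose2[of I \<gamma>]) (use assms(2) in \<open>auto simp: smooth_curve_def intro!: continuous_intros\<close>)
  moreover have "smooth_on {t \<in> uminus ` I. \<gamma> (- t) \<in> fst c} (\<lambda>t. (snd c \<circ> \<gamma>) (- t))" if c: "c \<in> A" for c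
  proof (rule smooth_on_compose[OF _ open_curve_domain[OF assms c] smooth_curve_coords[OF assms(2) c]])
    have eq: "{t \<in> uminus ` I. \<gamma> (- t) \<in> fst c} = uminus ` {t \<in> I. \<gamma> t \<in> fst c}" by force
    show "open {t \<in> uminus ` I. \<gamma> (- t) \<in> fst c}"
      unfolding eq by (rule open_negations[OF open_curve_domain[OF assms c]])
    show "smooth_on {t \<in> uminus ` I. \<gamma> (- t) \<in> fst c} uminus"
      by (rule smooth_on_bounded_linear[OF bounded_linear_minus[OF bounded_linear_ident]])
  qed auto
  ultimately show ?thesis by (simp add: smooth_curve_def o_def)
qed

lemma velocity_reflect:
  assumes "smooth_curve A I \<gamma>" "- t \<in> I"
  shows "velocity A (\<lambda>s. \<gamma> (- s)) t = tscale (- 1) (velocity A \<gamma> (- t))"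
proof
  fix c :: "('a, 'e) chart"
  show "velocity A (\<lambda>s. \<gamma> (- s)) t c = - 1 *\<^sub>R velocity A \<gamma> (- t) c"
  proof (cases "c \<in> A \<and> \<gamma> (- t) \<in> fst c")
    case True
    from curve_has_velocity[OF assms(1) _ assms(2)] True
    have "((snd c \<circ> \<gamma>) has_vector_derivative velocity A \<gamma> (- t) c) (at (- t))" by blast
    from vector_derivative_at[OF has_vector_derivative_reflect[OF this]] True
    show ?thesis by (simp add: velocity_def o_def)
  qed (auto simp: velocity_def)
qed

lemma christoffel_minus:
  assumes "c \<in> A" "x \<in> chart_image c"
  shows "christoffel A g c x (- u) (- u) = christoffel A g c x u u"
proof -
  have m: "metric_coords A g c y (- u) w = - metric_coords A g c y u w"
    "metric_coords A g c y w (- u) = - metric_coords A g c y w u" if "y \<in> chart_image c" for y w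
    using posdef_linear[OF posdef_G[OF assms(1) that]] by (metis scaleR_minus1_left mult_minus1)+
  have "2 * G c x (christoffel A g c x (- u) (- u)) w = 2 * G c x (christoffel A g c x u u) w" for w
  proof -
    have l: "DG c x (- u) v w = - DG c x u v w" "DG c x v (- u) w = - DG c x v u w"
      "DG c x v w (- u) = - DG c x v w u" for v w
      using DG_linear[OF assms] by (metis scaleR_minus1_left mult_minus1)+
    show ?thesis unfolding christoffel_eq[OF assms] by (simp add: l)
  qed
  then have "G c x (christoffel A g c x (- u) (- u)) w = G c x (christoffel A g c x u u) w" for w by simp
  then have "G c x (christoffel A g c x (- u) (- u) - christoffel A g c x u u)
      (christoffel A g c x (- u) (- u) - christoffel A g c x u u) = 0"
    using posdefD(7)[OF posdef_G[OF assms]] by simp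
  then show ?thesis using posdefD(3)[OF posdef_G[OF assms]] by (metis eq_iff_diff_eq_0 less_irrefl)
qed

text \<open>The sign from the reversed velocity and the sign from the reversed time cancel in the
  second derivative, and the Christoffel term is quadratic in the velocity.\<close>

lemma acceleration_reflect:
  assumes "open I" "smooth_curve A I \<gamma>" "- t \<in> I"
  shows "covariant_derivative A g (\<lambda>s. \<gamma> (- s)) (velocity A (\<lambda>s. \<gamma> (- s))) t
    = covariant_derivative A g \<gamma> (velocity A \<gamma>) (- t)"
proof
  fix c :: "('a, 'e) chart"
  have t: "t \<in> uminus ` I" using assms(3) by force
  show "covariant_derivative A g (\<lambda>s. \<gamma> (- s)) (velocity A (\<lambda>s. \<gamma> (- s))) t c
    = covariant_derivative A g \<gamma> (velocity A \<gamma>) (- t) c"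
  proof (cases "c \<in> A \<and> \<gamma> (- t) \<in> fst c")
    case True
    let ?w = "velocity A \<gamma> (- t) c" and ?a = "vector_derivative (\<lambda>s. velocity A \<gamma> s c) (at (- t))"
    have "((\<lambda>s. velocity A \<gamma> s c) has_vector_derivative ?a) (at (- t))"
      using velocity_has_derivative[OF assms(1,2) _ assms(3)] True by blast
    from has_vector_derivative_minus[OF has_vector_derivative_reflect[OF this]]
    have "((\<lambda>s. - velocity A \<gamma> (- s) c) has_vector_derivative ?a) (at t)" by simp
    then have "vector_derivative (\<lambda>s. - velocity A \<gamma> (- s) c) (at t) = ?a" by (rule vector_derivative_at)
    moreover have "vector_derivative (\<lambda>s. velocity A (\<lambda>s. \<gamma> (- s)) s c) (at t) = vector_derivative (\<lambda>s. - velocity A \<gamma> (- s) c) (at t)"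
    proof (rule vector_derivative_cong_open[OF open_negations[OF assms(1)] t])
      fix s assume "s \<in> uminus ` I"
      then have "- s \<in> I" by auto
      from velocity_reflect[OF assms(2) this]
      show "velocity A (\<lambda>s. \<gamma> (- s)) s c = - velocity A \<gamma> (- s) c" by simp
    qed
    moreover have "christoffel A g c (snd c (\<gamma> (- t))) (- ?w) (- ?w) = christoffel A g c (snd c (\<gamma> (- t))) ?w ?w"
      using True by (intro christoffel_minus chart_mem) auto
    ultimately show ?thesis using True velocity_reflect[OF assms(2,3)] by (simp add: covariant_derivative_def)
  qed (auto simp: covariant_derivative_def)
qed

lemma smooth_on_reflect:
  assumes "open U" "smooth_on (U \<times> UNIV) (\<lambda>(x, t). f x t)"
  shows "smooth_on (U \<times> UNIV) (\<lambda>(x::'e, t::real). f x (- t))"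
proof -
  have o: "open (U \<times> (UNIV :: real set))" by (rule open_Times[OF assms(1) open_UNIV])
  have h: "smooth_on (U \<times> UNIV) (\<lambda>z::'e \<times> real. (fst z, - snd z))"
    by (intro smooth_on_Pair o smooth_on_fst smooth_on_bounded_linear bounded_linear_minus bounded_linear_snd)
  have "smooth_on (U \<times> UNIV) (\<lambda>z. (\<lambda>(x, t). f x t) (fst z, - snd z))"
    by (rule smooth_on_compose[OF o o assms(2) h]) auto
  then show ?thesis by (simp add: case_prod_beta')
qed

text \<open>Reversal keeps the acceleration but changes the sign of the velocity, so the force that
  is linear in the velocity changes sign, while the potential is only run backwards.\<close>

lemma smooth_td_tensor_field_reflect:
  assumes "smooth_td_tensor_field A F"
  shows "smooth_td_tensor_field A (\<lambda>p t v. tscale (- 1) (F p (- t) v))"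
  unfolding smooth_td_tensor_field_def
proof (intro conjI allI ballI)
  fix p t v w and r :: real assume v: "v \<in> tangent_space A p" and w: "w \<in> tangent_space A p"
  note T = tensor_field[where t="- t", OF assms v]
  show "tscale (- 1) (F p (- t) v) \<in> tangent_space A p" by (rule tangent_scale[OF T(1)])
  show "tscale (- 1) (F p (- t) (tadd v w)) = tadd (tscale (- 1) (F p (- t) v)) (tscale (- 1) (F p (- t) w))"
    unfolding T(2)[OF w] by simp
  show "tscale (- 1) (F p (- t) (tscale r v)) = tscale r (tscale (- 1) (F p (- t) v))"
    unfolding T(3) by simp
next
  fix c :: "('a, 'e) chart" and u assume c: "c \<in> A"
  have o: "open (chart_image c \<times> (UNIV :: real set))" by (intro open_Times open_chart_image[OF c] open_UNIV)
  have "smooth_on (chart_image c \<times> UNIV) (\<lambda>(x, t). F (chart_inv c x) t (tvec_of A c (chart_inv c x) u) c)"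
    using assms c unfolding smooth_td_tensor_field_def by blast
  from smooth_on_linear_compose[OF bounded_linear_minus[OF bounded_linear_ident] o smooth_on_reflect[OF open_chart_image[OF c] this]]
  show "smooth_on (chart_image c \<times> UNIV) (\<lambda>(x, t). - 1 *\<^sub>R F (chart_inv c x) (- t) (tvec_of A c (chart_inv c x) u) c)"
    by (simp add: case_prod_beta')
qed

lemma smooth_td_function_reflect:
  assumes "smooth_td_function A V"
  shows "smooth_td_function A (\<lambda>p t. V p (- t))"
  using assms smooth_on_reflect[OF open_chart_image] unfolding smooth_td_function_def by blast

lemma trajectory_reflect:
  assumes F: "smooth_td_tensor_field A F" and tr: "trajectory A g F V I \<gamma>"
  shows "trajectory A g (\<lambda>p t v. tscale (- 1) (F p (- t) v)) (\<lambda>p t. V p (- t)) (uminus ` I) (\<lambda>t. \<gamma> (- t))"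
proof -
  have I: "open_interval I" "open I" "smooth_curve A I \<gamma>" using tr by (auto simp: trajectory_def open_interval_def)
  show ?thesis
    unfolding trajectory_def
  proof (intro conjI ballI open_interval_uminus[OF I(1)] smooth_curve_reflect[OF I(2,3)])
    fix t assume "t \<in> uminus ` I"
    then have t: "- t \<in> I" by auto
    note w = velocity_tangent[OF I(2,3) t]
    show "covariant_derivative A g (\<lambda>s. \<gamma> (- s)) (velocity A (\<lambda>s. \<gamma> (- s))) t =
        tdiff (tscale (- 1) (F (\<gamma> (- t)) (- t) (velocity A (\<lambda>s. \<gamma> (- s)) t))) (gradient A g (\<lambda>p. V p (- t)) (\<gamma> (- t)))"
      unfolding acceleration_reflect[OF I(2,3) t] velocity_reflect[OF I(3) t] tensor_field(3)[OF F w]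
      using tr t by (simp add: trajectory_def)
  qed
qed

text \<open>The speed bound enters as a hypothesis on symmetric time intervals, so that for the
  reversed system it is read off from the original trajectory instead of from reversed versions of
  the bounds on tensor and potential.\<close>

lemma trajectory_extends_right:
  assumes "complete_riemannian A g" and F: "smooth_td_tensor_field A F" and V: "smooth_td_function A V"
    and tr: "trajectory A g F V I \<gamma>" and ab: "a \<in> I" "a < b" "b \<notin> I"
    and speed: "\<And>R. R > 0 \<Longrightarrow> \<exists>K. \<forall>t\<in>I \<inter> {- R..R}. g (\<gamma> t) (velocity A \<gamma> t) (velocity A \<gamma> t) \<le> K"
  obtains J \<delta> where "trajectory A g F V J \<delta>" "I \<subseteq> J" "J \<noteq> I" "\<And>t. t \<in> I \<Longrightarrow> \<delta> t = \<gamma> t"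
proof -
  have I: "open I" "smooth_curve A I \<gamma>" "is_interval I" using tr by (auto simp: trajectory_def open_interval_def)
  have "t \<le> b" if "t \<in> I" for t
    using mem_is_interval_1_I[OF I(3) ab(1) that, of b] ab by linarith
  then have bdd: "bdd_above I" by (rule bdd_aboveI)
  define T where "T = Sup I"
  have IT: "t < T" if t: "t \<in> I" for t
  proof -
    obtain e where "e > 0" "cball t e \<subseteq> I" using I(1) t open_contains_cball by blast
    then have "t + e \<in> I" by (auto simp: dist_norm)
    from cSup_upper[OF this bdd] show ?thesis using \<open>e > 0\<close> by (simp add: T_def)
  qed
  have aT: "{a..<T} \<subseteq> I"
  proof
    fix s assume s: "s \<in> {a..<T}"
    then obtain u where "u \<in> I" "s < u" using less_cSup_iff[OF _ bdd, of s] ab(1) by (auto simp: T_def)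
    then show "s \<in> I" using mem_is_interval_1_I[OF I(3) ab(1), of u s] s by simp
  qed
  \<comment> \<open>Radius of a symmetric interval containing \<open>{a..<T}\<close>; the 1 keeps it
    positive.\<close>
  have "max \<bar>a\<bar> \<bar>T\<bar> + 1 > 0" by linarith
  from speed[OF this] obtain K where K: "\<And>t. t \<in> I \<Longrightarrow> t \<in> {- (max \<bar>a\<bar> \<bar>T\<bar> + 1)..max \<bar>a\<bar> \<bar>T\<bar> + 1} \<Longrightarrow>
      g (\<gamma> t) (velocity A \<gamma> t) (velocity A \<gamma> t) \<le> K" by blast
  have Kb: "g (\<gamma> t) (velocity A \<gamma> t) (velocity A \<gamma> t) \<le> K" if t: "t \<in> {a..<T}" for t
  proof (rule K)
    show "t \<in> I" using aT t by blast
    show "t \<in> {- (max \<bar>a\<bar> \<bar>T\<bar> + 1)..max \<bar>a\<bar> \<bar>T\<bar> + 1}" using t by (auto simp: max_def abs_if)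
  qed
  obtain q where q: "(\<gamma> \<longlongrightarrow> q) (at_left T)"
    by (rule bounded_speed_converges[OF assms(1) I(1,2) IT[OF ab(1)] aT Kb], assumption, rule that)
  show ?thesis
    by (rule trajectory_extends[OF F V tr IT[OF ab(1)] aT IT Kb q], assumption, assumption) (rule that)
qed

end

section \<open>Completeness of inextensible trajectories\<close>

theorem theorem2p3:
  fixes A :: "('a::{t2_space,second_countable_topology}, 'e::euclidean_space) chart set"
    and g :: "('a, 'e) metric"
    and F :: "('a, 'e) td_tensor"
    and V :: "'a \<Rightarrow> real \<Rightarrow> real"
    and \<alpha>\<^sub>0 \<beta>\<^sub>0 :: "real \<Rightarrow> real"
    and I :: "real set"
    and \<gamma> :: "real \<Rightarrow> 'a"
  assumes "riemannian_manifold A g"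
    and "connected (UNIV :: 'a set)"
    and "complete_riemannian A g"
    and "smooth_td_tensor_field A F"
    and "smooth_td_function A V"
    and "\<And>T. T > 0 \<Longrightarrow>
      \<exists>N::real. \<forall>t\<in>{-T..T}. S_norm A g (self_adjoint_part A g F) t \<le> ereal N"
    and "continuous_on UNIV \<beta>\<^sub>0"
    and "\<And>p t. V p t \<ge> \<beta>\<^sub>0 t"
    and "continuous_on UNIV \<alpha>\<^sub>0"
    and "\<And>p t. \<bar>deriv (\<lambda>s. V p s) t\<bar> \<le> \<alpha>\<^sub>0 t * (V p t - \<beta>\<^sub>0 t)"
    and "inextensible (trajectory A g F V) I \<gamma>"
  shows "I = UNIV"
proof (rule ccontr)
  interpret riemannian A g by unfold_locales (rule assms(1))
  note complete = assms(3) and F = assms(4) and V = assms(5)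
  have tr: "trajectory A g F V I \<gamma>" using assms(11) by (simp add: inextensible_def)
  have maximal: "J = I" if "trajectory A g F V J \<delta>" "I \<subseteq> J" "\<And>t. t \<in> I \<Longrightarrow> \<delta> t = \<gamma> t" for J \<delta>
    using assms(11) that unfolding inextensible_def by blast
  have I: "open I" "smooth_curve A I \<gamma>" "I \<noteq> {}" using tr by (auto simp: trajectory_def open_interval_def)
  have speed: "\<exists>K. \<forall>t\<in>I \<inter> {- R..R}. g (\<gamma> t) (velocity A \<gamma> t) (velocity A \<gamma> t) \<le> K" if R: "R > 0" for R
  proof -
    obtain N :: real where N: "\<And>t. t \<in> {- R..R} \<Longrightarrow> S_norm A g (self_adjoint_part A g F) t \<le> ereal N"
      using assms(6)[OF R] by blast
    obtain K where "\<And>t. t \<in> I \<Longrightarrow> t \<in> {- R..R} \<Longrightarrow> g (\<gamma> t) (velocity A \<gamma> t) (velocity A \<gamma> t) \<le> K"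
      by (rule speed_bounded[OF F V tr R N assms(7-10)], assumption, rule that)
    then show ?thesis by blast
  qed
  assume "I \<noteq> UNIV"
  then obtain b where b: "b \<notin> I" by blast
  obtain a where a: "a \<in> I" using I(3) by blast
  \<comment> \<open>A time missing from \<open>I\<close> lies to the right or to the left of it; the
    left case is the right case of the reversed curve.\<close>
  consider "a < b" | "b < a" using a b by (metis linorder_neqE)
  then show False
  proof cases
    case 1
    show False
    proof (rule trajectory_extends_right[OF complete F V tr a 1 b speed])
      fix J \<delta> assume "trajectory A g F V J \<delta>" "I \<subseteq> J" "J \<noteq> I" "\<And>t. t \<in> I \<Longrightarrow> \<delta> t = \<gamma> t"
      then show False using maximal by blast
    qed
  next
    case 2
    let ?F = "\<lambda>p t v. tscale (- 1) (F p (- t) v)" and ?V = "\<lambda>p t. V p (- t)"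
    have F': "smooth_td_tensor_field A ?F" by (rule smooth_td_tensor_field_reflect[OF F])
    have speed': "\<exists>K. \<forall>t\<in>uminus ` I \<inter> {- R..R}. g (\<gamma> (- t)) (velocity A (\<lambda>s. \<gamma> (- s)) t) (velocity A (\<lambda>s. \<gamma> (- s)) t) \<le> K"
      if R: "R > 0" for R
    proof -
      obtain K where K: "\<And>t. t \<in> I \<inter> {- R..R} \<Longrightarrow> g (\<gamma> t) (velocity A \<gamma> t) (velocity A \<gamma> t) \<le> K"
        using speed[OF R] by blast
      have "g (\<gamma> (- t)) (velocity A (\<lambda>s. \<gamma> (- s)) t) (velocity A (\<lambda>s. \<gamma> (- s)) t) \<le> K"
        if t: "t \<in> uminus ` I \<inter> {- R..R}" for t
      proof -
        have mt: "- t \<in> I" "- t \<in> I \<inter> {- R..R}" using t by auto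
        note w = velocity_tangent[OF I(1,2) mt(1)]
        note w' = tangent_scale[OF w, of "- 1"]
        have "g (\<gamma> (- t)) (tscale (- 1) (velocity A \<gamma> (- t))) (tscale (- 1) (velocity A \<gamma> (- t)))
            = g (\<gamma> (- t)) (velocity A \<gamma> (- t)) (velocity A \<gamma> (- t))"
          using metricD(3)[OF w w' w', of "- 1"] metric_linear_right(2)[OF w w w, of "- 1"] by simp
        then show ?thesis unfolding velocity_reflect[OF I(2) mt(1)] using K[OF mt(2)] by simp
      qed
      then show ?thesis by blast
    qed
    have ab: "- a \<in> uminus ` I" "- a < - b" "- b \<notin> uminus ` I" using a b 2 by auto
    show False
    proof (rule trajectory_extends_right[OF complete F' smooth_td_function_reflect[OF V] trajectory_reflect[OF F tr] ab speed'])
      fix J \<delta> assume J: "trajectory A g ?F ?V J \<delta>" "uminus ` I \<subseteq> J" "J \<noteq> uminus ` I" "\<And>t. t \<in> uminus ` I \<Longrightarrow> \<delta> t = \<gamma> (- t)"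
      \<comment> \<open>Reversal is an involution, so the extension of the reversed curve is turned
        back into one for the original tensor and potential.\<close>
      have "trajectory A g F V (uminus ` J) (\<lambda>t. \<delta> (- t))" using trajectory_reflect[OF F' J(1)] by simp
      moreover have "I \<subseteq> uminus ` J" using J(2) by force
      moreover have "\<delta> (- t) = \<gamma> t" if "t \<in> I" for t using J(4)[of "- t"] that by simp
      ultimately have "uminus ` J = I" by (rule maximal)
      then have "uminus ` I = J" by (auto simp: image_image)
      with J(3) show False by simp
    qed
  qed
qed

end
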